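(* Let $(A,L)$ be a Lie-Rinehart algebra. Then there is a natural transformation $$\Theta_L:L\longrightarrow\mathrm{Der}_\Bbbk^{\,s}\big(\mathcal V_A(L)^\circ,A_\varepsilon\big)=\mathscr L\mathscr I(L),\qquad X\longmapsto\big[z\mapsto-\zeta(z)(\iota_L(X))\big]$$ of Lie-Rinehart algebras. Moreover, this morphism factors as $$\Theta_L=\mathscr L(\hat\zeta)\circ\Theta'_L$$ in a commutative triangle of Lie-Rinehart algebras, where $\mathscr L(\hat\zeta):\mathrm{Der}_\Bbbk^{\,s}(\mathcal V_A(L)^\bullet,A_\varepsilon)\to\mathrm{Der}_\Bbbk^{\,s}(\mathcal V_A(L)^\circ,A_\varepsilon)$ is $\delta\mapsto\delta\circ\hat\zeta$, and $$\Theta'_L:L\longrightarrow\mathrm{Der}_\Bbbk^{\,s}\big(\mathcal V_A(L)^\bullet,A_\varepsilon\big),\qquad X\longmapsto\big[z\mapsto-\xi(z)(\iota_L(X))\big].$$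
   Context: $\Bbbk$ is a field of characteristic $0$, $A$ a commutative $\Bbbk$-algebra, $\otimes=\otimes_\Bbbk$. An $A$-ring is an algebra $R$ with an algebra map $A\to R$. $R^*=\mathrm{Hom}_{-A}(R,A)$ (right $A$-linear maps) with $(afb)(r)=af(br)$. An $A$-coring is an $A$-bimodule $C$ with $A$-bilinear coassociative $\Delta(c)=c_1\otimes_Ac_2$ and counit $\varepsilon:C\to A$. **Lie-Rinehart algebras.** $(A,L)$: a Lie $\Bbbk$-algebra $L$ that is an $A$-module with an $A$-linear Lie map $\omega:L\to\mathrm{Der}_\Bbbk(A)$ such that $[X,aY]=a[X,Y]+X(a)Y$, $X(a)=\omega(X)(a)$. Morphisms: $A$-linear Lie maps commuting with anchors. **Commutative Hopf algebroids.** $(A,\mathcal H)$: commutative algebras with algebra maps $s,t:A\to\mathcal H$, $\Delta:\mathcal H\to\mathcal H\otimes_A\mathcal H$, $\varepsilon:\mathcal H\to A$, $\mathcal S:\mathcal H\to\mathcal H$, where $\mathcal H$ is the $A$-bimodule ${}_s\mathcal H_t$ (left via $s$, right via $t$), $({}_s\mathcal H_t,\Delta,\varepsilon)$ is an $A$-coring, $\mathcal Ss=t$, $\mathcal St=s$, $\mathcal S^2=\mathrm{id}$, $\mathcal S(h_1)h_2=t(\varepsilon(h))$, $h_1\mathcal S(h_2)=s(\varepsilon(h))$; unit $\eta(a\otimes b)=s(a)t(b)$. $\mathscr L(\mathcal H)=\mathrm{Der}_\Bbbk^{\,s}(\mathcal H,A_\varepsilon)$ is the set of $\Bbbk$-linear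 $\delta:\mathcal H\to A$ with $\delta\circ s=0$, $\delta(uv)=\varepsilon(u)\delta(v)+\delta(u)\varepsilon(v)$; it is a Lie-Rinehart algebra with $(a\delta)(u)=a\delta(u)$, $[\delta,\delta'](u)=\delta(u_1t(\delta'(u_2)))-\delta'(u_1t(\delta(u_2)))$, anchor $\delta\mapsto\delta\circ t$; $\mathscr L(\phi)(\delta)=\delta\circ\phi$. **$\mathcal V_A(L)$.** The universal algebra with an algebra map $\iota_A:A\to\mathcal V_A(L)$ and a Lie map $\iota_L:L\to\mathcal V_A(L)$ such that $\iota_L(aX)=\iota_L(X)\iota_A(a)$, $\iota_L(X)\iota_A(a)-\iota_A(a)\iota_L(X)=\iota_A(X(a))$. It is a (right) co-commutative Hopf algebroid $\mathcal U$ over $A$: $\varepsilon:\mathcal U\to A$ right $A$-linear with $\varepsilon(uv)=\varepsilon(\varepsilon(u)v)$, $\varepsilon(\iota_A(a))=a$, $\varepsilon(\iota_L(X))=0$; $\Delta:\mathcal U\to\mathcal U_A\otimes_A\mathcal U_A$, $u\mapsto u_1\otimes_Au_2$, multiplicative (its image lies in $\{\sum u_i\otimes v_i\mid\sum au_i\otimes v_i=\sum u_i\otimes av_i\}$, with componentwise product), $\Delta(\iota_A(a))=\iota_A(a)\otimes_A1$, $\Delta(\iota_L(X))=\iota_L(X)\otimes_A1+1\otimes_A\iota_L(X)$; the map $\beta(u\otimes_Av)=uv_1\otimes_Av_2$ from $\mathcal U_A\otimes_A{}_A\mathcal U$ to $\mathcal U_A\otimes_A\mathcal U_A$ is bijective,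 and $u_-\otimes_Au_+=\beta^{-1}(1\otimes_Au)$. **$\mathcal U^\circ$ and $\zeta$.** Let $\mathcal A_{\mathcal U}$ be the category of right $\mathcal U$-modules finitely generated projective over $A$; $P^*=\mathrm{Hom}_{-A}(P,A)$, $T_P=\mathrm{End}_{\mathcal U}(P)$. $\mathcal U^\circ=(\bigoplus_PP^*\otimes_{T_P}P)/\mathfrak J$, $\mathfrak J$ the $A$-subbimodule generated by all $q^*\otimes tp-q^*t\otimes p$, $t\in\mathrm{Hom}_{\mathcal U}(P,Q)$. It is a commutative Hopf algebroid with $\Delta(\overline{p^*\otimes p})=\sum_i\overline{p^*\otimes e_i}\otimes_A\overline{e_i^*\otimes p}$ (dual basis), $\varepsilon(\overline{p^*\otimes p})=p^*(p)$, product $\overline{p^*\otimes p}\cdot\overline{q^*\otimes q}=\overline{(q^*\star p^* )\otimes(q\otimes_Ap)}$ where $(\varphi\star\psi)(x\otimes_Ay)=\varphi(x)\psi(y)$ and $Q\otimes_AP$ has action $(q\otimes p)u=qu_1\otimes pu_2$, unit $a\otimes a'\mapsto\overline{l_a\otimes a'}$ ($l_a\in A^*$ multiplication by $a$; $A$ has action $a\cdot u=\varepsilon(au)$), antipode $\overline{p^*\otimes p}\mapsto\overline{\mathrm{ev}_p\otimes p^*}$ ($P^*$ has action $(\varphi\cdot u)(m)=\varphi(mu_-)\cdot u_+$). $\zeta:\mathcal U^\circ\to\mathcal U^*$, $\zeta(\overline{p^*\otimes p})(u)=p^*(pu)$. **$\mathcal U^\bullet$, $\xi$, $\hat\zeta$.**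 For an $A$-bimodule map $f:C\to\mathcal U^*$ from an $A$-coring consider $( * )$: $f(z)(uv)=f(z_1)(f(z_2)(u)v)$, $f(z)(1)=\varepsilon(z)$, $f(azb)(u)=af(z)(bu)$. $\mathcal U^\bullet$ is the $A$-coring with $\xi:\mathcal U^\bullet\to\mathcal U^*$ satisfying $( * )$, universal: each $f$ satisfying $( * )$ equals $\xi\circ\hat f$ for a unique coring map $\hat f$. It is a commutative Hopf algebroid with structure determined by $\xi(\eta(a\otimes b))(u)=\varepsilon(bu)a$, $\xi(xy)(u)=\xi(x)(u_1)\xi(y)(u_2)$, $\xi(\mathcal S(x))(u)=\varepsilon(\xi(x)(u_-)u_+)$. The map $\zeta$ satisfies $( * )$ and $\hat\zeta:\mathcal U^\circ\to\mathcal U^\bullet$, with $\xi\hat\zeta=\zeta$, is a morphism of Hopf algebroids. $\mathscr I(L)=\mathcal V_A(L)^\circ$. *)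

theory Defs
  imports "HOL-Algebra.Module" "HOL-Library.FuncSet"
begin

section \<open>Conventions\<close>

text \<open>
  The field and the commutative algebra \<open>A\<close> are types; the structure map of the algebra is a ring
  homomorphism \<open>\<kappa>\<close> from the field to \<open>A\<close>.  The sort of \<open>A\<close> is \<open>{comm_ring, comm_monoid_mult}\<close>
  and not \<open>comm_ring_1\<close>, because the latter excludes the zero algebra.  All other objects
  are records with a carrier.
\<close>

definition base_ring :: "'a::{comm_ring,comm_monoid_mult} ring" where
  "base_ring = \<lparr>carrier = UNIV, mult = (*), one = 1, zero = 0, add = (+)\<rparr>"

definition rep :: "'x set \<Rightarrow> 'x" where
  "rep X = (SOME x. x \<in> X)"

definition lsum :: "('m, 'x) ring_scheme \<Rightarrow> 'm list \<Rightarrow> 'm" where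
  "lsum M xs = foldr (add M) xs \<zero>\<^bsub>M\<^esub>"


section \<open>Bimodules and their tensor products\<close>

text \<open>Where only the bimodule structure matters, the fields \<open>mult\<close> and \<open>one\<close> of the underlying
  ring record carry no meaning.\<close>

record ('a, 'm) bimod = "'m ring" +
  lact :: "'a \<Rightarrow> 'm \<Rightarrow> 'm"
  ract :: "'m \<Rightarrow> 'a \<Rightarrow> 'm"

locale bimodule = abelian_group M
  for \<kappa> :: "'k::field_char_0 \<Rightarrow> 'a::{comm_ring,comm_monoid_mult}"
    and M :: "('a, 'm, 'x) bimod_scheme" (structure) +
  assumes lact_closed: "m \<in> carrier M \<Longrightarrow> lact M a m \<in> carrier M"
    and ract_closed: "m \<in> carrier M \<Longrightarrow> ract M m a \<in> carrier M"
    and lact_add: "\<lbrakk>m \<in> carrier M; n \<in> carrier M\<rbrakk> \<Longrightarrow> lact M a (m \<oplus> n) = lact M a m \<oplus> lact M a n"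
    and ract_add: "\<lbrakk>m \<in> carrier M; n \<in> carrier M\<rbrakk> \<Longrightarrow> ract M (m \<oplus> n) a = ract M m a \<oplus> ract M n a"
    and add_lact: "m \<in> carrier M \<Longrightarrow> lact M (a + b) m = lact M a m \<oplus> lact M b m"
    and add_ract: "m \<in> carrier M \<Longrightarrow> ract M m (a + b) = ract M m a \<oplus> ract M m b"
    and mult_lact: "m \<in> carrier M \<Longrightarrow> lact M (a * b) m = lact M a (lact M b m)"
    and mult_ract: "m \<in> carrier M \<Longrightarrow> ract M m (a * b) = ract M (ract M m a) b"
    and one_lact: "m \<in> carrier M \<Longrightarrow> lact M 1 m = m"
    and one_ract: "m \<in> carrier M \<Longrightarrow> ract M m 1 = m"
    and lact_ract: "m \<in> carrier M \<Longrightarrow> ract M (lact M a m) b = lact M a (ract M m b)"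
    and central: "m \<in> carrier M \<Longrightarrow> lact M (\<kappa> c) m = ract M m (\<kappa> c)"

definition regular_bimod :: "('a::{comm_ring,comm_monoid_mult}, 'a) bimod" where
  "regular_bimod =
    \<lparr>carrier = UNIV, mult = (*), one = 1, zero = 0, add = (+), lact = (*), ract = (*)\<rparr>"

definition bimod_hom ::
    "('a, 'm, 'x) bimod_scheme \<Rightarrow> ('a, 'n, 'y) bimod_scheme \<Rightarrow> ('m \<Rightarrow> 'n) set" where
  "bimod_hom M N = {g \<in> carrier M \<rightarrow> carrier N.
     (\<forall>m\<in>carrier M. \<forall>m'\<in>carrier M. g (m \<oplus>\<^bsub>M\<^esub> m') = g m \<oplus>\<^bsub>N\<^esub> g m') \<and>
     (\<forall>m\<in>carrier M. \<forall>a. g (lact M a m) = lact N a (g m) \<and> g (ract M m a) = ract N (g m) a)}"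

text \<open>
  A list of pairs \<open>[(m\<^sub>1, n\<^sub>1), \<dots>]\<close> stands for the sum of the pure tensors \<open>m\<^sub>i \<otimes> n\<^sub>i\<close>; \<open>teq M N\<close> is the
  congruence on such formal sums that defines \<open>M \<otimes>\<^sub>A N\<close>.  It uses only the right
  action on \<open>M\<close> and the left action on \<open>N\<close>.
\<close>

inductive teq :: "('a, 'm, 'x) bimod_scheme \<Rightarrow> ('a, 'n, 'y) bimod_scheme \<Rightarrow>
    ('m \<times> 'n) list \<Rightarrow> ('m \<times> 'n) list \<Rightarrow> bool"
  for M :: "('a, 'm, 'x) bimod_scheme" and N :: "('a, 'n, 'y) bimod_scheme" where
  teq_refl: "set zs \<subseteq> carrier M \<times> carrier N \<Longrightarrow> teq M N zs zs"
| teq_sym: "teq M N zs ws \<Longrightarrow> teq M N ws zs"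
| teq_trans: "teq M N zs ws \<Longrightarrow> teq M N ws vs \<Longrightarrow> teq M N zs vs"
| teq_append: "teq M N zs zs' \<Longrightarrow> teq M N ws ws' \<Longrightarrow> teq M N (zs @ ws) (zs' @ ws')"
| teq_comm: "set zs \<subseteq> carrier M \<times> carrier N \<Longrightarrow> set ws \<subseteq> carrier M \<times> carrier N \<Longrightarrow>
    teq M N (zs @ ws) (ws @ zs)"
| teq_add_left: "m \<in> carrier M \<Longrightarrow> m' \<in> carrier M \<Longrightarrow> n \<in> carrier N \<Longrightarrow>
    teq M N [(m \<oplus>\<^bsub>M\<^esub> m', n)] [(m, n), (m', n)]"
| teq_add_right: "m \<in> carrier M \<Longrightarrow> n \<in> carrier N \<Longrightarrow> n' \<in> carrier N \<Longrightarrow>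
    teq M N [(m, n \<oplus>\<^bsub>N\<^esub> n')] [(m, n), (m, n')]"
| teq_zero_left: "n \<in> carrier N \<Longrightarrow> teq M N [(\<zero>\<^bsub>M\<^esub>, n)] []"
| teq_zero_right: "m \<in> carrier M \<Longrightarrow> teq M N [(m, \<zero>\<^bsub>N\<^esub>)] []"
| teq_balanced: "m \<in> carrier M \<Longrightarrow> n \<in> carrier N \<Longrightarrow>
    teq M N [(ract M m a, n)] [(m, lact N a n)]"

definition tcls :: "('a, 'm, 'x) bimod_scheme \<Rightarrow> ('a, 'n, 'y) bimod_scheme \<Rightarrow>
    ('m \<times> 'n) list \<Rightarrow> ('m \<times> 'n) list set" where
  "tcls M N zs = {ws. teq M N zs ws}"

definition tensor :: "('a, 'm, 'x) bimod_scheme \<Rightarrow> ('a, 'n, 'y) bimod_scheme \<Rightarrow>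
    ('a, ('m \<times> 'n) list set) bimod" where
  "tensor M N =
    \<lparr>carrier = tcls M N ` {zs. set zs \<subseteq> carrier M \<times> carrier N},
     mult = undefined, one = undefined,
     zero = tcls M N [],
     add = (\<lambda>X Y. \<Union>x\<in>X. \<Union>y\<in>Y. tcls M N (x @ y)),
     lact = (\<lambda>a X. \<Union>x\<in>X. tcls M N [(lact M a m, n). (m, n) \<leftarrow> x]),
     ract = (\<lambda>X a. \<Union>x\<in>X. tcls M N [(m, ract N n a). (m, n) \<leftarrow> x])\<rparr>"


section \<open>Corings and commutative Hopf algebroids\<close>

record ('a, 'c) coring = "('a, 'c) bimod" +
  comult :: "'c \<Rightarrow> ('c \<times> 'c) list set"
  counit :: "'c \<Rightarrow> 'a"

text \<open>Coassociativity compares \<open>\<Sum> z\<^sub>1 \<otimes> \<Delta> z\<^sub>2\<close> and \<open>\<Sum> \<Delta> z\<^sub>1 \<otimes> z\<^sub>2\<close>, the latter reassociated,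
  in \<open>C \<otimes> (C \<otimes> C)\<close>.\<close>

locale coring = bimodule \<kappa> C
  for \<kappa> :: "'k::field_char_0 \<Rightarrow> 'a::{comm_ring,comm_monoid_mult}"
    and C :: "('a, 'c, 'x) coring_scheme" (structure) +
  assumes comult_hom: "comult C \<in> bimod_hom C (tensor C C)"
    and counit_hom: "counit C \<in> bimod_hom C regular_bimod"
    and coassoc: "\<lbrakk>z \<in> carrier C; zs \<in> comult C z\<rbrakk> \<Longrightarrow>
      teq C (tensor C C)
        [(x, comult C y). (x, y) \<leftarrow> zs]
        [(a, tcls C C [(b, y)]). (x, y) \<leftarrow> zs, (a, b) \<leftarrow> rep (comult C x)]"
    and counit_left: "\<lbrakk>z \<in> carrier C; zs \<in> comult C z\<rbrakk> \<Longrightarrow>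
      lsum C [lact C (counit C x) y. (x, y) \<leftarrow> zs] = z"
    and counit_right: "\<lbrakk>z \<in> carrier C; zs \<in> comult C z\<rbrakk> \<Longrightarrow>
      lsum C [ract C x (counit C y). (x, y) \<leftarrow> zs] = z"

definition coring_hom ::
    "('a, 'c, 'x) coring_scheme \<Rightarrow> ('a, 'd, 'y) coring_scheme \<Rightarrow> ('c \<Rightarrow> 'd) set" where
  "coring_hom C D = {g \<in> bimod_hom C D. \<forall>z\<in>carrier C.
     counit D (g z) = counit C z \<and>
     (\<forall>zs\<in>comult C z. [(g x, g y). (x, y) \<leftarrow> zs] \<in> comult D (g z))}"

record ('a, 'h) hopf_algebroid = "('a, 'h) coring" +
  src :: "'a \<Rightarrow> 'h"
  tgt :: "'a \<Rightarrow> 'h"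
  antipode :: "'h \<Rightarrow> 'h"

text \<open>That the comultiplication is an algebra map refers to the componentwise product on
  \<open>H \<otimes>\<^sub>A H\<close>.\<close>

locale comm_hopf_algebroid = coring \<kappa> H + cring H
  for \<kappa> :: "'k::field_char_0 \<Rightarrow> 'a::{comm_ring,comm_monoid_mult}"
    and H :: "('a, 'h, 'x) hopf_algebroid_scheme" (structure) +
  assumes src_hom: "src H \<in> ring_hom base_ring H"
    and tgt_hom: "tgt H \<in> ring_hom base_ring H"
    and src_tgt_field: "src H (\<kappa> c) = tgt H (\<kappa> c)"
    and lact_src: "h \<in> carrier H \<Longrightarrow> lact H a h = src H a \<otimes> h"
    and ract_tgt: "h \<in> carrier H \<Longrightarrow> ract H h a = h \<otimes> tgt H a"
    and comult_one: "[(\<one>, \<one>)] \<in> comult H \<one>"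
    and comult_mult: "\<lbrakk>g \<in> carrier H; h \<in> carrier H; zs \<in> comult H g; ws \<in> comult H h\<rbrakk> \<Longrightarrow>
      [(x \<otimes> x', y \<otimes> y'). (x, y) \<leftarrow> zs, (x', y') \<leftarrow> ws] \<in> comult H (g \<otimes> h)"
    and counit_alg: "counit H \<in> ring_hom H base_ring"
    and antipode_hom: "antipode H \<in> ring_hom H H"
    and antipode_src: "antipode H (src H a) = tgt H a"
    and antipode_tgt: "antipode H (tgt H a) = src H a"
    and antipode_antipode: "h \<in> carrier H \<Longrightarrow> antipode H (antipode H h) = h"
    and antipode_left: "\<lbrakk>h \<in> carrier H; zs \<in> comult H h\<rbrakk> \<Longrightarrow>
      lsum H [antipode H x \<otimes> y. (x, y) \<leftarrow> zs] = tgt H (counit H h)"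
    and antipode_right: "\<lbrakk>h \<in> carrier H; zs \<in> comult H h\<rbrakk> \<Longrightarrow>
      lsum H [x \<otimes> antipode H y. (x, y) \<leftarrow> zs] = src H (counit H h)"


section \<open>Lie-Rinehart algebras\<close>

record ('a, 'l) lr_algebra = "('a, 'l) module" +
  bracket :: "'l \<Rightarrow> 'l \<Rightarrow> 'l"
  anchor :: "'l \<Rightarrow> 'a \<Rightarrow> 'a"

definition derivations ::
    "('k::field_char_0 \<Rightarrow> 'a::{comm_ring,comm_monoid_mult}) \<Rightarrow> ('a \<Rightarrow> 'a) set" where
  "derivations \<kappa> = {D. (\<forall>a b. D (a + b) = D a + D b) \<and> (\<forall>c a. D (\<kappa> c * a) = \<kappa> c * D a) \<and>
     (\<forall>a b. D (a * b) = a * D b + D a * b)}"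

locale lie_rinehart = module base_ring L
  for \<kappa> :: "'k::field_char_0 \<Rightarrow> 'a::{comm_ring,comm_monoid_mult}"
    and L :: "('a, 'l, 'x) lr_algebra_scheme" (structure) +
  assumes bracket_closed: "\<lbrakk>X \<in> carrier L; Y \<in> carrier L\<rbrakk> \<Longrightarrow> bracket L X Y \<in> carrier L"
    and bracket_add_left: "\<lbrakk>X \<in> carrier L; Y \<in> carrier L; Z \<in> carrier L\<rbrakk> \<Longrightarrow>
      bracket L (X \<oplus>\<^bsub>L\<^esub> Y) Z = bracket L X Z \<oplus>\<^bsub>L\<^esub> bracket L Y Z"
    and bracket_add_right: "\<lbrakk>X \<in> carrier L; Y \<in> carrier L; Z \<in> carrier L\<rbrakk> \<Longrightarrow>
      bracket L X (Y \<oplus>\<^bsub>L\<^esub> Z) = bracket L X Y \<oplus>\<^bsub>L\<^esub> bracket L X Z"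
    and bracket_scale_left: "\<lbrakk>X \<in> carrier L; Y \<in> carrier L\<rbrakk> \<Longrightarrow>
      bracket L (\<kappa> c \<odot>\<^bsub>L\<^esub> X) Y = \<kappa> c \<odot>\<^bsub>L\<^esub> bracket L X Y"
    and bracket_scale_right: "\<lbrakk>X \<in> carrier L; Y \<in> carrier L\<rbrakk> \<Longrightarrow>
      bracket L X (\<kappa> c \<odot>\<^bsub>L\<^esub> Y) = \<kappa> c \<odot>\<^bsub>L\<^esub> bracket L X Y"
    and bracket_self: "X \<in> carrier L \<Longrightarrow> bracket L X X = \<zero>\<^bsub>L\<^esub>"
    and jacobi: "\<lbrakk>X \<in> carrier L; Y \<in> carrier L; Z \<in> carrier L\<rbrakk> \<Longrightarrow>
      bracket L X (bracket L Y Z) \<oplus>\<^bsub>L\<^esub> bracket L Y (bracket L Z X) \<oplus>\<^bsub>L\<^esub> bracket L Z (bracket L X Y)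
        = \<zero>\<^bsub>L\<^esub>"
    and anchor_der: "X \<in> carrier L \<Longrightarrow> anchor L X \<in> derivations \<kappa>"
    and anchor_add: "\<lbrakk>X \<in> carrier L; Y \<in> carrier L\<rbrakk> \<Longrightarrow>
      anchor L (X \<oplus>\<^bsub>L\<^esub> Y) a = anchor L X a + anchor L Y a"
    and anchor_smult: "X \<in> carrier L \<Longrightarrow> anchor L (a \<odot>\<^bsub>L\<^esub> X) b = a * anchor L X b"
    and anchor_bracket: "\<lbrakk>X \<in> carrier L; Y \<in> carrier L\<rbrakk> \<Longrightarrow>
      anchor L (bracket L X Y) a = anchor L X (anchor L Y a) - anchor L Y (anchor L X a)"
    and leibniz: "\<lbrakk>X \<in> carrier L; Y \<in> carrier L\<rbrakk> \<Longrightarrow>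
      bracket L X (a \<odot>\<^bsub>L\<^esub> Y) = a \<odot>\<^bsub>L\<^esub> bracket L X Y \<oplus>\<^bsub>L\<^esub> anchor L X a \<odot>\<^bsub>L\<^esub> Y"

definition lr_morphism ::
    "('k::field_char_0 \<Rightarrow> 'a::{comm_ring,comm_monoid_mult}) \<Rightarrow>
     ('a, 'l) lr_algebra \<Rightarrow> ('a, 'm) lr_algebra \<Rightarrow> ('l \<Rightarrow> 'm) \<Rightarrow> bool" where
  "lr_morphism \<kappa> L M \<phi> \<longleftrightarrow> lie_rinehart \<kappa> L \<and> lie_rinehart \<kappa> M \<and>
     \<phi> \<in> carrier L \<rightarrow> carrier M \<and>
     (\<forall>X\<in>carrier L. \<forall>Y\<in>carrier L. \<phi> (X \<oplus>\<^bsub>L\<^esub> Y) = \<phi> X \<oplus>\<^bsub>M\<^esub> \<phi> Y) \<and>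
     (\<forall>X\<in>carrier L. \<forall>a. \<phi> (a \<odot>\<^bsub>L\<^esub> X) = a \<odot>\<^bsub>M\<^esub> \<phi> X) \<and>
     (\<forall>X\<in>carrier L. \<forall>Y\<in>carrier L. \<phi> (bracket L X Y) = bracket M (\<phi> X) (\<phi> Y)) \<and>
     (\<forall>X\<in>carrier L. anchor M (\<phi> X) = anchor L X)"

text \<open>The Lie-Rinehart algebra of derivations of a commutative Hopf algebroid.  Its elements are
  functions on the carrier of \<open>H\<close>, hence extensional.\<close>

definition s_derivations ::
    "('k::field_char_0 \<Rightarrow> 'a::{comm_ring,comm_monoid_mult}) \<Rightarrow>
     ('a, 'h) hopf_algebroid \<Rightarrow> ('h \<Rightarrow> 'a) set" where
  "s_derivations \<kappa> H = {\<delta> \<in> extensional (carrier H).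
     (\<forall>u\<in>carrier H. \<forall>v\<in>carrier H. \<delta> (u \<oplus>\<^bsub>H\<^esub> v) = \<delta> u + \<delta> v) \<and>
     (\<forall>c. \<forall>u\<in>carrier H. \<delta> (src H (\<kappa> c) \<otimes>\<^bsub>H\<^esub> u) = \<kappa> c * \<delta> u) \<and>
     (\<forall>a. \<delta> (src H a) = 0) \<and>
     (\<forall>u\<in>carrier H. \<forall>v\<in>carrier H. \<delta> (u \<otimes>\<^bsub>H\<^esub> v) = counit H u * \<delta> v + \<delta> u * counit H v)}"

definition der_lr ::
    "('k::field_char_0 \<Rightarrow> 'a::{comm_ring,comm_monoid_mult}) \<Rightarrow>
     ('a, 'h) hopf_algebroid \<Rightarrow> ('a, 'h \<Rightarrow> 'a) lr_algebra" where
  "der_lr \<kappa> H =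
    \<lparr>carrier = s_derivations \<kappa> H, mult = undefined, one = undefined,
     zero = (\<lambda>u\<in>carrier H. 0),
     add = (\<lambda>\<delta> \<delta>'. \<lambda>u\<in>carrier H. \<delta> u + \<delta>' u),
     smult = (\<lambda>a \<delta>. \<lambda>u\<in>carrier H. a * \<delta> u),
     bracket = (\<lambda>\<delta> \<delta>'. \<lambda>u\<in>carrier H.
       (\<Sum>(x, y) \<leftarrow> rep (comult H u).
          \<delta> (x \<otimes>\<^bsub>H\<^esub> tgt H (\<delta>' y)) - \<delta>' (x \<otimes>\<^bsub>H\<^esub> tgt H (\<delta> y)))),
     anchor = (\<lambda>\<delta> a. \<delta> (tgt H a))\<rparr>"

definition der_map :: "('a, 'h) hopf_algebroid \<Rightarrow> ('h \<Rightarrow> 'h') \<Rightarrow> ('h' \<Rightarrow> 'a) \<Rightarrow> ('h \<Rightarrow> 'a)" where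
  "der_map H \<phi> \<delta> = (\<lambda>u\<in>carrier H. \<delta> (\<phi> u))"


section \<open>The universal enveloping algebroid\<close>

text \<open>
  The universal algebra is constructed by generators and relations: terms over the
  symbols \<open>\<iota>\<^sub>A(a)\<close> and \<open>\<iota>\<^sub>L(X)\<close>, modulo the smallest congruence that contains the ring axioms and the
  defining relations.  The zero and the one are \<open>\<iota>\<^sub>A(0)\<close> and \<open>\<iota>\<^sub>A(1)\<close>, the additive inverse of \<open>t\<close> is
  \<open>\<iota>\<^sub>A(-1) t\<close>.  The field acts through \<open>\<iota>\<^sub>A\<close>; its image is central because anchors are linear
  over the field.
\<close>

datatype (cfs: 'a, gens: 'l) uterm =
  IotaA 'a
| IotaL 'l
| Add "('a, 'l) uterm" "('a, 'l) uterm"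
| Mul "('a, 'l) uterm" "('a, 'l) uterm"

definition uterms :: "('a, 'l) lr_algebra \<Rightarrow> ('a, 'l) uterm set" where
  "uterms L = {t. gens t \<subseteq> carrier L}"

inductive ucong :: "('a::{comm_ring,comm_monoid_mult}, 'l) lr_algebra \<Rightarrow>
    ('a, 'l) uterm \<Rightarrow> ('a, 'l) uterm \<Rightarrow> bool"
  for L :: "('a, 'l) lr_algebra" where
  ucong_refl: "t \<in> uterms L \<Longrightarrow> ucong L t t"
| ucong_sym: "ucong L t t' \<Longrightarrow> ucong L t' t"
| ucong_trans: "ucong L t t' \<Longrightarrow> ucong L t' t'' \<Longrightarrow> ucong L t t''"
| ucong_Add: "ucong L t t' \<Longrightarrow> ucong L r r' \<Longrightarrow> ucong L (Add t r) (Add t' r')"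
| ucong_Mul: "ucong L t t' \<Longrightarrow> ucong L r r' \<Longrightarrow> ucong L (Mul t r) (Mul t' r')"
| uadd_assoc: "t \<in> uterms L \<Longrightarrow> r \<in> uterms L \<Longrightarrow> q \<in> uterms L \<Longrightarrow>
    ucong L (Add (Add t r) q) (Add t (Add r q))"
| uadd_comm: "t \<in> uterms L \<Longrightarrow> r \<in> uterms L \<Longrightarrow> ucong L (Add t r) (Add r t)"
| uadd_zero: "t \<in> uterms L \<Longrightarrow> ucong L (Add (IotaA 0) t) t"
| uadd_neg: "t \<in> uterms L \<Longrightarrow> ucong L (Add (Mul (IotaA (- 1)) t) t) (IotaA 0)"
| umul_assoc: "t \<in> uterms L \<Longrightarrow> r \<in> uterms L \<Longrightarrow> q \<in> uterms L \<Longrightarrow>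
    ucong L (Mul (Mul t r) q) (Mul t (Mul r q))"
| uone_mul: "t \<in> uterms L \<Longrightarrow> ucong L (Mul (IotaA 1) t) t"
| umul_one: "t \<in> uterms L \<Longrightarrow> ucong L (Mul t (IotaA 1)) t"
| udistrib_left: "t \<in> uterms L \<Longrightarrow> r \<in> uterms L \<Longrightarrow> q \<in> uterms L \<Longrightarrow>
    ucong L (Mul t (Add r q)) (Add (Mul t r) (Mul t q))"
| udistrib_right: "t \<in> uterms L \<Longrightarrow> r \<in> uterms L \<Longrightarrow> q \<in> uterms L \<Longrightarrow>
    ucong L (Mul (Add t r) q) (Add (Mul t q) (Mul r q))"
| iotaA_add: "ucong L (IotaA (a + b)) (Add (IotaA a) (IotaA b))"
| iotaA_mult: "ucong L (IotaA (a * b)) (Mul (IotaA a) (IotaA b))"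
| iotaL_add: "X \<in> carrier L \<Longrightarrow> Y \<in> carrier L \<Longrightarrow>
    ucong L (IotaL (X \<oplus>\<^bsub>L\<^esub> Y)) (Add (IotaL X) (IotaL Y))"
| iotaL_bracket: "X \<in> carrier L \<Longrightarrow> Y \<in> carrier L \<Longrightarrow>
    ucong L (Add (IotaL (bracket L X Y)) (Mul (IotaL Y) (IotaL X))) (Mul (IotaL X) (IotaL Y))"
| iotaL_smult: "X \<in> carrier L \<Longrightarrow> ucong L (IotaL (a \<odot>\<^bsub>L\<^esub> X)) (Mul (IotaL X) (IotaA a))"
| iotaL_iotaA: "X \<in> carrier L \<Longrightarrow>
    ucong L (Mul (IotaL X) (IotaA a)) (Add (Mul (IotaA a) (IotaL X)) (IotaA (anchor L X a)))"

type_synonym ('a, 'l) env = "('a, 'l) uterm set"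

definition ucls :: "('a::{comm_ring,comm_monoid_mult}, 'l) lr_algebra \<Rightarrow>
    ('a, 'l) uterm \<Rightarrow> ('a, 'l) env" where
  "ucls L t = {t'. ucong L t t'}"

definition iotaA :: "('a::{comm_ring,comm_monoid_mult}, 'l) lr_algebra \<Rightarrow> 'a \<Rightarrow> ('a, 'l) env" where
  "iotaA L a = ucls L (IotaA a)"

definition iotaL :: "('a::{comm_ring,comm_monoid_mult}, 'l) lr_algebra \<Rightarrow> 'l \<Rightarrow> ('a, 'l) env" where
  "iotaL L X = ucls L (IotaL X)"

definition VA :: "('a::{comm_ring,comm_monoid_mult}, 'l) lr_algebra \<Rightarrow>
    ('a, ('a, 'l) env) bimod" where
  "VA L =
    \<lparr>carrier = ucls L ` uterms L,
     mult = (\<lambda>u v. \<Union>t\<in>u. \<Union>r\<in>v. ucls L (Mul t r)),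
     one = iotaA L 1,
     zero = iotaA L 0,
     add = (\<lambda>u v. \<Union>t\<in>u. \<Union>r\<in>v. ucls L (Add t r)),
     lact = (\<lambda>a u. \<Union>t\<in>u. ucls L (Mul (IotaA a) t)),
     ract = (\<lambda>u a. \<Union>t\<in>u. ucls L (Mul t (IotaA a)))\<rparr>"

lemma uterms_simps [simp]:
  "IotaA a \<in> uterms L" "IotaL X \<in> uterms L \<longleftrightarrow> X \<in> carrier L"
  "Add t r \<in> uterms L \<longleftrightarrow> t \<in> uterms L \<and> r \<in> uterms L"
  "Mul t r \<in> uterms L \<longleftrightarrow> t \<in> uterms L \<and> r \<in> uterms L"
  by (auto simp: uterms_def)

lemma ucong_uterms:
  assumes L: "lie_rinehart \<kappa> L" and "ucong L t t'"
  shows "t \<in> uterms L \<and> t' \<in> uterms L"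
proof -
  interpret lie_rinehart \<kappa> L by fact
  have smult: "a \<odot>\<^bsub>L\<^esub> X \<in> carrier L" if "X \<in> carrier L" for a X
    using that smult_closed[of a X] by (simp add: base_ring_def)
  show ?thesis
    using assms(2) by (induction rule: ucong.induct) (simp_all add: bracket_closed smult)
qed

lemma ucls_eq_iff:
  assumes "t \<in> uterms L"
  shows "ucls L t = ucls L r \<longleftrightarrow> ucong L t r"
proof
  have "t \<in> ucls L t" using assms by (simp add: ucls_def ucong_refl)
  also assume "ucls L t = ucls L r"
  finally show "ucong L t r" by (simp add: ucls_def ucong_sym)
next
  assume "ucong L t r"
  then show "ucls L t = ucls L r"
    unfolding ucls_def by (blast intro: ucong_sym ucong_trans)
qed

lemma ucls_self: "t \<in> uterms L \<Longrightarrow> t \<in> ucls L t"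
  by (simp add: ucls_def ucong_refl)

lemma VA_op:
  assumes t: "t \<in> uterms L" and r: "r \<in> uterms L"
  shows "ucls L t \<otimes>\<^bsub>VA L\<^esub> ucls L r = ucls L (Mul t r)"
    and "ucls L t \<oplus>\<^bsub>VA L\<^esub> ucls L r = ucls L (Add t r)"
proof -
  have *: "(\<Union>t'\<in>ucls L t. \<Union>r'\<in>ucls L r. ucls L (c t' r')) = ucls L (c t r)"
    if "c = Mul \<or> c = Add" for c
  proof -
    have "ucls L (c t r) = ucls L (c t' r')" if "t' \<in> ucls L t" "r' \<in> ucls L r" for t' r'
    proof -
      have "c t r \<in> uterms L" "ucong L (c t r) (c t' r')"
        using that t r \<open>c = Mul \<or> c = Add\<close> by (auto simp: ucls_def intro: ucong_Mul ucong_Add)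
      then show ?thesis by (simp add: ucls_eq_iff)
    qed
    then show ?thesis using ucls_self[OF t] ucls_self[OF r] by blast
  qed
  show "ucls L t \<otimes>\<^bsub>VA L\<^esub> ucls L r = ucls L (Mul t r)"
    using *[of Mul] by (simp add: VA_def)
  show "ucls L t \<oplus>\<^bsub>VA L\<^esub> ucls L r = ucls L (Add t r)"
    using *[of Add] by (simp add: VA_def)
qed

lemma VA_ring: "ring (VA L)"
proof -
  have car: "carrier (VA L) = ucls L ` uterms L" "\<one>\<^bsub>VA L\<^esub> = ucls L (IotaA 1)"
    "\<zero>\<^bsub>VA L\<^esub> = ucls L (IotaA 0)"
    by (simp_all add: VA_def iotaA_def)
  note op = VA_op
  have eqs: "ucls L (Add (Add t r) q) = ucls L (Add t (Add r q))"
      "ucls L (Add t r) = ucls L (Add r t)" "ucls L (Add (IotaA 0) t) = ucls L t"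
    if "t \<in> uterms L" "r \<in> uterms L" "q \<in> uterms L" for t r q
    using that by (simp_all add: ucls_eq_iff uadd_assoc uadd_comm uadd_zero)
  have eqs': "ucls L (Mul (Mul t r) q) = ucls L (Mul t (Mul r q))"
      "ucls L (Mul t (Add r q)) = ucls L (Add (Mul t r) (Mul t q))"
      "ucls L (Mul (Add t r) q) = ucls L (Add (Mul t q) (Mul r q))"
      "ucls L (Mul (IotaA 1) t) = ucls L t" "ucls L (Mul t (IotaA 1)) = ucls L t"
    if "t \<in> uterms L" "r \<in> uterms L" "q \<in> uterms L" for t r q
    using that
    by (simp_all add: ucls_eq_iff umul_assoc udistrib_left udistrib_right uone_mul umul_one)
  note ones = eqs'(4,5)[OF _ uterms_simps(1)[of 1] uterms_simps(1)[of 1]]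
  show ?thesis
  proof (rule ringI)
    show "abelian_group (VA L)"
    proof (rule abelian_groupI)
      fix x assume "x \<in> carrier (VA L)"
      then obtain t where t: "t \<in> uterms L" "x = ucls L t" by (auto simp: car)
      then show "\<exists>y\<in>carrier (VA L). y \<oplus>\<^bsub>VA L\<^esub> x = \<zero>\<^bsub>VA L\<^esub>"
        by (intro bexI[of _ "ucls L (Mul (IotaA (- 1)) t)"])
          (auto simp: car op ucls_eq_iff intro: uadd_neg)
    next
      fix x y assume "x \<in> carrier (VA L)" "y \<in> carrier (VA L)"
      then obtain t r where "t \<in> uterms L" "x = ucls L t" "r \<in> uterms L" "y = ucls L r"
        by (auto simp: car)
      then show "x \<oplus>\<^bsub>VA L\<^esub> y = y \<oplus>\<^bsub>VA L\<^esub> x" using eqs(2)[of t r r] by (simp add: op)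
    qed (auto simp: car op eqs(1) eqs(3)[of _ "IotaA 0" "IotaA 0"])
    show "monoid (VA L)"
      by (rule monoidI) (auto simp: car op eqs'(1) ones)
  qed (auto simp: car op eqs'(2,3))
qed

primrec ueval :: "('r, 'x) ring_scheme \<Rightarrow> ('a \<Rightarrow> 'r) \<Rightarrow> ('l \<Rightarrow> 'r) \<Rightarrow> ('a, 'l) uterm \<Rightarrow> 'r" where
  "ueval R jA jL (IotaA a) = jA a"
| "ueval R jA jL (IotaL X) = jL X"
| "ueval R jA jL (Add t r) = ueval R jA jL t \<oplus>\<^bsub>R\<^esub> ueval R jA jL r"
| "ueval R jA jL (Mul t r) = ueval R jA jL t \<otimes>\<^bsub>R\<^esub> ueval R jA jL r"

theorem VA_universal:
  assumes R: "ring R"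
    and jA: "jA \<in> ring_hom base_ring R"
    and jL: "jL \<in> carrier L \<rightarrow> carrier R"
    and add: "\<And>X Y. \<lbrakk>X \<in> carrier L; Y \<in> carrier L\<rbrakk> \<Longrightarrow> jL (X \<oplus>\<^bsub>L\<^esub> Y) = jL X \<oplus>\<^bsub>R\<^esub> jL Y"
    and brk: "\<And>X Y. \<lbrakk>X \<in> carrier L; Y \<in> carrier L\<rbrakk> \<Longrightarrow>
      jL (bracket L X Y) = jL X \<otimes>\<^bsub>R\<^esub> jL Y \<ominus>\<^bsub>R\<^esub> jL Y \<otimes>\<^bsub>R\<^esub> jL X"
    and smu: "\<And>X a. X \<in> carrier L \<Longrightarrow> jL (a \<odot>\<^bsub>L\<^esub> X) = jL X \<otimes>\<^bsub>R\<^esub> jA a"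
    and anc: "\<And>X a. X \<in> carrier L \<Longrightarrow>
      jL X \<otimes>\<^bsub>R\<^esub> jA a \<ominus>\<^bsub>R\<^esub> jA a \<otimes>\<^bsub>R\<^esub> jL X = jA (anchor L X a)"
  shows "\<exists>!h. h \<in> extensional (carrier (VA L)) \<and> h \<in> ring_hom (VA L) R \<and>
    (\<forall>a. h (iotaA L a) = jA a) \<and> (\<forall>X\<in>carrier L. h (iotaL L X) = jL X)"
proof -
  interpret R: ring R by fact
  have jA': "jA a \<in> carrier R" "jA (a + b) = jA a \<oplus>\<^bsub>R\<^esub> jA b" "jA (a * b) = jA a \<otimes>\<^bsub>R\<^esub> jA b"
    "jA 1 = \<one>\<^bsub>R\<^esub>" for a b
    using jA by (auto simp: ring_hom_def base_ring_def)
  have jA0: "jA 0 = \<zero>\<^bsub>R\<^esub>"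
    using jA'(2)[of 0 0] jA'(1)[of 0] R.add.l_cancel_one' by force
  have jAm: "jA (- a) = \<ominus>\<^bsub>R\<^esub> jA a" for a
    using jA'(2)[of "- a" a] jA'(1) jA0 R.minus_equality by force
  have jL': "jL X \<in> carrier R" if "X \<in> carrier L" for X
    using that jL by auto
  let ?e = "ueval R jA jL"
  have e: "?e t \<in> carrier R" if "t \<in> uterms L" for t
    using that by (induction t) (auto simp: jA' jL')
  have resp: "?e t = ?e t'" if "ucong L t t'" for t t'
    using that
  proof (induction rule: ucong.induct)
    case (uadd_neg t)
    then show ?case using e[of t] by (simp add: jAm jA' jA0 R.l_minus R.l_neg)
  next
    case (iotaL_bracket X Y)
    then show ?case using jL'[of X] jL'[of Y]
      by (simp add: brk R.minus_eq R.a_assoc R.l_neg)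
  next
    case (iotaL_iotaA X a)
    then have "jA (anchor L X a) = jL X \<otimes>\<^bsub>R\<^esub> jA a \<ominus>\<^bsub>R\<^esub> jA a \<otimes>\<^bsub>R\<^esub> jL X" by (simp add: anc)
    moreover have "x = y \<oplus>\<^bsub>R\<^esub> (x \<ominus>\<^bsub>R\<^esub> y)" if "x \<in> carrier R" "y \<in> carrier R" for x y
      using that by (metis R.add.inv_solve_right R.a_comm R.minus_closed R.minus_eq)
    ultimately show ?case using jL'[OF iotaL_iotaA] jA'(1)[of a] by simp
  qed (simp_all add: e jA' jA0 add smu R.a_ac R.m_assoc R.l_distr R.r_distr jL')
  have car: "carrier (VA L) = ucls L ` uterms L" "\<one>\<^bsub>VA L\<^esub> = ucls L (IotaA 1)"
    by (simp_all add: VA_def iotaA_def)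
  define h where "h = (\<lambda>u\<in>carrier (VA L). ?e (rep u))"
  have h: "h (ucls L t) = ?e t" if "t \<in> uterms L" for t
  proof -
    have "rep (ucls L t) \<in> ucls L t" unfolding rep_def by (rule someI) (rule ucls_self[OF that])
    then have "ucong L t (rep (ucls L t))" by (simp add: ucls_def)
    then show ?thesis using that resp by (force simp: h_def car)
  qed
  show ?thesis
  proof (rule ex1I[of _ h])
    show "h \<in> extensional (carrier (VA L)) \<and> h \<in> ring_hom (VA L) R \<and>
      (\<forall>a. h (iotaA L a) = jA a) \<and> (\<forall>X\<in>carrier L. h (iotaL L X) = jL X)"
      by (auto simp: h iotaA_def iotaL_def ring_hom_def car VA_op e jA')
        (simp add: h_def car)
  next
    fix g assume g: "g \<in> extensional (carrier (VA L)) \<and> g \<in> ring_hom (VA L) R \<and>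
      (\<forall>a. g (iotaA L a) = jA a) \<and> (\<forall>X\<in>carrier L. g (iotaL L X) = jL X)"
    have "g (ucls L t) = ?e t" if "t \<in> uterms L" for t
      using that
    proof (induction t)
      case (Add t r)
      then have "g (ucls L t \<oplus>\<^bsub>VA L\<^esub> ucls L r) = g (ucls L t) \<oplus>\<^bsub>R\<^esub> g (ucls L r)"
        using g by (intro ring_hom_add) (auto simp: car)
      with Add show ?case by (simp add: VA_op)
    next
      case (Mul t r)
      then have "g (ucls L t \<otimes>\<^bsub>VA L\<^esub> ucls L r) = g (ucls L t) \<otimes>\<^bsub>R\<^esub> g (ucls L r)"
        using g by (intro ring_hom_mult) (auto simp: car)
      with Mul show ?case by (simp add: VA_op)
    qed (use g in \<open>auto simp: iotaA_def iotaL_def\<close>)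
    then show "g = h"
      using g h by (intro extensionalityI[of g "carrier (VA L)" h]) (auto simp: h_def car)
  qed
qed

text \<open>\<open>VA_right L\<close> is \<open>\<U>\<^sub>A\<close>: the right \<open>A\<close>-module, made into a symmetric bimodule.\<close>

definition VA_right :: "('a::{comm_ring,comm_monoid_mult}, 'l) lr_algebra \<Rightarrow>
    ('a, ('a, 'l) env) bimod" where
  "VA_right L = VA L\<lparr>lact := (\<lambda>a u. ract (VA L) u a)\<rparr>"

text \<open>
  \<open>uact L t a\<close> is \<open>a \<cdot> t = \<epsilon>(a t)\<close>, by recursion on \<open>t\<close>.  The value at \<open>\<iota>\<^sub>L(X)\<close> is forced by
  \<open>\<epsilon>(\<iota>\<^sub>A(a) \<iota>\<^sub>L(X)) = \<epsilon>(\<iota>\<^sub>L(X) \<iota>\<^sub>A(a)) - X(a) = - X(a)\<close> and the value at products by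
  \<open>\<epsilon>(u v) = \<epsilon>(\<epsilon>(u) v)\<close>.
\<close>

primrec uact :: "('a::{comm_ring,comm_monoid_mult}, 'l) lr_algebra \<Rightarrow> ('a, 'l) uterm \<Rightarrow> 'a \<Rightarrow> 'a" where
  "uact L (IotaA b) a = a * b"
| "uact L (IotaL X) a = - anchor L X a"
| "uact L (Add t r) a = uact L t a + uact L r a"
| "uact L (Mul t r) a = uact L r (uact L t a)"

definition ucounit :: "('a::{comm_ring,comm_monoid_mult}, 'l) lr_algebra \<Rightarrow> ('a, 'l) env \<Rightarrow> 'a" where
  "ucounit L u = uact L (rep u) 1"

text \<open>\<open>ucop\<close> extends the values of the comultiplication on generators additively and
  multiplicatively.\<close>

primrec ucop :: "('a::{comm_ring,comm_monoid_mult}, 'l) lr_algebra \<Rightarrow> ('a, 'l) uterm \<Rightarrow>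
    (('a, 'l) env \<times> ('a, 'l) env) list" where
  "ucop L (IotaA a) = [(iotaA L a, \<one>\<^bsub>VA L\<^esub>)]"
| "ucop L (IotaL X) = [(iotaL L X, \<one>\<^bsub>VA L\<^esub>), (\<one>\<^bsub>VA L\<^esub>, iotaL L X)]"
| "ucop L (Add t r) = ucop L t @ ucop L r"
| "ucop L (Mul t r) =
    [(x \<otimes>\<^bsub>VA L\<^esub> x', y \<otimes>\<^bsub>VA L\<^esub> y'). (x, y) \<leftarrow> ucop L t, (x', y') \<leftarrow> ucop L r]"

definition ucomult :: "('a::{comm_ring,comm_monoid_mult}, 'l) lr_algebra \<Rightarrow> ('a, 'l) env \<Rightarrow>
    (('a, 'l) env \<times> ('a, 'l) env) list set" where
  "ucomult L u = tcls (VA_right L) (VA_right L) (ucop L (rep u))"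

text \<open>\<open>utrans L u\<close> is the element \<open>\<beta>\<^sup>-\<^sup>1(1 \<otimes> u)\<close> of \<open>\<U>\<^sub>A \<otimes>\<^sub>A \<^sub>A\<U>\<close>, as the set of the formal sums that
  represent it.\<close>

definition ubeta :: "('a::{comm_ring,comm_monoid_mult}, 'l) lr_algebra \<Rightarrow>
    (('a, 'l) env \<times> ('a, 'l) env) list \<Rightarrow> (('a, 'l) env \<times> ('a, 'l) env) list set" where
  "ubeta L zs = tcls (VA_right L) (VA_right L)
     [(u \<otimes>\<^bsub>VA L\<^esub> x, y). (u, v) \<leftarrow> zs, (x, y) \<leftarrow> rep (ucomult L v)]"

definition utrans :: "('a::{comm_ring,comm_monoid_mult}, 'l) lr_algebra \<Rightarrow> ('a, 'l) env \<Rightarrow>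
    (('a, 'l) env \<times> ('a, 'l) env) list set" where
  "utrans L u = {zs. set zs \<subseteq> carrier (VA L) \<times> carrier (VA L) \<and>
     ubeta L zs = tcls (VA_right L) (VA_right L) [(\<one>\<^bsub>VA L\<^esub>, u)]}"

definition udual :: "('a::{comm_ring,comm_monoid_mult}, 'l) lr_algebra \<Rightarrow>
    (('a, 'l) env \<Rightarrow> 'a) set" where
  "udual L = {f \<in> extensional (carrier (VA L)).
     (\<forall>u\<in>carrier (VA L). \<forall>v\<in>carrier (VA L). f (u \<oplus>\<^bsub>VA L\<^esub> v) = f u + f v) \<and>
     (\<forall>u\<in>carrier (VA L). \<forall>a. f (u \<otimes>\<^bsub>VA L\<^esub> iotaA L a) = f u * a)}"

text \<open>\<open>VA_map M \<phi>\<close> is the algebra map to \<open>VA M\<close> induced by a morphism \<open>\<phi>\<close> of Lie-Rinehart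
  algebras.\<close>

definition VA_map :: "('a::{comm_ring,comm_monoid_mult}, 'm) lr_algebra \<Rightarrow> ('l \<Rightarrow> 'm) \<Rightarrow>
    ('a, 'l) env \<Rightarrow> ('a, 'm) env" where
  "VA_map M \<phi> u = (\<Union>t\<in>u. ucls M (map_uterm id \<phi> t))"


section \<open>Right modules, finitely generated and projective over the base\<close>

text \<open>The field \<open>smult\<close> of the module record holds a right action here: \<open>r \<odot> m\<close> stands for \<open>m r\<close>.\<close>

locale right_module = R?: ring R + M?: abelian_group M
  for R :: "('r, 'x) ring_scheme" and M :: "('r, 'm, 'y) module_scheme" +
  assumes act_closed: "\<lbrakk>r \<in> carrier R; m \<in> carrier M\<rbrakk> \<Longrightarrow> r \<odot>\<^bsub>M\<^esub> m \<in> carrier M"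
    and act_add_left: "\<lbrakk>r \<in> carrier R; s \<in> carrier R; m \<in> carrier M\<rbrakk> \<Longrightarrow>
      (r \<oplus>\<^bsub>R\<^esub> s) \<odot>\<^bsub>M\<^esub> m = r \<odot>\<^bsub>M\<^esub> m \<oplus>\<^bsub>M\<^esub> s \<odot>\<^bsub>M\<^esub> m"
    and act_add_right: "\<lbrakk>r \<in> carrier R; m \<in> carrier M; n \<in> carrier M\<rbrakk> \<Longrightarrow>
      r \<odot>\<^bsub>M\<^esub> (m \<oplus>\<^bsub>M\<^esub> n) = r \<odot>\<^bsub>M\<^esub> m \<oplus>\<^bsub>M\<^esub> r \<odot>\<^bsub>M\<^esub> n"
    and act_mult: "\<lbrakk>r \<in> carrier R; s \<in> carrier R; m \<in> carrier M\<rbrakk> \<Longrightarrow>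
      (r \<otimes>\<^bsub>R\<^esub> s) \<odot>\<^bsub>M\<^esub> m = s \<odot>\<^bsub>M\<^esub> (r \<odot>\<^bsub>M\<^esub> m)"
    and act_one: "m \<in> carrier M \<Longrightarrow> \<one>\<^bsub>R\<^esub> \<odot>\<^bsub>M\<^esub> m = m"

definition rmod_hom :: "('r, 'x) ring_scheme \<Rightarrow> ('r, 'm, 'y) module_scheme \<Rightarrow>
    ('r, 'n, 'z) module_scheme \<Rightarrow> ('m \<Rightarrow> 'n) set" where
  "rmod_hom R M N = {h \<in> carrier M \<rightarrow> carrier N.
     (\<forall>m\<in>carrier M. \<forall>n\<in>carrier M. h (m \<oplus>\<^bsub>M\<^esub> n) = h m \<oplus>\<^bsub>N\<^esub> h n) \<and>
     (\<forall>m\<in>carrier M. \<forall>r\<in>carrier R. h (r \<odot>\<^bsub>M\<^esub> m) = r \<odot>\<^bsub>N\<^esub> h m)}"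

definition amod :: "('a::{comm_ring,comm_monoid_mult}, 'l) lr_algebra \<Rightarrow>
    (('a, 'l) env, 'm) module \<Rightarrow> ('a, 'm) bimod" where
  "amod L M =
    \<lparr>carrier = carrier M, mult = undefined, one = undefined, zero = \<zero>\<^bsub>M\<^esub>, add = add M,
     lact = (\<lambda>a m. iotaA L a \<odot>\<^bsub>M\<^esub> m), ract = (\<lambda>m a. iotaA L a \<odot>\<^bsub>M\<^esub> m)\<rparr>"

definition free_mod :: "nat \<Rightarrow> ('a::{comm_ring,comm_monoid_mult}, 'a list) bimod" where
  "free_mod n =
    \<lparr>carrier = {xs. length xs = n}, mult = undefined, one = undefined,
     zero = replicate n 0, add = (\<lambda>xs ys. map2 (+) xs ys),
     lact = (\<lambda>a. map ((*) a)), ract = (\<lambda>xs a. map ((*) a) xs)\<rparr>"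

text \<open>Finitely generated projective means: a direct summand of some \<open>A\<^sup>n\<close>.\<close>

definition fg_projective :: "('a::{comm_ring,comm_monoid_mult}, 'm) bimod \<Rightarrow> bool" where
  "fg_projective M \<longleftrightarrow> (\<exists>n. \<exists>i\<in>bimod_hom M (free_mod n). \<exists>p\<in>bimod_hom (free_mod n) M.
     \<forall>m\<in>carrier M. p (i m) = m)"

text \<open>
  The category of right modules that are finitely generated projective over \<open>A\<close> is represented by
  its modules with carrier in \<open>'a list\<close>.  Every module of the category is isomorphic to one of these,
  since it is a direct summand of some \<open>A\<^sup>n\<close>.
\<close>

type_synonym ('a, 'l) rmod = "(('a, 'l) env, 'a list) module"

definition objects :: "('a::{comm_ring,comm_monoid_mult}, 'l) lr_algebra \<Rightarrow> ('a, 'l) rmod set" where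
  "objects L = {P. right_module (VA L) P \<and> fg_projective (amod L P)}"

definition mdual :: "('a::{comm_ring,comm_monoid_mult}, 'l) lr_algebra \<Rightarrow>
    (('a, 'l) env, 'm) module \<Rightarrow> ('m \<Rightarrow> 'a) set" where
  "mdual L M = bimod_hom (amod L M) regular_bimod \<inter> extensional (carrier M)"

definition dual_basis :: "('a::{comm_ring,comm_monoid_mult}, 'l) lr_algebra \<Rightarrow>
    (('a, 'l) env, 'm) module \<Rightarrow> ('m \<times> ('m \<Rightarrow> 'a)) list \<Rightarrow> bool" where
  "dual_basis L M es \<longleftrightarrow> set es \<subseteq> carrier M \<times> mdual L M \<and>
     (\<forall>m\<in>carrier M. m = lsum M [iotaA L (f m) \<odot>\<^bsub>M\<^esub> e. (e, f) \<leftarrow> es])"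

definition unit_mod :: "('a::{comm_ring,comm_monoid_mult}, 'l) lr_algebra \<Rightarrow>
    (('a, 'l) env, 'a) module" where
  "unit_mod L =
    \<lparr>carrier = UNIV, mult = undefined, one = undefined, zero = 0, add = (+),
     smult = (\<lambda>u a. ucounit L (iotaA L a \<otimes>\<^bsub>VA L\<^esub> u))\<rparr>"

definition mod_tensor :: "('a::{comm_ring,comm_monoid_mult}, 'l) lr_algebra \<Rightarrow>
    (('a, 'l) env, 'q) module \<Rightarrow> (('a, 'l) env, 'p) module \<Rightarrow>
    (('a, 'l) env, ('q \<times> 'p) list set) module" where
  "mod_tensor L Q P = (let T = tensor (amod L Q) (amod L P) in
    \<lparr>carrier = carrier T, mult = undefined, one = undefined, zero = \<zero>\<^bsub>T\<^esub>, add = add T,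
     smult = (\<lambda>u X. \<Union>zs\<in>X. tcls (amod L Q) (amod L P)
       [(x \<odot>\<^bsub>Q\<^esub> q, y \<odot>\<^bsub>P\<^esub> p). (q, p) \<leftarrow> zs, (x, y) \<leftarrow> rep (ucomult L u)])\<rparr>)"

text \<open>On the dual, \<open>(\<phi> u)(m) = \<phi>(m u\<^sub>-) \<cdot> u\<^sub>+\<close> with the action \<open>a \<cdot> v = \<epsilon>(a v)\<close> on \<open>A\<close>.\<close>

definition dual_mod :: "('a::{comm_ring,comm_monoid_mult}, 'l) lr_algebra \<Rightarrow>
    (('a, 'l) env, 'p) module \<Rightarrow> (('a, 'l) env, 'p \<Rightarrow> 'a) module" where
  "dual_mod L P =
    \<lparr>carrier = mdual L P, mult = undefined, one = undefined,
     zero = (\<lambda>m\<in>carrier P. 0),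
     add = (\<lambda>\<phi> \<psi>. \<lambda>m\<in>carrier P. \<phi> m + \<psi> m),
     smult = (\<lambda>u \<phi>. \<lambda>m\<in>carrier P.
       (\<Sum>(x, y) \<leftarrow> rep (utrans L u). ucounit L (iotaA L (\<phi> (x \<odot>\<^bsub>P\<^esub> m)) \<otimes>\<^bsub>VA L\<^esub> y)))\<rparr>"


section \<open>The finite dual \<open>\<U>\<^sup>\<circ>\<close>\<close>

text \<open>
  A triple \<open>(P, f, p)\<close> stands for \<open>f \<otimes> p\<close> in \<open>P\<^sup>* \<otimes> P\<close>, a list for a sum.  The congruence \<open>ceq\<close> presents
  the quotient of the direct sum of the \<open>P\<^sup>* \<otimes>\<^bsub>T\<^sub>P\<^esub> P\<close> by \<open>\<J>\<close>: the rule \<open>ceq_hom\<close> for \<open>P = Q\<close> says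
  that the tensors are balanced over \<open>T\<^sub>P = End(P)\<close>, and in general it imposes the generators of \<open>\<J>\<close>.
  These generators are stable under both actions of \<open>A\<close>, so the subgroup they generate is the
  subbimodule.
\<close>

type_synonym ('a, 'l) coeff = "('a, 'l) rmod \<times> ('a list \<Rightarrow> 'a) \<times> 'a list"
type_synonym ('a, 'l) fdual = "('a, 'l) coeff list set"

definition coeffs :: "('a::{comm_ring,comm_monoid_mult}, 'l) lr_algebra \<Rightarrow> ('a, 'l) coeff set" where
  "coeffs L = {(P, f, p). P \<in> objects L \<and> f \<in> mdual L P \<and> p \<in> carrier P}"

inductive ceq :: "('a::{comm_ring,comm_monoid_mult}, 'l) lr_algebra \<Rightarrow>
    ('a, 'l) coeff list \<Rightarrow> ('a, 'l) coeff list \<Rightarrow> bool"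
  for L :: "('a, 'l) lr_algebra" where
  ceq_refl: "set zs \<subseteq> coeffs L \<Longrightarrow> ceq L zs zs"
| ceq_sym: "ceq L zs ws \<Longrightarrow> ceq L ws zs"
| ceq_trans: "ceq L zs ws \<Longrightarrow> ceq L ws vs \<Longrightarrow> ceq L zs vs"
| ceq_append: "ceq L zs zs' \<Longrightarrow> ceq L ws ws' \<Longrightarrow> ceq L (zs @ ws) (zs' @ ws')"
| ceq_comm: "set zs \<subseteq> coeffs L \<Longrightarrow> set ws \<subseteq> coeffs L \<Longrightarrow> ceq L (zs @ ws) (ws @ zs)"
| ceq_add_left: "P \<in> objects L \<Longrightarrow> f \<in> mdual L P \<Longrightarrow> g \<in> mdual L P \<Longrightarrow> p \<in> carrier P \<Longrightarrow>
    ceq L [(P, \<lambda>m\<in>carrier P. f m + g m, p)] [(P, f, p), (P, g, p)]"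
| ceq_add_right: "P \<in> objects L \<Longrightarrow> f \<in> mdual L P \<Longrightarrow> p \<in> carrier P \<Longrightarrow> q \<in> carrier P \<Longrightarrow>
    ceq L [(P, f, p \<oplus>\<^bsub>P\<^esub> q)] [(P, f, p), (P, f, q)]"
| ceq_zero_left: "P \<in> objects L \<Longrightarrow> p \<in> carrier P \<Longrightarrow> ceq L [(P, \<lambda>m\<in>carrier P. 0, p)] []"
| ceq_zero_right: "P \<in> objects L \<Longrightarrow> f \<in> mdual L P \<Longrightarrow> ceq L [(P, f, \<zero>\<^bsub>P\<^esub>)] []"
| ceq_hom: "P \<in> objects L \<Longrightarrow> Q \<in> objects L \<Longrightarrow> h \<in> rmod_hom (VA L) P Q \<Longrightarrow>
    f \<in> mdual L Q \<Longrightarrow> p \<in> carrier P \<Longrightarrow>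
    ceq L [(Q, f, h p)] [(P, \<lambda>m\<in>carrier P. f (h m), p)]"

definition ccls :: "('a::{comm_ring,comm_monoid_mult}, 'l) lr_algebra \<Rightarrow>
    ('a, 'l) coeff list \<Rightarrow> ('a, 'l) fdual" where
  "ccls L zs = {ws. ceq L zs ws}"

text \<open>
  \<open>transport L M f m\<close> is a triple that represents \<open>f \<otimes> m\<close> when the carrier of \<open>M\<close> lies in an
  arbitrary type: \<open>M\<close> is replaced by an isomorphic module among \<open>objects L\<close>.  By \<open>ceq_hom\<close>
  the class of the result does not depend on the choice.
\<close>

definition realization :: "('a::{comm_ring,comm_monoid_mult}, 'l) lr_algebra \<Rightarrow>
    (('a, 'l) env, 'm) module \<Rightarrow> ('a, 'l) rmod \<times> ('m \<Rightarrow> 'a list)" where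
  "realization L M = (SOME (R, h). R \<in> objects L \<and> h \<in> rmod_hom (VA L) M R \<and>
     bij_betw h (carrier M) (carrier R))"

definition transport :: "('a::{comm_ring,comm_monoid_mult}, 'l) lr_algebra \<Rightarrow>
    (('a, 'l) env, 'm) module \<Rightarrow> ('m \<Rightarrow> 'a) \<Rightarrow> 'm \<Rightarrow> ('a, 'l) coeff" where
  "transport L M f m = (case realization L M of (R, h) \<Rightarrow>
     (R, \<lambda>r\<in>carrier R. f (inv_into (carrier M) h r), h m))"

definition coeff_mult :: "('a::{comm_ring,comm_monoid_mult}, 'l) lr_algebra \<Rightarrow>
    ('a, 'l) coeff \<Rightarrow> ('a, 'l) coeff \<Rightarrow> ('a, 'l) coeff" where
  "coeff_mult L = (\<lambda>(P, f, p) (Q, g, q).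
     transport L (mod_tensor L Q P)
       (\<lambda>T. \<Sum>(x, y) \<leftarrow> rep T. g x * f y)
       (tcls (amod L Q) (amod L P) [(q, p)]))"

definition coeff_antipode :: "('a::{comm_ring,comm_monoid_mult}, 'l) lr_algebra \<Rightarrow>
    ('a, 'l) coeff \<Rightarrow> ('a, 'l) coeff" where
  "coeff_antipode L = (\<lambda>(P, f, p). transport L (dual_mod L P) (\<lambda>\<phi>. \<phi> p) f)"

definition fdual_unit :: "('a::{comm_ring,comm_monoid_mult}, 'l) lr_algebra \<Rightarrow>
    'a \<Rightarrow> 'a \<Rightarrow> ('a, 'l) fdual" where
  "fdual_unit L a b = ccls L [transport L (unit_mod L) ((*) a) b]"

definition finite_dual :: "('a::{comm_ring,comm_monoid_mult}, 'l) lr_algebra \<Rightarrow>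
    ('a, ('a, 'l) fdual) hopf_algebroid" where
  "finite_dual L = (let
     car = ccls L ` {zs. set zs \<subseteq> coeffs L};
     add' = (\<lambda>X Y. \<Union>x\<in>X. \<Union>y\<in>Y. ccls L (x @ y));
     lact' = (\<lambda>a X. \<Union>x\<in>X. ccls L [(P, \<lambda>m\<in>carrier P. a * f m, p). (P, f, p) \<leftarrow> x]);
     ract' = (\<lambda>X a. \<Union>x\<in>X. ccls L [(P, f, iotaA L a \<odot>\<^bsub>P\<^esub> p). (P, f, p) \<leftarrow> x]);
     C = \<lparr>carrier = car, mult = undefined, one = undefined,
          zero = ccls L [], add = add', lact = lact', ract = ract'\<rparr>
   in
    \<lparr>carrier = car,
     mult = (\<lambda>X Y. \<Union>x\<in>X. \<Union>y\<in>Y. ccls L [coeff_mult L g h. g \<leftarrow> x, h \<leftarrow> y]),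
     one = fdual_unit L 1 1,
     zero = ccls L [],
     add = add',
     lact = lact',
     ract = ract',
     comult = (\<lambda>X. \<Union>x\<in>X. tcls C C
       [(ccls L [(P, f, e)], ccls L [(P, e', p)]).
          (P, f, p) \<leftarrow> x, (e, e') \<leftarrow> (SOME es. dual_basis L P es)]),
     counit = (\<lambda>X. \<Sum>(P, f, p) \<leftarrow> rep X. f p),
     src = (\<lambda>a. fdual_unit L a 1),
     tgt = (\<lambda>a. fdual_unit L 1 a),
     antipode = (\<lambda>X. \<Union>x\<in>X. ccls L (map (coeff_antipode L) x))\<rparr>)"

definition zeta :: "('a::{comm_ring,comm_monoid_mult}, 'l) lr_algebra \<Rightarrow>
    ('a, 'l) fdual \<Rightarrow> ('a, 'l) env \<Rightarrow> 'a" where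
  "zeta L X = (\<lambda>u\<in>carrier (VA L). \<Sum>(P, f, p) \<leftarrow> rep X. f (u \<odot>\<^bsub>P\<^esub> p))"

text \<open>The action on morphisms: \<open>\<phi>\<close> from \<open>L\<close> to \<open>M\<close> induces a map from the finite dual of \<open>VA M\<close>
  to that of \<open>VA L\<close> by restriction of scalars.\<close>

definition restrict_scalars :: "('a::{comm_ring,comm_monoid_mult}, 'm) lr_algebra \<Rightarrow>
    ('l \<Rightarrow> 'm) \<Rightarrow> ('a, 'm) rmod \<Rightarrow> ('a, 'l) rmod" where
  "restrict_scalars M \<phi> P =
    \<lparr>carrier = carrier P, mult = undefined, one = undefined, zero = \<zero>\<^bsub>P\<^esub>, add = add P,
     smult = (\<lambda>u p. VA_map M \<phi> u \<odot>\<^bsub>P\<^esub> p)\<rparr>"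

definition finite_dual_map :: "('a::{comm_ring,comm_monoid_mult}, 'l) lr_algebra \<Rightarrow>
    ('a, 'm) lr_algebra \<Rightarrow> ('l \<Rightarrow> 'm) \<Rightarrow> ('a, 'm) fdual \<Rightarrow> ('a, 'l) fdual" where
  "finite_dual_map L M \<phi> X =
     (\<Union>x\<in>X. ccls L [(restrict_scalars M \<phi> P, f, p). (P, f, p) \<leftarrow> x])"


section \<open>The universal coring \<open>\<U>\<^sup>\<bullet>\<close>\<close>

definition pairing :: "('a::{comm_ring,comm_monoid_mult}, 'l) lr_algebra \<Rightarrow>
    ('a, 'c, 'x) coring_scheme \<Rightarrow> ('c \<Rightarrow> ('a, 'l) env \<Rightarrow> 'a) \<Rightarrow> bool" where
  "pairing L C f \<longleftrightarrow>
     f \<in> carrier C \<rightarrow> udual L \<and>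
     (\<forall>z\<in>carrier C. \<forall>w\<in>carrier C. \<forall>u\<in>carrier (VA L). f (z \<oplus>\<^bsub>C\<^esub> w) u = f z u + f w u) \<and>
     (\<forall>z\<in>carrier C. \<forall>a b. \<forall>u\<in>carrier (VA L).
        f (ract C (lact C a z) b) u = a * f z (iotaA L b \<otimes>\<^bsub>VA L\<^esub> u)) \<and>
     (\<forall>z\<in>carrier C. f z \<one>\<^bsub>VA L\<^esub> = counit C z) \<and>
     (\<forall>z\<in>carrier C. \<forall>zs\<in>comult C z. \<forall>u\<in>carrier (VA L). \<forall>v\<in>carrier (VA L).
        f z (u \<otimes>\<^bsub>VA L\<^esub> v) = (\<Sum>(x, y) \<leftarrow> zs. f x (iotaA L (f y u) \<otimes>\<^bsub>VA L\<^esub> v)))"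

definition universal_pairing :: "'c itself \<Rightarrow>
    ('k::field_char_0 \<Rightarrow> 'a::{comm_ring,comm_monoid_mult}) \<Rightarrow> ('a, 'l) lr_algebra \<Rightarrow>
    ('a, 'h, 'x) coring_scheme \<Rightarrow> ('h \<Rightarrow> ('a, 'l) env \<Rightarrow> 'a) \<Rightarrow> bool" where
  "universal_pairing _ \<kappa> L H \<xi> \<longleftrightarrow>
     (\<forall>(C :: ('a, 'c) coring) f. coring \<kappa> C \<longrightarrow> pairing L C f \<longrightarrow>
        (\<exists>!g. g \<in> extensional (carrier C) \<and> g \<in> coring_hom C H \<and>
           (\<forall>z\<in>carrier C. \<xi> (g z) = f z)))"

text \<open>
  HOL cannot quantify over the carrier types of all corings \<open>C\<close>, so the universal property is
  required for two carrier types only: that of \<open>\<U>\<^sup>\<circ>\<close> and that of its tensor products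
  \<open>\<U>\<^sup>\<circ> \<otimes> \<U>\<^sup>\<circ>\<close>.  This asks less than the full universal property, hence a result that
  assumes \<open>universal_hopf\<close> covers in particular the coring that is universal for all types.
\<close>

definition universal_hopf ::
    "('k::field_char_0 \<Rightarrow> 'a::{comm_ring,comm_monoid_mult}) \<Rightarrow> ('a, 'l) lr_algebra \<Rightarrow>
     ('a, 'h) hopf_algebroid \<Rightarrow> ('h \<Rightarrow> ('a, 'l) env \<Rightarrow> 'a) \<Rightarrow> bool" where
  "universal_hopf \<kappa> L H \<xi> \<longleftrightarrow>
     comm_hopf_algebroid \<kappa> H \<and> pairing L H \<xi> \<and>
     universal_pairing TYPE(('a, 'l) fdual) \<kappa> L H \<xi> \<and>
     universal_pairing TYPE((('a, 'l) fdual \<times> ('a, 'l) fdual) list set) \<kappa> L H \<xi> \<and>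
     (\<forall>a b. \<forall>u\<in>carrier (VA L).
        \<xi> (src H a \<otimes>\<^bsub>H\<^esub> tgt H b) u = ucounit L (iotaA L b \<otimes>\<^bsub>VA L\<^esub> u) * a) \<and>
     (\<forall>x\<in>carrier H. \<forall>y\<in>carrier H. \<forall>u\<in>carrier (VA L). \<forall>us\<in>ucomult L u.
        \<xi> (x \<otimes>\<^bsub>H\<^esub> y) u = (\<Sum>(u', u'') \<leftarrow> us. \<xi> x u' * \<xi> y u'')) \<and>
     (\<forall>x\<in>carrier H. \<forall>u\<in>carrier (VA L). \<forall>us\<in>utrans L u.
        \<xi> (antipode H x) u =
          (\<Sum>(u', u'') \<leftarrow> us. ucounit L (iotaA L (\<xi> x u') \<otimes>\<^bsub>VA L\<^esub> u'')))"

definition zeta_hat :: "('a::{comm_ring,comm_monoid_mult}, 'l) lr_algebra \<Rightarrow>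
    ('a, 'h) hopf_algebroid \<Rightarrow> ('h \<Rightarrow> ('a, 'l) env \<Rightarrow> 'a) \<Rightarrow> ('a, 'l) fdual \<Rightarrow> 'h" where
  "zeta_hat L H \<xi> = (THE g. g \<in> extensional (carrier (finite_dual L)) \<and>
     g \<in> coring_hom (finite_dual L) H \<and> (\<forall>z\<in>carrier (finite_dual L). \<xi> (g z) = zeta L z))"


section \<open>The natural transformations\<close>

definition Theta :: "('a::{comm_ring,comm_monoid_mult}, 'l) lr_algebra \<Rightarrow>
    'l \<Rightarrow> ('a, 'l) fdual \<Rightarrow> 'a" where
  "Theta L X = (\<lambda>z\<in>carrier (finite_dual L). - zeta L z (iotaL L X))"

definition Theta' :: "('a::{comm_ring,comm_monoid_mult}, 'l) lr_algebra \<Rightarrow>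
    ('a, 'h) hopf_algebroid \<Rightarrow> ('h \<Rightarrow> ('a, 'l) env \<Rightarrow> 'a) \<Rightarrow> 'l \<Rightarrow> 'h \<Rightarrow> 'a" where
  "Theta' L H \<xi> X = (\<lambda>z\<in>carrier H. - \<xi> z (iotaL L X))"

end

theory Submission
  imports Defs
begin

text \<open>The derivations of a commutative bialgebroid \<open>H\<close> lie in its left dual, which is a ring
  under convolution; the bracket of \<open>Der\<^sup>s(H, A)\<close> is the commutator of that ring, which gives the
  Lie-Rinehart axioms.  For a multiplicative pairing \<open>\<xi>\<close> of \<open>H\<close> with \<open>V\<^sub>A(L)\<close>, the functional
  \<open>z \<mapsto> - \<xi>(z)(\<iota>\<^sub>L(X))\<close> is a derivation because \<open>\<iota>\<^sub>L(X)\<close> is primitive, and brackets are respected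
  because \<open>\<xi>(z)(u v) = \<xi>(z\<^sub>1)(\<xi>(z\<^sub>2)(u) v)\<close>.  None of this involves an antipode, so for the finite
  dual only the bialgebroid structure has to be established.

  The comparison map from the finite dual to the universal Hopf algebroid is given as a morphism of
  corings.  It is multiplicative by the uniqueness clause of the universal property, applied to the
  coring \<open>C \<otimes> C\<close> over \<open>A \<otimes> A\<close> with \<open>C\<close> the finite dual; it is unital because the image of \<open>1\<close> is an
  idempotent grouplike element, which the antipode of the target inverts.\<close>

section \<open>Sums over lists and additive maps\<close>

text \<open>Three quotients occur: tensor products, the finite dual, and the tensor square of a
  coring. All consist of classes of lists of generators, so all are instances of one scheme, an
  abelian group presented by generators and relations; maps out of it are defined and compared on
  generators.

  The obstacle is the carrier type. Elements of the finite dual refer to modules with carrier in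
  \<open>'a list\<close>, but its product and its unit involve tensor products and \<open>A\<close>
  itself, which live in other types. The class \<open>cc L M f m\<close> of
  \<open>f \<otimes> m\<close> for a module of any type is therefore the basic object: it does not
  depend on the chosen realization, it is natural in \<open>M\<close>, and each structure map of the
  bialgebroid is computed on it.

  The universal property is granted for two carrier types. This is why products are treated through
  a coring whose elements are classes of lists of pairs, and why the unit has an argument of its
  own: \<open>A \<otimes> A\<close>, the coring that is the source of the unit map, is not of these
  types.\<close>

lemma lsum_Nil [simp]: "lsum M [] = \<zero>\<^bsub>M\<^esub>"
  by (simp add: lsum_def)

lemma lsum_Cons [simp]: "lsum M (x # xs) = x \<oplus>\<^bsub>M\<^esub> lsum M xs"
  by (simp add: lsum_def)

context abelian_group
begin

lemma lsum_closed [simp, intro]: "set xs \<subseteq> carrier G \<Longrightarrow> lsum G xs \<in> carrier G"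
  by (induction xs) auto

lemma lsum_append:
  "\<lbrakk>set xs \<subseteq> carrier G; set ys \<subseteq> carrier G\<rbrakk> \<Longrightarrow> lsum G (xs @ ys) = lsum G xs \<oplus> lsum G ys"
  by (induction xs) (auto simp: a_assoc)

lemma lsum_map_closed [simp, intro]:
  "(\<And>x. x \<in> set xs \<Longrightarrow> f x \<in> carrier G) \<Longrightarrow> lsum G (map f xs) \<in> carrier G"
  by (rule lsum_closed) auto

lemma lsum_concat:
  "(\<And>x. x \<in> set xs \<Longrightarrow> set (f x) \<subseteq> carrier G) \<Longrightarrow>
    lsum G (concat (map f xs)) = lsum G (map (\<lambda>x. lsum G (f x)) xs)"
proof (induction xs)
  case (Cons x xs)
  then have "set (concat (map f xs)) \<subseteq> carrier G" by auto
  with Cons show ?case by (simp add: lsum_append)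
qed simp

lemma lsum_map_add:
  "\<lbrakk>\<And>x. x \<in> set xs \<Longrightarrow> f x \<in> carrier G; \<And>x. x \<in> set xs \<Longrightarrow> g x \<in> carrier G\<rbrakk> \<Longrightarrow>
    lsum G (map (\<lambda>x. f x \<oplus> g x) xs) = lsum G (map f xs) \<oplus> lsum G (map g xs)"
proof (induction xs)
  case (Cons x xs)
  then have "f x \<in> carrier G" "g x \<in> carrier G" "lsum G (map f xs) \<in> carrier G"
    "lsum G (map g xs) \<in> carrier G" by auto
  with Cons show ?case by (simp add: a_ac)
qed simp

lemma lsum_zero: "(\<And>x. x \<in> set xs \<Longrightarrow> f x = \<zero>) \<Longrightarrow> lsum G (map f xs) = \<zero>"
  by (induction xs) auto

lemma lsum_swap:
  "(\<And>x y. \<lbrakk>x \<in> set xs; y \<in> set ys\<rbrakk> \<Longrightarrow> f x y \<in> carrier G) \<Longrightarrow>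
    lsum G (map (\<lambda>x. lsum G (map (f x) ys)) xs) = lsum G (map (\<lambda>y. lsum G (map (\<lambda>x. f x y) xs)) ys)"
proof (induction xs)
  case Nil
  show ?case by (simp add: lsum_zero)
next
  case (Cons x xs)
  then have "lsum G (map (\<lambda>y. f x y \<oplus> lsum G (map (\<lambda>x. f x y) xs)) ys) =
      lsum G (map (f x) ys) \<oplus> lsum G (map (\<lambda>y. lsum G (map (\<lambda>x. f x y) xs)) ys)"
    by (intro lsum_map_add) auto
  with Cons show ?case by simp
qed

end

text \<open>Only the additive fields of the two records enter, so one predicate serves rings,
  modules, bimodules and the base algebra.\<close>

definition additive :: "('m, 'x) ring_scheme \<Rightarrow> ('n, 'y) ring_scheme \<Rightarrow> ('m \<Rightarrow> 'n) \<Rightarrow> bool" where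
  "additive M N h \<longleftrightarrow> h \<in> carrier M \<rightarrow> carrier N \<and>
     (\<forall>x\<in>carrier M. \<forall>y\<in>carrier M. h (x \<oplus>\<^bsub>M\<^esub> y) = h x \<oplus>\<^bsub>N\<^esub> h y)"

lemma additiveI:
  "\<lbrakk>\<And>x. x \<in> carrier M \<Longrightarrow> h x \<in> carrier N;
    \<And>x y. \<lbrakk>x \<in> carrier M; y \<in> carrier M\<rbrakk> \<Longrightarrow> h (x \<oplus>\<^bsub>M\<^esub> y) = h x \<oplus>\<^bsub>N\<^esub> h y\<rbrakk> \<Longrightarrow> additive M N h"
  by (simp add: additive_def)

lemma additive_closed: "additive M N h \<Longrightarrow> x \<in> carrier M \<Longrightarrow> h x \<in> carrier N"
  and additive_add: "additive M N h \<Longrightarrow> x \<in> carrier M \<Longrightarrow> y \<in> carrier M \<Longrightarrow> h (x \<oplus>\<^bsub>M\<^esub> y) = h x \<oplus>\<^bsub>N\<^esub> h y"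
  by (auto simp: additive_def)

text \<open>Lets an operation that is defined by a union over representatives inherit additivity
  from the lifted map with which it agrees on the carrier.\<close>

lemma additive_cong:
  assumes "abelian_group M" "\<And>x. x \<in> carrier M \<Longrightarrow> h x = k x"
  shows "additive M N h \<longleftrightarrow> additive M N k"
proof -
  interpret abelian_group M by fact
  show ?thesis by (simp add: additive_def assms(2) Pi_def cong: ball_cong)
qed

lemma additive_comp:
  "\<lbrakk>additive M N h; additive N P k\<rbrakk> \<Longrightarrow> additive M P (\<lambda>x. k (h x))"
  by (auto simp: additive_def Pi_def)

lemma additive_zero:
  assumes "abelian_group M" "abelian_group N" "additive M N h"
  shows "h \<zero>\<^bsub>M\<^esub> = \<zero>\<^bsub>N\<^esub>"
proof -
  interpret M: abelian_group M by fact
  interpret N: abelian_group N by fact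
  have "h \<zero>\<^bsub>M\<^esub> \<oplus>\<^bsub>N\<^esub> h \<zero>\<^bsub>M\<^esub> = h \<zero>\<^bsub>M\<^esub>" using assms(3) additive_add[OF assms(3), of "\<zero>\<^bsub>M\<^esub>" "\<zero>\<^bsub>M\<^esub>"] by simp
  then show ?thesis
    using additive_closed[OF assms(3) M.zero_closed] N.add.l_cancel_one' by force
qed

lemma additive_lsum:
  assumes "abelian_group M" "abelian_group N" "additive M N h" "set xs \<subseteq> carrier M"
  shows "h (lsum M xs) = lsum N (map h xs)"
proof -
  interpret M: abelian_group M by fact
  show ?thesis
    using assms(4) by (induction xs) (auto simp: additive_zero[OF assms(1-3)] additive_add[OF assms(3)])
qed

lemma additive_lsum_map:
  assumes "abelian_group M" "abelian_group N" "additive M N h" "\<And>x. x \<in> set xs \<Longrightarrow> f x \<in> carrier M"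
  shows "h (lsum M (map f xs)) = lsum N (map (\<lambda>x. h (f x)) xs)"
  using additive_lsum[OF assms(1-3), of "map f xs"] assms(4) by (auto simp: o_def)

lemma lsum_cong: "(\<And>x. x \<in> set xs \<Longrightarrow> f x = g x) \<Longrightarrow> lsum M (map f xs) = lsum M (map g xs)"
  by (metis (no_types, lifting) map_cong)

lemma additive_add_fun:
  assumes "abelian_group M" "abelian_group N" "additive M N h" "additive M N k"
  shows "additive M N (\<lambda>x. h x \<oplus>\<^bsub>N\<^esub> k x)"
proof -
  interpret N: abelian_group N by fact
  note cl = additive_closed[OF assms(3)] additive_closed[OF assms(4)]
  show ?thesis
    by (rule additiveI) (simp_all add: cl additive_add[OF assms(3)] additive_add[OF assms(4)] N.a_ac)
qed

lemma additive_lsum_fun: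
  assumes "abelian_group M" "abelian_group N" "\<And>i. i \<in> set is \<Longrightarrow> additive M N (h i)"
  shows "additive M N (\<lambda>x. lsum N (map (\<lambda>i. h i x) is))"
proof -
  interpret N: abelian_group N by fact
  note cl = additive_closed[OF assms(3)]
  show ?thesis
    by (rule additiveI)
      (auto simp: cl additive_add[OF assms(3)] N.lsum_map_add[symmetric] cong: map_cong)
qed

lemma regular_bimod_simps [simp]:
  "carrier regular_bimod = UNIV" "zero regular_bimod = 0" "add regular_bimod = (+)"
  "lact regular_bimod = (*)" "ract regular_bimod = (*)"
  by (simp_all add: regular_bimod_def)

text \<open>The base algebra is the target of all functionals; with \<open>lsum_regular\<close>
  their sums become ordinary sums of lists.\<close>

lemma regular_abelian_group: "abelian_group regular_bimod"
  by (rule abelian_groupI) (auto simp: add.assoc add.commute intro: exI[of _ "- _"] add.left_inverse)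

lemma lsum_regular [simp]: "lsum regular_bimod xs = sum_list xs"
  by (induction xs) auto

lemma base_ring_simps [simp]:
  "carrier base_ring = UNIV" "zero base_ring = 0" "add base_ring = (+)" "mult base_ring = (*)"
  "one base_ring = 1"
  by (simp_all add: base_ring_def)

lemma base_ring_cring: "cring base_ring"
proof (rule cringI)
  show "abelian_group base_ring"
    by (rule abelian_groupI) (auto simp: add.assoc add.commute intro: exI[of _ "- _"] add.left_inverse)
  show "comm_monoid base_ring"
    by (rule comm_monoidI) (auto simp: ac_simps)
qed (simp add: distrib_right)

section \<open>Abelian groups given by generators and relations\<close>

text \<open>A list is a sum of generators with nonnegative coefficients; no formal inverses are
  adjoined, so negatives have to come out of the base relations \<open>B\<close>.\<close>

inductive peq :: "'g set \<Rightarrow> ('g list \<Rightarrow> 'g list \<Rightarrow> bool) \<Rightarrow> 'g list \<Rightarrow> 'g list \<Rightarrow> bool"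
  for G :: "'g set" and B :: "'g list \<Rightarrow> 'g list \<Rightarrow> bool" where
  peq_refl: "set zs \<subseteq> G \<Longrightarrow> peq G B zs zs"
| peq_sym: "peq G B zs ws \<Longrightarrow> peq G B ws zs"
| peq_trans: "peq G B zs ws \<Longrightarrow> peq G B ws vs \<Longrightarrow> peq G B zs vs"
| peq_append: "peq G B zs zs' \<Longrightarrow> peq G B ws ws' \<Longrightarrow> peq G B (zs @ ws) (zs' @ ws')"
| peq_comm: "set zs \<subseteq> G \<Longrightarrow> set ws \<subseteq> G \<Longrightarrow> peq G B (zs @ ws) (ws @ zs)"
| peq_base: "B zs ws \<Longrightarrow> peq G B zs ws"

definition pcls :: "'g set \<Rightarrow> ('g list \<Rightarrow> 'g list \<Rightarrow> bool) \<Rightarrow> 'g list \<Rightarrow> 'g list set" where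
  "pcls G B zs = {ws. peq G B zs ws}"

definition compat :: "'g set \<Rightarrow> ('g list \<Rightarrow> 'g list \<Rightarrow> bool) \<Rightarrow> ('m, 'x) ring_scheme \<Rightarrow> ('g \<Rightarrow> 'm) \<Rightarrow> bool" where
  "compat G B Y \<phi> \<longleftrightarrow> abelian_group Y \<and> \<phi> \<in> G \<rightarrow> carrier Y \<and>
     (\<forall>l r. B l r \<longrightarrow> lsum Y (map \<phi> l) = lsum Y (map \<phi> r))"

text \<open>Evaluation at a chosen representative; \<open>compat\<close> is what makes the choice
  irrelevant.\<close>

definition plift :: "('m, 'x) ring_scheme \<Rightarrow> ('g \<Rightarrow> 'm) \<Rightarrow> 'g list set \<Rightarrow> 'm" where
  "plift Y \<phi> X = lsum Y (map \<phi> (rep X))"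

text \<open>Nothing is said about the remaining fields of \<open>R\<close>, so a record with
  products, actions or a comultiplication can be an instance. Inverses are demanded for generators,
  where they are found by negating one component.\<close>

locale presented_group =
  fixes G :: "'g set" and B :: "'g list \<Rightarrow> 'g list \<Rightarrow> bool"
    and R :: "('g list set, 'x) ring_scheme" (structure)
  assumes carrier_eq: "carrier R = pcls G B ` {zs. set zs \<subseteq> G}"
    and zero_eq: "\<zero> = pcls G B []"
    and add_eq: "X \<oplus> Y = (\<Union>x\<in>X. \<Union>y\<in>Y. pcls G B (x @ y))"
    and base_sub: "B l r \<Longrightarrow> set l \<subseteq> G \<and> set r \<subseteq> G"
    and inverse_ex: "g \<in> G \<Longrightarrow> \<exists>h\<in>G. peq G B [g, h] []"
begin

lemma peq_sub: "peq G B zs ws \<Longrightarrow> set zs \<subseteq> G \<and> set ws \<subseteq> G"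
  by (induction rule: peq.induct) (auto dest: base_sub)

lemma pcls_eq_iff: "set zs \<subseteq> G \<Longrightarrow> pcls G B zs = pcls G B ws \<longleftrightarrow> peq G B zs ws"
  unfolding pcls_def by (blast intro: peq_sym peq_trans peq_refl)

lemma pcls_eqI: "peq G B zs ws \<Longrightarrow> pcls G B zs = pcls G B ws"
  using pcls_eq_iff peq_sub by blast

lemma pcls_self: "set zs \<subseteq> G \<Longrightarrow> zs \<in> pcls G B zs"
  by (simp add: pcls_def peq_refl)

lemma pcls_memD: "ws \<in> pcls G B zs \<Longrightarrow> peq G B zs ws"
  by (simp add: pcls_def)

lemma pcls_closed: "set zs \<subseteq> G \<Longrightarrow> pcls G B zs \<in> carrier R"
  by (auto simp: carrier_eq)

lemma carrier_memD:
  assumes "X \<in> carrier R" "zs \<in> X"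
  shows "set zs \<subseteq> G" "pcls G B zs = X"
proof -
  obtain ws where "set ws \<subseteq> G" "X = pcls G B ws" using assms(1) by (auto simp: carrier_eq)
  moreover from this have "peq G B ws zs" using assms(2) by (simp add: pcls_memD)
  ultimately show "set zs \<subseteq> G" "pcls G B zs = X"
    using peq_sub[of ws zs] pcls_eqI[of ws zs] by simp_all
qed

lemma rep_mem: "X \<in> carrier R \<Longrightarrow> rep X \<in> X"
  unfolding rep_def carrier_eq by (auto intro: someI pcls_self)

lemma UN_pcls:
  assumes "X \<in> carrier R" "zs \<in> X" "\<And>ws. ws \<in> X \<Longrightarrow> c ws = c zs"
  shows "(\<Union>ws\<in>X. c ws) = c zs"
  using assms by blast

lemma pcls_append:
  assumes "set zs \<subseteq> G" "set ws \<subseteq> G"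
  shows "pcls G B zs \<oplus> pcls G B ws = pcls G B (zs @ ws)"
proof -
  have "pcls G B (x @ y) = pcls G B (zs @ ws)" if "x \<in> pcls G B zs" "y \<in> pcls G B ws" for x y
    using that by (auto dest!: pcls_memD intro!: pcls_eqI intro: peq_append peq_sym)
  then show ?thesis
    unfolding add_eq using pcls_self[OF assms(1)] pcls_self[OF assms(2)] by blast
qed

lemma pcls_inverse: "set zs \<subseteq> G \<Longrightarrow> \<exists>ws. set ws \<subseteq> G \<and> peq G B (ws @ zs) []"
proof (induction zs)
  case Nil
  show ?case by (rule exI[of _ "[]"]) (simp add: peq_refl)
next
  case (Cons g zs)
  then obtain ws where ws: "set ws \<subseteq> G" "peq G B (ws @ zs) []" by auto
  obtain h where h: "h \<in> G" "peq G B [g, h] []" using inverse_ex Cons.prems by auto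
  \<comment> \<open>The three rearrangements lead from \<open>ws h g zs\<close> to
    \<open>g h\<close>, with \<open>ws zs\<close> cancelled on the way, and \<open>g h\<close> is
    zero by the choice of \<open>h\<close>.\<close>
  have "peq G B ((ws @ [h]) @ [g] @ zs) (([h] @ ws) @ [g] @ zs)"
    using ws h Cons.prems by (intro peq_append peq_comm peq_refl) auto
  moreover have "peq G B ([h] @ (ws @ [g]) @ zs) ([h] @ ([g] @ ws) @ zs)"
    using ws h Cons.prems by (intro peq_append peq_comm peq_refl) auto
  moreover have "peq G B (([h] @ [g]) @ (ws @ zs)) (([g] @ [h]) @ [])"
    using ws h Cons.prems by (intro peq_append peq_comm) auto
  ultimately have "peq G B ((ws @ [h]) @ (g # zs)) []"
    using h(2) by (auto intro: peq_trans)
  then show ?case using ws h by (intro exI[of _ "ws @ [h]"]) auto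
qed

lemma is_abelian_group: "abelian_group R"
proof (rule abelian_groupI)
  fix X assume "X \<in> carrier R"
  then obtain zs where zs: "set zs \<subseteq> G" "X = pcls G B zs" by (auto simp: carrier_eq)
  from pcls_inverse[OF zs(1)] obtain ws where "set ws \<subseteq> G" "peq G B (ws @ zs) []" by auto
  then show "\<exists>Y\<in>carrier R. Y \<oplus> X = \<zero>"
    using zs pcls_eqI[of "ws @ zs" "[]"]
    by (intro bexI[of _ "pcls G B ws"]) (simp_all add: pcls_append zero_eq pcls_closed)
next
  fix X Y assume "X \<in> carrier R" "Y \<in> carrier R"
  then show "X \<oplus> Y = Y \<oplus> X" using pcls_eqI[OF peq_comm] by (auto simp: carrier_eq pcls_append)
qed (auto simp: carrier_eq pcls_append zero_eq)

sublocale abelian_group R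
  by (rule is_abelian_group)

lemma pcls_lsum: "set zs \<subseteq> G \<Longrightarrow> pcls G B zs = lsum R (map (\<lambda>g. pcls G B [g]) zs)"
proof (induction zs)
  case (Cons g zs)
  then show ?case using pcls_append[of "[g]" zs] by simp
qed (simp add: zero_eq)

text \<open>Every class is the sum of the classes of its entries, so additive maps are determined by
  the generators. Nearly all identities below rest on this principle or on its specializations
  \<open>tensor_ext\<close>, \<open>fdual_ext\<close> and \<open>square_ext\<close>.\<close>

lemma additive_ext:
  assumes "additive R Y h" "additive R Y k" "abelian_group Y" "X \<in> carrier R"
    and "\<And>g. g \<in> G \<Longrightarrow> h (pcls G B [g]) = k (pcls G B [g])"
  shows "h X = k X"
proof -
  obtain zs where zs: "set zs \<subseteq> G" "X = pcls G B zs" using assms(4) by (auto simp: carrier_eq)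
  have cl: "pcls G B [g] \<in> carrier R" if "g \<in> set zs" for g using that zs by (intro pcls_closed) auto
  show ?thesis
    unfolding zs(2) pcls_lsum[OF zs(1)] using zs(1) assms(5)
    by (simp add: additive_lsum_map[OF is_abelian_group assms(3,1)] cl
        additive_lsum_map[OF is_abelian_group assms(3,2)] subset_iff cong: map_cong)
qed

lemma compat_peq:
  assumes "compat G B Y \<phi>" "peq G B zs ws"
  shows "lsum Y (map \<phi> zs) = lsum Y (map \<phi> ws)"
proof -
  interpret Y: abelian_group Y using assms(1) by (simp add: compat_def)
  have cl: "set (map \<phi> zs) \<subseteq> carrier Y" if "set zs \<subseteq> G" for zs
    using assms(1) that by (auto simp: compat_def)
  show ?thesis
    using assms(2)
  proof (induction rule: peq.induct)
    case (peq_append zs zs' ws ws')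
    then show ?case using peq_sub cl by (metis map_append Y.lsum_append)
  next
    case (peq_comm zs ws)
    then show ?case using cl[of zs] cl[of ws] by (simp add: Y.lsum_append Y.a_comm)
  next
    case (peq_base zs ws)
    then show ?case using assms(1) by (simp add: compat_def)
  qed simp_all
qed

lemma plift_mem:
  assumes "compat G B Y \<phi>" "X \<in> carrier R" "zs \<in> X"
  shows "lsum Y (map \<phi> zs) = plift Y \<phi> X"
proof -
  have "pcls G B zs = X" "pcls G B (rep X) = X" "set zs \<subseteq> G"
    using carrier_memD[OF assms(2)] assms(3) rep_mem[OF assms(2)] by auto
  then show ?thesis
    unfolding plift_def by (intro compat_peq[OF assms(1)]) (simp add: pcls_eq_iff[symmetric])
qed

lemma plift_pcls: "compat G B Y \<phi> \<Longrightarrow> set zs \<subseteq> G \<Longrightarrow> plift Y \<phi> (pcls G B zs) = lsum Y (map \<phi> zs)"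
  by (rule plift_mem[symmetric]) (auto intro: pcls_closed pcls_self)

lemma plift_gen: "compat G B Y \<phi> \<Longrightarrow> g \<in> G \<Longrightarrow> plift Y \<phi> (pcls G B [g]) = \<phi> g"
  by (subst plift_pcls) (auto simp: compat_def Pi_def abelian_group.axioms abelian_monoid.r_zero)

lemma plift_additive:
  assumes "compat G B Y \<phi>"
  shows "additive R Y (plift Y \<phi>)"
proof -
  interpret Y: abelian_group Y using assms by (simp add: compat_def)
  have cl: "set (map \<phi> zs) \<subseteq> carrier Y" if "set zs \<subseteq> G" for zs
    using assms that by (auto simp: compat_def)
  show ?thesis
    by (rule additiveI)
      (use cl in \<open>auto simp: carrier_eq pcls_append plift_pcls[OF assms] Y.lsum_append\<close>)
qed

text \<open>The operations of the quotient records are unions over all representatives. When the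
  values on generators are compatible with the relations, all members of the union coincide, and the
  operation becomes the lifted map.\<close>

lemma UN_plift:
  "compat G B Y \<phi> \<Longrightarrow> X \<in> carrier R \<Longrightarrow> (\<Union>ws\<in>X. lsum Y (map \<phi> ws)) = plift Y \<phi> X"
  using plift_mem rep_mem by (metis (no_types, lifting) UN_pcls)

end

section \<open>Tensor products\<close>

text \<open>What remains of \<open>teq\<close> after the rules of an arbitrary congruence of formal
  sums are taken away.\<close>

inductive tbase :: "('a, 'm, 'x) bimod_scheme \<Rightarrow> ('a, 'n, 'y) bimod_scheme \<Rightarrow>
    ('m \<times> 'n) list \<Rightarrow> ('m \<times> 'n) list \<Rightarrow> bool"
  for M :: "('a, 'm, 'x) bimod_scheme" and N :: "('a, 'n, 'y) bimod_scheme" where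
  "m \<in> carrier M \<Longrightarrow> m' \<in> carrier M \<Longrightarrow> n \<in> carrier N \<Longrightarrow> tbase M N [(m \<oplus>\<^bsub>M\<^esub> m', n)] [(m, n), (m', n)]"
| "m \<in> carrier M \<Longrightarrow> n \<in> carrier N \<Longrightarrow> n' \<in> carrier N \<Longrightarrow> tbase M N [(m, n \<oplus>\<^bsub>N\<^esub> n')] [(m, n), (m, n')]"
| "n \<in> carrier N \<Longrightarrow> tbase M N [(\<zero>\<^bsub>M\<^esub>, n)] []"
| "m \<in> carrier M \<Longrightarrow> tbase M N [(m, \<zero>\<^bsub>N\<^esub>)] []"
| "m \<in> carrier M \<Longrightarrow> n \<in> carrier N \<Longrightarrow> tbase M N [(ract M m a, n)] [(m, lact N a n)]"

lemma teq_peq: "teq M N = peq (carrier M \<times> carrier N) (tbase M N)"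
proof (intro ext iffI)
  fix zs ws assume "teq M N zs ws"
  then show "peq (carrier M \<times> carrier N) (tbase M N) zs ws"
    by (induction rule: teq.induct) (blast intro: peq.intros tbase.intros)+
next
  fix zs ws assume "peq (carrier M \<times> carrier N) (tbase M N) zs ws"
  then show "teq M N zs ws"
  proof (induction rule: peq.induct)
    case (peq_base zs ws)
    then show ?case by cases (auto intro: teq.intros)
  qed (blast intro: teq.intros)+
qed

lemma tcls_pcls: "tcls M N = pcls (carrier M \<times> carrier N) (tbase M N)"
  by (rule ext) (simp add: tcls_def pcls_def teq_peq)

text \<open>Allows a bimodule to be replaced by another record with the same underlying structure:
  \<open>VA_right\<close> by the regular module, and the finite dual by its bare bimodule.\<close>

lemma teq_cong:
  assumes "carrier M = carrier M'" "carrier N = carrier N'" "\<zero>\<^bsub>M\<^esub> = \<zero>\<^bsub>M'\<^esub>" "\<zero>\<^bsub>N\<^esub> = \<zero>\<^bsub>N'\<^esub>"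
    and "\<And>x y. x \<in> carrier M \<Longrightarrow> y \<in> carrier M \<Longrightarrow> x \<oplus>\<^bsub>M\<^esub> y = x \<oplus>\<^bsub>M'\<^esub> y"
    and "\<And>x y. x \<in> carrier N \<Longrightarrow> y \<in> carrier N \<Longrightarrow> x \<oplus>\<^bsub>N\<^esub> y = x \<oplus>\<^bsub>N'\<^esub> y"
    and "\<And>x a. x \<in> carrier M \<Longrightarrow> ract M x a = ract M' x a"
    and "\<And>x a. x \<in> carrier N \<Longrightarrow> lact N a x = lact N' a x"
  shows "teq M N = teq M' N'"
proof -
  have "tbase M N l r \<Longrightarrow> tbase M' N' l r" for l r
    by (erule tbase.cases) (simp_all add: assms tbase.intros)
  moreover have "tbase M' N' l r \<Longrightarrow> tbase M N l r" for l r
    by (erule tbase.cases) (simp_all add: tbase.intros flip: assms)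
  ultimately have "tbase M N = tbase M' N'" by (intro ext iffI)
  then show ?thesis by (simp add: teq_peq assms)
qed

definition tn :: "('a, 'm, 'x) bimod_scheme \<Rightarrow> ('a, 'n, 'y) bimod_scheme \<Rightarrow> 'm \<Rightarrow> 'n \<Rightarrow> ('m \<times> 'n) list set" where
  "tn M N m n = tcls M N [(m, n)]"

definition tlift :: "('z, 'v) ring_scheme \<Rightarrow> ('m \<Rightarrow> 'n \<Rightarrow> 'z) \<Rightarrow> ('m \<times> 'n) list set \<Rightarrow> 'z" where
  "tlift Y \<beta> X = lsum Y (map (\<lambda>(m, n). \<beta> m n) (rep X))"

definition balanced :: "('a, 'm, 'x) bimod_scheme \<Rightarrow> ('a, 'n, 'y) bimod_scheme \<Rightarrow> ('z, 'v) ring_scheme \<Rightarrow>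
    ('m \<Rightarrow> 'n \<Rightarrow> 'z) \<Rightarrow> bool" where
  "balanced M N Y \<beta> \<longleftrightarrow> abelian_group Y \<and> (\<forall>n\<in>carrier N. additive M Y (\<lambda>m. \<beta> m n)) \<and>
     (\<forall>m\<in>carrier M. additive N Y (\<beta> m)) \<and>
     (\<forall>m\<in>carrier M. \<forall>n\<in>carrier N. \<forall>a. \<beta> (ract M m a) n = \<beta> m (lact N a n))"

section \<open>The tensor product of two bimodules and its universal property\<close>

locale bimodule_pair = M: bimodule \<kappa> M + N: bimodule \<kappa> N
  for \<kappa> :: "'k::field_char_0 \<Rightarrow> 'a::{comm_ring,comm_monoid_mult}"
    and M :: "('a, 'm, 'x) bimod_scheme" and N :: "('a, 'n, 'y) bimod_scheme"

context bimodule
begin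

lemma lact_zero: "lact M a \<zero> = \<zero>"
  by (auto intro!: additive_zero additiveI
      simp: abelian_group_axioms lact_closed ract_closed lact_add ract_add)

lemma additive_lact: "additive M M (lact M a)" and additive_ract: "additive M M (\<lambda>m. ract M m a)"
  by (auto intro!: additiveI simp: lact_closed ract_closed lact_add ract_add)

lemma zero_lact: assumes "m \<in> carrier M" shows "lact M 0 m = \<zero>"
proof -
  have "lact M 0 m \<oplus> lact M 0 m = lact M 0 m" using add_lact[OF assms, of 0 0] by simp
  then show ?thesis using lact_closed[OF assms] add.l_cancel_one' by force
qed

end

context bimodule_pair
begin

abbreviation (input) "T \<equiv> tensor M N"

text \<open>The inverse of the generator \<open>(m, n)\<close> is \<open>(- m, n)\<close>: together
  they represent \<open>(m - m) \<otimes> n\<close>, which the relations equate to zero.\<close>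

lemma tensor_presented: "presented_group (carrier M \<times> carrier N) (tbase M N) T"
proof
  fix l r :: "('m \<times> 'n) list" assume "tbase M N l r"
  then show "set l \<subseteq> carrier M \<times> carrier N \<and> set r \<subseteq> carrier M \<times> carrier N"
    by cases (auto simp: N.lact_closed M.ract_closed)
next
  fix g assume "g \<in> carrier M \<times> carrier N"
  then obtain m n where g: "g = (m, n)" "m \<in> carrier M" "n \<in> carrier N" by auto
  have "peq (carrier M \<times> carrier N) (tbase M N) [(m \<oplus>\<^bsub>M\<^esub> \<ominus>\<^bsub>M\<^esub> m, n)] [(m, n), (\<ominus>\<^bsub>M\<^esub> m, n)]"
    using g by (intro peq_base tbase.intros) auto
  moreover have "peq (carrier M \<times> carrier N) (tbase M N) [(m \<oplus>\<^bsub>M\<^esub> \<ominus>\<^bsub>M\<^esub> m, n)] []"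
    using g by (auto simp: M.r_neg intro: peq_base tbase.intros)
  ultimately show "\<exists>h\<in>carrier M \<times> carrier N. peq (carrier M \<times> carrier N) (tbase M N) [g, h] []"
    using g by (intro bexI[of _ "(\<ominus>\<^bsub>M\<^esub> m, n)"]) (auto intro: peq_trans peq_sym)
qed (simp_all add: tensor_def tcls_pcls)

sublocale T: presented_group "carrier M \<times> carrier N" "tbase M N" "tensor M N"
  by (rule tensor_presented)

lemma tcls_closed: "set zs \<subseteq> carrier M \<times> carrier N \<Longrightarrow> tcls M N zs \<in> carrier T"
  by (simp add: tcls_pcls T.pcls_closed)

lemma tn_closed [simp, intro]: "m \<in> carrier M \<Longrightarrow> n \<in> carrier N \<Longrightarrow> tn M N m n \<in> carrier T"
  by (simp add: tn_def tcls_closed)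

lemma tcls_lsum:
  "set zs \<subseteq> carrier M \<times> carrier N \<Longrightarrow> tcls M N zs = lsum T (map (\<lambda>(m, n). tn M N m n) zs)"
  by (simp add: tcls_pcls T.pcls_lsum tn_def case_prod_unfold)

lemma tensor_mem:
  assumes "X \<in> carrier T" "zs \<in> X"
  shows "set zs \<subseteq> carrier M \<times> carrier N" "tcls M N zs = X"
    "X = lsum T (map (\<lambda>(m, n). tn M N m n) zs)"
  using T.carrier_memD[OF assms] tcls_lsum[of zs] by (simp_all add: tcls_pcls)

lemma tcls_self: "set zs \<subseteq> carrier M \<times> carrier N \<Longrightarrow> zs \<in> tcls M N zs"
  by (simp add: tcls_pcls T.pcls_self)

lemma tcls_memI: "X \<in> carrier T \<Longrightarrow> set zs \<subseteq> carrier M \<times> carrier N \<Longrightarrow>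
    X = lsum T (map (\<lambda>(m, n). tn M N m n) zs) \<Longrightarrow> zs \<in> X"
  using tcls_self tcls_lsum by metis

lemma tn_add_left:
  "\<lbrakk>m \<in> carrier M; m' \<in> carrier M; n \<in> carrier N\<rbrakk> \<Longrightarrow> tn M N (m \<oplus>\<^bsub>M\<^esub> m') n = tn M N m n \<oplus>\<^bsub>T\<^esub> tn M N m' n"
  and tn_add_right:
  "\<lbrakk>m \<in> carrier M; n \<in> carrier N; n' \<in> carrier N\<rbrakk> \<Longrightarrow> tn M N m (n \<oplus>\<^bsub>N\<^esub> n') = tn M N m n \<oplus>\<^bsub>T\<^esub> tn M N m n'"
  and tn_balanced:
  "\<lbrakk>m \<in> carrier M; n \<in> carrier N\<rbrakk> \<Longrightarrow> tn M N (ract M m a) n = tn M N m (lact N a n)"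
  unfolding tn_def tcls_pcls
  by (simp_all add: T.pcls_append, auto intro!: T.pcls_eqI peq_base tbase.intros)

text \<open>The relations with a zero entry are respected because additive maps between groups send
  zero to zero; the other relations are the clauses of \<open>balanced\<close>.\<close>

lemma balanced_compat:
  assumes "balanced M N Y \<beta>"
  shows "compat (carrier M \<times> carrier N) (tbase M N) Y (\<lambda>(m, n). \<beta> m n)"
proof -
  interpret Y: abelian_group Y using assms by (simp add: balanced_def)
  have cl: "\<beta> m n \<in> carrier Y" if "m \<in> carrier M" "n \<in> carrier N" for m n
    using assms that by (auto simp: balanced_def additive_def)
  have z: "\<beta> \<zero>\<^bsub>M\<^esub> n = \<zero>\<^bsub>Y\<^esub>" if "n \<in> carrier N" for n
    using assms that additive_zero[OF M.abelian_group_axioms Y.abelian_group_axioms, of "\<lambda>m. \<beta> m n"]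
    by (simp add: balanced_def)
  have z': "\<beta> m \<zero>\<^bsub>N\<^esub> = \<zero>\<^bsub>Y\<^esub>" if "m \<in> carrier M" for m
    using assms that additive_zero[OF N.abelian_group_axioms Y.abelian_group_axioms, of "\<beta> m"]
    by (simp add: balanced_def)
  have "lsum Y (map (\<lambda>(m, n). \<beta> m n) l) = lsum Y (map (\<lambda>(m, n). \<beta> m n) r)" if "tbase M N l r" for l r
    using that
  proof cases
    case 1
    then show ?thesis using assms cl by (auto simp: balanced_def additive_def)
  next
    case 2
    then show ?thesis using assms cl by (auto simp: balanced_def additive_def)
  next
    case (5 m n a)
    moreover have "\<beta> (ract M m a) n = \<beta> m (lact N a n)" using assms 5 by (simp add: balanced_def)
    ultimately show ?thesis by simp
  qed (auto simp: z z')
  then show ?thesis using cl Y.abelian_group_axioms by (auto simp: compat_def)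
qed

lemma tlift_plift: "tlift Y \<beta> = plift Y (\<lambda>(m, n). \<beta> m n)"
  by (rule ext) (simp add: tlift_def plift_def)

lemma tlift_mem:
  "balanced M N Y \<beta> \<Longrightarrow> X \<in> carrier T \<Longrightarrow> zs \<in> X \<Longrightarrow> lsum Y (map (\<lambda>(m, n). \<beta> m n) zs) = tlift Y \<beta> X"
  by (simp add: tlift_plift T.plift_mem balanced_compat)

lemma tlift_tn: "balanced M N Y \<beta> \<Longrightarrow> m \<in> carrier M \<Longrightarrow> n \<in> carrier N \<Longrightarrow> tlift Y \<beta> (tn M N m n) = \<beta> m n"
  using T.plift_gen[OF balanced_compat, of Y \<beta> "(m, n)"] by (simp add: tlift_plift tn_def tcls_pcls)

lemma tlift_additive: "balanced M N Y \<beta> \<Longrightarrow> additive T Y (tlift Y \<beta>)"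
  by (simp add: tlift_plift T.plift_additive balanced_compat)

lemma tlift_closed: "balanced M N Y \<beta> \<Longrightarrow> X \<in> carrier T \<Longrightarrow> tlift Y \<beta> X \<in> carrier Y"
  by (rule additive_closed[OF tlift_additive])

lemma tensor_ext:
  assumes "additive T Y h" "additive T Y k" "abelian_group Y" "X \<in> carrier T"
    and "\<And>m n. m \<in> carrier M \<Longrightarrow> n \<in> carrier N \<Longrightarrow> h (tn M N m n) = k (tn M N m n)"
  shows "h X = k X"
proof (rule T.additive_ext[OF assms(1-4)])
  fix g assume "g \<in> carrier M \<times> carrier N"
  then obtain m n where "g = (m, n)" "m \<in> carrier M" "n \<in> carrier N" by blast
  then show "h (pcls (carrier M \<times> carrier N) (tbase M N) [g]) = k (pcls (carrier M \<times> carrier N) (tbase M N) [g])"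
    using assms(5)[of m n] by (simp only: tn_def tcls_pcls)
qed

lemma balanced_lact: "balanced M N T (\<lambda>m n. tn M N (lact M a m) n)"
  using T.is_abelian_group
  by (auto simp: balanced_def M.lact_closed M.lact_add tn_add_left tn_add_right M.lact_ract
      tn_balanced[symmetric] intro!: additiveI)

lemma balanced_ract: "balanced M N T (\<lambda>m n. tn M N m (ract N n a))"
  using T.is_abelian_group
  by (auto simp: balanced_def N.ract_closed N.ract_add tn_add_left tn_add_right N.lact_ract
      tn_balanced intro!: additiveI)

lemma tensor_lact:
  assumes X: "X \<in> carrier T"
  shows "lact T a X = tlift T (\<lambda>m n. tn M N (lact M a m) n) X"
proof -
  have "tcls M N (map (\<lambda>(m, n). (lact M a m, n)) ws) = lsum T (map (\<lambda>(m, n). tn M N (lact M a m) n) ws)"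
    if "ws \<in> X" for ws
  proof -
    have "set ws \<subseteq> carrier M \<times> carrier N" by (rule tensor_mem(1)[OF X that])
    then have "set (map (\<lambda>(m, n). (lact M a m, n)) ws) \<subseteq> carrier M \<times> carrier N"
      by (auto simp: M.lact_closed)
    from tcls_lsum[OF this] show ?thesis by (simp add: case_prod_unfold o_def)
  qed
  then have "lact T a X = (\<Union>ws\<in>X. lsum T (map (\<lambda>(m, n). tn M N (lact M a m) n) ws))"
    by (simp add: tensor_def)
  then show ?thesis
    unfolding tlift_plift by (simp only: T.UN_plift[OF balanced_compat[OF balanced_lact] X])
qed

lemma tensor_ract:
  assumes X: "X \<in> carrier T"
  shows "ract T X a = tlift T (\<lambda>m n. tn M N m (ract N n a)) X"
proof -
  have "tcls M N (map (\<lambda>(m, n). (m, ract N n a)) ws) = lsum T (map (\<lambda>(m, n). tn M N m (ract N n a)) ws)"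
    if "ws \<in> X" for ws
  proof -
    have "set ws \<subseteq> carrier M \<times> carrier N" by (rule tensor_mem(1)[OF X that])
    then have "set (map (\<lambda>(m, n). (m, ract N n a)) ws) \<subseteq> carrier M \<times> carrier N"
      by (auto simp: N.ract_closed)
    from tcls_lsum[OF this] show ?thesis by (simp add: case_prod_unfold o_def)
  qed
  then have "ract T X a = (\<Union>ws\<in>X. lsum T (map (\<lambda>(m, n). tn M N m (ract N n a)) ws))"
    by (simp add: tensor_def)
  then show ?thesis
    unfolding tlift_plift by (simp only: T.UN_plift[OF balanced_compat[OF balanced_ract] X])
qed

lemma lact_tn: "m \<in> carrier M \<Longrightarrow> n \<in> carrier N \<Longrightarrow> lact T a (tn M N m n) = tn M N (lact M a m) n"
  by (simp add: tensor_lact tlift_tn[OF balanced_lact])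

lemma ract_tn: "m \<in> carrier M \<Longrightarrow> n \<in> carrier N \<Longrightarrow> ract T (tn M N m n) a = tn M N m (ract N n a)"
  by (simp add: tensor_ract tlift_tn[OF balanced_ract])

lemma additive_lact_T: "additive T T (lact T a)"
  by (rule iffD2[OF additive_cong[OF T.is_abelian_group] tlift_additive[OF balanced_lact]])
    (rule tensor_lact)

lemma additive_ract_T: "additive T T (\<lambda>X. ract T X a)"
  by (rule iffD2[OF additive_cong[OF T.is_abelian_group] tlift_additive[OF balanced_ract]])
    (rule tensor_ract)

lemma tensor_bimodule: "bimodule \<kappa> T"
proof -
  note ag = T.is_abelian_group
  note la = additive_lact_T and ra = additive_ract_T
  have id: "additive T T (\<lambda>X. X)" by (simp add: additive_def)
  note ext = tensor_ext[OF _ _ ag]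
  show ?thesis
  proof (rule bimodule.intro[OF ag], unfold_locales)
    fix X a b assume X: "X \<in> carrier T"
    show "lact T (a + b) X = lact T a X \<oplus>\<^bsub>T\<^esub> lact T b X"
      by (rule ext[OF la additive_add_fun[OF ag ag la la] X])
        (simp add: lact_tn M.add_lact M.lact_closed tn_add_left)
    show "ract T X (a + b) = ract T X a \<oplus>\<^bsub>T\<^esub> ract T X b"
      by (rule ext[OF ra additive_add_fun[OF ag ag ra ra] X])
        (simp add: ract_tn N.add_ract N.ract_closed tn_add_right)
    show "lact T (a * b) X = lact T a (lact T b X)"
      by (rule ext[OF la additive_comp[OF la la] X]) (simp add: lact_tn M.mult_lact M.lact_closed)
    show "ract T X (a * b) = ract T (ract T X a) b"
      by (rule ext[OF ra additive_comp[OF ra ra] X]) (simp add: ract_tn N.mult_ract N.ract_closed)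
    show "lact T 1 X = X" by (rule ext[OF la id X]) (simp add: lact_tn M.one_lact)
    show "ract T X 1 = X" by (rule ext[OF ra id X]) (simp add: ract_tn N.one_ract)
    show "ract T (lact T a X) b = lact T a (ract T X b)"
      by (rule ext[OF additive_comp[OF la ra] additive_comp[OF ra la] X])
        (simp add: lact_tn ract_tn M.lact_closed N.ract_closed)
    \<comment> \<open>A scalar passes from the left end to the right end: it is central in
      \<open>M\<close>, crosses the tensor sign by balancedness, and is central in
      \<open>N\<close>.\<close>
    fix c show "lact T (\<kappa> c) X = ract T X (\<kappa> c)"
      by (rule ext[OF la ra X])
        (simp add: lact_tn ract_tn M.central tn_balanced N.central)
  qed (auto simp: additive_closed[OF la] additive_closed[OF ra] additive_add[OF la] additive_add[OF ra])
qed

end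

lemma bimodule_pairI: "bimodule \<kappa> M \<Longrightarrow> bimodule \<kappa> N \<Longrightarrow> bimodule_pair \<kappa> M N"
  by (simp add: bimodule_pair_def)

lemma sum_list_concat_map: "sum_list (concat (map f xs)) = sum_list (map (\<lambda>x. sum_list (f x)) xs)"
  by (induction xs) simp_all

context bimodule_pair
begin

lemma balanced_teq:
  assumes "balanced M N Y \<beta>" "teq M N zs ws"
  shows "lsum Y (map (\<lambda>(m, n). \<beta> m n) zs) = lsum Y (map (\<lambda>(m, n). \<beta> m n) ws)"
  using T.compat_peq[OF balanced_compat[OF assms(1)]] assms(2) by (simp add: teq_peq)

text \<open>The modified map is again balanced because the left action on \<open>M\<close> commutes
  with the right action over which the tensor product is formed.\<close>

lemma tlift_lact:
  assumes "balanced M N Y \<beta>" "X \<in> carrier T"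
  shows "tlift Y \<beta> (lact T a X) = tlift Y (\<lambda>m n. \<beta> (lact M a m) n) X"
proof -
  interpret Y: abelian_group Y using assms(1) by (simp add: balanced_def)
  have bal: "balanced M N Y (\<lambda>m n. \<beta> (lact M a m) n)"
    using assms(1)
    by (auto simp: balanced_def M.lact_closed M.lact_add M.lact_ract[symmetric] additive_def Pi_def)
  show ?thesis
    by (rule tensor_ext[OF additive_comp[OF additive_lact_T tlift_additive[OF assms(1)]]
          tlift_additive[OF bal] Y.abelian_group_axioms assms(2)])
      (simp add: lact_tn tlift_tn[OF assms(1)] tlift_tn[OF bal] M.lact_closed)
qed

lemma tlift_ract:
  assumes "balanced M N Y \<beta>" "X \<in> carrier T"
  shows "tlift Y \<beta> (ract T X a) = tlift Y (\<lambda>m n. \<beta> m (ract N n a)) X"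
proof -
  interpret Y: abelian_group Y using assms(1) by (simp add: balanced_def)
  have bal: "balanced M N Y (\<lambda>m n. \<beta> m (ract N n a))"
    using assms(1) by (auto simp: balanced_def N.ract_closed N.ract_add N.lact_ract[symmetric]
        additive_def N.lact_closed Pi_def)
  show ?thesis
    by (rule tensor_ext[OF additive_comp[OF additive_ract_T tlift_additive[OF assms(1)]]
          tlift_additive[OF bal] Y.abelian_group_axioms assms(2)])
      (simp add: ract_tn tlift_tn[OF assms(1)] tlift_tn[OF bal] N.ract_closed)
qed

end

section \<open>Convolution on the left dual of a coring\<close>

text \<open>The product of the left dual ring of a coring,
  \<open>(\<phi> * \<psi>)(z) = \<phi>(z\<^sub>1 \<psi>(z\<^sub>2))\<close>. In a commutative Hopf
  algebroid the right action is multiplication by the target, so this is the first summand of the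
  bracket of derivations.\<close>

definition conv :: "('a::{comm_ring,comm_monoid_mult}, 'c, 'x) coring_scheme \<Rightarrow>
    ('c \<Rightarrow> 'a) \<Rightarrow> ('c \<Rightarrow> 'a) \<Rightarrow> 'c \<Rightarrow> 'a" where
  "conv C \<phi> \<psi> z = (\<Sum>(x, y) \<leftarrow> rep (comult C z). \<phi> (ract C x (\<psi> y)))"

definition left_linear :: "('a::{comm_ring,comm_monoid_mult}, 'c, 'x) bimod_scheme \<Rightarrow> ('c \<Rightarrow> 'a) \<Rightarrow> bool" where
  "left_linear C \<phi> \<longleftrightarrow> (\<forall>x\<in>carrier C. \<forall>y\<in>carrier C. \<phi> (x \<oplus>\<^bsub>C\<^esub> y) = \<phi> x + \<phi> y) \<and>
     (\<forall>x\<in>carrier C. \<forall>a. \<phi> (lact C a x) = a * \<phi> x)"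

context coring
begin

sublocale CC: bimodule_pair \<kappa> C C
  by (intro bimodule_pairI bimodule_axioms)

lemma comult_closed: "z \<in> carrier C \<Longrightarrow> comult C z \<in> carrier (tensor C C)"
  and comult_additive: "additive C (tensor C C) (comult C)"
  and comult_lact: "z \<in> carrier C \<Longrightarrow> comult C (lact C a z) = lact (tensor C C) a (comult C z)"
  and comult_ract: "z \<in> carrier C \<Longrightarrow> comult C (ract C z a) = ract (tensor C C) (comult C z) a"
  using comult_hom by (auto simp: bimod_hom_def additive_def)

lemma counit_add: "z \<in> carrier C \<Longrightarrow> w \<in> carrier C \<Longrightarrow> counit C (z \<oplus> w) = counit C z + counit C w"
  and counit_lact: "z \<in> carrier C \<Longrightarrow> counit C (lact C a z) = a * counit C z"
  and counit_ract: "z \<in> carrier C \<Longrightarrow> counit C (ract C z a) = counit C z * a"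
  using counit_hom by (auto simp: bimod_hom_def)

lemma left_linear_counit: "left_linear C (counit C)"
  by (simp add: left_linear_def counit_add counit_lact)

lemma rep_comult: "z \<in> carrier C \<Longrightarrow> rep (comult C z) \<in> comult C z"
  by (rule CC.T.rep_mem) (rule comult_closed)

lemma comult_sub: "z \<in> carrier C \<Longrightarrow> zs \<in> comult C z \<Longrightarrow> set zs \<subseteq> carrier C \<times> carrier C"
  using CC.tensor_mem(1)[OF comult_closed] .

lemma comult_elem: "z \<in> carrier C \<Longrightarrow> zs \<in> comult C z \<Longrightarrow> (x, y) \<in> set zs \<Longrightarrow> x \<in> carrier C \<and> y \<in> carrier C"
  using comult_sub by blast

lemma left_linear_additive: "left_linear C \<phi> \<Longrightarrow> additive C regular_bimod \<phi>"
  by (simp add: left_linear_def additive_def)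

lemma left_linear_add: "left_linear C \<phi> \<Longrightarrow> x \<in> carrier C \<Longrightarrow> y \<in> carrier C \<Longrightarrow> \<phi> (x \<oplus> y) = \<phi> x + \<phi> y"
  and left_linear_lact: "left_linear C \<phi> \<Longrightarrow> x \<in> carrier C \<Longrightarrow> \<phi> (lact C a x) = a * \<phi> x"
  by (simp_all add: left_linear_def)

lemma balanced_conv:
  assumes "left_linear C \<phi>" "left_linear C \<psi>"
  shows "balanced C C regular_bimod (\<lambda>x y. \<phi> (ract C x (\<psi> y)))"
  using assms regular_abelian_group
  by (auto simp: balanced_def additive_def ract_closed ract_add add_ract left_linear_add
      left_linear_lact mult_ract)

lemma conv_tlift: "conv C \<phi> \<psi> z = tlift regular_bimod (\<lambda>x y. \<phi> (ract C x (\<psi> y))) (comult C z)"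
  by (simp add: conv_def tlift_def)

lemma conv_eq:
  "\<lbrakk>left_linear C \<phi>; left_linear C \<psi>; z \<in> carrier C; zs \<in> comult C z\<rbrakk> \<Longrightarrow>
    conv C \<phi> \<psi> z = (\<Sum>(x, y) \<leftarrow> zs. \<phi> (ract C x (\<psi> y)))"
  using CC.tlift_mem[OF balanced_conv comult_closed] by (simp add: conv_tlift)

lemma conv_cong:
  assumes "\<And>x. x \<in> carrier C \<Longrightarrow> \<phi> x = \<phi>' x" "\<And>x. x \<in> carrier C \<Longrightarrow> \<psi> x = \<psi>' x" "z \<in> carrier C"
  shows "conv C \<phi> \<psi> z = conv C \<phi>' \<psi>' z"
  unfolding conv_def using comult_elem[OF assms(3) rep_comult[OF assms(3)]]
  by (intro arg_cong[of _ _ sum_list] map_cong refl) (auto simp: assms ract_closed)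

lemma left_linear_conv:
  assumes "left_linear C \<phi>" "left_linear C \<psi>"
  shows "left_linear C (conv C \<phi> \<psi>)"
proof -
  note bal = balanced_conv[OF assms]
  have "conv C \<phi> \<psi> (lact C a z) = a * conv C \<phi> \<psi> z" if z: "z \<in> carrier C" for z a
  proof -
    have "conv C \<phi> \<psi> (lact C a z) =
        tlift regular_bimod (\<lambda>x y. \<phi> (ract C (lact C a x) (\<psi> y))) (comult C z)"
      by (simp add: conv_tlift comult_lact[OF z] CC.tlift_lact[OF bal comult_closed[OF z]])
    also have "\<dots> = (\<Sum>(x, y) \<leftarrow> rep (comult C z). a * \<phi> (ract C x (\<psi> y)))"
      unfolding tlift_def lsum_regular using comult_elem[OF z rep_comult[OF z]] assms
      by (intro arg_cong[of _ _ sum_list] map_cong refl) (auto simp: lact_ract ract_closed left_linear_def)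
    finally show ?thesis by (simp add: conv_def case_prod_unfold sum_list_const_mult)
  qed
  moreover have "additive C regular_bimod (conv C \<phi> \<psi>)"
    unfolding conv_tlift by (rule additive_comp[OF comult_additive CC.tlift_additive[OF bal]])
  ultimately show ?thesis by (simp add: left_linear_def additive_def)
qed

text \<open>By linearity \<open>\<epsilon>(z\<^sub>1 \<psi>(z\<^sub>2)) = \<epsilon>(z\<^sub>1)
  \<psi>(z\<^sub>2) = \<psi>(\<epsilon>(z\<^sub>1) z\<^sub>2)\<close>, and the counit axiom sums the
  arguments to \<open>z\<close>.\<close>

lemma conv_counit_left:
  assumes "left_linear C \<psi>" "z \<in> carrier C"
  shows "conv C (counit C) \<psi> z = \<psi> z"
proof -
  have "lsum C [lact C (counit C x) y. (x, y) \<leftarrow> rep (comult C z)] = z"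
    using counit_left rep_comult assms(2) by blast
  then have "\<psi> z = \<psi> (lsum C [lact C (counit C x) y. (x, y) \<leftarrow> rep (comult C z)])" by simp
  also have "\<dots> = (\<Sum>(x, y) \<leftarrow> rep (comult C z). \<psi> (lact C (counit C x) y))"
    using comult_elem[OF assms(2) rep_comult[OF assms(2)]]
    by (subst additive_lsum_map[OF abelian_group_axioms regular_abelian_group left_linear_additive[OF assms(1)]])
      (auto simp: lact_closed case_prod_unfold)
  also have "\<dots> = conv C (counit C) \<psi> z"
    unfolding conv_def using comult_elem[OF assms(2) rep_comult[OF assms(2)]] assms(1)
    by (intro arg_cong[of _ _ sum_list] map_cong refl) (auto simp: counit_ract left_linear_lact)
  finally show ?thesis ..
qed

text \<open>Both sides are values of one functional on \<open>C \<otimes> (C \<otimes> C)\<close>,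
  namely \<open>x \<otimes> T \<mapsto> \<phi>(x k(T))\<close> with
  \<open>k(b \<otimes> y) = \<psi>(b \<chi>(y))\<close>, at the two formal sums that coassociativity
  identifies.\<close>

lemma conv_assoc:
  assumes \<phi>: "left_linear C \<phi>" and \<psi>: "left_linear C \<psi>" and \<chi>: "left_linear C \<chi>" and z: "z \<in> carrier C"
  shows "conv C (conv C \<phi> \<psi>) \<chi> z = conv C \<phi> (conv C \<psi> \<chi>) z"
proof -
  interpret CT: bimodule_pair \<kappa> C "tensor C C"
    by (intro bimodule_pairI bimodule_axioms CC.tensor_bimodule)
  let ?zs = "rep (comult C z)"
  let ?k = "tlift regular_bimod (\<lambda>b y. \<psi> (ract C b (\<chi> y)))"
  have zs: "?zs \<in> comult C z" by (rule rep_comult[OF z])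
  note el = comult_elem[OF z zs]
  note bal = balanced_conv[OF \<psi> \<chi>]
  have k: "additive (tensor C C) regular_bimod ?k" by (rule CC.tlift_additive[OF bal])
  have k_lact: "?k (lact (tensor C C) a T) = a * ?k T" if T: "T \<in> carrier (tensor C C)" for a T
  proof -
    have "?k (lact (tensor C C) a T) = (\<Sum>(b, y) \<leftarrow> rep T. \<psi> (ract C (lact C a b) (\<chi> y)))"
      by (simp add: CC.tlift_lact[OF bal T]) (simp add: tlift_def)
    also have "\<dots> = (\<Sum>(b, y) \<leftarrow> rep T. a * \<psi> (ract C b (\<chi> y)))"
      using CC.tensor_mem(1)[OF T CC.T.rep_mem[OF T]] \<psi>
      by (intro arg_cong[of _ _ sum_list] map_cong refl) (auto simp: lact_ract left_linear_lact ract_closed)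
    finally show ?thesis by (simp add: tlift_def case_prod_unfold sum_list_const_mult)
  qed
  \<comment> \<open>Left linearity of \<open>k\<close> is what lets the functional factor through
    the tensor product over \<open>A\<close>.\<close>
  have B: "balanced C (tensor C C) regular_bimod (\<lambda>x T. \<phi> (ract C x (?k T)))"
    using \<phi> k k_lact regular_abelian_group
    by (auto simp: balanced_def additive_def ract_closed ract_add add_ract left_linear_add mult_ract)
  have k_tn: "?k (tcls C C [(b, y)]) = \<psi> (ract C b (\<chi> y))" if "b \<in> carrier C" "y \<in> carrier C" for b y
    using CC.tlift_tn[OF bal that] by (simp add: tn_def)
  have "conv C (conv C \<phi> \<psi>) \<chi> z = (\<Sum>(x, y) \<leftarrow> ?zs. conv C \<phi> \<psi> (ract C x (\<chi> y)))"
    by (simp add: conv_def[of C "conv C \<phi> \<psi>"])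
  also have "\<dots> = (\<Sum>(x, y) \<leftarrow> ?zs. \<Sum>(a, b) \<leftarrow> rep (comult C x). \<phi> (ract C a (\<psi> (ract C b (\<chi> y)))))"
    using el by (intro arg_cong[of _ _ sum_list] map_cong refl)
      (auto simp: conv_tlift comult_ract CC.tlift_ract[OF balanced_conv[OF \<phi> \<psi>]] comult_closed,
       auto simp: tlift_def)
  also have "\<dots> = (\<Sum>(x, y) \<leftarrow> ?zs. \<Sum>(a, b) \<leftarrow> rep (comult C x). \<phi> (ract C a (?k (tcls C C [(b, y)]))))"
  proof -
    have "(\<Sum>(a, b) \<leftarrow> rep (comult C x). \<phi> (ract C a (\<psi> (ract C b (\<chi> y))))) =
        (\<Sum>(a, b) \<leftarrow> rep (comult C x). \<phi> (ract C a (?k (tcls C C [(b, y)]))))"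
      if "x \<in> carrier C" "y \<in> carrier C" for x y
      using comult_elem[OF that(1) rep_comult[OF that(1)]] that
      by (intro arg_cong[of _ _ sum_list] map_cong refl) (auto simp: k_tn)
    then show ?thesis
      using el by (intro arg_cong[of _ _ sum_list] map_cong refl) auto
  qed
  also have "\<dots> = (\<Sum>(x, T) \<leftarrow> [(a, tcls C C [(b, y)]). (x, y) \<leftarrow> ?zs, (a, b) \<leftarrow> rep (comult C x)].
      \<phi> (ract C x (?k T)))"
    by (simp add: map_concat sum_list_concat_map o_def case_prod_unfold)
  also have "\<dots> = (\<Sum>(x, T) \<leftarrow> [(x, comult C y). (x, y) \<leftarrow> ?zs]. \<phi> (ract C x (?k T)))"
    using CT.balanced_teq[OF B coassoc[OF z zs]] by simp
  also have "\<dots> = conv C \<phi> (conv C \<psi> \<chi>) z"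
    by (simp add: conv_def[of C \<phi> "conv C \<psi> \<chi>"] conv_tlift[of \<psi> \<chi>] o_def case_prod_unfold)
  finally show ?thesis .
qed

lemma conv_diff_left:
  assumes "left_linear C \<phi>" "left_linear C \<phi>'" "left_linear C \<psi>" "z \<in> carrier C"
  shows "conv C (\<lambda>u. \<phi> u - \<phi>' u) \<psi> z = conv C \<phi> \<psi> z - conv C \<phi>' \<psi> z"
  by (simp add: conv_def case_prod_unfold sum_list_subtractf)

lemma ract_diff:
  assumes "x \<in> carrier C" shows "ract C x (a - b) = ract C x a \<ominus> ract C x b"
proof -
  have "ract C x (a - b) \<oplus> ract C x b = ract C x a"
    using add_ract[OF assms, of "a - b" b] by simp
  then show ?thesis
    using ract_closed[OF assms] by (metis a_minus_def add.inv_solve_right)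
qed

lemma left_linear_diff:
  assumes "left_linear C \<phi>" "x \<in> carrier C" "y \<in> carrier C"
  shows "\<phi> (x \<ominus> y) = \<phi> x - \<phi> y"
proof -
  have "\<phi> ((x \<ominus> y) \<oplus> y) = \<phi> (x \<ominus> y) + \<phi> y" using assms by (intro left_linear_add) auto
  moreover have "(x \<ominus> y) \<oplus> y = x" using assms by (simp add: a_minus_def a_assoc l_neg)
  ultimately show ?thesis by simp
qed

lemma conv_diff_right:
  assumes "left_linear C \<phi>" "left_linear C \<psi>" "left_linear C \<psi>'" "z \<in> carrier C"
  shows "conv C \<phi> (\<lambda>u. \<psi> u - \<psi>' u) z = conv C \<phi> \<psi> z - conv C \<phi> \<psi>' z"
proof -
  have "conv C \<phi> (\<lambda>u. \<psi> u - \<psi>' u) z =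
      (\<Sum>(x, y) \<leftarrow> rep (comult C z). \<phi> (ract C x (\<psi> y)) - \<phi> (ract C x (\<psi>' y)))"
    unfolding conv_def using comult_elem[OF assms(4) rep_comult[OF assms(4)]] assms(1)
    by (intro arg_cong[of _ _ sum_list] map_cong refl) (auto simp: ract_diff left_linear_diff ract_closed)
  then show ?thesis by (simp add: conv_def case_prod_unfold sum_list_subtractf)
qed

end

section \<open>The Lie-Rinehart algebra of a commutative bialgebroid\<close>

locale comm_bialgebroid = coring \<kappa> H + cring H
  for \<kappa> :: "'k::field_char_0 \<Rightarrow> 'a::{comm_ring,comm_monoid_mult}"
    and H :: "('a, 'h) hopf_algebroid" (structure) +
  assumes src_hom: "src H \<in> ring_hom base_ring H"
    and tgt_hom: "tgt H \<in> ring_hom base_ring H"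
    and src_tgt_field: "src H (\<kappa> c) = tgt H (\<kappa> c)"
    and lact_src: "h \<in> carrier H \<Longrightarrow> lact H a h = src H a \<otimes> h"
    and ract_tgt: "h \<in> carrier H \<Longrightarrow> ract H h a = h \<otimes> tgt H a"
    and comult_one: "[(\<one>, \<one>)] \<in> comult H \<one>"
    and comult_mult: "\<lbrakk>g \<in> carrier H; h \<in> carrier H; zs \<in> comult H g; ws \<in> comult H h\<rbrakk> \<Longrightarrow>
      [(x \<otimes> x', y \<otimes> y'). (x, y) \<leftarrow> zs, (x', y') \<leftarrow> ws] \<in> comult H (g \<otimes> h)"
    and counit_alg: "counit H \<in> ring_hom H base_ring"

lemma comm_hopf_algebroid_imp_bialgebroid:
  assumes "comm_hopf_algebroid \<kappa> H"
  shows "comm_bialgebroid \<kappa> H"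
proof -
  interpret comm_hopf_algebroid \<kappa> H by fact
  show ?thesis
    by unfold_locales (fact src_hom tgt_hom src_tgt_field lact_src ract_tgt comult_one comult_mult counit_alg)+
qed

context comm_bialgebroid
begin

lemma src_closed [simp]: "src H a \<in> carrier H" and tgt_closed [simp]: "tgt H a \<in> carrier H"
  and src_one: "src H 1 = \<one>" and tgt_one: "tgt H 1 = \<one>"
  and src_add: "src H (a + b) = src H a \<oplus> src H b" and tgt_add: "tgt H (a + b) = tgt H a \<oplus> tgt H b"
  and src_mult: "src H (a * b) = src H a \<otimes> src H b" and tgt_mult: "tgt H (a * b) = tgt H a \<otimes> tgt H b"
  using src_hom tgt_hom by (auto simp: ring_hom_def)

lemma counit_mult: "u \<in> carrier H \<Longrightarrow> v \<in> carrier H \<Longrightarrow> counit H (u \<otimes> v) = counit H u * counit H v"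
  and counit_one: "counit H \<one> = 1"
  using counit_alg by (auto simp: ring_hom_def)

lemma lact_one: "lact H a \<one> = src H a" and ract_one: "ract H \<one> a = tgt H a"
  by (simp_all add: lact_src ract_tgt)

lemma counit_src: "counit H (src H a) = a" and counit_tgt: "counit H (tgt H a) = a"
  using counit_lact[of \<one> a] counit_ract[of \<one> a] by (simp_all add: lact_one ract_one counit_one)

text \<open>Given the Leibniz rule, vanishing on the source and left linearity imply each other:
  \<open>\<delta>(s(a) u) = a \<delta>(u) + \<delta>(s(a)) \<epsilon>(u)\<close>, and the rule at
  the product of \<open>1\<close> with itself gives \<open>\<delta>(1) = 0\<close>. Left linearity
  is the form to which convolution applies.\<close>

lemma s_derivations_iff:
  "\<delta> \<in> s_derivations \<kappa> H \<longleftrightarrow> \<delta> \<in> extensional (carrier H) \<and> left_linear H \<delta> \<and>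
    (\<forall>u\<in>carrier H. \<forall>v\<in>carrier H. \<delta> (u \<otimes> v) = counit H u * \<delta> v + \<delta> u * counit H v)"
proof -
  have "\<delta> (src H a) = 0"
    if "left_linear H \<delta>" "\<forall>u\<in>carrier H. \<forall>v\<in>carrier H. \<delta> (u \<otimes> v) = counit H u * \<delta> v + \<delta> u * counit H v" for a
  proof -
    have "\<delta> \<one> = \<delta> \<one> + \<delta> \<one>" using that(2)[rule_format, of \<one> \<one>] by (simp add: counit_one mult.commute)
    then show ?thesis using left_linear_lact[OF that(1), of \<one> a] by (simp add: lact_one)
  qed
  then show ?thesis
    by (auto simp: s_derivations_def left_linear_def lact_src counit_src)
qed

lemma derivation_left_linear: "\<delta> \<in> s_derivations \<kappa> H \<Longrightarrow> left_linear H \<delta>"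
  and derivation_mult: "\<delta> \<in> s_derivations \<kappa> H \<Longrightarrow> u \<in> carrier H \<Longrightarrow> v \<in> carrier H \<Longrightarrow>
    \<delta> (u \<otimes> v) = counit H u * \<delta> v + \<delta> u * counit H v"
  and derivation_ext: "\<delta> \<in> s_derivations \<kappa> H \<Longrightarrow> \<delta> \<in> extensional (carrier H)"
  by (simp_all add: s_derivations_iff)

lemma derivation_eqI:
  "\<lbrakk>\<delta> \<in> s_derivations \<kappa> H; \<delta>' \<in> s_derivations \<kappa> H; \<And>u. u \<in> carrier H \<Longrightarrow> \<delta> u = \<delta>' u\<rbrakk> \<Longrightarrow> \<delta> = \<delta>'"
  by (rule extensionalityI[OF derivation_ext derivation_ext])

abbreviation "DL \<equiv> der_lr \<kappa> H"

lemma der_lr_simps: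
  "carrier DL = s_derivations \<kappa> H" "u \<in> carrier H \<Longrightarrow> (\<delta> \<oplus>\<^bsub>DL\<^esub> \<delta>') u = \<delta> u + \<delta>' u"
  "u \<in> carrier H \<Longrightarrow> (a \<odot>\<^bsub>DL\<^esub> \<delta>) u = a * \<delta> u" "anchor DL \<delta> a = \<delta> (tgt H a)"
  "u \<in> carrier H \<Longrightarrow> \<zero>\<^bsub>DL\<^esub> u = 0"
  by (simp_all add: der_lr_def)

lemma der_lr_bracket:
  assumes "u \<in> carrier H"
  shows "bracket DL \<delta> \<delta>' u = conv H \<delta> \<delta>' u - conv H \<delta>' \<delta> u"
proof -
  have "bracket DL \<delta> \<delta>' u = (\<Sum>(x, y) \<leftarrow> rep (comult H u). \<delta> (ract H x (\<delta>' y)) - \<delta>' (ract H x (\<delta> y)))"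
    using assms comult_elem[OF assms rep_comult[OF assms]]
    by (simp add: der_lr_def, intro arg_cong[of _ _ sum_list] map_cong refl) (auto simp: ract_tgt)
  then show ?thesis by (simp add: conv_def case_prod_unfold sum_list_subtractf)
qed

text \<open>A product of two derivations is a differential operator of second order: besides the
  Leibniz terms it has the mixed terms
  \<open>\<delta>(u) \<delta>'(v) + \<delta>'(u) \<delta>(v)\<close>. They are symmetric in the two
  derivations and cancel in the commutator.\<close>

lemma conv_mult:
  assumes \<delta>: "\<delta> \<in> s_derivations \<kappa> H" and \<delta>': "\<delta>' \<in> s_derivations \<kappa> H"
    and u: "u \<in> carrier H" and v: "v \<in> carrier H"
  shows "conv H \<delta> \<delta>' (u \<otimes> v) = counit H u * conv H \<delta> \<delta>' v + \<delta> u * \<delta>' v + \<delta>' u * \<delta> v +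
    conv H \<delta> \<delta>' u * counit H v"
proof -
  note ll = derivation_left_linear[OF \<delta>] derivation_left_linear[OF \<delta>']
  let ?zs = "rep (comult H u)" and ?ws = "rep (comult H v)"
  note zs = rep_comult[OF u] and ws = rep_comult[OF v]
  note ez = comult_elem[OF u zs] and ew = comult_elem[OF v ws]
  \<comment> \<open>The Leibniz rule of \<open>\<delta>'\<close> is applied to \<open>y y'\<close>
    inside the target map. In each of the two summands one of the pairs \<open>(x, y)\<close>,
    \<open>(x', y')\<close> is left with the counit.\<close>
  have t1: "\<delta> ((x \<otimes> x') \<otimes> tgt H (\<delta>' (y \<otimes> y'))) =
      \<delta> (ract H x (counit H y) \<otimes> ract H x' (\<delta>' y')) + \<delta> (ract H x (\<delta>' y) \<otimes> ract H x' (counit H y'))"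
    if "(x, y) \<in> set ?zs" "(x', y') \<in> set ?ws" for x y x' y'
  proof -
    have c: "x \<in> carrier H" "y \<in> carrier H" "x' \<in> carrier H" "y' \<in> carrier H"
      using ez[OF that(1)] ew[OF that(2)] by auto
    have "(x \<otimes> x') \<otimes> tgt H (\<delta>' (y \<otimes> y')) =
        ract H x (counit H y) \<otimes> ract H x' (\<delta>' y') \<oplus> ract H x (\<delta>' y) \<otimes> ract H x' (counit H y')"
      using c by (simp add: derivation_mult[OF \<delta>'] tgt_add tgt_mult ract_tgt r_distr m_ac a_comm)
    then show ?thesis using c by (simp add: left_linear_add[OF ll(1)] ract_closed)
  qed
  have u_eq: "lsum H [ract H x (counit H y). (x, y) \<leftarrow> ?zs] = u" by (rule counit_right[OF u zs])
  have v_eq: "lsum H [ract H x (counit H y). (x, y) \<leftarrow> ?ws] = v" by (rule counit_right[OF v ws])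
  note hom = additive_lsum_map[OF abelian_group_axioms regular_abelian_group]
  \<comment> \<open>The elements \<open>x t(\<epsilon>(y))\<close> sum to \<open>u\<close> by the
    counit axiom, also in the presence of a fixed factor \<open>w\<close>.\<close>
  have A: "(\<Sum>(x, y) \<leftarrow> ?zs. \<delta> (ract H x (counit H y) \<otimes> w)) = \<delta> (u \<otimes> w)" if "w \<in> carrier H" for w
  proof -
    have "additive H regular_bimod (\<lambda>x. \<delta> (x \<otimes> w))"
      using that by (intro additiveI) (auto simp: l_distr left_linear_add[OF ll(1)])
    from hom[OF this, of ?zs "\<lambda>(x, y). ract H x (counit H y)"]
    show ?thesis using ez u_eq by (auto simp: case_prod_unfold ract_closed)
  qed
  have A': "(\<Sum>(x, y) \<leftarrow> ?ws. \<delta> (w \<otimes> ract H x (counit H y))) = \<delta> (w \<otimes> v)" if "w \<in> carrier H" for w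
  proof -
    have "additive H regular_bimod (\<lambda>x. \<delta> (w \<otimes> x))"
      using that by (intro additiveI) (auto simp: r_distr left_linear_add[OF ll(1)])
    from hom[OF this, of ?ws "\<lambda>(x, y). ract H x (counit H y)"]
    show ?thesis using ew v_eq by (auto simp: case_prod_unfold ract_closed)
  qed
  have "conv H \<delta> \<delta>' (u \<otimes> v) =
      (\<Sum>(x, y) \<leftarrow> [(x \<otimes> x', y \<otimes> y'). (x, y) \<leftarrow> ?zs, (x', y') \<leftarrow> ?ws]. \<delta> (ract H x (\<delta>' y)))"
    using u v by (intro conv_eq ll comult_mult zs ws) auto
  also have "\<dots> = (\<Sum>(x, y) \<leftarrow> ?zs. \<Sum>(x', y') \<leftarrow> ?ws. \<delta> (ract H (x \<otimes> x') (\<delta>' (y \<otimes> y'))))"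
    by (simp add: map_concat sum_list_concat_map o_def case_prod_unfold)
  also have "\<dots> = (\<Sum>(x, y) \<leftarrow> ?zs. \<Sum>(x', y') \<leftarrow> ?ws.
      \<delta> (ract H x (counit H y) \<otimes> ract H x' (\<delta>' y')) + \<delta> (ract H x (\<delta>' y) \<otimes> ract H x' (counit H y')))"
    using ez ew
    by (intro arg_cong[of _ _ sum_list] map_cong refl)
      (auto intro!: arg_cong[of _ _ sum_list] map_cong simp: t1 ract_tgt)
  also have "\<dots> = (\<Sum>(x, y) \<leftarrow> ?zs. \<Sum>(x', y') \<leftarrow> ?ws. \<delta> (ract H x (counit H y) \<otimes> ract H x' (\<delta>' y'))) +
      (\<Sum>(x, y) \<leftarrow> ?zs. \<Sum>(x', y') \<leftarrow> ?ws. \<delta> (ract H x (\<delta>' y) \<otimes> ract H x' (counit H y')))"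
    by (simp add: case_prod_unfold sum_list_addf)
  \<comment> \<open>In this half the pair belonging to \<open>u\<close> carries the counit, so the
    sums are exchanged to contract it first; in the other half the inner sum already carries the
    counit.\<close>
  also have "(\<Sum>(x, y) \<leftarrow> ?zs. \<Sum>(x', y') \<leftarrow> ?ws. \<delta> (ract H x (counit H y) \<otimes> ract H x' (\<delta>' y'))) =
      (\<Sum>(x', y') \<leftarrow> ?ws. \<Sum>(x, y) \<leftarrow> ?zs. \<delta> (ract H x (counit H y) \<otimes> ract H x' (\<delta>' y')))"
    using abelian_group.lsum_swap[OF regular_abelian_group, of ?zs ?ws
        "\<lambda>(x, y) (x', y'). \<delta> (ract H x (counit H y) \<otimes> ract H x' (\<delta>' y'))"]
    by (simp add: case_prod_unfold)
  also have "\<dots> = (\<Sum>(x', y') \<leftarrow> ?ws. \<delta> (u \<otimes> ract H x' (\<delta>' y')))"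
    using ew by (intro arg_cong[of _ _ sum_list] map_cong refl) (auto simp: A ract_closed)
  also have "\<dots> = (\<Sum>(x', y') \<leftarrow> ?ws. counit H u * \<delta> (ract H x' (\<delta>' y')) + \<delta> u * counit H (ract H x' (\<delta>' y')))"
    using ew u by (intro arg_cong[of _ _ sum_list] map_cong refl)
      (auto simp: derivation_mult[OF \<delta>] ract_closed)
  also have "\<dots> = counit H u * conv H \<delta> \<delta>' v + \<delta> u * conv H (counit H) \<delta>' v"
    by (simp add: case_prod_unfold sum_list_addf sum_list_const_mult conv_def)
  also have "(\<Sum>(x, y) \<leftarrow> ?zs. \<Sum>(x', y') \<leftarrow> ?ws. \<delta> (ract H x (\<delta>' y) \<otimes> ract H x' (counit H y'))) =
      (\<Sum>(x, y) \<leftarrow> ?zs. \<delta> (ract H x (\<delta>' y) \<otimes> v))"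
    using ez by (intro arg_cong[of _ _ sum_list] map_cong refl) (auto simp: A' ract_closed)
  also have "\<dots> = (\<Sum>(x, y) \<leftarrow> ?zs. counit H (ract H x (\<delta>' y)) * \<delta> v + \<delta> (ract H x (\<delta>' y)) * counit H v)"
    using ez v by (intro arg_cong[of _ _ sum_list] map_cong refl)
      (auto simp: derivation_mult[OF \<delta>] ract_closed)
  also have "\<dots> = conv H (counit H) \<delta>' u * \<delta> v + conv H \<delta> \<delta>' u * counit H v"
    by (simp add: case_prod_unfold sum_list_addf sum_list_mult_const conv_def)
  finally show ?thesis
    by (simp add: conv_counit_left[OF ll(2)] u v algebra_simps)
qed

lemma bracket_closed_DL:
  assumes "\<delta> \<in> s_derivations \<kappa> H" "\<delta>' \<in> s_derivations \<kappa> H"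
  shows "bracket DL \<delta> \<delta>' \<in> s_derivations \<kappa> H"
  unfolding s_derivations_iff
proof (intro conjI ballI)
  note ll = derivation_left_linear[OF assms(1)] derivation_left_linear[OF assms(2)]
  show "bracket DL \<delta> \<delta>' \<in> extensional (carrier H)" by (simp add: der_lr_def)
  show "left_linear H (bracket DL \<delta> \<delta>')"
    using left_linear_conv[OF ll] left_linear_conv[OF ll(2,1)]
    by (simp add: left_linear_def der_lr_bracket lact_closed algebra_simps)
  fix u v assume "u \<in> carrier H" "v \<in> carrier H"
  then show "bracket DL \<delta> \<delta>' (u \<otimes> v) = counit H u * bracket DL \<delta> \<delta>' v + bracket DL \<delta> \<delta>' u * counit H v"
    using assms by (simp add: der_lr_bracket conv_mult algebra_simps)
qed

lemma add_closed_DL: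
  "\<delta> \<in> s_derivations \<kappa> H \<Longrightarrow> \<delta>' \<in> s_derivations \<kappa> H \<Longrightarrow> \<delta> \<oplus>\<^bsub>DL\<^esub> \<delta>' \<in> s_derivations \<kappa> H"
  and smult_closed_DL: "\<delta> \<in> s_derivations \<kappa> H \<Longrightarrow> a \<odot>\<^bsub>DL\<^esub> \<delta> \<in> s_derivations \<kappa> H"
  and zero_closed_DL: "\<zero>\<^bsub>DL\<^esub> \<in> s_derivations \<kappa> H"
  by (auto simp: s_derivations_iff der_lr_def left_linear_def lact_closed algebra_simps)

text \<open>Since \<open>t(a) = 1 a\<close> and the comultiplication is right linear,
  \<open>\<Delta>(t(a)) = 1 \<otimes> t(a)\<close>. This makes the anchor of a bracket the
  commutator of the anchors.\<close>

lemma conv_tgt: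
  assumes "\<delta> \<in> s_derivations \<kappa> H" "\<delta>' \<in> s_derivations \<kappa> H"
  shows "conv H \<delta> \<delta>' (tgt H a) = \<delta> (tgt H (\<delta>' (tgt H a)))"
proof -
  note ll = derivation_left_linear[OF assms(1)] derivation_left_linear[OF assms(2)]
  note bal = balanced_conv[OF ll]
  have bal': "balanced H H regular_bimod (\<lambda>x y. \<delta> (ract H x (\<delta>' (ract H y a))))"
    using bal by (auto simp: balanced_def additive_def ract_closed ract_add lact_ract lact_closed)
  have "conv H \<delta> \<delta>' (tgt H a) = conv H \<delta> \<delta>' (ract H \<one> a)" by (simp add: ract_one)
  also have "\<dots> = tlift regular_bimod (\<lambda>x y. \<delta> (ract H x (\<delta>' (ract H y a)))) (comult H \<one>)"
    by (simp add: conv_tlift comult_ract CC.tlift_ract[OF bal comult_closed])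
  also have "\<dots> = \<delta> (tgt H (\<delta>' (tgt H a)))"
    using CC.tlift_mem[OF bal' comult_closed[OF one_closed] comult_one] by (simp add: ract_one)
  finally show ?thesis .
qed

text \<open>Here \<open>x t(a \<delta>'(y)) = x t(\<delta>'(y)) t(a)\<close> is a product to which
  the Leibniz rule of \<open>\<delta>\<close> applies; the term with \<open>\<delta>(t(a))\<close>
  becomes the anchor term of the Lie-Rinehart identity.\<close>

lemma conv_smult_right:
  assumes "\<delta> \<in> s_derivations \<kappa> H" "\<delta>' \<in> s_derivations \<kappa> H" "u \<in> carrier H"
  shows "conv H \<delta> (\<lambda>u. a * \<delta>' u) u = a * conv H \<delta> \<delta>' u + \<delta> (tgt H a) * \<delta>' u"
proof -
  have "\<delta> (ract H x (a * \<delta>' y)) = counit H (ract H x (\<delta>' y)) * \<delta> (tgt H a) + \<delta> (ract H x (\<delta>' y)) * a"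
    if "x \<in> carrier H" for x y
  proof -
    have "ract H x (a * \<delta>' y) = ract H x (\<delta>' y) \<otimes> tgt H a"
      using that by (simp add: ract_tgt tgt_mult m_ac)
    then show ?thesis using that by (simp add: derivation_mult[OF assms(1)] ract_closed counit_tgt)
  qed
  then have "conv H \<delta> (\<lambda>u. a * \<delta>' u) u =
      (\<Sum>(x, y) \<leftarrow> rep (comult H u). counit H (ract H x (\<delta>' y)) * \<delta> (tgt H a) + \<delta> (ract H x (\<delta>' y)) * a)"
    unfolding conv_def using comult_elem[OF assms(3) rep_comult[OF assms(3)]]
    by (intro arg_cong[of _ _ sum_list] map_cong refl) auto
  also have "\<dots> = conv H (counit H) \<delta>' u * \<delta> (tgt H a) + conv H \<delta> \<delta>' u * a"
    by (simp add: case_prod_unfold sum_list_addf sum_list_mult_const conv_def)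
  finally show ?thesis
    by (simp add: conv_counit_left[OF derivation_left_linear[OF assms(2)] assms(3)] mult.commute add.commute)
qed

lemma conv_smult_left: "conv H (\<lambda>u. a * \<delta> u) \<delta>' u = a * conv H \<delta> \<delta>' u"
  by (simp add: conv_def case_prod_unfold sum_list_const_mult)

lemma conv_add_left: "conv H (\<lambda>u. \<delta> u + \<delta>'' u) \<delta>' u = conv H \<delta> \<delta>' u + conv H \<delta>'' \<delta>' u"
  by (simp add: conv_def case_prod_unfold sum_list_addf)

lemma conv_add_right:
  assumes "left_linear H \<delta>" "u \<in> carrier H"
  shows "conv H \<delta> (\<lambda>u. \<delta>' u + \<delta>'' u) u = conv H \<delta> \<delta>' u + conv H \<delta> \<delta>'' u"
proof -
  have "conv H \<delta> (\<lambda>u. \<delta>' u + \<delta>'' u) u =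
      (\<Sum>(x, y) \<leftarrow> rep (comult H u). \<delta> (ract H x (\<delta>' y)) + \<delta> (ract H x (\<delta>'' y)))"
    unfolding conv_def using comult_elem[OF assms(2) rep_comult[OF assms(2)]]
    by (intro arg_cong[of _ _ sum_list] map_cong refl)
      (auto simp: add_ract left_linear_add[OF assms(1)] ract_closed)
  then show ?thesis by (simp add: conv_def case_prod_unfold sum_list_addf)
qed

text \<open>Associativity brings all four triple products into right-nested form. In the cyclic sum
  each right-nested product then occurs once with either sign.\<close>

lemma jacobi_DL:
  assumes "\<delta>\<^sub>1 \<in> s_derivations \<kappa> H" "\<delta>\<^sub>2 \<in> s_derivations \<kappa> H" "\<delta>\<^sub>3 \<in> s_derivations \<kappa> H" "u \<in> carrier H"
  shows "bracket DL \<delta>\<^sub>1 (bracket DL \<delta>\<^sub>2 \<delta>\<^sub>3) u =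
    conv H \<delta>\<^sub>1 (conv H \<delta>\<^sub>2 \<delta>\<^sub>3) u - conv H \<delta>\<^sub>1 (conv H \<delta>\<^sub>3 \<delta>\<^sub>2) u
    - conv H \<delta>\<^sub>2 (conv H \<delta>\<^sub>3 \<delta>\<^sub>1) u + conv H \<delta>\<^sub>3 (conv H \<delta>\<^sub>2 \<delta>\<^sub>1) u"
proof -
  note ll = assms(1-3)[THEN derivation_left_linear]
  note cl = left_linear_conv[OF ll(2,3)] left_linear_conv[OF ll(3,2)]
  have "conv H \<delta>\<^sub>1 (bracket DL \<delta>\<^sub>2 \<delta>\<^sub>3) u = conv H \<delta>\<^sub>1 (\<lambda>u. conv H \<delta>\<^sub>2 \<delta>\<^sub>3 u - conv H \<delta>\<^sub>3 \<delta>\<^sub>2 u) u"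
    "conv H (bracket DL \<delta>\<^sub>2 \<delta>\<^sub>3) \<delta>\<^sub>1 u = conv H (\<lambda>u. conv H \<delta>\<^sub>2 \<delta>\<^sub>3 u - conv H \<delta>\<^sub>3 \<delta>\<^sub>2 u) \<delta>\<^sub>1 u"
    by (intro conv_cong assms(4); simp add: der_lr_bracket)+
  then show ?thesis
    by (simp add: der_lr_bracket[OF assms(4)] conv_diff_right[OF ll(1) cl assms(4)]
        conv_diff_left[OF cl ll(1) assms(4)] conv_assoc ll assms(4))
qed

lemma module_DL: "module base_ring DL"
proof (rule moduleI[OF base_ring_cring])
  note [simp] = der_lr_simps and [intro!] = add_closed_DL smult_closed_DL zero_closed_DL
  show "abelian_group DL"
  proof (rule abelian_groupI)
    fix \<delta> assume "\<delta> \<in> carrier DL"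
    then show "\<exists>\<delta>'\<in>carrier DL. \<delta>' \<oplus>\<^bsub>DL\<^esub> \<delta> = \<zero>\<^bsub>DL\<^esub>"
      by (intro bexI[of _ "(- 1) \<odot>\<^bsub>DL\<^esub> \<delta>"] derivation_eqI) auto
  qed (auto intro!: derivation_eqI simp: algebra_simps)
qed (auto intro!: derivation_eqI add_closed_DL smult_closed_DL zero_closed_DL
    simp: der_lr_simps algebra_simps)

theorem lie_rinehart_DL: "lie_rinehart \<kappa> DL"
proof -
  note [simp] = der_lr_simps der_lr_bracket
    and [intro!] = add_closed_DL smult_closed_DL zero_closed_DL bracket_closed_DL
  note ll = derivation_left_linear
  have add1: "conv H (\<delta> \<oplus>\<^bsub>DL\<^esub> \<delta>'') \<delta>' u = conv H \<delta> \<delta>' u + conv H \<delta>'' \<delta>' u" if "u \<in> carrier H" for \<delta> \<delta>' \<delta>'' u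
    using conv_cong[OF _ refl that, of "\<delta> \<oplus>\<^bsub>DL\<^esub> \<delta>''" "\<lambda>u. \<delta> u + \<delta>'' u" \<delta>'] by (simp add: conv_add_left)
  have add2: "conv H \<delta> (\<delta>' \<oplus>\<^bsub>DL\<^esub> \<delta>'') u = conv H \<delta> \<delta>' u + conv H \<delta> \<delta>'' u"
    if "\<delta> \<in> s_derivations \<kappa> H" "u \<in> carrier H" for \<delta> \<delta>' \<delta>'' u
    using conv_cong[OF refl _ that(2), of "\<delta>' \<oplus>\<^bsub>DL\<^esub> \<delta>''" "\<lambda>u. \<delta>' u + \<delta>'' u" \<delta>]
    by (simp add: conv_add_right[OF ll[OF that(1)] that(2)])
  have sm1: "conv H (a \<odot>\<^bsub>DL\<^esub> \<delta>) \<delta>' u = a * conv H \<delta> \<delta>' u" if "u \<in> carrier H" for a \<delta> \<delta>' u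
    using conv_cong[OF _ refl that, of "a \<odot>\<^bsub>DL\<^esub> \<delta>" "\<lambda>u. a * \<delta> u" \<delta>'] by (simp add: conv_smult_left)
  have sm2: "conv H \<delta> (a \<odot>\<^bsub>DL\<^esub> \<delta>') u = a * conv H \<delta> \<delta>' u + \<delta> (tgt H a) * \<delta>' u"
    if "\<delta> \<in> s_derivations \<kappa> H" "\<delta>' \<in> s_derivations \<kappa> H" "u \<in> carrier H" for a \<delta> \<delta>' u
    using conv_cong[OF refl _ that(3), of "a \<odot>\<^bsub>DL\<^esub> \<delta>'" "\<lambda>u. a * \<delta>' u" \<delta>]
    by (simp add: conv_smult_right[OF that])
  \<comment> \<open>Source and target agree on the field and derivations vanish on the source, so
    the extra term of \<open>sm2\<close> disappears for scalars from the field.\<close>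
  have field: "\<delta> (tgt H (\<kappa> c)) = 0" if "\<delta> \<in> s_derivations \<kappa> H" for \<delta> c
    using that by (simp add: s_derivations_def flip: src_tgt_field)
  show ?thesis
  proof (rule lie_rinehart.intro[OF module_DL], unfold_locales)
    fix \<delta> assume "\<delta> \<in> carrier DL"
    then have \<delta>: "\<delta> \<in> s_derivations \<kappa> H" by simp
    then show "anchor DL \<delta> \<in> derivations \<kappa>"
      by (auto simp: derivations_def tgt_add tgt_mult left_linear_add[OF ll] derivation_mult counit_tgt field)
    fix \<delta>' assume "\<delta>' \<in> carrier DL"
    then have \<delta>': "\<delta>' \<in> s_derivations \<kappa> H" by simp
    show "anchor DL (bracket DL \<delta> \<delta>') a = anchor DL \<delta> (anchor DL \<delta>' a) - anchor DL \<delta>' (anchor DL \<delta> a)" for a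
      using \<delta> \<delta>' by (simp add: conv_tgt)
    show "bracket DL \<delta> (a \<odot>\<^bsub>DL\<^esub> \<delta>') = a \<odot>\<^bsub>DL\<^esub> bracket DL \<delta> \<delta>' \<oplus>\<^bsub>DL\<^esub> anchor DL \<delta> a \<odot>\<^bsub>DL\<^esub> \<delta>'" for a
      using \<delta> \<delta>' by (intro derivation_eqI) (auto simp: sm1 sm2 algebra_simps)
    show "bracket DL (\<kappa> c \<odot>\<^bsub>DL\<^esub> \<delta>) \<delta>' = \<kappa> c \<odot>\<^bsub>DL\<^esub> bracket DL \<delta> \<delta>'"
      "bracket DL \<delta> (\<kappa> c \<odot>\<^bsub>DL\<^esub> \<delta>') = \<kappa> c \<odot>\<^bsub>DL\<^esub> bracket DL \<delta> \<delta>'" for c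
      using \<delta> \<delta>' by (auto intro!: derivation_eqI simp: sm1 sm2 field algebra_simps)
    fix \<delta>'' assume "\<delta>'' \<in> carrier DL"
    then have \<delta>'': "\<delta>'' \<in> s_derivations \<kappa> H" by simp
    show "bracket DL (\<delta> \<oplus>\<^bsub>DL\<^esub> \<delta>') \<delta>'' = bracket DL \<delta> \<delta>'' \<oplus>\<^bsub>DL\<^esub> bracket DL \<delta>' \<delta>''"
      "bracket DL \<delta> (\<delta>' \<oplus>\<^bsub>DL\<^esub> \<delta>'') = bracket DL \<delta> \<delta>' \<oplus>\<^bsub>DL\<^esub> bracket DL \<delta> \<delta>''"
      using \<delta> \<delta>' \<delta>'' by (auto intro!: derivation_eqI simp: add1 add2 algebra_simps)
    show "bracket DL \<delta> (bracket DL \<delta>' \<delta>'') \<oplus>\<^bsub>DL\<^esub> bracket DL \<delta>' (bracket DL \<delta>'' \<delta>) \<oplus>\<^bsub>DL\<^esub>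
        bracket DL \<delta>'' (bracket DL \<delta> \<delta>') = \<zero>\<^bsub>DL\<^esub>"
      using \<delta> \<delta>' \<delta>'' by (intro derivation_eqI) (auto simp del: der_lr_bracket simp: jacobi_DL)
  qed (auto intro!: derivation_eqI)
qed

end

definition bialgebroid_hom :: "('a, 'h) hopf_algebroid \<Rightarrow> ('a, 'g) hopf_algebroid \<Rightarrow> ('h \<Rightarrow> 'g) set" where
  "bialgebroid_hom H G = {F \<in> coring_hom H G. F \<one>\<^bsub>H\<^esub> = \<one>\<^bsub>G\<^esub> \<and>
     (\<forall>u\<in>carrier H. \<forall>v\<in>carrier H. F (u \<otimes>\<^bsub>H\<^esub> v) = F u \<otimes>\<^bsub>G\<^esub> F v)}"

text \<open>Precomposition with \<open>F\<close> respects convolution because \<open>F\<close> is a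
  morphism of corings. Multiplicativity of \<open>F\<close> gives the Leibniz rule, and preservation
  of the unit gives the anchors, through \<open>F(t(a)) = F(1 a) = t(a)\<close>.\<close>

theorem der_map_lr_morphism:
  assumes H: "comm_bialgebroid \<kappa> H" and G: "comm_bialgebroid \<kappa> G" and F: "F \<in> bialgebroid_hom H G"
  shows "lr_morphism \<kappa> (der_lr \<kappa> G) (der_lr \<kappa> H) (der_map H F)"
proof -
  interpret H: comm_bialgebroid \<kappa> H by fact
  interpret G: comm_bialgebroid \<kappa> G by fact
  have F1: "F u \<in> carrier G" "F (lact H a u) = lact G a (F u)" "F (ract H u a) = ract G (F u) a"
    "counit G (F u) = counit H u" "zs \<in> comult H u \<Longrightarrow> [(F x, F y). (x, y) \<leftarrow> zs] \<in> comult G (F u)"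
    if "u \<in> carrier H" for u a zs
    using F that by (auto simp: bialgebroid_hom_def coring_hom_def bimod_hom_def)
  have F2: "F (u \<otimes>\<^bsub>H\<^esub> v) = F u \<otimes>\<^bsub>G\<^esub> F v" "F (u \<oplus>\<^bsub>H\<^esub> v) = F u \<oplus>\<^bsub>G\<^esub> F v"
    if "u \<in> carrier H" "v \<in> carrier H" for u v
    using F that by (auto simp: bialgebroid_hom_def coring_hom_def bimod_hom_def)
  have F_tgt: "F (tgt H a) = tgt G a" for a
    using F F1(3)[of "\<one>\<^bsub>H\<^esub>" a] by (simp add: bialgebroid_hom_def H.ract_one G.ract_one)
  have cl: "der_map H F \<delta> \<in> s_derivations \<kappa> H" if "\<delta> \<in> s_derivations \<kappa> G" for \<delta>
    using that G.derivation_left_linear[OF that]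
    by (auto simp: H.s_derivations_iff G.s_derivations_iff der_map_def left_linear_def F1 F2 H.lact_closed)
  have conv: "conv H (der_map H F \<delta>) (der_map H F \<delta>') u = conv G \<delta> \<delta>' (F u)"
    if "\<delta> \<in> s_derivations \<kappa> G" "\<delta>' \<in> s_derivations \<kappa> G" "u \<in> carrier H" for \<delta> \<delta>' u
  proof -
    note ll = that(1,2)[THEN G.derivation_left_linear]
    have "conv G \<delta> \<delta>' (F u) = (\<Sum>(x, y) \<leftarrow> [(F x, F y). (x, y) \<leftarrow> rep (comult H u)]. \<delta> (ract G x (\<delta>' y)))"
      using that(3) by (intro G.conv_eq ll F1 H.rep_comult)
    also have "\<dots> = (\<Sum>(x, y) \<leftarrow> rep (comult H u). \<delta> (ract G (F x) (\<delta>' (F y))))"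
      by (simp add: o_def case_prod_unfold)
    also have "\<dots> = conv H (der_map H F \<delta>) (der_map H F \<delta>') u"
      unfolding conv_def using H.comult_elem[OF that(3) H.rep_comult[OF that(3)]]
      by (intro arg_cong[of _ _ sum_list] map_cong refl) (auto simp: der_map_def F1 H.ract_closed)
    finally show ?thesis ..
  qed
  have ext: "der_map H F \<delta> u = \<delta> (F u)" if "u \<in> carrier H" for \<delta> u
    using that by (simp add: der_map_def)
  note [simp] = H.der_lr_simps G.der_lr_simps H.der_lr_bracket G.der_lr_bracket ext F1
  show ?thesis
    unfolding lr_morphism_def
  proof (intro conjI ballI allI H.lie_rinehart_DL G.lie_rinehart_DL)
    fix \<delta> assume \<delta>: "\<delta> \<in> carrier (der_lr \<kappa> G)"
    show "anchor (der_lr \<kappa> H) (der_map H F \<delta>) = anchor (der_lr \<kappa> G) \<delta>"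
      using \<delta> by (simp add: fun_eq_iff F_tgt)
  qed (auto simp: conv intro!: H.derivation_eqI cl
        H.add_closed_DL H.smult_closed_DL H.bracket_closed_DL
        G.add_closed_DL G.smult_closed_DL G.bracket_closed_DL)
qed

section \<open>The enveloping algebra and its modules\<close>

text \<open>A right module over the enveloping algebra is an abelian group with operators for the
  generators that satisfy the defining relations.\<close>

primrec uop :: "('m, 'x) ring_scheme \<Rightarrow> ('a \<Rightarrow> 'm \<Rightarrow> 'm) \<Rightarrow> ('l \<Rightarrow> 'm \<Rightarrow> 'm) \<Rightarrow> ('a, 'l) uterm \<Rightarrow> 'm \<Rightarrow> 'm" where
  "uop M oA oL (IotaA a) m = oA a m"
| "uop M oA oL (IotaL X) m = oL X m"
| "uop M oA oL (Add t r) m = uop M oA oL t m \<oplus>\<^bsub>M\<^esub> uop M oA oL r m"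
| "uop M oA oL (Mul t r) m = uop M oA oL r (uop M oA oL t m)"

locale lr_alg = lie_rinehart \<kappa> L
  for \<kappa> :: "'k::field_char_0 \<Rightarrow> 'a::{comm_ring,comm_monoid_mult}"
    and L :: "('a, 'l) lr_algebra" (structure)

lemma lr_algI: "lie_rinehart \<kappa> L \<Longrightarrow> lr_alg \<kappa> L"
  by (simp add: lr_alg_def)

text \<open>Operators are composed in the order in which the factors are written, because terms act
  from the right. So \<open>oL_bracket\<close> is flatness for a right action, and
  \<open>oA_mult\<close> lets \<open>a\<close> act before \<open>b\<close>.\<close>

locale flat_connection = lr_alg \<kappa> L + M: abelian_group M
  for \<kappa> :: "'k::field_char_0 \<Rightarrow> 'a::{comm_ring,comm_monoid_mult}"
    and L :: "('a, 'l) lr_algebra" (structure) and M :: "('m, 'x) ring_scheme" +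
  fixes oA :: "'a \<Rightarrow> 'm \<Rightarrow> 'm" and oL :: "'l \<Rightarrow> 'm \<Rightarrow> 'm"
  assumes oA_additive: "additive M M (oA a)"
    and oL_additive: "X \<in> carrier L \<Longrightarrow> additive M M (oL X)"
    and oA_add: "m \<in> carrier M \<Longrightarrow> oA (a + b) m = oA a m \<oplus>\<^bsub>M\<^esub> oA b m"
    and oA_mult: "m \<in> carrier M \<Longrightarrow> oA (a * b) m = oA b (oA a m)"
    and oA_one: "m \<in> carrier M \<Longrightarrow> oA 1 m = m"
    and oL_add: "\<lbrakk>X \<in> carrier L; Y \<in> carrier L; m \<in> carrier M\<rbrakk> \<Longrightarrow> oL (X \<oplus>\<^bsub>L\<^esub> Y) m = oL X m \<oplus>\<^bsub>M\<^esub> oL Y m"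
    and oL_bracket: "\<lbrakk>X \<in> carrier L; Y \<in> carrier L; m \<in> carrier M\<rbrakk> \<Longrightarrow>
      oL (bracket L X Y) m \<oplus>\<^bsub>M\<^esub> oL X (oL Y m) = oL Y (oL X m)"
    and oL_smult: "\<lbrakk>X \<in> carrier L; m \<in> carrier M\<rbrakk> \<Longrightarrow> oL (a \<odot>\<^bsub>L\<^esub> X) m = oA a (oL X m)"
    and oL_oA: "\<lbrakk>X \<in> carrier L; m \<in> carrier M\<rbrakk> \<Longrightarrow>
      oA a (oL X m) = oL X (oA a m) \<oplus>\<^bsub>M\<^esub> oA (anchor L X a) m"
begin

lemma uop_additive: "t \<in> uterms L \<Longrightarrow> additive M M (uop M oA oL t)"
proof (induction t)
  case (Add t r)
  then show ?case
    using additive_add_fun[OF M.abelian_group_axioms M.abelian_group_axioms] by simp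
next
  case (Mul t r)
  then show ?case using additive_comp[of M M "uop M oA oL t" M "uop M oA oL r"] by simp
next
  case (IotaA a)
  show ?case using oA_additive[of a] by (simp add: additive_def)
next
  case (IotaL X)
  then show ?case using oL_additive[of X] by (simp add: additive_def)
qed

lemma uop_closed: "t \<in> uterms L \<Longrightarrow> m \<in> carrier M \<Longrightarrow> uop M oA oL t m \<in> carrier M"
  by (rule additive_closed[OF uop_additive])

lemma oA_zero: assumes "m \<in> carrier M" shows "oA 0 m = \<zero>\<^bsub>M\<^esub>"
proof -
  have "oA 0 m \<oplus>\<^bsub>M\<^esub> oA 0 m = oA 0 m" using oA_add[OF assms, of 0 0] by simp
  then show ?thesis
    using additive_closed[OF oA_additive assms] M.add.l_cancel_one' by force
qed

lemma uop_cong: "ucong L t t' \<Longrightarrow> m \<in> carrier M \<Longrightarrow> uop M oA oL t m = uop M oA oL t' m"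
proof (induction arbitrary: m rule: ucong.induct)
  case (ucong_Mul t t' r r')
  then show ?case using ucong_uterms[OF lie_rinehart_axioms ucong_Mul(1)] by (simp add: uop_closed)
next
  case (uadd_neg t)
  \<comment> \<open>The inverse of \<open>t\<close> is represented by \<open>IotaA (- 1)\<close>
    followed by \<open>t\<close>. So the operator of \<open>t\<close> is applied to
    \<open>oA (- 1) m\<close> and to \<open>m\<close>, which add up to zero.\<close>
  have c: "oA (- 1) m \<in> carrier M" by (rule additive_closed[OF oA_additive uadd_neg(2)])
  have "uop M oA oL t (oA (- 1) m) \<oplus>\<^bsub>M\<^esub> uop M oA oL t (oA 1 m) = uop M oA oL t (oA (- 1) m \<oplus>\<^bsub>M\<^esub> oA 1 m)"
    using uadd_neg c by (simp add: oA_one additive_add[OF uop_additive])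
  also have "oA (- 1) m \<oplus>\<^bsub>M\<^esub> oA 1 m = \<zero>\<^bsub>M\<^esub>"
    using oA_add[of m "- 1" 1] uadd_neg by (simp add: oA_zero)
  also have "uop M oA oL t \<zero>\<^bsub>M\<^esub> = \<zero>\<^bsub>M\<^esub>"
    using uadd_neg by (intro additive_zero M.abelian_group_axioms uop_additive)
  finally show ?case using uadd_neg by (simp add: oA_one oA_zero)
next
  case (uadd_assoc t r q)
  then show ?case by (simp add: uop_closed M.a_assoc)
next
  case (uadd_comm t r)
  then show ?case by (simp add: uop_closed M.a_comm)
next
  case (udistrib_right t r q)
  then show ?case by (simp add: uop_closed additive_add[OF uop_additive])
qed (simp_all add: uop_closed oA_zero oA_one oA_add oA_mult oL_add oL_bracket oL_smult oL_oA)

end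

text \<open>The right regular module. Its tensor square over \<open>A\<close> is the target of the
  comultiplication, so facts on tensor products of modules can be applied to \<Delta>.\<close>

definition VA_reg :: "('a::{comm_ring,comm_monoid_mult}, 'l) lr_algebra \<Rightarrow> (('a, 'l) env, ('a, 'l) env) module" where
  "VA_reg L = \<lparr>carrier = carrier (VA L), mult = undefined, one = undefined, zero = \<zero>\<^bsub>VA L\<^esub>,
     add = add (VA L), smult = (\<lambda>u v. v \<otimes>\<^bsub>VA L\<^esub> u)\<rparr>"

lemma amod_simps [simp]:
  "carrier (amod L M) = carrier M" "zero (amod L M) = zero M" "add (amod L M) = add M"
  "lact (amod L M) a m = iotaA L a \<odot>\<^bsub>M\<^esub> m" "ract (amod L M) m a = iotaA L a \<odot>\<^bsub>M\<^esub> m"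
  by (simp_all add: amod_def)

text \<open>Unlike \<open>mdual\<close> this does not ask for an extensional function, so forms can
  be composed and added as plain lambda terms and restricted at the end.\<close>

definition linear_form :: "('a::{comm_ring,comm_monoid_mult}, 'l) lr_algebra \<Rightarrow>
    (('a, 'l) env, 'm) module \<Rightarrow> ('m \<Rightarrow> 'a) \<Rightarrow> bool" where
  "linear_form L M f \<longleftrightarrow> (\<forall>m\<in>carrier M. \<forall>n\<in>carrier M. f (m \<oplus>\<^bsub>M\<^esub> n) = f m + f n) \<and>
     (\<forall>m\<in>carrier M. \<forall>a. f (iotaA L a \<odot>\<^bsub>M\<^esub> m) = a * f m)"

lemma mdual_iff: "f \<in> mdual L M \<longleftrightarrow> linear_form L M f \<and> f \<in> extensional (carrier M)"
  by (auto simp: mdual_def bimod_hom_def linear_form_def mult.commute)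

lemma linear_form_add: "linear_form L M f \<Longrightarrow> m \<in> carrier M \<Longrightarrow> n \<in> carrier M \<Longrightarrow> f (m \<oplus>\<^bsub>M\<^esub> n) = f m + f n"
  and linear_form_smult: "linear_form L M f \<Longrightarrow> m \<in> carrier M \<Longrightarrow> f (iotaA L a \<odot>\<^bsub>M\<^esub> m) = a * f m"
  and linear_form_additive: "linear_form L M f \<Longrightarrow> additive M regular_bimod f"
  by (simp_all add: linear_form_def additive_def)

section \<open>The enveloping algebra: generators, induction, and its action on the base\<close>

context lr_alg
begin

sublocale V: ring "VA L"
  by (rule VA_ring)

lemma VA_carrier: "carrier (VA L) = ucls L ` uterms L"
  by (simp add: VA_def)

lemma ucls_closed [simp]: "t \<in> uterms L \<Longrightarrow> ucls L t \<in> carrier (VA L)"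
  by (simp add: VA_carrier)

lemma iotaA_closed [simp]: "iotaA L a \<in> carrier (VA L)"
  and iotaL_closed [simp]: "X \<in> carrier L \<Longrightarrow> iotaL L X \<in> carrier (VA L)"
  and VA_one: "\<one>\<^bsub>VA L\<^esub> = iotaA L 1" and VA_zero: "\<zero>\<^bsub>VA L\<^esub> = iotaA L 0"
  by (simp_all add: iotaA_def iotaL_def) (simp_all add: VA_def iotaA_def)

lemma iotaA_add: "iotaA L (a + b) = iotaA L a \<oplus>\<^bsub>VA L\<^esub> iotaA L b"
  and iotaA_mult: "iotaA L (a * b) = iotaA L a \<otimes>\<^bsub>VA L\<^esub> iotaA L b"
  by (simp_all add: iotaA_def VA_op ucls_eq_iff ucong.iotaA_add ucong.iotaA_mult)

lemma iotaL_add: "X \<in> carrier L \<Longrightarrow> Y \<in> carrier L \<Longrightarrow> iotaL L (X \<oplus>\<^bsub>L\<^esub> Y) = iotaL L X \<oplus>\<^bsub>VA L\<^esub> iotaL L Y"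
  and iotaL_bracket: "X \<in> carrier L \<Longrightarrow> Y \<in> carrier L \<Longrightarrow>
    iotaL L (bracket L X Y) \<oplus>\<^bsub>VA L\<^esub> iotaL L Y \<otimes>\<^bsub>VA L\<^esub> iotaL L X = iotaL L X \<otimes>\<^bsub>VA L\<^esub> iotaL L Y"
  and iotaL_smult: "X \<in> carrier L \<Longrightarrow> iotaL L (a \<odot>\<^bsub>L\<^esub> X) = iotaL L X \<otimes>\<^bsub>VA L\<^esub> iotaA L a"
  and iotaL_iotaA: "X \<in> carrier L \<Longrightarrow> iotaL L X \<otimes>\<^bsub>VA L\<^esub> iotaA L a =
    iotaA L a \<otimes>\<^bsub>VA L\<^esub> iotaL L X \<oplus>\<^bsub>VA L\<^esub> iotaA L (anchor L X a)"
  by (simp_all add: iotaA_def iotaL_def VA_op ucls_eq_iff bracket_closed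
      ucong.iotaL_add ucong.iotaL_bracket ucong.iotaL_smult ucong.iotaL_iotaA)

lemma VA_cases:
  assumes "u \<in> carrier (VA L)" obtains t where "t \<in> uterms L" "u = ucls L t"
  using assms by (auto simp: VA_carrier)

lemma VA_induct [consumes 1, case_names iotaA iotaL add mult]:
  assumes "u \<in> carrier (VA L)"
    and "\<And>a. P (iotaA L a)" "\<And>X. X \<in> carrier L \<Longrightarrow> P (iotaL L X)"
    and "\<And>u v. \<lbrakk>u \<in> carrier (VA L); v \<in> carrier (VA L); P u; P v\<rbrakk> \<Longrightarrow> P (u \<oplus>\<^bsub>VA L\<^esub> v)"
    and "\<And>u v. \<lbrakk>u \<in> carrier (VA L); v \<in> carrier (VA L); P u; P v\<rbrakk> \<Longrightarrow> P (u \<otimes>\<^bsub>VA L\<^esub> v)"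
  shows "P u"
proof -
  have "P (ucls L t)" if "t \<in> uterms L" for t
    using that
  proof (induction t)
    case (Add t r)
    then show ?case using assms(4)[of "ucls L t" "ucls L r"] by (simp add: VA_op)
  next
    case (Mul t r)
    then show ?case using assms(5)[of "ucls L t" "ucls L r"] by (simp add: VA_op)
  qed (use assms(2,3) in \<open>auto simp: iotaA_def iotaL_def\<close>)
  then show ?thesis using assms(1) by (auto elim: VA_cases)
qed

lemma rep_ucls: assumes "t \<in> uterms L" shows "ucong L t (rep (ucls L t))" "rep (ucls L t) \<in> uterms L"
proof -
  have "rep (ucls L t) \<in> ucls L t" unfolding rep_def by (rule someI) (rule ucls_self[OF assms])
  then show "ucong L t (rep (ucls L t))" by (simp add: ucls_def)
  then show "rep (ucls L t) \<in> uterms L" using ucong_uterms[OF lie_rinehart_axioms] by blast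
qed

lemma ract_VA: assumes "u \<in> carrier (VA L)" shows "ract (VA L) u a = u \<otimes>\<^bsub>VA L\<^esub> iotaA L a"
proof -
  obtain t where t: "t \<in> uterms L" "u = ucls L t" using assms by (rule VA_cases)
  have "ucls L (Mul t' (IotaA a)) = ucls L (Mul t (IotaA a))" if "t' \<in> ucls L t" for t'
  proof -
    have "ucong L (Mul t (IotaA a)) (Mul t' (IotaA a))"
      using that ucong_Mul[of L t t' "IotaA a" "IotaA a"] ucong_refl[of "IotaA a" L]
      by (simp add: ucls_def)
    then show ?thesis using ucls_eq_iff[of "Mul t (IotaA a)" L "Mul t' (IotaA a)"] t(1) by simp
  qed
  then have "(\<Union>t'\<in>ucls L t. ucls L (Mul t' (IotaA a))) = ucls L (Mul t (IotaA a))"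
    using ucls_self[OF t(1)] by blast
  then show ?thesis using t by (simp add: iotaA_def VA_op) (simp add: VA_def)
qed

lemma VA_reg_simps [simp]:
  "carrier (VA_reg L) = carrier (VA L)" "zero (VA_reg L) = zero (VA L)" "add (VA_reg L) = add (VA L)"
  "smult (VA_reg L) u v = v \<otimes>\<^bsub>VA L\<^esub> u"
  by (simp_all add: VA_reg_def)

lemma VA_reg_module: "right_module (VA L) (VA_reg L)"
proof -
  have "abelian_group (VA_reg L)"
    using V.abelian_group_axioms by (intro abelian_groupI) (auto simp: V.a_ac intro: V.add.l_inv_ex)
  then show ?thesis
    by (intro right_module.intro V.ring_axioms right_module_axioms.intro)
      (auto simp: V.r_distr V.l_distr V.m_assoc)
qed

text \<open>On \<open>VA_right\<close> both actions are right multiplication by elements of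
  \<open>A\<close>, as they are on the regular module.\<close>

lemma tcls_VA_right: "tcls (VA_right L) (VA_right L) = tcls (amod L (VA_reg L)) (amod L (VA_reg L))"
proof -
  have "teq (VA_right L) (VA_right L) = teq (amod L (VA_reg L)) (amod L (VA_reg L))"
    by (rule teq_cong) (simp_all add: VA_right_def ract_VA)
  then show ?thesis by (simp add: tcls_def fun_eq_iff)
qed

text \<open>Reduces the module axioms over the whole enveloping algebra to the relations between
  operators of generators.\<close>

lemma right_moduleI_uop:
  assumes "flat_connection \<kappa> L M oA oL"
    and "\<And>t m. t \<in> uterms L \<Longrightarrow> m \<in> carrier M \<Longrightarrow> ucls L t \<odot>\<^bsub>M\<^esub> m = uop M oA oL t m"
  shows "right_module (VA L) M"
proof -
  interpret flat_connection \<kappa> L M oA oL by fact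
  show ?thesis
  proof (intro right_module.intro V.ring_axioms M.abelian_group_axioms right_module_axioms.intro)
    fix m assume m: "m \<in> carrier M"
    show "\<one>\<^bsub>VA L\<^esub> \<odot>\<^bsub>M\<^esub> m = m" using assms(2)[of "IotaA 1"] m by (simp add: VA_one iotaA_def oA_one)
    fix u assume "u \<in> carrier (VA L)"
    then obtain t where t: "t \<in> uterms L" "u = ucls L t" by (rule VA_cases)
    show "u \<odot>\<^bsub>M\<^esub> m \<in> carrier M" using t m by (simp add: assms(2) uop_closed)
    show "u \<odot>\<^bsub>M\<^esub> (m \<oplus>\<^bsub>M\<^esub> n) = u \<odot>\<^bsub>M\<^esub> m \<oplus>\<^bsub>M\<^esub> u \<odot>\<^bsub>M\<^esub> n" if "n \<in> carrier M" for n
      using t m that by (simp add: assms(2) additive_add[OF uop_additive])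
    fix v assume "v \<in> carrier (VA L)"
    then obtain r where r: "r \<in> uterms L" "v = ucls L r" by (rule VA_cases)
    show "(u \<oplus>\<^bsub>VA L\<^esub> v) \<odot>\<^bsub>M\<^esub> m = u \<odot>\<^bsub>M\<^esub> m \<oplus>\<^bsub>M\<^esub> v \<odot>\<^bsub>M\<^esub> m"
      using t r m by (simp add: assms(2) VA_op)
    show "(u \<otimes>\<^bsub>VA L\<^esub> v) \<odot>\<^bsub>M\<^esub> m = v \<odot>\<^bsub>M\<^esub> (u \<odot>\<^bsub>M\<^esub> m)"
      using t r m by (simp add: assms(2) VA_op uop_closed)
  qed
qed

lemma anchor_add_arg: "X \<in> carrier L \<Longrightarrow> anchor L X (a + b) = anchor L X a + anchor L X b"
  and anchor_mult: "X \<in> carrier L \<Longrightarrow> anchor L X (a * b) = a * anchor L X b + anchor L X a * b"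
  and anchor_field: "X \<in> carrier L \<Longrightarrow> anchor L X (\<kappa> c * a) = \<kappa> c * anchor L X a"
  using anchor_der[of X] by (auto simp: derivations_def)

lemma anchor_neg: "X \<in> carrier L \<Longrightarrow> anchor L X (- a) = - anchor L X a"
  using anchor_add_arg[of X "- a" a] anchor_add_arg[of X 0 0] by (simp add: eq_neg_iff_add_eq_0)

lemma anchor_one: "X \<in> carrier L \<Longrightarrow> anchor L X 1 = 0"
  using anchor_mult[of X 1 1] by (simp add: mult.commute[of _ 1])

lemma anchor_kappa: "X \<in> carrier L \<Longrightarrow> anchor L X (\<kappa> c) = 0"
  using anchor_field[of X c 1] by (simp add: anchor_one mult.commute[of _ 1])

text \<open>The anchor is a left action; the minus sign converts it into a right one, so that its
  bracket identity takes the order that \<open>flat_connection\<close> asks for. As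
  \<open>uact\<close> is the resulting operator, the counit is well defined on classes.\<close>

lemma unit_connection: "flat_connection \<kappa> L (unit_mod L) (\<lambda>b a. a * b) (\<lambda>X a. - anchor L X a)"
proof -
  have ag: "abelian_group (unit_mod L)"
    using regular_abelian_group
    by (intro abelian_groupI) (auto simp: unit_mod_def add.assoc add.commute intro: exI[of _ "- _"] add.left_inverse)
  show ?thesis
    by (intro flat_connection.intro flat_connection_axioms.intro lr_alg_axioms ag additiveI)
      (auto simp: unit_mod_def algebra_simps anchor_add_arg anchor_mult anchor_add anchor_smult
        anchor_bracket anchor_neg)
qed

lemma uact_uop: "uact L t a = uop (unit_mod L) (\<lambda>b a. a * b) (\<lambda>X a. - anchor L X a) t a"
  by (induction t arbitrary: a) (simp_all add: unit_mod_def)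

lemma uact_cong: "ucong L t t' \<Longrightarrow> uact L t a = uact L t' a"
  using flat_connection.uop_cong[OF unit_connection] by (simp add: uact_uop unit_mod_def)

lemma ucounit_ucls: "t \<in> uterms L \<Longrightarrow> ucounit L (ucls L t) = uact L t 1"
  using rep_ucls[of t] uact_cong by (simp add: ucounit_def)

lemma unit_mod_smult: "t \<in> uterms L \<Longrightarrow> ucls L t \<odot>\<^bsub>unit_mod L\<^esub> a = uact L t a"
  by (simp add: unit_mod_def iotaA_def VA_op ucounit_ucls)

lemma unit_mod_module: "right_module (VA L) (unit_mod L)"
  by (rule right_moduleI_uop[OF unit_connection]) (simp add: unit_mod_smult uact_uop)

lemma unit_mod_simps [simp]:
  "carrier (unit_mod L) = UNIV" "zero (unit_mod L) = 0" "add (unit_mod L) = (+)"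
  "iotaA L b \<odot>\<^bsub>unit_mod L\<^esub> a = a * b" "X \<in> carrier L \<Longrightarrow> iotaL L X \<odot>\<^bsub>unit_mod L\<^esub> a = - anchor L X a"
  using unit_mod_smult[of "IotaA b" a] unit_mod_smult[of "IotaL X" a]
  by (simp_all add: iotaA_def iotaL_def) (simp_all add: unit_mod_def)

lemma ucop_closed: "t \<in> uterms L \<Longrightarrow> set (ucop L t) \<subseteq> carrier (VA L) \<times> carrier (VA L)"
  by (induction t) fastforce+

end

section \<open>Right modules over the enveloping algebra\<close>

locale lr_module = lr_alg \<kappa> L + M: right_module "VA L" M
  for \<kappa> :: "'k::field_char_0 \<Rightarrow> 'a::{comm_ring,comm_monoid_mult}"
    and L :: "('a, 'l) lr_algebra" (structure) and M :: "(('a, 'l) env, 'm) module"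
begin

lemma act_additive: "u \<in> carrier (VA L) \<Longrightarrow> additive M M (smult M u)"
  by (rule additiveI) (simp_all add: M.act_closed M.act_add_right)

lemma amod_abelian_group: "abelian_group (amod L M)"
  by (rule abelian_groupI) (auto simp: M.a_ac intro: M.add.l_inv_ex)

lemma act_A: "m \<in> carrier M \<Longrightarrow> iotaA L (a * b) \<odot>\<^bsub>M\<^esub> m = iotaA L b \<odot>\<^bsub>M\<^esub> (iotaA L a \<odot>\<^bsub>M\<^esub> m)"
  by (simp add: iotaA_mult M.act_mult)

lemma act_A_commute: "m \<in> carrier M \<Longrightarrow>
    iotaA L a \<odot>\<^bsub>M\<^esub> (iotaA L b \<odot>\<^bsub>M\<^esub> m) = iotaA L b \<odot>\<^bsub>M\<^esub> (iotaA L a \<odot>\<^bsub>M\<^esub> m)"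
  using act_A[of m a b] act_A[of m b a] by (simp add: mult.commute)

lemma amod_bimodule: "bimodule \<kappa> (amod L M)"
proof (rule bimodule.intro[OF amod_abelian_group], unfold_locales)
  fix m a b assume m: "m \<in> carrier (amod L M)"
  then show "lact (amod L M) (a * b) m = lact (amod L M) a (lact (amod L M) b m)"
    "ract (amod L M) m (a * b) = ract (amod L M) (ract (amod L M) m a) b"
    "ract (amod L M) (lact (amod L M) a m) b = lact (amod L M) a (ract (amod L M) m b)"
    using act_A_commute[of m a b] by (simp_all add: act_A)
qed (auto simp: M.act_closed M.act_add_left M.act_add_right iotaA_add M.act_one simp flip: VA_one)

sublocale amod: bimodule \<kappa> "amod L M"
  by (rule amod_bimodule)

lemma act_smult: "X \<in> carrier L \<Longrightarrow> m \<in> carrier M \<Longrightarrow>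
    iotaL L (a \<odot>\<^bsub>L\<^esub> X) \<odot>\<^bsub>M\<^esub> m = iotaA L a \<odot>\<^bsub>M\<^esub> (iotaL L X \<odot>\<^bsub>M\<^esub> m)"
  by (simp add: iotaL_smult M.act_mult)

lemma act_anchor: "X \<in> carrier L \<Longrightarrow> m \<in> carrier M \<Longrightarrow> iotaA L a \<odot>\<^bsub>M\<^esub> (iotaL L X \<odot>\<^bsub>M\<^esub> m) =
    iotaL L X \<odot>\<^bsub>M\<^esub> (iotaA L a \<odot>\<^bsub>M\<^esub> m) \<oplus>\<^bsub>M\<^esub> iotaA L (anchor L X a) \<odot>\<^bsub>M\<^esub> m"
proof -
  assume *: "X \<in> carrier L" "m \<in> carrier M"
  then have "(iotaL L X \<otimes>\<^bsub>VA L\<^esub> iotaA L a) \<odot>\<^bsub>M\<^esub> m =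
      (iotaA L a \<otimes>\<^bsub>VA L\<^esub> iotaL L X \<oplus>\<^bsub>VA L\<^esub> iotaA L (anchor L X a)) \<odot>\<^bsub>M\<^esub> m"
    by (simp only: iotaL_iotaA)
  then show ?thesis using * by (simp add: M.act_mult M.act_add_left)
qed

lemma act_bracket: "X \<in> carrier L \<Longrightarrow> Y \<in> carrier L \<Longrightarrow> m \<in> carrier M \<Longrightarrow>
    iotaL L (bracket L X Y) \<odot>\<^bsub>M\<^esub> m \<oplus>\<^bsub>M\<^esub> iotaL L X \<odot>\<^bsub>M\<^esub> (iotaL L Y \<odot>\<^bsub>M\<^esub> m) =
    iotaL L Y \<odot>\<^bsub>M\<^esub> (iotaL L X \<odot>\<^bsub>M\<^esub> m)"
proof -
  assume *: "X \<in> carrier L" "Y \<in> carrier L" "m \<in> carrier M"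
  then have "(iotaL L (bracket L X Y) \<oplus>\<^bsub>VA L\<^esub> iotaL L Y \<otimes>\<^bsub>VA L\<^esub> iotaL L X) \<odot>\<^bsub>M\<^esub> m =
      (iotaL L X \<otimes>\<^bsub>VA L\<^esub> iotaL L Y) \<odot>\<^bsub>M\<^esub> m"
    by (simp only: iotaL_bracket)
  then show ?thesis using * by (simp add: M.act_mult M.act_add_left bracket_closed)
qed

end

lemma lr_moduleI: "lr_alg \<kappa> L \<Longrightarrow> right_module (VA L) M \<Longrightarrow> lr_module \<kappa> L M"
  by (simp add: lr_module_def)

context lr_alg
begin

lemma rmod_homI:
  assumes "right_module (VA L) M" "right_module (VA L) N" "additive M N h"
    and "\<And>a m. m \<in> carrier M \<Longrightarrow> h (iotaA L a \<odot>\<^bsub>M\<^esub> m) = iotaA L a \<odot>\<^bsub>N\<^esub> h m"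
    and "\<And>X m. X \<in> carrier L \<Longrightarrow> m \<in> carrier M \<Longrightarrow> h (iotaL L X \<odot>\<^bsub>M\<^esub> m) = iotaL L X \<odot>\<^bsub>N\<^esub> h m"
  shows "h \<in> rmod_hom (VA L) M N"
proof -
  interpret M: right_module "VA L" M by fact
  interpret N: right_module "VA L" N by fact
  have cl: "h m \<in> carrier N" if "m \<in> carrier M" for m using that by (rule additive_closed[OF assms(3)])
  have "h (u \<odot>\<^bsub>M\<^esub> m) = u \<odot>\<^bsub>N\<^esub> h m" if "u \<in> carrier (VA L)" "m \<in> carrier M" for u m
    using that
  proof (induction u arbitrary: m rule: VA_induct)
    case (add u v)
    then show ?case
      by (simp add: M.act_add_left N.act_add_left cl M.act_closed additive_add[OF assms(3)])
  qed (simp_all add: assms(4,5) M.act_mult N.act_mult cl M.act_closed)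
  then show ?thesis using assms(3) by (auto simp: rmod_hom_def additive_def)
qed

lemma rmod_hom_additive: "h \<in> rmod_hom (VA L) M N \<Longrightarrow> additive M N h"
  and rmod_hom_closed: "h \<in> rmod_hom (VA L) M N \<Longrightarrow> m \<in> carrier M \<Longrightarrow> h m \<in> carrier N"
  and rmod_hom_act: "h \<in> rmod_hom (VA L) M N \<Longrightarrow> u \<in> carrier (VA L) \<Longrightarrow> m \<in> carrier M \<Longrightarrow>
    h (u \<odot>\<^bsub>M\<^esub> m) = u \<odot>\<^bsub>N\<^esub> h m"
  by (auto simp: rmod_hom_def additive_def)

lemma linear_form_hom:
  "h \<in> rmod_hom (VA L) M N \<Longrightarrow> linear_form L N f \<Longrightarrow> linear_form L M (\<lambda>m. f (h m))"
  by (auto simp: rmod_hom_def linear_form_def Pi_def)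

end

section \<open>The tensor product of two right modules over the base\<close>

locale lr_module_pair = Q: lr_module \<kappa> L Q + P: lr_module \<kappa> L P
  for \<kappa> :: "'k::field_char_0 \<Rightarrow> 'a::{comm_ring,comm_monoid_mult}"
    and L :: "('a, 'l) lr_algebra" (structure)
    and Q :: "(('a, 'l) env, 'q) module" and P :: "(('a, 'l) env, 'p) module"
begin

sublocale TT: bimodule_pair \<kappa> "amod L Q" "amod L P"
  by (intro bimodule_pairI Q.amod_bimodule P.amod_bimodule)

abbreviation (input) "TQP \<equiv> tensor (amod L Q) (amod L P)"
abbreviation (input) "tq \<equiv> tn (amod L Q) (amod L P)"

text \<open>The operator prescribed by \<open>\<Delta>(X) = X \<otimes> 1 + 1 \<otimes> X\<close>.
  The diagonal action is built from operators of generators, so that the defining relations are all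
  that has to be checked; agreement with the comultiplication is shown afterwards.\<close>

definition tL :: "'l \<Rightarrow> ('q \<times> 'p) list set \<Rightarrow> ('q \<times> 'p) list set" where
  "tL X = tlift TQP (\<lambda>q p. tq (iotaL L X \<odot>\<^bsub>Q\<^esub> q) p \<oplus>\<^bsub>TQP\<^esub> tq q (iotaL L X \<odot>\<^bsub>P\<^esub> p))"

lemma tn_smult:
  "q \<in> carrier Q \<Longrightarrow> p \<in> carrier P \<Longrightarrow> tq (iotaA L a \<odot>\<^bsub>Q\<^esub> q) p = tq q (iotaA L a \<odot>\<^bsub>P\<^esub> p)"
  using TT.tn_balanced[of q p a] by simp

lemma tn_add:
  "q \<in> carrier Q \<Longrightarrow> q' \<in> carrier Q \<Longrightarrow> p \<in> carrier P \<Longrightarrow> tq (q \<oplus>\<^bsub>Q\<^esub> q') p = tq q p \<oplus>\<^bsub>TQP\<^esub> tq q' p"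
  "q \<in> carrier Q \<Longrightarrow> p \<in> carrier P \<Longrightarrow> p' \<in> carrier P \<Longrightarrow> tq q (p \<oplus>\<^bsub>P\<^esub> p') = tq q p \<oplus>\<^bsub>TQP\<^esub> tq q p'"
  using TT.tn_add_left TT.tn_add_right by simp_all

lemma lact_in: "q \<in> carrier Q \<Longrightarrow> p \<in> carrier P \<Longrightarrow> lact TQP a (tq q p) = tq (iotaA L a \<odot>\<^bsub>Q\<^esub> q) p"
  using TT.lact_tn by simp

text \<open>In general neither summand is balanced. Moving \<open>a\<close> across the tensor sign
  changes each of them by the term with \<open>X(a)\<close>, and the two changes cancel.\<close>

lemma balanced_tL:
  assumes X: "X \<in> carrier L"
  shows "balanced (amod L Q) (amod L P) TQP
    (\<lambda>q p. tq (iotaL L X \<odot>\<^bsub>Q\<^esub> q) p \<oplus>\<^bsub>TQP\<^esub> tq q (iotaL L X \<odot>\<^bsub>P\<^esub> p))"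
proof -
  note [simp] = Q.M.act_closed P.M.act_closed X
  have bal: "tq (iotaL L X \<odot>\<^bsub>Q\<^esub> (iotaA L a \<odot>\<^bsub>Q\<^esub> q)) p \<oplus>\<^bsub>TQP\<^esub> tq (iotaA L a \<odot>\<^bsub>Q\<^esub> q) (iotaL L X \<odot>\<^bsub>P\<^esub> p) =
      tq (iotaL L X \<odot>\<^bsub>Q\<^esub> q) (iotaA L a \<odot>\<^bsub>P\<^esub> p) \<oplus>\<^bsub>TQP\<^esub> tq q (iotaL L X \<odot>\<^bsub>P\<^esub> (iotaA L a \<odot>\<^bsub>P\<^esub> p))"
    if q: "q \<in> carrier Q" and p: "p \<in> carrier P" for q p a
  proof -
    have "tq (iotaL L X \<odot>\<^bsub>Q\<^esub> q) (iotaA L a \<odot>\<^bsub>P\<^esub> p) = tq (iotaA L a \<odot>\<^bsub>Q\<^esub> (iotaL L X \<odot>\<^bsub>Q\<^esub> q)) p"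
      using q p by (simp add: tn_smult)
    also have "\<dots> = tq (iotaL L X \<odot>\<^bsub>Q\<^esub> (iotaA L a \<odot>\<^bsub>Q\<^esub> q)) p \<oplus>\<^bsub>TQP\<^esub> tq (iotaA L (anchor L X a) \<odot>\<^bsub>Q\<^esub> q) p"
      using q p by (simp add: Q.act_anchor tn_add)
    finally have 1: "tq (iotaL L X \<odot>\<^bsub>Q\<^esub> q) (iotaA L a \<odot>\<^bsub>P\<^esub> p) =
        tq (iotaL L X \<odot>\<^bsub>Q\<^esub> (iotaA L a \<odot>\<^bsub>Q\<^esub> q)) p \<oplus>\<^bsub>TQP\<^esub> tq q (iotaA L (anchor L X a) \<odot>\<^bsub>P\<^esub> p)"
      using q p by (simp add: tn_smult)
    have 2: "tq (iotaA L a \<odot>\<^bsub>Q\<^esub> q) (iotaL L X \<odot>\<^bsub>P\<^esub> p) =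
        tq q (iotaL L X \<odot>\<^bsub>P\<^esub> (iotaA L a \<odot>\<^bsub>P\<^esub> p)) \<oplus>\<^bsub>TQP\<^esub> tq q (iotaA L (anchor L X a) \<odot>\<^bsub>P\<^esub> p)"
      using q p by (simp add: tn_smult P.act_anchor tn_add)
    show ?thesis unfolding 1 2 using q p by (simp add: TT.T.a_ac)
  qed
  show ?thesis
    using TT.T.is_abelian_group bal
    by (auto simp: balanced_def Q.M.act_add_right P.M.act_add_right tn_add TT.T.a_ac intro!: additiveI)
qed

lemma tL_tn: "X \<in> carrier L \<Longrightarrow> q \<in> carrier Q \<Longrightarrow> p \<in> carrier P \<Longrightarrow>
    tL X (tq q p) = tq (iotaL L X \<odot>\<^bsub>Q\<^esub> q) p \<oplus>\<^bsub>TQP\<^esub> tq q (iotaL L X \<odot>\<^bsub>P\<^esub> p)"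
  unfolding tL_def using TT.tlift_tn[OF balanced_tL] by simp

lemma tL_additive: "X \<in> carrier L \<Longrightarrow> additive TQP TQP (tL X)"
  unfolding tL_def by (rule TT.tlift_additive[OF balanced_tL])

lemma tensor_connection: "flat_connection \<kappa> L TQP (lact TQP) tL"
proof -
  interpret T: bimodule \<kappa> TQP by (rule TT.tensor_bimodule)
  note ag = TT.T.is_abelian_group
  note ext = TT.tensor_ext[OF _ _ ag]
  note [simp] = Q.M.act_closed P.M.act_closed tL_tn lact_in Q.bracket_closed
  note la = TT.additive_lact_T and tL = tL_additive
  show ?thesis
  proof (intro flat_connection.intro flat_connection_axioms.intro Q.lr_alg_axioms ag la tL)
    fix X Z assume X: "X \<in> carrier L" and Z: "Z \<in> carrier TQP"
    show "tL (a \<odot>\<^bsub>L\<^esub> X) Z = lact TQP a (tL X Z)" for a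
      by (rule ext[OF tL additive_comp[OF tL la] Z])
        (use X in \<open>simp_all add: T.lact_add Q.act_smult P.act_smult tn_smult\<close>)
    show "lact TQP a (tL X Z) = tL X (lact TQP a Z) \<oplus>\<^bsub>TQP\<^esub> lact TQP (anchor L X a) Z" for a
      by (rule ext[OF additive_comp[OF tL la] additive_add_fun[OF ag ag additive_comp[OF la tL] la] Z])
        (use X in \<open>simp_all add: T.lact_add Q.act_anchor tn_add TT.T.a_ac\<close>)
    fix Y assume Y: "Y \<in> carrier L"
    show "tL (X \<oplus>\<^bsub>L\<^esub> Y) Z = tL X Z \<oplus>\<^bsub>TQP\<^esub> tL Y Z"
      by (rule ext[OF tL additive_add_fun[OF ag ag tL tL] Z])
        (use X Y in \<open>simp_all add: Q.iotaL_add Q.M.act_add_left P.M.act_add_left tn_add TT.T.a_ac\<close>)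
    show "tL (bracket L X Y) Z \<oplus>\<^bsub>TQP\<^esub> tL X (tL Y Z) = tL Y (tL X Z)"
    proof (rule ext[OF additive_add_fun[OF ag ag tL additive_comp[OF tL tL]] additive_comp[OF tL tL] Z])
      fix q p assume "q \<in> carrier (amod L Q)" "p \<in> carrier (amod L P)"
      then have q: "q \<in> carrier Q" and p: "p \<in> carrier P" by simp_all
      \<comment> \<open>The bracket relation is needed for the terms where both operators hit the
        same factor; the mixed terms agree on both sides up to order.\<close>
      have 1: "tq (iotaL L Y \<odot>\<^bsub>Q\<^esub> (iotaL L X \<odot>\<^bsub>Q\<^esub> q)) p =
          tq (iotaL L (bracket L X Y) \<odot>\<^bsub>Q\<^esub> q) p \<oplus>\<^bsub>TQP\<^esub> tq (iotaL L X \<odot>\<^bsub>Q\<^esub> (iotaL L Y \<odot>\<^bsub>Q\<^esub> q)) p"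
        using X Y q p by (subst Q.act_bracket[OF X Y q, symmetric]) (simp add: tn_add)
      have 2: "tq q (iotaL L Y \<odot>\<^bsub>P\<^esub> (iotaL L X \<odot>\<^bsub>P\<^esub> p)) =
          tq q (iotaL L (bracket L X Y) \<odot>\<^bsub>P\<^esub> p) \<oplus>\<^bsub>TQP\<^esub> tq q (iotaL L X \<odot>\<^bsub>P\<^esub> (iotaL L Y \<odot>\<^bsub>P\<^esub> p))"
        using X Y q p by (subst P.act_bracket[OF X Y p, symmetric]) (simp add: tn_add)
      show "tL (bracket L X Y) (tq q p) \<oplus>\<^bsub>TQP\<^esub> tL X (tL Y (tq q p)) = tL Y (tL X (tq q p))"
        using X Y q p by (simp add: additive_add[OF tL] 1 2 TT.T.a_ac)
    qed (use X Y in simp_all)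
  next
    fix Z a b assume "Z \<in> carrier TQP"
    then show "lact TQP (a * b) Z = lact TQP b (lact TQP a Z)"
      using T.mult_lact[of Z b a] by (simp add: mult.commute)
  qed (simp_all add: T.add_lact T.one_lact)
qed

sublocale tc: flat_connection \<kappa> L TQP "lact TQP" tL
  by (rule tensor_connection)

text \<open>The operator of a term and its formal coproduct are defined by the same recursion; in a
  product the left factor acts first, which is the order in which \<open>ucop\<close>
  multiplies.\<close>

lemma uop_tn:
  assumes "t \<in> uterms L" "q \<in> carrier Q" "p \<in> carrier P"
  shows "uop TQP (lact TQP) tL t (tq q p) = lsum TQP [tq (x \<odot>\<^bsub>Q\<^esub> q) (y \<odot>\<^bsub>P\<^esub> p). (x, y) \<leftarrow> ucop L t]"
  using assms
proof (induction t arbitrary: q p)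
  case (IotaA a)
  then show ?case using Q.M.act_closed by (simp add: lact_in P.M.act_one)
next
  case (IotaL X)
  then show ?case using Q.M.act_closed P.M.act_closed by (simp add: tL_tn P.M.act_one Q.M.act_one)
next
  case (Add t r)
  then show ?case
    using Q.ucop_closed[of t] Q.ucop_closed[of r] Q.M.act_closed P.M.act_closed
    by (simp, subst TT.T.lsum_append) (auto simp: subset_iff)
next
  case (Mul t r)
  note cl = Q.ucop_closed[of t] Q.ucop_closed[of r]
  have "uop TQP (lact TQP) tL (Mul t r) (tq q p) =
      uop TQP (lact TQP) tL r (lsum TQP [tq (x \<odot>\<^bsub>Q\<^esub> q) (y \<odot>\<^bsub>P\<^esub> p). (x, y) \<leftarrow> ucop L t])"
    using Mul by simp
  also have "\<dots> = lsum TQP [uop TQP (lact TQP) tL r (tq (x \<odot>\<^bsub>Q\<^esub> q) (y \<odot>\<^bsub>P\<^esub> p)). (x, y) \<leftarrow> ucop L t]"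
    using Mul.prems cl Q.M.act_closed P.M.act_closed
    by (subst additive_lsum_map[OF TT.T.is_abelian_group TT.T.is_abelian_group tc.uop_additive])
      (auto simp: case_prod_unfold subset_iff)
  also have "\<dots> = lsum TQP [lsum TQP [tq (x' \<odot>\<^bsub>Q\<^esub> (x \<odot>\<^bsub>Q\<^esub> q)) (y' \<odot>\<^bsub>P\<^esub> (y \<odot>\<^bsub>P\<^esub> p)). (x', y') \<leftarrow> ucop L r].
      (x, y) \<leftarrow> ucop L t]"
    using Mul.prems cl Q.M.act_closed P.M.act_closed Mul.IH(2) by (intro lsum_cong) (auto simp: subset_iff)
  also have "\<dots> = lsum TQP [lsum TQP [tq ((x \<otimes>\<^bsub>VA L\<^esub> x') \<odot>\<^bsub>Q\<^esub> q) ((y \<otimes>\<^bsub>VA L\<^esub> y') \<odot>\<^bsub>P\<^esub> p). (x', y') \<leftarrow> ucop L r].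
      (x, y) \<leftarrow> ucop L t]"
    using Mul.prems cl
    by (intro lsum_cong) (auto simp: subset_iff Q.M.act_mult P.M.act_mult intro!: lsum_cong)
  also have "\<dots> = lsum TQP (concat [[tq ((x \<otimes>\<^bsub>VA L\<^esub> x') \<odot>\<^bsub>Q\<^esub> q) ((y \<otimes>\<^bsub>VA L\<^esub> y') \<odot>\<^bsub>P\<^esub> p). (x', y') \<leftarrow> ucop L r].
      (x, y) \<leftarrow> ucop L t])"
    using Mul.prems cl Q.M.act_closed P.M.act_closed
    by (subst TT.T.lsum_concat) (auto simp: subset_iff case_prod_unfold)
  finally show ?case by (simp add: map_concat o_def case_prod_unfold)
qed

end

section \<open>The comultiplication of the enveloping algebra\<close>

context lr_alg
begin

text \<open>The formal coproduct of a term represents the value of its operator at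
  \<open>1 \<otimes> 1\<close> in the tensor square of the regular module. Congruent terms have
  equal operators, so the comultiplication respects the relations.\<close>

lemma ucop_cong:
  assumes "ucong L t t'"
  shows "tcls (VA_right L) (VA_right L) (ucop L t) = tcls (VA_right L) (VA_right L) (ucop L t')"
proof -
  interpret R: lr_module \<kappa> L "VA_reg L" by (intro lr_moduleI lr_alg_axioms VA_reg_module)
  interpret RR: lr_module_pair \<kappa> L "VA_reg L" "VA_reg L" by unfold_locales
  let ?T = "tensor (amod L (VA_reg L)) (amod L (VA_reg L))"
  let ?t = "tn (amod L (VA_reg L)) (amod L (VA_reg L))"
  have u: "t \<in> uterms L" "t' \<in> uterms L" using ucong_uterms[OF lie_rinehart_axioms assms] by simp_all
  have "tcls (amod L (VA_reg L)) (amod L (VA_reg L)) (ucop L r) = uop ?T (lact ?T) RR.tL r (?t \<one>\<^bsub>VA L\<^esub> \<one>\<^bsub>VA L\<^esub>)"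
    if "r \<in> uterms L" for r
  proof -
    have "uop ?T (lact ?T) RR.tL r (?t \<one>\<^bsub>VA L\<^esub> \<one>\<^bsub>VA L\<^esub>) = lsum ?T [?t x y. (x, y) \<leftarrow> ucop L r]"
      using that ucop_closed[OF that] by (subst RR.uop_tn) (auto intro!: lsum_cong simp: subset_iff)
    then show ?thesis using ucop_closed[OF that] by (simp add: RR.TT.tcls_lsum)
  qed
  moreover have "?t \<one>\<^bsub>VA L\<^esub> \<one>\<^bsub>VA L\<^esub> \<in> carrier ?T" by simp
  ultimately show ?thesis
    using RR.tc.uop_cong[OF assms] u by (simp add: tcls_VA_right)
qed

lemma ucomult_ucls:
  "t \<in> uterms L \<Longrightarrow> ucomult L (ucls L t) = tcls (VA_right L) (VA_right L) (ucop L t)"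
  using ucop_cong[OF rep_ucls(1)] by (simp add: ucomult_def)

lemma ucop_mem_ucomult: assumes "t \<in> uterms L" shows "ucop L t \<in> ucomult L (ucls L t)"
proof -
  interpret R: lr_module \<kappa> L "VA_reg L" by (intro lr_moduleI lr_alg_axioms VA_reg_module)
  interpret RR: lr_module_pair \<kappa> L "VA_reg L" "VA_reg L" by unfold_locales
  show ?thesis
    using RR.TT.tcls_self ucop_closed[OF assms] by (simp add: ucomult_ucls assms tcls_VA_right)
qed

lemma ucomult_iotaL: "X \<in> carrier L \<Longrightarrow> [(iotaL L X, \<one>\<^bsub>VA L\<^esub>), (\<one>\<^bsub>VA L\<^esub>, iotaL L X)] \<in> ucomult L (iotaL L X)"
  using ucop_mem_ucomult[of "IotaL X"] by (simp add: iotaL_def)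

end

lemma (in lr_alg) ucomult_closed:
  assumes "t \<in> uterms L" "us \<in> ucomult L (ucls L t)"
  shows "set us \<subseteq> carrier (VA L) \<times> carrier (VA L)"
proof -
  interpret R: lr_module \<kappa> L "VA_reg L" by (intro lr_moduleI lr_alg_axioms VA_reg_module)
  interpret RR: lr_module_pair \<kappa> L "VA_reg L" "VA_reg L" by unfold_locales
  have "teq (amod L (VA_reg L)) (amod L (VA_reg L)) (ucop L t) us"
    using assms tcls_VA_right by (simp add: ucomult_ucls tcls_def)
  then show ?thesis using RR.TT.T.peq_sub by (simp add: teq_peq)
qed

section \<open>The diagonal action\<close>

context lr_module_pair
begin

text \<open>The map \<open>x \<otimes> y \<mapsto> q x \<otimes> p y\<close> is balanced over
  \<open>A\<close>, hence every representative of the coproduct gives the same sum, in particular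
  the one chosen in the definition of \<open>mod_tensor\<close>.\<close>

lemma ucomult_sum:
  assumes "t \<in> uterms L" "us \<in> ucomult L (ucls L t)" "q \<in> carrier Q" "p \<in> carrier P"
  shows "lsum TQP [tq (x \<odot>\<^bsub>Q\<^esub> q) (y \<odot>\<^bsub>P\<^esub> p). (x, y) \<leftarrow> us] = uop TQP (lact TQP) tL t (tq q p)"
proof -
  interpret R: lr_module \<kappa> L "VA_reg L" by (intro lr_moduleI Q.lr_alg_axioms Q.VA_reg_module)
  interpret RR: lr_module_pair \<kappa> L "VA_reg L" "VA_reg L" by unfold_locales
  let ?M = "amod L (VA_reg L)"
  have cl: "set (ucop L t) \<subseteq> carrier (VA L) \<times> carrier (VA L)" using Q.ucop_closed assms(1) by simp
  have us: "teq ?M ?M (ucop L t) us"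
    using assms(1,2) Q.tcls_VA_right by (simp add: Q.ucomult_ucls tcls_def)
  have "balanced ?M ?M TQP (\<lambda>x y. tq (x \<odot>\<^bsub>Q\<^esub> q) (y \<odot>\<^bsub>P\<^esub> p))"
    using assms(3,4) TT.T.is_abelian_group
    by (auto simp: balanced_def Q.M.act_closed P.M.act_closed Q.M.act_add_left P.M.act_add_left tn_add
        Q.M.act_mult P.M.act_mult tn_smult intro!: additiveI)
  from RR.TT.balanced_teq[OF this us]
  show "lsum TQP [tq (x \<odot>\<^bsub>Q\<^esub> q) (y \<odot>\<^bsub>P\<^esub> p). (x, y) \<leftarrow> us] = uop TQP (lact TQP) tL t (tq q p)"
    using assms by (simp add: uop_tn)
qed

lemma mod_tensor_simps [simp]:
  "carrier (mod_tensor L Q P) = carrier TQP" "zero (mod_tensor L Q P) = zero TQP"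
  "add (mod_tensor L Q P) = add TQP"
  by (simp_all add: mod_tensor_def Let_def)

text \<open>The action is defined through a chosen representative of the coproduct; in the form of
  an operator it inherits the module axioms from the flat connection.\<close>

lemma mod_tensor_smult:
  assumes t: "t \<in> uterms L" and Z: "Z \<in> carrier TQP"
  shows "ucls L t \<odot>\<^bsub>mod_tensor L Q P\<^esub> Z = uop TQP (lact TQP) tL t Z"
proof -
  let ?us = "rep (ucomult L (ucls L t))"
  have "?us \<in> ucomult L (ucls L t)"
    unfolding rep_def by (rule someI) (rule Q.ucop_mem_ucomult[OF t])
  note us = ucomult_sum[OF t this] Q.ucomult_closed[OF t this]
  note add = tc.uop_additive[OF t]
  have "tcls (amod L Q) (amod L P) [(x \<odot>\<^bsub>Q\<^esub> q, y \<odot>\<^bsub>P\<^esub> p). (q, p) \<leftarrow> zs, (x, y) \<leftarrow> ?us] =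
      uop TQP (lact TQP) tL t Z" if "zs \<in> Z" for zs
  proof -
    have zs: "set zs \<subseteq> carrier Q \<times> carrier P" and Zzs: "Z = lsum TQP [tq q p. (q, p) \<leftarrow> zs]"
      using TT.tensor_mem[OF Z that] by simp_all
    have cl: "set [(x \<odot>\<^bsub>Q\<^esub> q, y \<odot>\<^bsub>P\<^esub> p). (q, p) \<leftarrow> zs, (x, y) \<leftarrow> ?us] \<subseteq> carrier Q \<times> carrier P"
      using zs us(2) by (auto intro!: Q.M.act_closed P.M.act_closed)
    have "tcls (amod L Q) (amod L P) [(x \<odot>\<^bsub>Q\<^esub> q, y \<odot>\<^bsub>P\<^esub> p). (q, p) \<leftarrow> zs, (x, y) \<leftarrow> ?us] =
        lsum TQP (concat [[tq (x \<odot>\<^bsub>Q\<^esub> q) (y \<odot>\<^bsub>P\<^esub> p). (x, y) \<leftarrow> ?us]. (q, p) \<leftarrow> zs])"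
      using cl by (subst TT.tcls_lsum) (simp_all add: map_concat o_def case_prod_unfold)
    also have "\<dots> = lsum TQP [lsum TQP [tq (x \<odot>\<^bsub>Q\<^esub> q) (y \<odot>\<^bsub>P\<^esub> p). (x, y) \<leftarrow> ?us]. (q, p) \<leftarrow> zs]"
      using zs us(2) Q.M.act_closed P.M.act_closed
      by (subst TT.T.lsum_concat) (auto simp: case_prod_unfold subset_iff)
    also have "\<dots> = lsum TQP [uop TQP (lact TQP) tL t (tq q p). (q, p) \<leftarrow> zs]"
      using zs us(1) by (intro lsum_cong) auto
    also have "\<dots> = uop TQP (lact TQP) tL t Z"
      unfolding Zzs using zs
      by (subst additive_lsum_map[OF TT.T.is_abelian_group TT.T.is_abelian_group add])
        (auto simp: case_prod_unfold)
    finally show ?thesis .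
  qed
  then have "(\<Union>zs\<in>Z. tcls (amod L Q) (amod L P) [(x \<odot>\<^bsub>Q\<^esub> q, y \<odot>\<^bsub>P\<^esub> p). (q, p) \<leftarrow> zs, (x, y) \<leftarrow> ?us]) =
      uop TQP (lact TQP) tL t Z"
    using TT.T.rep_mem[OF Z] by blast
  then show ?thesis by (simp add: mod_tensor_def Let_def)
qed

lemma mod_tensor_module: "right_module (VA L) (mod_tensor L Q P)"
proof -
  have uop: "uop (mod_tensor L Q P) (lact TQP) tL t Z = uop TQP (lact TQP) tL t Z" for t Z
    by (induction t arbitrary: Z) simp_all
  have ag: "abelian_group (mod_tensor L Q P)"
    by (rule abelian_groupI) (auto simp: TT.T.a_ac intro: TT.T.add.l_inv_ex)
  have "flat_connection \<kappa> L (mod_tensor L Q P) (lact TQP) tL"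
    using tc.flat_connection_axioms ag
    by (simp add: flat_connection_def flat_connection_axioms_def additive_def)
  then show ?thesis
    by (rule Q.right_moduleI_uop) (simp add: uop mod_tensor_smult)
qed

lemma mod_tensor_iotaA: "Z \<in> carrier TQP \<Longrightarrow> iotaA L a \<odot>\<^bsub>mod_tensor L Q P\<^esub> Z = lact TQP a Z"
  and mod_tensor_iotaL: "X \<in> carrier L \<Longrightarrow> Z \<in> carrier TQP \<Longrightarrow> iotaL L X \<odot>\<^bsub>mod_tensor L Q P\<^esub> Z = tL X Z"
  using mod_tensor_smult[of "IotaA a" Z] mod_tensor_smult[of "IotaL X" Z]
  by (simp_all add: iotaA_def iotaL_def)

text \<open>The universal property of the tensor product in the category of right modules; the last
  premise is the Leibniz rule. All morphisms out of tensor products that the product of the finite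
  dual requires come from here.\<close>

lemma mod_tensor_homI:
  fixes N :: "(('a, 'l) env, 'n) module"
  assumes N: "right_module (VA L) N"
    and bal: "balanced (amod L Q) (amod L P) N \<beta>"
    and A: "\<And>q p a. \<lbrakk>q \<in> carrier Q; p \<in> carrier P\<rbrakk> \<Longrightarrow> \<beta> (iotaA L a \<odot>\<^bsub>Q\<^esub> q) p = iotaA L a \<odot>\<^bsub>N\<^esub> \<beta> q p"
    and Lb: "\<And>q p X. \<lbrakk>q \<in> carrier Q; p \<in> carrier P; X \<in> carrier L\<rbrakk> \<Longrightarrow>
      \<beta> (iotaL L X \<odot>\<^bsub>Q\<^esub> q) p \<oplus>\<^bsub>N\<^esub> \<beta> q (iotaL L X \<odot>\<^bsub>P\<^esub> p) = iotaL L X \<odot>\<^bsub>N\<^esub> \<beta> q p"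
  shows "tlift N \<beta> \<in> rmod_hom (VA L) (mod_tensor L Q P) N"
proof -
  interpret N: lr_module \<kappa> L N by (intro lr_moduleI Q.lr_alg_axioms N)
  note ag = N.M.abelian_group_axioms
  have ad: "additive TQP N (tlift N \<beta>)" by (rule TT.tlift_additive[OF bal])
  have tl: "tlift N \<beta> (tq q p) = \<beta> q p" if "q \<in> carrier Q" "p \<in> carrier P" for q p
    using TT.tlift_tn[OF bal] that by simp
  note [simp] = Q.M.act_closed P.M.act_closed
  show ?thesis
  proof (rule Q.rmod_homI[OF mod_tensor_module N])
    show "additive (mod_tensor L Q P) N (tlift N \<beta>)" using ad by (simp add: additive_def)
    fix Z assume "Z \<in> carrier (mod_tensor L Q P)"
    then have Z: "Z \<in> carrier TQP" by simp
    show "tlift N \<beta> (iotaA L a \<odot>\<^bsub>mod_tensor L Q P\<^esub> Z) = iotaA L a \<odot>\<^bsub>N\<^esub> tlift N \<beta> Z" for a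
      unfolding mod_tensor_iotaA[OF Z]
      by (rule TT.tensor_ext[OF additive_comp[OF TT.additive_lact_T ad]
            additive_comp[OF ad N.act_additive] ag Z])
        (simp_all add: lact_in tl A)
    fix X assume X: "X \<in> carrier L"
    show "tlift N \<beta> (iotaL L X \<odot>\<^bsub>mod_tensor L Q P\<^esub> Z) = iotaL L X \<odot>\<^bsub>N\<^esub> tlift N \<beta> Z"
      unfolding mod_tensor_iotaL[OF X Z]
      by (rule TT.tensor_ext[OF additive_comp[OF tL_additive ad]
            additive_comp[OF ad N.act_additive] ag Z])
        (use X in \<open>simp_all add: tL_tn tl Lb additive_add[OF ad]\<close>)
  qed
qed

lemma linear_form_ext:
  assumes "linear_form L (mod_tensor L Q P) f" "linear_form L (mod_tensor L Q P) g" "Z \<in> carrier TQP"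
    and "\<And>q p. q \<in> carrier Q \<Longrightarrow> p \<in> carrier P \<Longrightarrow> f (tq q p) = g (tq q p)"
  shows "f Z = g Z"
proof (rule TT.tensor_ext[OF _ _ regular_abelian_group assms(3)])
  show "additive TQP regular_bimod f" "additive TQP regular_bimod g"
    using assms(1,2) by (simp_all add: linear_form_def additive_def)
qed (simp add: assms(4))

end

lemma lr_module_pairI:
  "lr_alg \<kappa> L \<Longrightarrow> right_module (VA L) Q \<Longrightarrow> right_module (VA L) P \<Longrightarrow> lr_module_pair \<kappa> L Q P"
  by (simp add: lr_module_pair_def lr_module_def)

section \<open>The morphism to the derivations of a bialgebroid\<close>

text \<open>The reason for the sign: under convolution a pairing reverses products, so the
  commutator of the functionals \<open>z \<mapsto> \<xi>(z)(X)\<close> and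
  \<open>z \<mapsto> \<xi>(z)(Y)\<close> is evaluation at \<open>Y X - X Y\<close>, which is minus
  the bracket. The statement covers the finite dual with \<zeta> as well as the universal coring
  with \<xi>; the premise on products is the primitivity of \<open>X\<close>.\<close>

theorem (in lr_alg) Theta'_lr_morphism:
  fixes H :: "('a, 'h) hopf_algebroid"
  assumes H: "comm_bialgebroid \<kappa> H" and \<xi>: "pairing L H \<xi>"
    and mult: "\<And>x y X. \<lbrakk>x \<in> carrier H; y \<in> carrier H; X \<in> carrier L\<rbrakk> \<Longrightarrow> \<xi> (x \<otimes>\<^bsub>H\<^esub> y) (iotaL L X) =
      counit H x * \<xi> y (iotaL L X) + \<xi> x (iotaL L X) * counit H y"
  shows "lr_morphism \<kappa> L (der_lr \<kappa> H) (Theta' L H \<xi>)"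
proof -
  interpret H: comm_bialgebroid \<kappa> H by fact
  have u: "\<xi> z (u \<oplus>\<^bsub>VA L\<^esub> v) = \<xi> z u + \<xi> z v" "\<xi> z (u \<otimes>\<^bsub>VA L\<^esub> iotaA L a) = \<xi> z u * a"
    if "z \<in> carrier H" "u \<in> carrier (VA L)" "v \<in> carrier (VA L)" for z u v a
    using \<xi> that by (auto simp: pairing_def udual_def Pi_def)
  have add: "\<xi> (z \<oplus>\<^bsub>H\<^esub> w) u = \<xi> z u + \<xi> w u" if "z \<in> carrier H" "w \<in> carrier H" "u \<in> carrier (VA L)" for z w u
    using \<xi> that by (simp add: pairing_def)
  have bim: "\<xi> (ract H (lact H a z) b) u = a * \<xi> z (iotaA L b \<otimes>\<^bsub>VA L\<^esub> u)"
    if "z \<in> carrier H" "u \<in> carrier (VA L)" for z u a b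
    using \<xi> that by (simp add: pairing_def)
  have one: "\<xi> z \<one>\<^bsub>VA L\<^esub> = counit H z" if "z \<in> carrier H" for z
    using \<xi> that by (simp add: pairing_def)
  have prod: "\<xi> z (u \<otimes>\<^bsub>VA L\<^esub> v) = (\<Sum>(x, y) \<leftarrow> zs. \<xi> x (iotaA L (\<xi> y u) \<otimes>\<^bsub>VA L\<^esub> v))"
    if "z \<in> carrier H" "zs \<in> comult H z" "u \<in> carrier (VA L)" "v \<in> carrier (VA L)" for z u v zs
    using \<xi> that by (simp add: pairing_def)
  have lac: "\<xi> (lact H a z) u = a * \<xi> z u" if "z \<in> carrier H" "u \<in> carrier (VA L)" for a z u
    using bim[OF that, of a 1] that by (simp add: H.one_ract H.lact_closed flip: VA_one)
  have rac: "\<xi> (ract H z a) u = \<xi> z (iotaA L a \<otimes>\<^bsub>VA L\<^esub> u)" if "z \<in> carrier H" "u \<in> carrier (VA L)" for a z u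
    using bim[OF that, of 1 a] that by (simp add: H.one_lact)
  \<comment> \<open>Convolution of two of the functionals inserts \<open>- \<xi>(y)(Y)\<close> as an
    argument of \<open>iotaA\<close>, and this sign has to be moved out.\<close>
  have neg: "\<xi> z (iotaA L (- a) \<otimes>\<^bsub>VA L\<^esub> u) = - \<xi> z (iotaA L a \<otimes>\<^bsub>VA L\<^esub> u)"
    if "z \<in> carrier H" "u \<in> carrier (VA L)" for a z u
  proof -
    have z0: "\<xi> z \<zero>\<^bsub>VA L\<^esub> = 0" using u(1)[OF that(1) V.zero_closed V.zero_closed] by simp
    have "iotaA L (- a) \<otimes>\<^bsub>VA L\<^esub> u \<oplus>\<^bsub>VA L\<^esub> iotaA L a \<otimes>\<^bsub>VA L\<^esub> u = iotaA L (- a + a) \<otimes>\<^bsub>VA L\<^esub> u"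
      using that(2) by (simp only: iotaA_add V.l_distr iotaA_closed)
    also have "\<dots> = \<zero>\<^bsub>VA L\<^esub>" using that(2) by (simp flip: VA_zero)
    finally have "\<xi> z (iotaA L (- a) \<otimes>\<^bsub>VA L\<^esub> u) + \<xi> z (iotaA L a \<otimes>\<^bsub>VA L\<^esub> u) = 0"
      using u(1)[OF that(1), of "iotaA L (- a) \<otimes>\<^bsub>VA L\<^esub> u" "iotaA L a \<otimes>\<^bsub>VA L\<^esub> u"] z0 that by simp
    then show ?thesis by (simp add: eq_neg_iff_add_eq_0)
  qed
  let ?\<Theta> = "Theta' L H \<xi>"
  have \<Theta>: "?\<Theta> X z = - \<xi> z (iotaL L X)" if "z \<in> carrier H" for X z
    using that by (simp add: Theta'_def)
  have der: "?\<Theta> X \<in> s_derivations \<kappa> H" if "X \<in> carrier L" for X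
    unfolding H.s_derivations_iff using that
    by (auto simp: left_linear_def \<Theta> add lac mult H.lact_closed) (simp_all add: Theta'_def)
  have conv: "conv H (?\<Theta> X) (?\<Theta> Y) z = \<xi> z (iotaL L Y \<otimes>\<^bsub>VA L\<^esub> iotaL L X)"
    if "X \<in> carrier L" "Y \<in> carrier L" "z \<in> carrier H" for X Y z
  proof -
    have "conv H (?\<Theta> X) (?\<Theta> Y) z = (\<Sum>(x, y) \<leftarrow> rep (comult H z). \<xi> x (iotaA L (\<xi> y (iotaL L Y)) \<otimes>\<^bsub>VA L\<^esub> iotaL L X))"
      unfolding conv_def using H.comult_elem[OF that(3) H.rep_comult[OF that(3)]] that(1,2)
      by (intro arg_cong[of _ _ sum_list] map_cong refl) (auto simp: \<Theta> H.ract_closed rac neg)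
    then show ?thesis using prod[OF that(3) H.rep_comult[OF that(3)], of "iotaL L Y" "iotaL L X"] that by simp
  qed
  \<comment> \<open>Evaluate \<open>\<xi>(1)\<close> at \<open>X a\<close>. It vanishes, because the
    product rule at the unit gives \<open>\<xi>(1)(X) = 0\<close>. On the other hand
    \<open>X a = a X + X(a)\<close>, and in the first summand \<open>a\<close> can be moved to the
    right action on \<open>1\<close>, which yields \<open>t(a)\<close>.\<close>
  have anc: "?\<Theta> X (tgt H a) = anchor L X a" if X: "X \<in> carrier L" for X a
  proof -
    have "\<xi> \<one>\<^bsub>H\<^esub> (iotaL L X) = 0"
      using mult[of "\<one>\<^bsub>H\<^esub>" "\<one>\<^bsub>H\<^esub>" X] X by (simp add: H.counit_one mult.commute)
    then have "0 = \<xi> \<one>\<^bsub>H\<^esub> (iotaL L X \<otimes>\<^bsub>VA L\<^esub> iotaA L a)" using X by (simp add: u(2)[where v = "\<zero>\<^bsub>VA L\<^esub>"])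
    also have "\<dots> = \<xi> \<one>\<^bsub>H\<^esub> (iotaA L a \<otimes>\<^bsub>VA L\<^esub> iotaL L X) + \<xi> \<one>\<^bsub>H\<^esub> (\<one>\<^bsub>VA L\<^esub> \<otimes>\<^bsub>VA L\<^esub> iotaA L (anchor L X a))"
      using X by (simp add: iotaL_iotaA u(1))
    also have "\<xi> \<one>\<^bsub>H\<^esub> (\<one>\<^bsub>VA L\<^esub> \<otimes>\<^bsub>VA L\<^esub> iotaA L (anchor L X a)) = anchor L X a"
      using u(2)[of "\<one>\<^bsub>H\<^esub>" "\<one>\<^bsub>VA L\<^esub>" "\<one>\<^bsub>VA L\<^esub>"] by (simp add: one H.counit_one)
    finally have "- \<xi> \<one>\<^bsub>H\<^esub> (iotaA L a \<otimes>\<^bsub>VA L\<^esub> iotaL L X) = anchor L X a" by (simp add: neg_eq_iff_add_eq_0)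
    then show ?thesis using X rac[of "\<one>\<^bsub>H\<^esub>" "iotaL L X" a] by (simp add: \<Theta> H.ract_one)
  qed
  show ?thesis
    unfolding lr_morphism_def
  proof (intro conjI ballI allI lie_rinehart_axioms H.lie_rinehart_DL)
    show "?\<Theta> \<in> carrier L \<rightarrow> carrier (der_lr \<kappa> H)" using der by (simp add: H.der_lr_simps)
    fix X assume X: "X \<in> carrier L"
    show "anchor (der_lr \<kappa> H) (?\<Theta> X) = anchor L X"
      using X by (simp add: fun_eq_iff H.der_lr_simps anc)
    show "?\<Theta> (a \<odot>\<^bsub>L\<^esub> X) = a \<odot>\<^bsub>der_lr \<kappa> H\<^esub> ?\<Theta> X" for a
      using X by (intro H.derivation_eqI H.smult_closed_DL der)
        (auto simp: H.der_lr_simps \<Theta> iotaL_smult u(2)[where v = "\<zero>\<^bsub>VA L\<^esub>"] mult.commute)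
    fix Y assume Y: "Y \<in> carrier L"
    show "?\<Theta> (X \<oplus>\<^bsub>L\<^esub> Y) = ?\<Theta> X \<oplus>\<^bsub>der_lr \<kappa> H\<^esub> ?\<Theta> Y"
      using X Y by (intro H.derivation_eqI H.add_closed_DL der) (auto simp: H.der_lr_simps \<Theta> iotaL_add u(1))
    show "?\<Theta> (bracket L X Y) = bracket (der_lr \<kappa> H) (?\<Theta> X) (?\<Theta> Y)"
    proof (intro H.derivation_eqI H.bracket_closed_DL der)
      fix z assume z: "z \<in> carrier H"
      have "\<xi> z (iotaL L (bracket L X Y)) + \<xi> z (iotaL L Y \<otimes>\<^bsub>VA L\<^esub> iotaL L X) = \<xi> z (iotaL L X \<otimes>\<^bsub>VA L\<^esub> iotaL L Y)"
        using z X Y u(1)[OF z, of "iotaL L (bracket L X Y)" "iotaL L Y \<otimes>\<^bsub>VA L\<^esub> iotaL L X"]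
        by (simp add: bracket_closed iotaL_bracket)
      then show "?\<Theta> (bracket L X Y) z = bracket (der_lr \<kappa> H) (?\<Theta> X) (?\<Theta> Y) z"
        using z X Y by (simp add: H.der_lr_bracket conv \<Theta>) (simp add: algebra_simps)
    qed (use X Y in \<open>auto simp: bracket_closed\<close>)
  qed
qed

section \<open>Finitely generated projective modules\<close>

text \<open>The same condition as membership in \<open>objects\<close>, for a carrier of any
  type.\<close>

definition fgm :: "('a::{comm_ring,comm_monoid_mult}, 'l) lr_algebra \<Rightarrow> (('a, 'l) env, 'm) module \<Rightarrow> bool" where
  "fgm L M \<longleftrightarrow> right_module (VA L) M \<and> fg_projective (amod L M)"

lemma objects_iff: "P \<in> objects L \<longleftrightarrow> fgm L P"
  by (simp add: objects_def fgm_def)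

lemma free_mod_simps [simp]:
  "carrier (free_mod n) = {xs. length xs = n}" "zero (free_mod n) = replicate n 0"
  "add (free_mod n) xs ys = map2 (+) xs ys" "lact (free_mod n) a xs = map ((*) a) xs"
  "ract (free_mod n) xs a = map ((*) a) xs"
  by (simp_all add: free_mod_def)

lemma free_mod_abelian_group: "abelian_group (free_mod n :: ('a::{comm_ring,comm_monoid_mult}, 'a list) bimod)"
proof (rule abelian_groupI)
  fix xs :: "'a list" assume "xs \<in> carrier (free_mod n)"
  then show "\<exists>ys\<in>carrier (free_mod n). ys \<oplus>\<^bsub>free_mod n\<^esub> xs = \<zero>\<^bsub>free_mod n\<^esub>"
    by (intro bexI[of _ "map uminus xs"]) (auto intro!: nth_equalityI)
qed (auto intro!: nth_equalityI simp: add.assoc add.commute)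

lemma lsum_free_mod:
  "(\<And>z. z \<in> set zs \<Longrightarrow> length z = n) \<Longrightarrow> j < n \<Longrightarrow>
    length (lsum (free_mod n) zs) = n \<and> lsum (free_mod n) zs ! j = (\<Sum>z \<leftarrow> zs. z ! j)"
  by (induction zs) auto

lemma free_mod_basis:
  fixes xs :: "'a::{comm_ring,comm_monoid_mult} list"
  assumes "length xs = n"
  shows "xs = lsum (free_mod n) [map ((*) (xs ! k)) (map (\<lambda>j. if j = k then 1 else 0) [0..<n]). k \<leftarrow> [0..<n]]"
    (is "_ = lsum _ ?zs")
proof -
  have len: "length z = n" if "z \<in> set ?zs" for z using that by auto
  have cl: "lsum (free_mod n) ?zs \<in> carrier (free_mod n)"
    by (intro abelian_group.lsum_closed free_mod_abelian_group) auto
  have "xs ! j = lsum (free_mod n) ?zs ! j" if j: "j < n" for j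
  proof -
    have "lsum (free_mod n) ?zs ! j = (\<Sum>z \<leftarrow> ?zs. z ! j)"
      using lsum_free_mod[of ?zs n j] len j by blast
    also have "\<dots> = (\<Sum>k \<leftarrow> [0..<n]. if j = k then xs ! k else 0)"
      using j by (intro arg_cong[of _ _ sum_list]) auto
    also have "\<dots> = (\<Sum>k \<in> {0..<n}. if j = k then xs ! k else 0)"
      by (simp only: interv_sum_list_conv_sum_set_nat set_upt)
    finally show ?thesis using j by simp
  qed
  then show ?thesis using assms cl by (intro nth_equalityI) auto
qed

section \<open>Dual bases and realization by lists over the base\<close>

context lr_alg
begin

lemma fgm_module: "fgm L M \<Longrightarrow> right_module (VA L) M"
  and fgm_lr_module: "fgm L M \<Longrightarrow> lr_module \<kappa> L M"
  by (auto simp: fgm_def intro: lr_moduleI lr_alg_axioms)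

lemma dual_basisD:
  assumes "dual_basis L M es"
  shows "(e, f) \<in> set es \<Longrightarrow> e \<in> carrier M" "(e, f) \<in> set es \<Longrightarrow> linear_form L M f"
    "(e, f) \<in> set es \<Longrightarrow> f \<in> mdual L M"
    "m \<in> carrier M \<Longrightarrow> lsum M [iotaA L (f m) \<odot>\<^bsub>M\<^esub> e. (e, f) \<leftarrow> es] = m"
  using assms unfolding dual_basis_def by (auto simp: mdual_iff)

text \<open>The coordinate forms give the embedding into a free module, the basis elements give the
  retraction.\<close>

lemma dual_basis_imp_fg:
  assumes M: "right_module (VA L) M" and es: "dual_basis L M es"
  shows "fg_projective (amod L M)"
proof -
  interpret M: lr_module \<kappa> L M by (intro lr_moduleI lr_alg_axioms M)
  let ?n = "length es"
  define i where "i = (\<lambda>m. map (\<lambda>(e, f). f m) es)"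
  define p where "p = (\<lambda>xs. lsum M (map2 (\<lambda>x (e, f). iotaA L x \<odot>\<^bsub>M\<^esub> e) xs es))"
  note es' = dual_basisD[OF es]
  have i: "i \<in> bimod_hom (amod L M) (free_mod ?n)"
    unfolding bimod_hom_def i_def using es'(2)
    by (auto intro!: nth_equalityI simp: case_prod_unfold linear_form_add linear_form_smult)
      (metis linear_form_add linear_form_smult nth_mem prod.collapse)+
  have p_closed: "p xs \<in> carrier M" if "length xs = length ds" "set ds \<subseteq> set es" for xs ds
    unfolding p_def using es'(1) by (intro M.M.lsum_map_closed) (auto dest!: set_zip_rightD intro!: M.M.act_closed)
  have cl: "lsum M (map2 (\<lambda>x (e, f). iotaA L x \<odot>\<^bsub>M\<^esub> e) xs ds) \<in> carrier M" if "set ds \<subseteq> set es" for xs ds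
    using that es'(1)
    by (intro M.M.lsum_map_closed) (auto dest!: set_zip_rightD intro!: M.M.act_closed)
  \<comment> \<open>Stated for every list \<open>ds\<close> with entries from \<open>es\<close>,
    because the induction shortens the list while the closure facts refer to the whole
    basis.\<close>
  have add: "lsum M (map2 (\<lambda>x (e, f). iotaA L x \<odot>\<^bsub>M\<^esub> e) (map2 (+) xs ys) ds) =
      lsum M (map2 (\<lambda>x (e, f). iotaA L x \<odot>\<^bsub>M\<^esub> e) xs ds) \<oplus>\<^bsub>M\<^esub> lsum M (map2 (\<lambda>x (e, f). iotaA L x \<odot>\<^bsub>M\<^esub> e) ys ds)"
    if "length xs = length ys" "length ys = length ds" "set ds \<subseteq> set es" for xs ys and ds
    using that
  proof (induction xs ys ds rule: list_induct3)
    case (Cons x xs y ys d ds)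
    obtain e f where d: "d = (e, f)" by (cases d)
    then have "e \<in> carrier M" using Cons.prems es'(1) by auto
    then show ?case using Cons cl[of ds] d
      by (simp add: iotaA_add M.M.act_add_left M.M.act_closed M.M.a_ac)
  qed simp
  have sm: "lsum M (map2 (\<lambda>x (e, f). iotaA L x \<odot>\<^bsub>M\<^esub> e) (map ((*) a) xs) ds) =
      iotaA L a \<odot>\<^bsub>M\<^esub> lsum M (map2 (\<lambda>x (e, f). iotaA L x \<odot>\<^bsub>M\<^esub> e) xs ds)"
    if "length xs = length ds" "set ds \<subseteq> set es" for xs ds a
    using that
  proof (induction xs ds rule: list_induct2)
    case Nil
    show ?case using M.amod.lact_zero[of a] by simp
  next
    case (Cons x xs d ds)
    obtain e f where d: "d = (e, f)" by (cases d)
    then have "e \<in> carrier M" using Cons.prems es'(1) by auto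
    then show ?case using Cons cl[of ds] d M.act_A[of e x a]
      by (simp add: M.M.act_add_right M.M.act_closed mult.commute)
  qed
  have p: "p \<in> bimod_hom (free_mod ?n) (amod L M)"
    unfolding bimod_hom_def using add sm cl by (auto simp: p_def)
  have "p (i m) = m" if "m \<in> carrier M" for m
  proof -
    have "p (i m) = lsum M [iotaA L (f m) \<odot>\<^bsub>M\<^esub> e. (e, f) \<leftarrow> es]"
      unfolding p_def i_def by (intro arg_cong[of _ _ "lsum M"]) (auto intro!: nth_equalityI simp: case_prod_unfold)
    then show ?thesis using es'(4)[OF that] by simp
  qed
  then show ?thesis unfolding fg_projective_def using i p by auto
qed

lemma fg_imp_dual_basis:
  assumes "fgm L M"
  shows "\<exists>es. dual_basis L M es"
proof -
  interpret M: lr_module \<kappa> L M by (rule fgm_lr_module[OF assms])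
  obtain n i p where i: "i \<in> bimod_hom (amod L M) (free_mod n)" and p: "p \<in> bimod_hom (free_mod n) (amod L M)"
    and pi: "\<And>m. m \<in> carrier M \<Longrightarrow> p (i m) = m"
    using assms unfolding fgm_def fg_projective_def by auto
  define u where "u = (\<lambda>k. map (\<lambda>j. if j = k then 1 else 0 :: 'a) [0..<n])"
  \<comment> \<open>The images of the unit vectors under the retraction, paired with the coordinates
    of the embedding.\<close>
  let ?es = "[(p (u k), restrict (\<lambda>m. i m ! k) (carrier M)). k \<leftarrow> [0..<n]]"
  have len: "length (i m) = n" if "m \<in> carrier M" for m using i that by (auto simp: bimod_hom_def)
  have pu: "p (u k) \<in> carrier M" for k using p by (auto simp: bimod_hom_def u_def)
  have "(\<lambda>m\<in>carrier M. i m ! k) \<in> mdual L M" if "k < n" for k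
    unfolding mdual_iff using i that
    by (auto simp: linear_form_def bimod_hom_def Pi_def M.M.act_closed)
  moreover have "m = lsum M [iotaA L (f m) \<odot>\<^bsub>M\<^esub> e. (e, f) \<leftarrow> ?es]" if m: "m \<in> carrier M" for m
  proof -
    have pa: "additive (free_mod n) M p" using p by (auto simp: bimod_hom_def additive_def)
    have ps: "p (map ((*) a) xs) = iotaA L a \<odot>\<^bsub>M\<^esub> p xs" if "length xs = n" for a xs
      using p that by (auto simp: bimod_hom_def)
    have "m = p (i m)" using pi m by simp
    also have "\<dots> = p (lsum (free_mod n) [map ((*) (i m ! k)) (u k). k \<leftarrow> [0..<n]])"
      using free_mod_basis[OF len[OF m]] by (simp add: u_def)
    also have "\<dots> = lsum M [p (map ((*) (i m ! k)) (u k)). k \<leftarrow> [0..<n]]"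
      by (rule additive_lsum_map[OF free_mod_abelian_group M.M.abelian_group_axioms pa]) (simp add: u_def)
    also have "\<dots> = lsum M [iotaA L (i m ! k) \<odot>\<^bsub>M\<^esub> p (u k). k \<leftarrow> [0..<n]]"
      by (intro lsum_cong ps) (simp add: u_def)
    finally show ?thesis using m by (simp add: o_def)
  qed
  ultimately have "dual_basis L M ?es" unfolding dual_basis_def using pu by auto
  then show ?thesis by blast
qed

lemma fgmI: "right_module (VA L) M \<Longrightarrow> dual_basis L M es \<Longrightarrow> fgm L M"
  using dual_basis_imp_fg by (simp add: fgm_def)

lemma fgm_basis:
  assumes "fgm L M" obtains es where "dual_basis L M es"
  using fg_imp_dual_basis[OF assms] by blast

lemma some_dual_basis: "fgm L M \<Longrightarrow> dual_basis L M (SOME es. dual_basis L M es)"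
  by (rule someI_ex) (rule fg_imp_dual_basis)

lemma rmod_hom_inv:
  assumes "right_module (VA L) M" "h \<in> rmod_hom (VA L) M N" "bij_betw h (carrier M) (carrier N)"
  shows "inv_into (carrier M) h \<in> rmod_hom (VA L) N M"
proof -
  interpret M: right_module "VA L" M by fact
  let ?k = "inv_into (carrier M) h"
  have k: "?k n \<in> carrier M" "h (?k n) = n" if "n \<in> carrier N" for n
    using assms(3) that by (auto simp: bij_betw_def f_inv_into_f inv_into_into)
  have kh: "?k (h m) = m" if "m \<in> carrier M" for m
    using assms(3) that by (auto simp: bij_betw_def)
  have "?k (n \<oplus>\<^bsub>N\<^esub> n') = ?k n \<oplus>\<^bsub>M\<^esub> ?k n'" if "n \<in> carrier N" "n' \<in> carrier N" for n n'
  proof -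
    have "h (?k n \<oplus>\<^bsub>M\<^esub> ?k n') = n \<oplus>\<^bsub>N\<^esub> n'"
      using k that additive_add[OF rmod_hom_additive[OF assms(2)]] by simp
    then show ?thesis using kh[of "?k n \<oplus>\<^bsub>M\<^esub> ?k n'"] k that by simp
  qed
  moreover have "?k (u \<odot>\<^bsub>N\<^esub> n) = u \<odot>\<^bsub>M\<^esub> ?k n" if "n \<in> carrier N" "u \<in> carrier (VA L)" for n u
  proof -
    have "h (u \<odot>\<^bsub>M\<^esub> ?k n) = u \<odot>\<^bsub>N\<^esub> n" using k that rmod_hom_act[OF assms(2)] by simp
    then show ?thesis using kh[of "u \<odot>\<^bsub>M\<^esub> ?k n"] k that M.act_closed by simp
  qed
  ultimately show ?thesis using k by (auto simp: rmod_hom_def)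
qed

lemma dual_basis_iso:
  assumes M: "right_module (VA L) M" and h: "h \<in> rmod_hom (VA L) M N" "bij_betw h (carrier M) (carrier N)"
    and N: "right_module (VA L) N" and es: "dual_basis L M es"
  shows "dual_basis L N [(h e, \<lambda>n\<in>carrier N. f (inv_into (carrier M) h n)). (e, f) \<leftarrow> es]"
proof -
  interpret M: lr_module \<kappa> L M by (intro lr_moduleI lr_alg_axioms M)
  interpret N: lr_module \<kappa> L N by (intro lr_moduleI lr_alg_axioms N)
  let ?k = "inv_into (carrier M) h"
  note k = rmod_hom_inv[OF M h]
  have hk: "h (?k n) = n" if "n \<in> carrier N" for n
    using h(2) that by (auto simp: bij_betw_def f_inv_into_f)
  note es' = dual_basisD[OF es]
  have 1: "h e \<in> carrier N \<and> (\<lambda>n\<in>carrier N. f (?k n)) \<in> mdual L N" if "(e, f) \<in> set es" for e f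
    using linear_form_hom[OF k es'(2)[OF that]] es'(1)[OF that] rmod_hom_closed[OF h(1)]
    by (auto simp: mdual_iff linear_form_def N.M.act_closed)
  have 2: "n = lsum N [iotaA L (f (?k n)) \<odot>\<^bsub>N\<^esub> h e. (e, f) \<leftarrow> es]" if n: "n \<in> carrier N" for n
  proof -
    have kn: "?k n \<in> carrier M" by (rule rmod_hom_closed[OF k n])
    have "n = h (lsum M [iotaA L (f (?k n)) \<odot>\<^bsub>M\<^esub> e. (e, f) \<leftarrow> es])" using es'(4)[OF kn] hk[OF n] by simp
    also have "\<dots> = lsum N [h (iotaA L (f (?k n)) \<odot>\<^bsub>M\<^esub> e). (e, f) \<leftarrow> es]"
      using es'(1)
      by (subst additive_lsum_map[OF M.M.abelian_group_axioms N.M.abelian_group_axioms rmod_hom_additive[OF h(1)]])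
        (auto simp: case_prod_unfold M.M.act_closed)
    also have "\<dots> = lsum N [iotaA L (f (?k n)) \<odot>\<^bsub>N\<^esub> h e. (e, f) \<leftarrow> es]"
      using es'(1) by (intro lsum_cong) (auto simp: rmod_hom_act[OF h(1)])
    finally show ?thesis .
  qed
  show ?thesis
    unfolding dual_basis_def using 1 2 by (auto simp: o_def case_prod_unfold)
qed

text \<open>The coordinates with respect to a dual basis embed the module into lists over
  \<open>A\<close>, and its structure is carried over to the image. Hence modules with carrier in
  \<open>'a list\<close> represent the whole category.\<close>

lemma realization_ex:
  assumes "fgm L M"
  shows "\<exists>(R :: ('a, 'l) rmod) h. R \<in> objects L \<and> h \<in> rmod_hom (VA L) M R \<and> bij_betw h (carrier M) (carrier R)"
proof -
  interpret M: lr_module \<kappa> L M by (rule fgm_lr_module[OF assms])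
  obtain es where es: "dual_basis L M es" using fgm_basis[OF assms] .
  define h where "h = (\<lambda>m. map (\<lambda>(e, f). f m) es)"
  let ?k = "inv_into (carrier M) h"
  have inj: "inj_on h (carrier M)"
  proof (rule inj_onI)
    fix m n assume mn: "m \<in> carrier M" "n \<in> carrier M" "h m = h n"
    then have "[iotaA L (f m) \<odot>\<^bsub>M\<^esub> e. (e, f) \<leftarrow> es] = [iotaA L (f n) \<odot>\<^bsub>M\<^esub> e. (e, f) \<leftarrow> es]"
      by (auto simp: h_def)
    then show "m = n" using dual_basisD(4)[OF es] mn(1,2) by metis
  qed
  define R :: "('a, 'l) rmod" where "R = \<lparr>carrier = h ` carrier M, mult = undefined, one = undefined,
    zero = h \<zero>\<^bsub>M\<^esub>, add = (\<lambda>x y. h (?k x \<oplus>\<^bsub>M\<^esub> ?k y)), smult = (\<lambda>u x. h (u \<odot>\<^bsub>M\<^esub> ?k x))\<rparr>"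
  have R: "carrier R = h ` carrier M" "\<zero>\<^bsub>R\<^esub> = h \<zero>\<^bsub>M\<^esub>" "x \<oplus>\<^bsub>R\<^esub> y = h (?k x \<oplus>\<^bsub>M\<^esub> ?k y)"
    "u \<odot>\<^bsub>R\<^esub> x = h (u \<odot>\<^bsub>M\<^esub> ?k x)" for x y u
    by (simp_all add: R_def)
  have kh: "?k (h m) = m" if "m \<in> carrier M" for m using inj that by simp
  have ag: "abelian_group R"
  proof (rule abelian_groupI)
    fix x assume "x \<in> carrier R"
    then obtain m where m: "m \<in> carrier M" "x = h m" by (auto simp: R)
    then show "\<exists>y\<in>carrier R. y \<oplus>\<^bsub>R\<^esub> x = \<zero>\<^bsub>R\<^esub>"
      by (intro bexI[of _ "h (\<ominus>\<^bsub>M\<^esub> m)"]) (auto simp: R kh M.M.l_neg)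
  qed (auto simp: R kh M.M.a_ac)
  have mod: "right_module (VA L) R"
    by (intro right_module.intro V.ring_axioms ag right_module_axioms.intro)
      (auto simp: R kh M.M.act_closed M.M.act_add_left M.M.act_add_right M.M.act_mult M.M.act_one)
  have bij: "bij_betw h (carrier M) (carrier R)" using inj by (simp add: bij_betw_def R)
  have hom: "h \<in> rmod_hom (VA L) M R" by (auto simp: rmod_hom_def R kh)
  have "R \<in> objects L"
    unfolding objects_iff by (rule fgmI[OF mod dual_basis_iso[OF M.M.right_module_axioms hom bij mod es]])
  then show ?thesis using hom bij by blast
qed

lemma realization:
  assumes "fgm L M" "realization L M = (R, h)"
  shows "R \<in> objects L" "h \<in> rmod_hom (VA L) M R" "bij_betw h (carrier M) (carrier R)"
proof -
  let ?P = "\<lambda>(R, h). R \<in> objects L \<and> h \<in> rmod_hom (VA L) M R \<and> bij_betw h (carrier M) (carrier R)"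
  have "\<exists>x. ?P x" using realization_ex[OF assms(1)] by auto
  then have "?P (realization L M)" unfolding realization_def by (rule someI_ex)
  then show "R \<in> objects L" "h \<in> rmod_hom (VA L) M R" "bij_betw h (carrier M) (carrier R)"
    using assms(2) by simp_all
qed

end

section \<open>The finite dual as an \<open>A\<close>-bimodule\<close>

inductive cbase :: "('a::{comm_ring,comm_monoid_mult}, 'l) lr_algebra \<Rightarrow>
    ('a, 'l) coeff list \<Rightarrow> ('a, 'l) coeff list \<Rightarrow> bool" for L :: "('a, 'l) lr_algebra" where
  "P \<in> objects L \<Longrightarrow> f \<in> mdual L P \<Longrightarrow> g \<in> mdual L P \<Longrightarrow> p \<in> carrier P \<Longrightarrow>
    cbase L [(P, \<lambda>m\<in>carrier P. f m + g m, p)] [(P, f, p), (P, g, p)]"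
| "P \<in> objects L \<Longrightarrow> f \<in> mdual L P \<Longrightarrow> p \<in> carrier P \<Longrightarrow> q \<in> carrier P \<Longrightarrow>
    cbase L [(P, f, p \<oplus>\<^bsub>P\<^esub> q)] [(P, f, p), (P, f, q)]"
| "P \<in> objects L \<Longrightarrow> p \<in> carrier P \<Longrightarrow> cbase L [(P, \<lambda>m\<in>carrier P. 0, p)] []"
| "P \<in> objects L \<Longrightarrow> f \<in> mdual L P \<Longrightarrow> cbase L [(P, f, \<zero>\<^bsub>P\<^esub>)] []"
| "P \<in> objects L \<Longrightarrow> Q \<in> objects L \<Longrightarrow> h \<in> rmod_hom (VA L) P Q \<Longrightarrow> f \<in> mdual L Q \<Longrightarrow> p \<in> carrier P \<Longrightarrow>
    cbase L [(Q, f, h p)] [(P, \<lambda>m\<in>carrier P. f (h m), p)]"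

lemma ceq_peq: "ceq L = peq (coeffs L) (cbase L)"
proof (intro ext iffI)
  fix zs ws assume "ceq L zs ws"
  then show "peq (coeffs L) (cbase L) zs ws"
    by (induction rule: ceq.induct) (blast intro: peq.intros cbase.intros)+
next
  fix zs ws assume "peq (coeffs L) (cbase L) zs ws"
  then show "ceq L zs ws"
  proof (induction rule: peq.induct)
    case (peq_base zs ws)
    then show ?case by cases (auto intro: ceq.intros)
  qed (blast intro: ceq.intros)+
qed

lemma ccls_pcls: "ccls L = pcls (coeffs L) (cbase L)"
  by (rule ext) (simp add: ccls_def pcls_def ceq_peq)

lemma finite_dual_simps:
  "carrier (finite_dual L) = ccls L ` {zs. set zs \<subseteq> coeffs L}" "\<zero>\<^bsub>finite_dual L\<^esub> = ccls L []"
  "X \<oplus>\<^bsub>finite_dual L\<^esub> Y = (\<Union>x\<in>X. \<Union>y\<in>Y. ccls L (x @ y))"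
  "X \<otimes>\<^bsub>finite_dual L\<^esub> Y = (\<Union>x\<in>X. \<Union>y\<in>Y. ccls L [coeff_mult L g h. g \<leftarrow> x, h \<leftarrow> y])"
  "\<one>\<^bsub>finite_dual L\<^esub> = fdual_unit L 1 1"
  "lact (finite_dual L) a X = (\<Union>x\<in>X. ccls L [(P, \<lambda>m\<in>carrier P. a * f m, p). (P, f, p) \<leftarrow> x])"
  "ract (finite_dual L) X a = (\<Union>x\<in>X. ccls L [(P, f, iotaA L a \<odot>\<^bsub>P\<^esub> p). (P, f, p) \<leftarrow> x])"
  "counit (finite_dual L) X = (\<Sum>(P, f, p) \<leftarrow> rep X. f p)"
  "src (finite_dual L) a = fdual_unit L a 1" "tgt (finite_dual L) a = fdual_unit L 1 a"
  by (simp_all add: finite_dual_def Let_def)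

text \<open>The element of the finite dual given by \<open>f \<otimes> m\<close> when the carrier of
  \<open>M\<close> has any type; on \<open>objects\<close> it is the plain class, by
  \<open>cc_object\<close>.\<close>

definition cc :: "('a::{comm_ring,comm_monoid_mult}, 'l) lr_algebra \<Rightarrow> (('a, 'l) env, 'm) module \<Rightarrow>
    ('m \<Rightarrow> 'a) \<Rightarrow> 'm \<Rightarrow> ('a, 'l) fdual" where
  "cc L M f m = ccls L [transport L M f m]"

context lr_alg
begin

abbreviation (input) "U \<equiv> finite_dual L"

lemma linear_form_restrict:
  assumes "right_module (VA L) M"
  shows "linear_form L M (restrict f (carrier M)) \<longleftrightarrow> linear_form L M f"
proof -
  interpret M: right_module "VA L" M by fact
  show ?thesis by (simp add: linear_form_def M.act_closed)
qed

lemma linear_form_cong: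
  assumes "right_module (VA L) M" "\<And>m. m \<in> carrier M \<Longrightarrow> f m = g m"
  shows "linear_form L M f \<longleftrightarrow> linear_form L M g"
proof -
  interpret M: right_module "VA L" M by fact
  show ?thesis by (simp add: linear_form_def M.act_closed assms(2))
qed

lemma mdual_restrict: "right_module (VA L) M \<Longrightarrow> restrict f (carrier M) \<in> mdual L M \<longleftrightarrow> linear_form L M f"
  by (simp add: mdual_iff linear_form_restrict)

lemma linear_form_plus: "linear_form L M f \<Longrightarrow> linear_form L M g \<Longrightarrow> linear_form L M (\<lambda>m. f m + g m)"
  and linear_form_scale: "linear_form L M f \<Longrightarrow> linear_form L M (\<lambda>m. a * f m)"
  and linear_form_zero: "linear_form L M (\<lambda>m. 0)"
  by (auto simp: linear_form_def algebra_simps)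

lemma coeffs_iff: "(P, f, p) \<in> coeffs L \<longleftrightarrow> fgm L P \<and> f \<in> mdual L P \<and> p \<in> carrier P"
  by (simp add: coeffs_def objects_iff)

lemma finite_dual_presented: "presented_group (coeffs L) (cbase L) U"
proof
  fix l r assume "cbase L l r"
  then show "set l \<subseteq> coeffs L \<and> set r \<subseteq> coeffs L"
  proof cases
    case (1 P f g p)
    then interpret P: lr_module \<kappa> L P by (simp add: objects_iff fgm_lr_module)
    show ?thesis using 1
      by (simp add: coeffs_iff objects_iff mdual_restrict P.M.right_module_axioms)
        (simp add: mdual_iff linear_form_plus)
  next
    case (2 P f p q)
    then interpret P: lr_module \<kappa> L P by (simp add: objects_iff fgm_lr_module)
    show ?thesis using 2 by (simp add: coeffs_iff objects_iff)
  next
    case (3 P p)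
    then interpret P: lr_module \<kappa> L P by (simp add: objects_iff fgm_lr_module)
    show ?thesis using 3
      by (simp add: coeffs_iff objects_iff mdual_restrict P.M.right_module_axioms linear_form_zero)
  next
    case (4 P f)
    then interpret P: lr_module \<kappa> L P by (simp add: objects_iff fgm_lr_module)
    show ?thesis using 4 by (simp add: coeffs_iff objects_iff)
  next
    case (5 P Q h f p)
    then interpret P: lr_module \<kappa> L P by (simp add: objects_iff fgm_lr_module)
    show ?thesis using 5 rmod_hom_closed[of h P Q p] linear_form_hom[of h P Q f]
      by (simp add: coeffs_iff objects_iff mdual_restrict P.M.right_module_axioms) (simp add: mdual_iff)
  qed
next
  fix g assume "g \<in> coeffs L"
  then obtain P f p where g: "g = (P, f, p)" "P \<in> objects L" "f \<in> mdual L P" "p \<in> carrier P"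
    by (auto simp: coeffs_def)
  interpret P: lr_module \<kappa> L P using g by (simp add: objects_iff fgm_lr_module)
  have "peq (coeffs L) (cbase L) [(P, f, p \<oplus>\<^bsub>P\<^esub> \<ominus>\<^bsub>P\<^esub> p)] [(P, f, p), (P, f, \<ominus>\<^bsub>P\<^esub> p)]"
    using g by (intro peq_base cbase.intros) auto
  moreover have "peq (coeffs L) (cbase L) [(P, f, p \<oplus>\<^bsub>P\<^esub> \<ominus>\<^bsub>P\<^esub> p)] []"
    using g by (auto simp: P.M.r_neg intro: peq_base cbase.intros)
  ultimately show "\<exists>h\<in>coeffs L. peq (coeffs L) (cbase L) [g, h] []"
    using g by (intro bexI[of _ "(P, f, \<ominus>\<^bsub>P\<^esub> p)"]) (auto simp: coeffs_iff objects_iff intro: peq_trans peq_sym)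
qed (simp_all add: finite_dual_simps ccls_pcls)

sublocale U: presented_group "coeffs L" "cbase L" "finite_dual L"
  by (rule finite_dual_presented)

section \<open>Classes of coefficients for modules of any carrier type\<close>

lemma transport_coeffs:
  assumes "fgm L M" "linear_form L M f" "m \<in> carrier M"
  shows "transport L M f m \<in> coeffs L"
proof -
  obtain R h where r: "realization L M = (R, h)" by (cases "realization L M")
  note R = realization[OF assms(1) r]
  have "linear_form L R (\<lambda>r. f (inv_into (carrier M) h r))"
    by (rule linear_form_hom[OF rmod_hom_inv[OF fgm_module[OF assms(1)] R(2,3)] assms(2)])
  then show ?thesis
    using R rmod_hom_closed[OF R(2) assms(3)]
    by (simp add: transport_def r coeffs_iff objects_iff mdual_restrict fgm_module)
qed

lemma cc_closed: "fgm L M \<Longrightarrow> linear_form L M f \<Longrightarrow> m \<in> carrier M \<Longrightarrow> cc L M f m \<in> carrier U"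
  unfolding cc_def ccls_pcls using transport_coeffs by (intro U.pcls_closed) simp

lemma ccls_eqI: "ceq L zs ws \<Longrightarrow> ccls L zs = ccls L ws"
  unfolding ccls_pcls ceq_peq by (rule U.pcls_eqI)

text \<open>The generators of the subbimodule \<open>J\<close>, for modules of any type: conjugating
  \<open>h\<close> with the two realizations gives a morphism between objects, to which
  \<open>ceq_hom\<close> applies. Most identities in the finite dual are instances of this
  relation.\<close>

lemma cc_hom:
  assumes M: "fgm L M" and N: "fgm L N" and h: "h \<in> rmod_hom (VA L) M N"
    and f: "linear_form L N f" and m: "m \<in> carrier M"
  shows "cc L N f (h m) = cc L M (\<lambda>x. f (h x)) m"
proof -
  obtain R i where r: "realization L M = (R, i)" by (cases "realization L M")
  obtain S j where s: "realization L N = (S, j)" by (cases "realization L N")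
  note R = realization[OF M r] and S = realization[OF N s]
  let ?i' = "inv_into (carrier M) i" and ?j' = "inv_into (carrier N) j"
  note i' = rmod_hom_inv[OF fgm_module[OF M] R(2,3)] and j' = rmod_hom_inv[OF fgm_module[OF N] S(2,3)]
  have ii: "?i' (i x) = x" if "x \<in> carrier M" for x using R(3) that by (simp add: bij_betw_def)
  have jj: "?j' (j x) = x" if "x \<in> carrier N" for x using S(3) that by (simp add: bij_betw_def)
  let ?k = "\<lambda>r. j (h (?i' r))"
  have k: "?k \<in> rmod_hom (VA L) R S"
    using i' h S(2) by (auto simp: rmod_hom_def Pi_def)
  have F: "(\<lambda>s\<in>carrier S. f (?j' s)) \<in> mdual L S"
    using linear_form_hom[OF j' f] S(1) by (simp add: mdual_restrict objects_iff fgm_module)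
  have "ceq L [(S, \<lambda>s\<in>carrier S. f (?j' s), ?k (i m))]
      [(R, \<lambda>r\<in>carrier R. (\<lambda>s\<in>carrier S. f (?j' s)) (?k r), i m)]"
    using R(1) S(1) k F rmod_hom_closed[OF R(2) m] by (rule ceq_hom)
  moreover have "(\<lambda>r\<in>carrier R. (\<lambda>s\<in>carrier S. f (?j' s)) (?k r)) = (\<lambda>r\<in>carrier R. f (h (?i' r)))"
    using rmod_hom_closed[OF h rmod_hom_closed[OF i']] rmod_hom_closed[OF S(2)] by (auto simp: jj)
  ultimately have "ceq L [(S, \<lambda>s\<in>carrier S. f (?j' s), j (h m))] [(R, \<lambda>r\<in>carrier R. f (h (?i' r)), i m)]"
    using m by (simp add: ii)
  then show ?thesis by (simp add: cc_def transport_def r s ccls_eqI)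
qed

lemma cc_cong:
  assumes "fgm L M" "\<And>x. x \<in> carrier M \<Longrightarrow> f x = g x"
  shows "cc L M f m = cc L M g m"
proof -
  obtain R h where r: "realization L M = (R, h)" by (cases "realization L M")
  note R = realization[OF assms(1) r]
  have "(\<lambda>r\<in>carrier R. f (inv_into (carrier M) h r)) = (\<lambda>r\<in>carrier R. g (inv_into (carrier M) h r))"
    using assms(2) rmod_hom_closed[OF rmod_hom_inv[OF fgm_module[OF assms(1)] R(2,3)]] by auto
  then show ?thesis by (simp add: cc_def transport_def r)
qed

text \<open>The realization of an object is itself a morphism of objects, so \<open>ceq_hom\<close>
  identifies the transported triple with the original one.\<close>

lemma cc_object:
  assumes P: "(P, f, p) \<in> coeffs L"
  shows "cc L P f p = ccls L [(P, f, p)]"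
proof -
  obtain R h where r: "realization L P = (R, h)" by (cases "realization L P")
  have fg: "fgm L P" and f: "f \<in> mdual L P" and p: "p \<in> carrier P" using P by (auto simp: coeffs_iff)
  note R = realization[OF fg r]
  let ?k = "inv_into (carrier P) h"
  have kh: "?k (h x) = x" if "x \<in> carrier P" for x using R(3) that by (simp add: bij_betw_def)
  have F: "(\<lambda>s\<in>carrier R. f (?k s)) \<in> mdual L R"
    using linear_form_hom[OF rmod_hom_inv[OF fgm_module[OF fg] R(2,3)], of f] f[unfolded mdual_iff] R(1)
    by (simp add: mdual_restrict objects_iff fgm_module)
  have "ceq L [(R, \<lambda>s\<in>carrier R. f (?k s), h p)] [(P, \<lambda>x\<in>carrier P. (\<lambda>s\<in>carrier R. f (?k s)) (h x), p)]"
    using fg[folded objects_iff] R(1,2) F p by (rule ceq_hom)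
  moreover have "(\<lambda>x\<in>carrier P. (\<lambda>s\<in>carrier R. f (?k s)) (h x)) = f"
    using f rmod_hom_closed[OF R(2)]
    by (intro extensionalityI[of _ "carrier P"]) (auto simp: kh mdual_iff)
  ultimately show ?thesis by (simp add: cc_def transport_def r ccls_eqI)
qed

lemma cc_restrict: "fgm L M \<Longrightarrow> cc L M (restrict f (carrier M)) m = cc L M f m"
  by (rule cc_cong) auto

lemma coeffs_restrict:
  "fgm L P \<Longrightarrow> linear_form L P f \<Longrightarrow> p \<in> carrier P \<Longrightarrow> (P, restrict f (carrier P), p) \<in> coeffs L"
  by (simp add: coeffs_iff mdual_restrict fgm_module)

lemma ccls_restrict:
  "fgm L P \<Longrightarrow> linear_form L P f \<Longrightarrow> p \<in> carrier P \<Longrightarrow> ccls L [(P, restrict f (carrier P), p)] = cc L P f p"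
  using cc_object[OF coeffs_restrict] by (simp add: cc_restrict)

text \<open>Additive maps are compared on classes of plain linear forms, so the extensionality of
  stored forms disappears from later arguments.\<close>

lemma fdual_ext:
  assumes "additive U Y h" "additive U Y k" "abelian_group Y" "X \<in> carrier U"
    and "\<And>(P :: ('a, 'l) rmod) f p. \<lbrakk>fgm L P; linear_form L P f; p \<in> carrier P\<rbrakk> \<Longrightarrow> h (cc L P f p) = k (cc L P f p)"
  shows "h X = k X"
proof (rule U.additive_ext[OF assms(1-4)])
  fix g assume "g \<in> coeffs L"
  then obtain P f p where g: "g = (P, f, p)" "(P, f, p) \<in> coeffs L" by (cases g) auto
  then have "h (cc L P f p) = k (cc L P f p)" by (intro assms(5)) (auto simp: coeffs_iff mdual_iff)
  then show "h (pcls (coeffs L) (cbase L) [g]) = k (pcls (coeffs L) (cbase L) [g])"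
    using cc_object[OF g(2)] g(1) by (simp only: ccls_pcls)
qed

text \<open>To define an additive map on the finite dual, it suffices to give its values on the classes
  of \<open>f \<otimes> p\<close> for arbitrary modules, subject to additivity and naturality.\<close>

definition natural_coeff :: "('z, 'v) ring_scheme \<Rightarrow> (('a, 'l) rmod \<Rightarrow> ('a list \<Rightarrow> 'a) \<Rightarrow> 'a list \<Rightarrow> 'z) \<Rightarrow> bool" where
  "natural_coeff Y \<phi> \<longleftrightarrow> abelian_group Y \<and>
     (\<forall>P f p. fgm L P \<longrightarrow> linear_form L P f \<longrightarrow> p \<in> carrier P \<longrightarrow> \<phi> P f p \<in> carrier Y) \<and>
     (\<forall>P f g p. fgm L P \<longrightarrow> linear_form L P f \<longrightarrow> linear_form L P g \<longrightarrow> p \<in> carrier P \<longrightarrow>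
        \<phi> P (\<lambda>m. f m + g m) p = \<phi> P f p \<oplus>\<^bsub>Y\<^esub> \<phi> P g p) \<and>
     (\<forall>P f p q. fgm L P \<longrightarrow> linear_form L P f \<longrightarrow> p \<in> carrier P \<longrightarrow> q \<in> carrier P \<longrightarrow>
        \<phi> P f (p \<oplus>\<^bsub>P\<^esub> q) = \<phi> P f p \<oplus>\<^bsub>Y\<^esub> \<phi> P f q) \<and>
     (\<forall>P Q h f p. fgm L P \<longrightarrow> fgm L Q \<longrightarrow> h \<in> rmod_hom (VA L) P Q \<longrightarrow> linear_form L Q f \<longrightarrow> p \<in> carrier P \<longrightarrow>
        \<phi> Q f (h p) = \<phi> P (\<lambda>m. f (h m)) p) \<and>
     (\<forall>P f g p. fgm L P \<longrightarrow> linear_form L P f \<longrightarrow> p \<in> carrier P \<longrightarrow> (\<forall>m\<in>carrier P. f m = g m) \<longrightarrow> \<phi> P f p = \<phi> P g p)"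

lemma natural_coeffD:
  assumes "natural_coeff Y \<phi>" "fgm L P" "linear_form L P f" "p \<in> carrier P"
  shows "\<phi> P f p \<in> carrier Y"
    and "linear_form L P g \<Longrightarrow> \<phi> P (\<lambda>m. f m + g m) p = \<phi> P f p \<oplus>\<^bsub>Y\<^esub> \<phi> P g p"
    and "q \<in> carrier P \<Longrightarrow> \<phi> P f (p \<oplus>\<^bsub>P\<^esub> q) = \<phi> P f p \<oplus>\<^bsub>Y\<^esub> \<phi> P f q"
    and "\<lbrakk>fgm L Q; h \<in> rmod_hom (VA L) Q P; x \<in> carrier Q\<rbrakk> \<Longrightarrow> \<phi> P f (h x) = \<phi> Q (\<lambda>m. f (h m)) x"
    and "(\<And>m. m \<in> carrier P \<Longrightarrow> f m = g m) \<Longrightarrow> \<phi> P f p = \<phi> P g p"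
proof -
  note N = assms(1)[unfolded natural_coeff_def, THEN conjunct2]
  note N' = N[THEN conjunct2] N[THEN conjunct2, THEN conjunct2] N[THEN conjunct2, THEN conjunct2, THEN conjunct2]
  show "\<phi> P f p \<in> carrier Y" by (rule N[THEN conjunct1, rule_format, OF assms(2-4)])
  show "linear_form L P g \<Longrightarrow> \<phi> P (\<lambda>m. f m + g m) p = \<phi> P f p \<oplus>\<^bsub>Y\<^esub> \<phi> P g p"
    by (rule N'(1)[THEN conjunct1, rule_format, OF assms(2,3) _ assms(4)])
  show "q \<in> carrier P \<Longrightarrow> \<phi> P f (p \<oplus>\<^bsub>P\<^esub> q) = \<phi> P f p \<oplus>\<^bsub>Y\<^esub> \<phi> P f q"
    by (rule N'(2)[THEN conjunct1, rule_format, OF assms(2-4)])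
  show "\<lbrakk>fgm L Q; h \<in> rmod_hom (VA L) Q P; x \<in> carrier Q\<rbrakk> \<Longrightarrow> \<phi> P f (h x) = \<phi> Q (\<lambda>m. f (h m)) x"
    by (rule N'(3)[THEN conjunct1, rule_format, OF _ assms(2) _ assms(3)])
  show "(\<And>m. m \<in> carrier P \<Longrightarrow> f m = g m) \<Longrightarrow> \<phi> P f p = \<phi> P g p"
    by (rule N'(3)[THEN conjunct2, rule_format, OF assms(2-4)])
qed

lemma natural_restrict:
  assumes "natural_coeff Y \<phi>" "fgm L P" "linear_form L P f" "p \<in> carrier P"
  shows "\<phi> P (restrict f (carrier P)) p = \<phi> P f p"
  by (rule natural_coeffD(5)[OF assms, symmetric]) simp

lemma natural_compat:
  assumes "natural_coeff Y \<phi>"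
  shows "compat (coeffs L) (cbase L) Y (\<lambda>(P, f, p). \<phi> P f p)"
proof -
  note N = assms[unfolded natural_coeff_def]
  interpret Y: abelian_group Y using N by blast
  have cl: "\<phi> P f p \<in> carrier Y" if "fgm L P" "linear_form L P f" "p \<in> carrier P" for P f p
    using N that by blast
  note restr = natural_restrict[OF assms]
  have "lsum Y (map (\<lambda>(P, f, p). \<phi> P f p) l) = lsum Y (map (\<lambda>(P, f, p). \<phi> P f p) r)" if "cbase L l r" for l r
    using that
  proof cases
    case (1 P f g p)
    then have "fgm L P" "linear_form L P f" "linear_form L P g" by (auto simp: objects_iff mdual_iff)
    then show ?thesis using 1 N by (simp add: restr linear_form_plus cl)
  next
    case (2 P f p q)
    then have P: "fgm L P" "linear_form L P f" by (auto simp: objects_iff mdual_iff)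
    then show ?thesis using 2 N by (simp add: cl)
  next
    case (3 P p)
    have P: "fgm L P" using 3 by (simp add: objects_iff)
    \<comment> \<open>Additivity at \<open>0 + 0\<close> forces the value zero; the same argument
      serves the zero vector.\<close>
    have "\<phi> P (\<lambda>m. 0) p \<oplus>\<^bsub>Y\<^esub> \<phi> P (\<lambda>m. 0) p = \<phi> P (\<lambda>m. 0 + 0) p"
      by (rule natural_coeffD(2)[OF assms P linear_form_zero 3(4) linear_form_zero, symmetric])
    then have "\<phi> P (\<lambda>m. 0) p \<oplus>\<^bsub>Y\<^esub> \<phi> P (\<lambda>m. 0) p = \<phi> P (\<lambda>m. 0) p" by simp
    then have "\<phi> P (\<lambda>m. 0) p = \<zero>\<^bsub>Y\<^esub>"
      using cl[OF P linear_form_zero 3(4)] Y.add.l_cancel_one' by metis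
    then show ?thesis using 3 P by (simp add: restr linear_form_zero)
  next
    case (4 P f)
    then have P: "fgm L P" "linear_form L P f" by (auto simp: objects_iff mdual_iff)
    then interpret P: lr_module \<kappa> L P by (simp add: fgm_lr_module)
    have "\<phi> P f \<zero>\<^bsub>P\<^esub> \<oplus>\<^bsub>Y\<^esub> \<phi> P f \<zero>\<^bsub>P\<^esub> = \<phi> P f (\<zero>\<^bsub>P\<^esub> \<oplus>\<^bsub>P\<^esub> \<zero>\<^bsub>P\<^esub>)"
      using N P P.M.zero_closed by metis
    then have "\<phi> P f \<zero>\<^bsub>P\<^esub> \<oplus>\<^bsub>Y\<^esub> \<phi> P f \<zero>\<^bsub>P\<^esub> = \<phi> P f \<zero>\<^bsub>P\<^esub>" by simp
    then have "\<phi> P f \<zero>\<^bsub>P\<^esub> = \<zero>\<^bsub>Y\<^esub>"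
      using cl[OF P P.M.zero_closed] Y.add.l_cancel_one' by metis
    then show ?thesis using 4 by simp
  next
    case (5 P Q h f p)
    then have P: "fgm L P" "fgm L Q" "linear_form L Q f" by (auto simp: objects_iff mdual_iff)
    then have "\<phi> Q f (h p) = \<phi> P (\<lambda>m. f (h m)) p"
      using natural_coeffD(4)[OF assms P(2,3) rmod_hom_closed[OF 5(5,7)] P(1) 5(5,7)] by simp
    then show ?thesis using 5 P linear_form_hom[OF 5(5) P(3)] rmod_hom_closed[OF 5(5,7)]
      by (simp add: restr cl)
  qed
  then show ?thesis
    unfolding compat_def using cl Y.abelian_group_axioms by (auto simp: coeffs_iff mdual_iff)
qed

definition fdlift :: "('z, 'v) ring_scheme \<Rightarrow> (('a, 'l) rmod \<Rightarrow> ('a list \<Rightarrow> 'a) \<Rightarrow> 'a list \<Rightarrow> 'z) \<Rightarrow> ('a, 'l) fdual \<Rightarrow> 'z" where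
  "fdlift Y \<phi> = plift Y (\<lambda>(P, f, p). \<phi> P f p)"

lemma fdlift_additive: "natural_coeff Y \<phi> \<Longrightarrow> additive U Y (fdlift Y \<phi>)"
  unfolding fdlift_def by (rule U.plift_additive[OF natural_compat])

lemma fdlift_ccls: "natural_coeff Y \<phi> \<Longrightarrow> (P, f, p) \<in> coeffs L \<Longrightarrow> fdlift Y \<phi> (ccls L [(P, f, p)]) = \<phi> P f p"
  unfolding fdlift_def ccls_pcls by (subst U.plift_gen[OF natural_compat]) auto

lemma fdlift_cc:
  assumes "natural_coeff Y \<phi>" "fgm L P" "linear_form L P f" "p \<in> carrier P"
  shows "fdlift Y \<phi> (cc L P f p) = \<phi> P f p"
  using fdlift_ccls[OF assms(1) coeffs_restrict[OF assms(2-4)]] natural_restrict[OF assms]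
  by (simp only: ccls_restrict[OF assms(2-4)])

lemma fdlift_UN:
  assumes "natural_coeff U \<phi>" "X \<in> carrier U"
    and "\<And>P f p. (P, f, p) \<in> coeffs L \<Longrightarrow> \<psi> P f p \<in> coeffs L \<and> ccls L [\<psi> P f p] = \<phi> P f p"
  shows "(\<Union>x\<in>X. ccls L [\<psi> P f p. (P, f, p) \<leftarrow> x]) = fdlift U \<phi> X"
proof -
  have "ccls L [\<psi> P f p. (P, f, p) \<leftarrow> x] = lsum U (map (\<lambda>(P, f, p). \<phi> P f p) x)" if "x \<in> X" for x
  proof -
    have x: "set x \<subseteq> coeffs L" by (rule U.carrier_memD[OF assms(2) that])
    then have "set [\<psi> P f p. (P, f, p) \<leftarrow> x] \<subseteq> coeffs L" using assms(3) by auto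
    then have "ccls L [\<psi> P f p. (P, f, p) \<leftarrow> x] = lsum U [ccls L [\<psi> P f p]. (P, f, p) \<leftarrow> x]"
      unfolding ccls_pcls by (subst U.pcls_lsum) (simp_all add: o_def case_prod_unfold)
    also have "\<dots> = lsum U (map (\<lambda>(P, f, p). \<phi> P f p) x)"
      using x assms(3) by (intro lsum_cong) auto
    finally show ?thesis .
  qed
  then have "(\<Union>x\<in>X. ccls L [\<psi> P f p. (P, f, p) \<leftarrow> x]) = (\<Union>x\<in>X. lsum U (map (\<lambda>(P, f, p). \<phi> P f p) x))"
    by simp
  then show ?thesis
    unfolding fdlift_def by (simp only: U.UN_plift[OF natural_compat[OF assms(1)] assms(2)])
qed

lemma cc_add_left:
  assumes "fgm L M" "linear_form L M f" "linear_form L M g" "m \<in> carrier M"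
  shows "cc L M (\<lambda>x. f x + g x) m = cc L M f m \<oplus>\<^bsub>U\<^esub> cc L M g m"
proof -
  obtain R h where r: "realization L M = (R, h)" by (cases "realization L M")
  note R = realization[OF assms(1) r]
  note k = rmod_hom_inv[OF fgm_module[OF assms(1)] R(2,3)]
  let ?t = "\<lambda>f. \<lambda>r\<in>carrier R. f (inv_into (carrier M) h r)"
  have t: "?t f \<in> mdual L R" if "linear_form L M f" for f
    using linear_form_hom[OF k that] R(1) by (simp add: mdual_restrict objects_iff fgm_module)
  have hm: "h m \<in> carrier R" by (rule rmod_hom_closed[OF R(2) assms(4)])
  have "ceq L [(R, \<lambda>r\<in>carrier R. ?t f r + ?t g r, h m)] [(R, ?t f, h m), (R, ?t g, h m)]"
    by (intro ceq_add_left R t assms hm)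
  moreover have "(\<lambda>r\<in>carrier R. ?t f r + ?t g r) = ?t (\<lambda>x. f x + g x)" by auto
  ultimately have "ccls L [(R, ?t (\<lambda>x. f x + g x), h m)] = ccls L ([(R, ?t f, h m)] @ [(R, ?t g, h m)])"
    by (simp add: ccls_eqI)
  also have "\<dots> = ccls L [(R, ?t f, h m)] \<oplus>\<^bsub>U\<^esub> ccls L [(R, ?t g, h m)]"
    unfolding ccls_pcls using t R(1) hm assms by (subst U.pcls_append) (auto simp: coeffs_def)
  finally show ?thesis by (simp add: cc_def transport_def r)
qed

lemma cc_add_right:
  assumes "fgm L M" "linear_form L M f" "m \<in> carrier M" "n \<in> carrier M"
  shows "cc L M f (m \<oplus>\<^bsub>M\<^esub> n) = cc L M f m \<oplus>\<^bsub>U\<^esub> cc L M f n"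
proof -
  obtain R h where r: "realization L M = (R, h)" by (cases "realization L M")
  note R = realization[OF assms(1) r]
  note k = rmod_hom_inv[OF fgm_module[OF assms(1)] R(2,3)]
  let ?f = "\<lambda>r\<in>carrier R. f (inv_into (carrier M) h r)"
  have t: "?f \<in> mdual L R"
    using linear_form_hom[OF k assms(2)] R(1) by (simp add: mdual_restrict objects_iff fgm_module)
  have hm: "h m \<in> carrier R" "h n \<in> carrier R" "h (m \<oplus>\<^bsub>M\<^esub> n) = h m \<oplus>\<^bsub>R\<^esub> h n"
    using assms rmod_hom_closed[OF R(2)] additive_add[OF rmod_hom_additive[OF R(2)]] by simp_all
  have "ceq L [(R, ?f, h m \<oplus>\<^bsub>R\<^esub> h n)] [(R, ?f, h m), (R, ?f, h n)]"
    by (intro ceq_add_right R t hm)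
  then have "ccls L [(R, ?f, h m \<oplus>\<^bsub>R\<^esub> h n)] = ccls L ([(R, ?f, h m)] @ [(R, ?f, h n)])"
    by (simp add: ccls_eqI)
  also have "\<dots> = ccls L [(R, ?f, h m)] \<oplus>\<^bsub>U\<^esub> ccls L [(R, ?f, h n)]"
    unfolding ccls_pcls using t R(1) hm by (subst U.pcls_append) (auto simp: coeffs_def)
  finally show ?thesis by (simp add: cc_def transport_def r hm(3))
qed

lemma cc_additive_right: "fgm L M \<Longrightarrow> linear_form L M f \<Longrightarrow> additive M U (cc L M f)"
  by (rule additiveI) (simp_all add: cc_closed cc_add_right)

section \<open>The two actions of the base\<close>

lemma lact_natural: "natural_coeff U (\<lambda>P f p. cc L P (\<lambda>m. a * f m) p)"
proof -
  have hom: "cc L Q (\<lambda>m. a * f m) (h p) = cc L P (\<lambda>m. a * f (h m)) p"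
    if "fgm L P" "fgm L Q" "h \<in> rmod_hom (VA L) P Q" "linear_form L Q f" "p \<in> carrier P"
    for P Q :: "('a, 'l) rmod" and h f p
    using cc_hom[OF that(1-3) linear_form_scale[OF that(4)] that(5)] .
  show ?thesis
    unfolding natural_coeff_def
    using U.is_abelian_group hom
    by (auto simp: cc_closed linear_form_scale distrib_left cc_add_left cc_add_right intro!: cc_cong)
qed

lemma ract_natural: "natural_coeff U (\<lambda>P f p. cc L P f (iotaA L a \<odot>\<^bsub>P\<^esub> p))"
proof -
  have hom: "cc L Q f (iotaA L a \<odot>\<^bsub>Q\<^esub> h p) = cc L P (\<lambda>m. f (h m)) (iotaA L a \<odot>\<^bsub>P\<^esub> p)"
    if "fgm L P" "fgm L Q" "h \<in> rmod_hom (VA L) P Q" "linear_form L Q f" "p \<in> carrier P"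
    for P Q :: "('a, 'l) rmod" and h f p
  proof -
    interpret P: lr_module \<kappa> L P by (rule fgm_lr_module[OF that(1)])
    show ?thesis
      using cc_hom[OF that(1-4), of "iotaA L a \<odot>\<^bsub>P\<^esub> p"] that(5) rmod_hom_act[OF that(3)]
      by (simp add: P.M.act_closed)
  qed
  have cl: "iotaA L a \<odot>\<^bsub>P\<^esub> p \<in> carrier P" "q \<in> carrier P \<Longrightarrow>
      iotaA L a \<odot>\<^bsub>P\<^esub> (p \<oplus>\<^bsub>P\<^esub> q) = iotaA L a \<odot>\<^bsub>P\<^esub> p \<oplus>\<^bsub>P\<^esub> iotaA L a \<odot>\<^bsub>P\<^esub> q"
    if "fgm L P" "p \<in> carrier P" for P :: "('a, 'l) rmod" and p q
  proof -
    interpret P: lr_module \<kappa> L P by (rule fgm_lr_module[OF that(1)])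
    show "iotaA L a \<odot>\<^bsub>P\<^esub> p \<in> carrier P" "q \<in> carrier P \<Longrightarrow>
      iotaA L a \<odot>\<^bsub>P\<^esub> (p \<oplus>\<^bsub>P\<^esub> q) = iotaA L a \<odot>\<^bsub>P\<^esub> p \<oplus>\<^bsub>P\<^esub> iotaA L a \<odot>\<^bsub>P\<^esub> q"
      using that by (simp_all add: P.M.act_closed P.M.act_add_right)
  qed
  show ?thesis
    unfolding natural_coeff_def
    using U.is_abelian_group hom
    by (auto simp: cc_closed cl cc_add_left cc_add_right intro!: cc_cong)
qed

lemma lact_fdlift:
  assumes "X \<in> carrier U"
  shows "lact U a X = fdlift U (\<lambda>P f p. cc L P (\<lambda>m. a * f m) p) X"
  unfolding finite_dual_simps
proof (rule fdlift_UN[OF lact_natural assms])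
  fix P f p assume "(P, f, p) \<in> coeffs L"
  then have "fgm L P" "linear_form L P (\<lambda>m. a * f m)" "p \<in> carrier P"
    by (auto simp: coeffs_iff mdual_iff linear_form_scale)
  then show "(P, \<lambda>m\<in>carrier P. a * f m, p) \<in> coeffs L \<and>
      ccls L [(P, \<lambda>m\<in>carrier P. a * f m, p)] = cc L P (\<lambda>m. a * f m) p"
    by (simp only: coeffs_restrict ccls_restrict)
qed

lemma ract_fdlift:
  assumes "X \<in> carrier U"
  shows "ract U X a = fdlift U (\<lambda>P f p. cc L P f (iotaA L a \<odot>\<^bsub>P\<^esub> p)) X"
  unfolding finite_dual_simps
proof (rule fdlift_UN[OF ract_natural assms])
  fix P f p assume *: "(P, f, p) \<in> coeffs L"
  then interpret P: lr_module \<kappa> L P by (simp add: coeffs_iff fgm_lr_module)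
  have "(P, f, iotaA L a \<odot>\<^bsub>P\<^esub> p) \<in> coeffs L" using * by (simp add: coeffs_iff P.M.act_closed)
  then show "(P, f, iotaA L a \<odot>\<^bsub>P\<^esub> p) \<in> coeffs L \<and> ccls L [(P, f, iotaA L a \<odot>\<^bsub>P\<^esub> p)] = cc L P f (iotaA L a \<odot>\<^bsub>P\<^esub> p)"
    by (simp add: cc_object)
qed

lemma lact_additive: "additive U U (lact U a)"
  by (rule iffD2[OF additive_cong[OF U.is_abelian_group] fdlift_additive[OF lact_natural]]) (rule lact_fdlift)

lemma ract_additive: "additive U U (\<lambda>X. ract U X a)"
  by (rule iffD2[OF additive_cong[OF U.is_abelian_group] fdlift_additive[OF ract_natural]]) (rule ract_fdlift)

lemma lact_cc_object: "fgm L P \<Longrightarrow> linear_form L P f \<Longrightarrow> p \<in> carrier P \<Longrightarrow>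
    lact U a (cc L P f p) = cc L P (\<lambda>m. a * f m) p" for P :: "('a, 'l) rmod"
  by (simp add: lact_fdlift cc_closed fdlift_cc[OF lact_natural])

lemma ract_cc_object: "fgm L P \<Longrightarrow> linear_form L P f \<Longrightarrow> p \<in> carrier P \<Longrightarrow>
    ract U (cc L P f p) a = cc L P f (iotaA L a \<odot>\<^bsub>P\<^esub> p)" for P :: "('a, 'l) rmod"
  by (simp add: ract_fdlift cc_closed fdlift_cc[OF ract_natural])

text \<open>Passing to a realization expresses a class over any module by one over an object, where
  the formulas for lifted maps apply; forms are composed with the inverse of the
  isomorphism.\<close>

lemma cc_realize:
  assumes "fgm L M" "linear_form L M f" "m \<in> carrier M"
  obtains R :: "('a, 'l) rmod" and h where "fgm L R" "h \<in> rmod_hom (VA L) M R"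
    "inv_into (carrier M) h \<in> rmod_hom (VA L) R M"
    "\<And>x. x \<in> carrier M \<Longrightarrow> inv_into (carrier M) h (h x) = x"
    "linear_form L R (\<lambda>r. f (inv_into (carrier M) h r))"
    "\<And>f m. linear_form L M f \<Longrightarrow> m \<in> carrier M \<Longrightarrow> cc L M f m = cc L R (\<lambda>r. f (inv_into (carrier M) h r)) (h m)"
proof -
  obtain R h where r: "realization L M = (R, h)" by (cases "realization L M")
  note R = realization[OF assms(1) r]
  let ?k = "inv_into (carrier M) h"
  note k = rmod_hom_inv[OF fgm_module[OF assms(1)] R(2,3)]
  have fR: "fgm L R" using R(1) by (simp add: objects_iff)
  have kh: "?k (h x) = x" if "x \<in> carrier M" for x using R(3) that by (simp add: bij_betw_def)
  have "cc L M f m = cc L R (\<lambda>r. f (?k r)) (h m)" if "linear_form L M f" "m \<in> carrier M" for f m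
  proof -
    have "cc L R (\<lambda>r. f (?k r)) (h m) = cc L M (\<lambda>x. f (?k (h x))) m"
      by (rule cc_hom[OF assms(1) fR R(2) linear_form_hom[OF k that(1)] that(2)])
    also have "\<dots> = cc L M f m" by (rule cc_cong[OF assms(1)]) (simp add: kh)
    finally show ?thesis ..
  qed
  then show ?thesis using that[OF fR R(2) k kh linear_form_hom[OF k assms(2)]] by blast
qed

lemma lact_cc:
  assumes "fgm L M" "linear_form L M f" "m \<in> carrier M"
  shows "lact U a (cc L M f m) = cc L M (\<lambda>x. a * f x) m"
proof -
  obtain R :: "('a, 'l) rmod" and h where R: "fgm L R" "h \<in> rmod_hom (VA L) M R"
    "inv_into (carrier M) h \<in> rmod_hom (VA L) R M"
    "\<And>x. x \<in> carrier M \<Longrightarrow> inv_into (carrier M) h (h x) = x"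
    "linear_form L R (\<lambda>r. f (inv_into (carrier M) h r))"
    "\<And>f m. linear_form L M f \<Longrightarrow> m \<in> carrier M \<Longrightarrow> cc L M f m = cc L R (\<lambda>r. f (inv_into (carrier M) h r)) (h m)"
    using cc_realize[OF assms] by metis
  show ?thesis
    using R(6)[OF assms(2,3)] R(6)[OF linear_form_scale[OF assms(2)] assms(3)]
    by (simp add: lact_cc_object[OF R(1,5) rmod_hom_closed[OF R(2) assms(3)]])
qed

lemma ract_cc:
  assumes "fgm L M" "linear_form L M f" "m \<in> carrier M"
  shows "ract U (cc L M f m) a = cc L M f (iotaA L a \<odot>\<^bsub>M\<^esub> m)"
proof -
  interpret M: lr_module \<kappa> L M by (rule fgm_lr_module[OF assms(1)])
  obtain R :: "('a, 'l) rmod" and h where R: "fgm L R" "h \<in> rmod_hom (VA L) M R"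
    "inv_into (carrier M) h \<in> rmod_hom (VA L) R M"
    "\<And>x. x \<in> carrier M \<Longrightarrow> inv_into (carrier M) h (h x) = x"
    "linear_form L R (\<lambda>r. f (inv_into (carrier M) h r))"
    "\<And>f m. linear_form L M f \<Longrightarrow> m \<in> carrier M \<Longrightarrow> cc L M f m = cc L R (\<lambda>r. f (inv_into (carrier M) h r)) (h m)"
    using cc_realize[OF assms] by metis
  show ?thesis
    using R(6)[OF assms(2,3)] R(6)[OF assms(2), of "iotaA L a \<odot>\<^bsub>M\<^esub> m"] assms(3)
    by (simp add: ract_cc_object[OF R(1,5) rmod_hom_closed[OF R(2) assms(3)]] M.M.act_closed rmod_hom_act[OF R(2)])
qed

text \<open>Since \<open>X(\<kappa>(c)) = 0\<close>, scalars from the field commute with the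
  generators. Their action is thus an endomorphism of the module, and \<open>cc_hom\<close> moves it
  from the vector to the form; this is how the field becomes central in the finite dual.\<close>

lemma iotaA_field_hom:
  fixes M :: "(('a, 'l) env, 'm) module"
  assumes "right_module (VA L) M"
  shows "smult M (iotaA L (\<kappa> c)) \<in> rmod_hom (VA L) M M"
proof -
  interpret M: lr_module \<kappa> L M by (intro lr_moduleI lr_alg_axioms assms)
  have z: "iotaA L 0 \<odot>\<^bsub>M\<^esub> m = \<zero>\<^bsub>M\<^esub>" if "m \<in> carrier M" for m using M.amod.zero_lact that by simp
  show ?thesis
    by (rule rmod_homI[OF assms assms M.act_additive])
      (simp_all add: M.act_anchor anchor_kappa z M.M.act_closed M.act_A_commute)
qed

lemma finite_dual_bimodule: "bimodule \<kappa> U"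
proof -
  note ag = U.is_abelian_group
  note la = lact_additive and ra = ract_additive
  have id: "additive U U (\<lambda>X. X)" by (simp add: additive_def)
  note ext = fdual_ext[OF _ _ ag]
  note [simp] = lact_cc ract_cc linear_form_scale cc_closed
  show ?thesis
  proof (rule bimodule.intro[OF ag], unfold_locales)
    fix X a b assume X: "X \<in> carrier U"
    show "lact U (a + b) X = lact U a X \<oplus>\<^bsub>U\<^esub> lact U b X"
      by (rule ext[OF la additive_add_fun[OF ag ag la la] X])
        (simp add: distrib_right cc_add_left)
    show "lact U (a * b) X = lact U a (lact U b X)"
      by (rule ext[OF la additive_comp[OF la la] X]) (simp add: mult.assoc)
    show "lact U 1 X = X" by (rule ext[OF la id X]) simp
    show "ract U X (a + b) = ract U X a \<oplus>\<^bsub>U\<^esub> ract U X b"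
    proof (rule ext[OF ra additive_add_fun[OF ag ag ra ra] X])
      fix P :: "('a, 'l) rmod" and f p assume P: "fgm L P" "linear_form L P f" "p \<in> carrier P"
      interpret P: lr_module \<kappa> L P by (rule fgm_lr_module[OF P(1)])
      show "ract U (cc L P f p) (a + b) = ract U (cc L P f p) a \<oplus>\<^bsub>U\<^esub> ract U (cc L P f p) b"
        using P by (simp add: iotaA_add P.M.act_add_left P.M.act_closed cc_add_right)
    qed
    show "ract U X (a * b) = ract U (ract U X a) b"
    proof (rule ext[OF ra additive_comp[OF ra ra] X])
      fix P :: "('a, 'l) rmod" and f p assume P: "fgm L P" "linear_form L P f" "p \<in> carrier P"
      interpret P: lr_module \<kappa> L P by (rule fgm_lr_module[OF P(1)])
      show "ract U (cc L P f p) (a * b) = ract U (ract U (cc L P f p) a) b"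
        using P by (simp add: P.act_A P.M.act_closed)
    qed
    show "ract U X 1 = X"
    proof (rule ext[OF ra id X])
      fix P :: "('a, 'l) rmod" and f p assume P: "fgm L P" "linear_form L P f" "p \<in> carrier P"
      interpret P: lr_module \<kappa> L P by (rule fgm_lr_module[OF P(1)])
      show "ract U (cc L P f p) 1 = cc L P f p" using P P.M.act_one[of p] by (simp add: VA_one)
    qed
    show "ract U (lact U a X) b = lact U a (ract U X b)"
    proof (rule ext[OF additive_comp[OF la ra] additive_comp[OF ra la] X])
      fix P :: "('a, 'l) rmod" and f p assume P: "fgm L P" "linear_form L P f" "p \<in> carrier P"
      interpret P: lr_module \<kappa> L P by (rule fgm_lr_module[OF P(1)])
      show "ract U (lact U a (cc L P f p)) b = lact U a (ract U (cc L P f p) b)"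
        using P by (simp add: P.M.act_closed)
    qed
    fix c show "lact U (\<kappa> c) X = ract U X (\<kappa> c)"
    proof (rule ext[OF la ra X])
      fix P :: "('a, 'l) rmod" and f p assume P: "fgm L P" "linear_form L P f" "p \<in> carrier P"
      interpret P: lr_module \<kappa> L P by (rule fgm_lr_module[OF P(1)])
      have "cc L P f (iotaA L (\<kappa> c) \<odot>\<^bsub>P\<^esub> p) = cc L P (\<lambda>x. f (iotaA L (\<kappa> c) \<odot>\<^bsub>P\<^esub> x)) p"
        by (rule cc_hom[OF P(1,1) iotaA_field_hom[OF fgm_module[OF P(1)]] P(2,3)])
      also have "\<dots> = cc L P (\<lambda>x. \<kappa> c * f x) p"
        by (rule cc_cong[OF P(1)]) (simp add: linear_form_smult[OF P(2)])
      finally show "lact U (\<kappa> c) (cc L P f p) = ract U (cc L P f p) (\<kappa> c)" using P by simp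
    qed
  qed (auto simp: additive_closed[OF la] additive_closed[OF ra] additive_add[OF la] additive_add[OF ra])
qed

section \<open>The counit and the evaluation map \<zeta>\<close>

lemma counit_natural: "natural_coeff regular_bimod (\<lambda>P f p. f p)"
  unfolding natural_coeff_def using regular_abelian_group by (simp add: linear_form_def)

lemma zeta_natural:
  assumes "u \<in> carrier (VA L)"
  shows "natural_coeff regular_bimod (\<lambda>P f p. f (u \<odot>\<^bsub>P\<^esub> p))"
proof -
  have cl: "u \<odot>\<^bsub>P\<^esub> p \<in> carrier P" "q \<in> carrier P \<Longrightarrow> u \<odot>\<^bsub>P\<^esub> (p \<oplus>\<^bsub>P\<^esub> q) = u \<odot>\<^bsub>P\<^esub> p \<oplus>\<^bsub>P\<^esub> u \<odot>\<^bsub>P\<^esub> q"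
    if "fgm L P" "p \<in> carrier P" for P :: "('a, 'l) rmod" and p q
  proof -
    interpret P: lr_module \<kappa> L P by (rule fgm_lr_module[OF that(1)])
    show "u \<odot>\<^bsub>P\<^esub> p \<in> carrier P" "q \<in> carrier P \<Longrightarrow> u \<odot>\<^bsub>P\<^esub> (p \<oplus>\<^bsub>P\<^esub> q) = u \<odot>\<^bsub>P\<^esub> p \<oplus>\<^bsub>P\<^esub> u \<odot>\<^bsub>P\<^esub> q"
      using assms that by (simp_all add: P.M.act_closed P.M.act_add_right)
  qed
  show ?thesis
    unfolding natural_coeff_def using regular_abelian_group assms
    by (auto simp: linear_form_add cl rmod_hom_act)
qed

lemma counit_fdlift: "counit U X = fdlift regular_bimod (\<lambda>P f p. f p) X"
  by (simp add: finite_dual_simps fdlift_def plift_def)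

lemma zeta_fdlift: "u \<in> carrier (VA L) \<Longrightarrow> zeta L X u = fdlift regular_bimod (\<lambda>P f p. f (u \<odot>\<^bsub>P\<^esub> p)) X"
  by (simp add: zeta_def fdlift_def plift_def)

lemma counit_cc:
  assumes "fgm L M" "linear_form L M f" "m \<in> carrier M"
  shows "counit U (cc L M f m) = f m"
proof -
  obtain R :: "('a, 'l) rmod" and h where R: "fgm L R" "h \<in> rmod_hom (VA L) M R"
    "inv_into (carrier M) h \<in> rmod_hom (VA L) R M"
    "\<And>x. x \<in> carrier M \<Longrightarrow> inv_into (carrier M) h (h x) = x"
    "linear_form L R (\<lambda>r. f (inv_into (carrier M) h r))"
    "\<And>f m. linear_form L M f \<Longrightarrow> m \<in> carrier M \<Longrightarrow> cc L M f m = cc L R (\<lambda>r. f (inv_into (carrier M) h r)) (h m)"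
    using cc_realize[OF assms] by metis
  show ?thesis
    using fdlift_cc[OF counit_natural R(1,5) rmod_hom_closed[OF R(2) assms(3)]] assms
    by (simp add: R(4) R(6) counit_fdlift)
qed

lemma zeta_cc:
  assumes "fgm L M" "linear_form L M f" "m \<in> carrier M" "u \<in> carrier (VA L)"
  shows "zeta L (cc L M f m) u = f (u \<odot>\<^bsub>M\<^esub> m)"
proof -
  interpret M: lr_module \<kappa> L M by (rule fgm_lr_module[OF assms(1)])
  obtain R :: "('a, 'l) rmod" and h where R: "fgm L R" "h \<in> rmod_hom (VA L) M R"
    "inv_into (carrier M) h \<in> rmod_hom (VA L) R M"
    "\<And>x. x \<in> carrier M \<Longrightarrow> inv_into (carrier M) h (h x) = x"
    "linear_form L R (\<lambda>r. f (inv_into (carrier M) h r))"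
    "\<And>f m. linear_form L M f \<Longrightarrow> m \<in> carrier M \<Longrightarrow> cc L M f m = cc L R (\<lambda>r. f (inv_into (carrier M) h r)) (h m)"
    using cc_realize[OF assms(1-3)] by metis
  have "zeta L (cc L M f m) u = f (inv_into (carrier M) h (u \<odot>\<^bsub>R\<^esub> h m))"
    using fdlift_cc[OF zeta_natural[OF assms(4)] R(1,5) rmod_hom_closed[OF R(2) assms(3)]] assms(2-4)
    by (simp add: R(6) zeta_fdlift)
  then show ?thesis using assms(3,4) by (simp add: M.M.act_closed R(4) flip: rmod_hom_act[OF R(2)])
qed

end

section \<open>The product of the finite dual\<close>

definition star :: "('q \<Rightarrow> 'a::{comm_ring,comm_monoid_mult}) \<Rightarrow> ('p \<Rightarrow> 'a) \<Rightarrow> ('q \<times> 'p) list set \<Rightarrow> 'a" where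
  "star g f = tlift regular_bimod (\<lambda>x y. g x * f y)"

text \<open>Kept apart from \<open>tn\<close>: once \<open>mod_tensor_simps\<close> is removed from
  the simplifier, the tensor product is mostly handled as a module, through \<open>pure_add\<close>,
  \<open>pure_act\<close> and \<open>tlift_pure\<close>.\<close>

definition pure :: "('a::{comm_ring,comm_monoid_mult}, 'l) lr_algebra \<Rightarrow> (('a, 'l) env, 'q) module \<Rightarrow>
    (('a, 'l) env, 'p) module \<Rightarrow> 'q \<Rightarrow> 'p \<Rightarrow> ('q \<times> 'p) list set" where
  "pure L Q P = tn (amod L Q) (amod L P)"

context lr_module_pair
begin

lemma balanced_star:
  "linear_form L Q g \<Longrightarrow> linear_form L P f \<Longrightarrow> balanced (amod L Q) (amod L P) regular_bimod (\<lambda>x y. g x * f y)"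
  unfolding balanced_def using regular_abelian_group
  by (auto simp: linear_form_add linear_form_smult algebra_simps intro!: additiveI)

lemma star_tn: "linear_form L Q g \<Longrightarrow> linear_form L P f \<Longrightarrow> q \<in> carrier Q \<Longrightarrow> p \<in> carrier P \<Longrightarrow>
    star g f (pure L Q P q p) = g q * f p"
  using TT.tlift_tn[OF balanced_star, of g f q p] by (simp add: star_def pure_def)

lemma star_additive: "linear_form L Q g \<Longrightarrow> linear_form L P f \<Longrightarrow> additive TQP regular_bimod (star g f)"
  unfolding star_def by (rule TT.tlift_additive[OF balanced_star])

lemma linear_form_star:
  assumes "linear_form L Q g" "linear_form L P f"
  shows "linear_form L (mod_tensor L Q P) (star g f)"
proof -
  note ad = star_additive[OF assms]
  have "star g f (iotaA L a \<odot>\<^bsub>mod_tensor L Q P\<^esub> Z) = a * star g f Z" if Z: "Z \<in> carrier TQP" for a Z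
    unfolding mod_tensor_iotaA[OF Z]
  proof (rule TT.tensor_ext[OF additive_comp[OF TT.additive_lact_T ad] _ regular_abelian_group Z])
    show "additive TQP regular_bimod (\<lambda>Z. a * star g f Z)"
      using ad by (simp add: additive_def distrib_left)
    fix q p assume "q \<in> carrier (amod L Q)" "p \<in> carrier (amod L P)"
    then show "star g f (lact TQP a (tq q p)) = a * star g f (tq q p)"
      using star_tn[OF assms, unfolded pure_def]
      by (simp add: lact_in Q.M.act_closed linear_form_smult[OF assms(1)] mult.assoc)
  qed
  then show ?thesis using ad by (simp add: linear_form_def additive_def)
qed

lemma pure_closed [simp]: "q \<in> carrier Q \<Longrightarrow> p \<in> carrier P \<Longrightarrow> pure L Q P q p \<in> carrier (mod_tensor L Q P)"
  by (simp add: pure_def)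

declare mod_tensor_simps [simp del]

lemma pure_add:
  "q \<in> carrier Q \<Longrightarrow> q' \<in> carrier Q \<Longrightarrow> p \<in> carrier P \<Longrightarrow>
    pure L Q P (q \<oplus>\<^bsub>Q\<^esub> q') p = pure L Q P q p \<oplus>\<^bsub>mod_tensor L Q P\<^esub> pure L Q P q' p"
  "q \<in> carrier Q \<Longrightarrow> p \<in> carrier P \<Longrightarrow> p' \<in> carrier P \<Longrightarrow>
    pure L Q P q (p \<oplus>\<^bsub>P\<^esub> p') = pure L Q P q p \<oplus>\<^bsub>mod_tensor L Q P\<^esub> pure L Q P q p'"
  by (simp_all add: pure_def tn_add mod_tensor_simps)

lemma pure_act:
  "q \<in> carrier Q \<Longrightarrow> p \<in> carrier P \<Longrightarrow>
    iotaA L a \<odot>\<^bsub>mod_tensor L Q P\<^esub> pure L Q P q p = pure L Q P (iotaA L a \<odot>\<^bsub>Q\<^esub> q) p"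
  "q \<in> carrier Q \<Longrightarrow> p \<in> carrier P \<Longrightarrow> pure L Q P (iotaA L a \<odot>\<^bsub>Q\<^esub> q) p = pure L Q P q (iotaA L a \<odot>\<^bsub>P\<^esub> p)"
  "X \<in> carrier L \<Longrightarrow> q \<in> carrier Q \<Longrightarrow> p \<in> carrier P \<Longrightarrow> iotaL L X \<odot>\<^bsub>mod_tensor L Q P\<^esub> pure L Q P q p =
    pure L Q P (iotaL L X \<odot>\<^bsub>Q\<^esub> q) p \<oplus>\<^bsub>mod_tensor L Q P\<^esub> pure L Q P q (iotaL L X \<odot>\<^bsub>P\<^esub> p)"
  by (simp_all add: pure_def mod_tensor_iotaA mod_tensor_iotaL lact_in tL_tn tn_smult mod_tensor_simps)

lemma balancedI:
  assumes "abelian_group N" "\<And>q p. q \<in> carrier Q \<Longrightarrow> p \<in> carrier P \<Longrightarrow> \<beta> q p \<in> carrier N"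
    "\<And>q q' p. \<lbrakk>q \<in> carrier Q; q' \<in> carrier Q; p \<in> carrier P\<rbrakk> \<Longrightarrow> \<beta> (q \<oplus>\<^bsub>Q\<^esub> q') p = \<beta> q p \<oplus>\<^bsub>N\<^esub> \<beta> q' p"
    "\<And>q p p'. \<lbrakk>q \<in> carrier Q; p \<in> carrier P; p' \<in> carrier P\<rbrakk> \<Longrightarrow> \<beta> q (p \<oplus>\<^bsub>P\<^esub> p') = \<beta> q p \<oplus>\<^bsub>N\<^esub> \<beta> q p'"
    "\<And>q p a. \<lbrakk>q \<in> carrier Q; p \<in> carrier P\<rbrakk> \<Longrightarrow> \<beta> (iotaA L a \<odot>\<^bsub>Q\<^esub> q) p = \<beta> q (iotaA L a \<odot>\<^bsub>P\<^esub> p)"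
  shows "balanced (amod L Q) (amod L P) N \<beta>"
  using assms by (auto simp: balanced_def intro!: additiveI)

lemma tlift_pure:
  "balanced (amod L Q) (amod L P) N \<beta> \<Longrightarrow> q \<in> carrier Q \<Longrightarrow> p \<in> carrier P \<Longrightarrow> tlift N \<beta> (pure L Q P q p) = \<beta> q p"
  using TT.tlift_tn[of N \<beta> q p] by (simp add: pure_def)

text \<open>This one family shows that the category is closed under tensor products, and it later
  makes the comultiplication of the finite dual multiplicative.\<close>

lemma mod_tensor_dual_basis:
  assumes es: "dual_basis L Q es" and ds: "dual_basis L P ds"
  shows "dual_basis L (mod_tensor L Q P)
    [(pure L Q P e d, restrict (star e' d') (carrier (mod_tensor L Q P))). (e, e') \<leftarrow> es, (d, d') \<leftarrow> ds]"
    (is "dual_basis _ ?M _")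
proof -
  note eD = Q.dual_basisD[OF es] and dD = Q.dual_basisD[OF ds]
  interpret M: lr_module \<kappa> L ?M by (intro lr_moduleI Q.lr_alg_axioms mod_tensor_module)
  have ag: "abelian_group ?M" by (rule M.M.abelian_group_axioms)

  have el: "pure L Q P e d \<in> carrier ?M" "linear_form L ?M (star e' d')"
    if "(e, e') \<in> set es" "(d, d') \<in> set ds" for e e' d d'
    using eD(1,2)[OF that(1)] dD(1,2)[OF that(2)] by (auto simp: linear_form_star)
  \<comment> \<open>The expansion in the product basis as an additive operator, so that
    \<open>S Z = Z\<close> can be checked on pure tensors, where it separates into the expansions of
    \<open>q\<close> and \<open>p\<close>.\<close>
  define S where "S = (\<lambda>Z. lsum ?M [lsum ?M [iotaA L (star e' d' Z) \<odot>\<^bsub>?M\<^esub> pure L Q P e d. (d, d') \<leftarrow> ds]. (e, e') \<leftarrow> es])"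
  have S_add: "additive ?M ?M S"
    unfolding S_def case_prod_unfold
  proof (intro additive_lsum_fun ag)
    fix x y assume "x \<in> set es" "y \<in> set ds"
    then have "pure L Q P (fst x) (fst y) \<in> carrier ?M" "linear_form L ?M (star (snd x) (snd y))"
      using el[of "fst x" "snd x" "fst y" "snd y"] by simp_all
    then show "additive ?M ?M (\<lambda>Z. iotaA L (star (snd x) (snd y) Z) \<odot>\<^bsub>?M\<^esub> pure L Q P (fst x) (fst y))"
      by (intro additiveI M.M.act_closed Q.iotaA_closed)
        (simp_all only: linear_form_add Q.iotaA_add M.M.act_add_left Q.iotaA_closed)
  qed
  have SZ: "S Z = Z" if Z: "Z \<in> carrier ?M" for Z
  proof (rule TT.tensor_ext[of ?M])
    show "additive TQP ?M S" using S_add by (simp add: additive_def mod_tensor_simps)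
    show "additive TQP ?M (\<lambda>Z. Z)" by (simp add: additive_def mod_tensor_simps)
    fix q p assume "q \<in> carrier (amod L Q)" "p \<in> carrier (amod L P)"
    then have q: "q \<in> carrier Q" and p: "p \<in> carrier P" by simp_all
    have cl: "iotaA L (e' q) \<odot>\<^bsub>Q\<^esub> e \<in> carrier Q" if "(e, e') \<in> set es" for e e'
      using eD(1)[OF that] by (simp add: Q.M.act_closed)
    have cl': "iotaA L (d' p) \<odot>\<^bsub>P\<^esub> d \<in> carrier P" if "(d, d') \<in> set ds" for d d'
      using dD(1)[OF that] by (simp add: P.M.act_closed)
    have ad2: "additive P ?M (\<lambda>p. pure L Q P q p)" if "q \<in> carrier Q" for q
      using that by (intro additiveI) (simp_all add: pure_add)
    have ad1: "additive Q ?M (\<lambda>q. pure L Q P q p)"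
      using p by (intro additiveI) (simp_all add: pure_add)
    have "S (pure L Q P q p) = lsum ?M [lsum ?M [pure L Q P (iotaA L (e' q) \<odot>\<^bsub>Q\<^esub> e) (iotaA L (d' p) \<odot>\<^bsub>P\<^esub> d).
        (d, d') \<leftarrow> ds]. (e, e') \<leftarrow> es]"
      unfolding S_def
    proof (intro lsum_cong, clarify, intro lsum_cong, clarify)
      fix e e' d d' assume *: "(e, e') \<in> set es" "(d, d') \<in> set ds"
      have c: "e \<in> carrier Q" "d \<in> carrier P" using * eD(1) dD(1) by auto
      have "iotaA L (star e' d' (pure L Q P q p)) \<odot>\<^bsub>?M\<^esub> pure L Q P e d = iotaA L (e' q * d' p) \<odot>\<^bsub>?M\<^esub> pure L Q P e d"
        using star_tn[OF eD(2)[OF *(1)] dD(2)[OF *(2)] q p] by simp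
      also have "\<dots> = iotaA L (d' p) \<odot>\<^bsub>?M\<^esub> pure L Q P (iotaA L (e' q) \<odot>\<^bsub>Q\<^esub> e) d"
        using c M.act_A[of "pure L Q P e d" "e' q" "d' p"] pure_act(1)[of e d "e' q"] by simp
      also have "\<dots> = pure L Q P (iotaA L (e' q) \<odot>\<^bsub>Q\<^esub> e) (iotaA L (d' p) \<odot>\<^bsub>P\<^esub> d)"
        using pure_act(1,2)[OF cl[OF *(1)] c(2), of "d' p"] by simp
      finally show "iotaA L (star e' d' (pure L Q P q p)) \<odot>\<^bsub>?M\<^esub> pure L Q P e d =
        pure L Q P (iotaA L (e' q) \<odot>\<^bsub>Q\<^esub> e) (iotaA L (d' p) \<odot>\<^bsub>P\<^esub> d)" .
    qed
    also have "\<dots> = lsum ?M [pure L Q P (iotaA L (e' q) \<odot>\<^bsub>Q\<^esub> e) p. (e, e') \<leftarrow> es]"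
    proof (intro lsum_cong, clarify)
      fix e e' assume *: "(e, e') \<in> set es"
      have "pure L Q P (iotaA L (e' q) \<odot>\<^bsub>Q\<^esub> e) p =
          pure L Q P (iotaA L (e' q) \<odot>\<^bsub>Q\<^esub> e) (lsum P [iotaA L (d' p) \<odot>\<^bsub>P\<^esub> d. (d, d') \<leftarrow> ds])"
        using dD(4)[OF p] by simp
      also have "\<dots> = lsum ?M [pure L Q P (iotaA L (e' q) \<odot>\<^bsub>Q\<^esub> e) (iotaA L (d' p) \<odot>\<^bsub>P\<^esub> d). (d, d') \<leftarrow> ds]"
        using cl' by (subst additive_lsum_map[OF P.M.abelian_group_axioms ag ad2[OF cl[OF *]]])
          (auto simp: case_prod_unfold)
      finally show "lsum ?M [pure L Q P (iotaA L (e' q) \<odot>\<^bsub>Q\<^esub> e) (iotaA L (d' p) \<odot>\<^bsub>P\<^esub> d). (d, d') \<leftarrow> ds] =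
        pure L Q P (iotaA L (e' q) \<odot>\<^bsub>Q\<^esub> e) p" ..
    qed
    also have "\<dots> = pure L Q P (lsum Q [iotaA L (e' q) \<odot>\<^bsub>Q\<^esub> e. (e, e') \<leftarrow> es]) p"
      using cl by (subst additive_lsum_map[OF Q.M.abelian_group_axioms ag ad1]) (auto simp: case_prod_unfold)
    also have "\<dots> = pure L Q P q p" using eD(4)[OF q] by simp
    finally show "S (tq q p) = tq q p" by (simp add: pure_def)
  qed (use ag Z in \<open>auto simp: mod_tensor_simps\<close>)
  let ?B = "[(pure L Q P e d, restrict (star e' d') (carrier ?M)). (e, e') \<leftarrow> es, (d, d') \<leftarrow> ds]"
  have "S Z = lsum ?M [iotaA L (f Z) \<odot>\<^bsub>?M\<^esub> e. (e, f) \<leftarrow> ?B]" if Z: "Z \<in> carrier ?M" for Z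
  proof -
    have "S Z = lsum ?M (concat [[iotaA L (star e' d' Z) \<odot>\<^bsub>?M\<^esub> pure L Q P e d. (d, d') \<leftarrow> ds]. (e, e') \<leftarrow> es])"
      unfolding S_def using el(1)
      by (subst M.M.lsum_concat) (auto simp: case_prod_unfold intro!: M.M.act_closed)
    then show ?thesis using Z by (simp add: map_concat o_def case_prod_unfold)
  qed
  then have "\<forall>Z\<in>carrier ?M. Z = lsum ?M [iotaA L (f Z) \<odot>\<^bsub>?M\<^esub> e. (e, f) \<leftarrow> ?B]"
    using SZ by (metis (no_types, lifting))
  moreover have "set ?B \<subseteq> carrier ?M \<times> mdual L ?M"
  proof
    fix b assume "b \<in> set ?B"
    then obtain e e' d d' where *: "(e, e') \<in> set es" "(d, d') \<in> set ds"
      and b: "b = (pure L Q P e d, restrict (star e' d') (carrier ?M))" by (auto simp: restrict_def)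
    show "b \<in> carrier ?M \<times> mdual L ?M"
      unfolding b using el[OF *] by (simp only: mem_Times_iff fst_conv snd_conv Q.mdual_restrict[OF mod_tensor_module])
  qed
  ultimately show ?thesis unfolding dual_basis_def by (intro conjI)
qed

lemma mod_tensor_fgm: "fgm L Q \<Longrightarrow> fgm L P \<Longrightarrow> fgm L (mod_tensor L Q P)"
  by (metis Q.fgmI Q.fgm_basis mod_tensor_dual_basis mod_tensor_module)

end

text \<open>The factors appear in reverse order, on \<open>Q \<otimes> P\<close>, as in the
  multiplication of coefficients.\<close>

definition cprod :: "('a::{comm_ring,comm_monoid_mult}, 'l) lr_algebra \<Rightarrow> (('a, 'l) env, 'p) module \<Rightarrow>
    ('p \<Rightarrow> 'a) \<Rightarrow> 'p \<Rightarrow> (('a, 'l) env, 'q) module \<Rightarrow> ('q \<Rightarrow> 'a) \<Rightarrow> 'q \<Rightarrow> ('a, 'l) fdual" where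
  "cprod L P f p Q g q = cc L (mod_tensor L Q P) (star g f) (pure L Q P q p)"

section \<open>Naturality, commutativity and biadditivity of products of coefficients\<close>

context lr_alg
begin

lemma fgm_pair: "fgm L Q \<Longrightarrow> fgm L P \<Longrightarrow> lr_module_pair \<kappa> L Q P"
  by (intro lr_module_pairI lr_alg_axioms fgm_module)

lemma cprod_closed:
  assumes "fgm L P" "linear_form L P f" "p \<in> carrier P" "fgm L Q" "linear_form L Q g" "q \<in> carrier Q"
  shows "cprod L P f p Q g q \<in> carrier U"
proof -
  interpret lr_module_pair \<kappa> L Q P by (rule fgm_pair[OF assms(4,1)])
  show ?thesis
    unfolding cprod_def using assms by (intro cc_closed mod_tensor_fgm linear_form_star pure_closed)
qed

text \<open>All coherence isomorphisms are instances of this: a balanced Leibniz map \<open>\<beta>\<close> from \<open>Q \<times> P\<close>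
  identifies the class of \<open>F \<otimes> \<beta>(q, p)\<close> with a product.\<close>

lemma cc_balanced:
  fixes N :: "(('a, 'l) env, 'n) module" and Q :: "(('a, 'l) env, 'q) module" and P :: "(('a, 'l) env, 'p) module"
  assumes P: "fgm L P" "linear_form L P f" and Q: "fgm L Q" "linear_form L Q g"
    and N: "fgm L N" "linear_form L N F"
    and bal: "balanced (amod L Q) (amod L P) N \<beta>"
    and A: "\<And>q p a. \<lbrakk>q \<in> carrier Q; p \<in> carrier P\<rbrakk> \<Longrightarrow> \<beta> (iotaA L a \<odot>\<^bsub>Q\<^esub> q) p = iotaA L a \<odot>\<^bsub>N\<^esub> \<beta> q p"
    and Lb: "\<And>q p X. \<lbrakk>q \<in> carrier Q; p \<in> carrier P; X \<in> carrier L\<rbrakk> \<Longrightarrow>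
      \<beta> (iotaL L X \<odot>\<^bsub>Q\<^esub> q) p \<oplus>\<^bsub>N\<^esub> \<beta> q (iotaL L X \<odot>\<^bsub>P\<^esub> p) = iotaL L X \<odot>\<^bsub>N\<^esub> \<beta> q p"
    and F: "\<And>q p. \<lbrakk>q \<in> carrier Q; p \<in> carrier P\<rbrakk> \<Longrightarrow> F (\<beta> q p) = g q * f p"
    and qp: "q \<in> carrier Q" "p \<in> carrier P"
  shows "cc L N F (\<beta> q p) = cprod L P f p Q g q"
proof -
  interpret lr_module_pair \<kappa> L Q P by (rule fgm_pair[OF Q(1) P(1)])
  note h = mod_tensor_homI[OF fgm_module[OF N(1)] bal A Lb]
  note tl = tlift_pure[OF bal]
  have fg: "fgm L (mod_tensor L Q P)" by (rule mod_tensor_fgm[OF Q(1) P(1)])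
  have "cc L N F (\<beta> q p) = cc L N F (tlift N \<beta> (pure L Q P q p))" using tl qp by simp
  also have "\<dots> = cc L (mod_tensor L Q P) (\<lambda>x. F (tlift N \<beta> x)) (pure L Q P q p)"
    using qp by (intro cc_hom fg N h pure_closed)
  also have "\<dots> = cc L (mod_tensor L Q P) (star g f) (pure L Q P q p)"
  proof (rule cc_cong[OF fg], rule linear_form_ext)
    show "linear_form L (mod_tensor L Q P) (\<lambda>x. F (tlift N \<beta> x))" by (rule linear_form_hom[OF h N(2)])
    show "linear_form L (mod_tensor L Q P) (star g f)" by (rule linear_form_star[OF Q(2) P(2)])
  qed (auto simp: F tl star_tn[OF Q(2) P(2)] mod_tensor_simps simp flip: pure_def)
  finally show ?thesis by (simp add: cprod_def)
qed

text \<open>The balanced map is \<open>(q, p) \<mapsto> k(q) \<otimes> h(p)\<close>;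
  \<open>cc_balanced\<close> takes it directly, so the tensor product of two morphisms is not
  constructed separately.\<close>

lemma cprod_hom:
  assumes P: "fgm L P" "fgm L P'" "linear_form L P' f" "h \<in> rmod_hom (VA L) P P'" "p \<in> carrier P"
    and Q: "fgm L Q" "fgm L Q'" "linear_form L Q' g" "k \<in> rmod_hom (VA L) Q Q'" "q \<in> carrier Q"
  shows "cprod L P' f (h p) Q' g (k q) = cprod L P (\<lambda>x. f (h x)) p Q (\<lambda>x. g (k x)) q"
proof -
  interpret C: lr_module_pair \<kappa> L Q P by (rule fgm_pair[OF Q(1) P(1)])
  interpret D: lr_module_pair \<kappa> L Q' P' by (rule fgm_pair[OF Q(2) P(2)])
  have fg: "fgm L (mod_tensor L Q' P')" by (rule D.mod_tensor_fgm[OF Q(2) P(2)])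
  interpret N: lr_module \<kappa> L "mod_tensor L Q' P'" by (rule fgm_lr_module[OF fg])
  note cl = rmod_hom_closed[OF P(4)] rmod_hom_closed[OF Q(4)]
  note ac = rmod_hom_act[OF P(4)] rmod_hom_act[OF Q(4)]
  note ad = additive_add[OF rmod_hom_additive[OF P(4)]] additive_add[OF rmod_hom_additive[OF Q(4)]]
  have "cc L (mod_tensor L Q' P') (star g f) (pure L Q' P' (k q) (h p)) =
      cprod L P (\<lambda>x. f (h x)) p Q (\<lambda>x. g (k x)) q"
  proof (rule cc_balanced[OF P(1) linear_form_hom[OF P(4,3)] Q(1) linear_form_hom[OF Q(4,3)] fg
        D.linear_form_star[OF Q(3) P(3)]])
    show "balanced (amod L Q) (amod L P) (mod_tensor L Q' P') (\<lambda>q p. pure L Q' P' (k q) (h p))"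
      by (rule C.balancedI[OF N.M.abelian_group_axioms])
        (simp_all add: cl ac ad D.pure_add D.pure_act(2))
  qed (use P(5) Q(5) in \<open>simp_all add: cl ac D.pure_act D.star_tn P Q\<close>)
  then show ?thesis by (simp add: cprod_def)
qed

text \<open>The flip of a tensor product is a module morphism because the Leibniz rule is symmetric
  in the two factors, that is, because the comultiplication is cocommutative.\<close>

lemma cprod_commute:
  assumes P: "fgm L P" "linear_form L P f" "p \<in> carrier P" and Q: "fgm L Q" "linear_form L Q g" "q \<in> carrier Q"
  shows "cprod L P f p Q g q = cprod L Q g q P f p"
proof -
  interpret C: lr_module_pair \<kappa> L Q P by (rule fgm_pair[OF Q(1) P(1)])
  interpret D: lr_module_pair \<kappa> L P Q by (rule fgm_pair[OF P(1) Q(1)])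
  have fg: "fgm L (mod_tensor L P Q)" by (rule D.mod_tensor_fgm[OF P(1) Q(1)])
  interpret N: lr_module \<kappa> L "mod_tensor L P Q" by (rule fgm_lr_module[OF fg])
  note [simp] = C.Q.M.act_closed C.P.M.act_closed
  have "cc L (mod_tensor L P Q) (star f g) (pure L P Q p q) = cprod L P f p Q g q"
  proof (rule cc_balanced[OF P(1,2) Q(1,2) fg D.linear_form_star[OF P(2) Q(2)]])
    show "balanced (amod L Q) (amod L P) (mod_tensor L P Q) (\<lambda>q p. pure L P Q p q)"
      by (rule C.balancedI[OF N.M.abelian_group_axioms])
        (simp_all add: D.pure_add D.pure_act(2))
  qed (use P(3) Q(3) in \<open>simp_all add: D.pure_act D.star_tn P Q N.M.a_comm mult.commute\<close>)
  then show ?thesis by (simp add: cprod_def)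
qed

lemma cprod_add:
  assumes P: "fgm L P" "linear_form L P f" "p \<in> carrier P" and Q: "fgm L Q" "linear_form L Q g" "q \<in> carrier Q"
  shows "linear_form L P f' \<Longrightarrow> cprod L P (\<lambda>x. f x + f' x) p Q g q = cprod L P f p Q g q \<oplus>\<^bsub>U\<^esub> cprod L P f' p Q g q"
    and "p' \<in> carrier P \<Longrightarrow> cprod L P f (p \<oplus>\<^bsub>P\<^esub> p') Q g q = cprod L P f p Q g q \<oplus>\<^bsub>U\<^esub> cprod L P f p' Q g q"
proof -
  interpret C: lr_module_pair \<kappa> L Q P by (rule fgm_pair[OF Q(1) P(1)])
  have fg: "fgm L (mod_tensor L Q P)" by (rule C.mod_tensor_fgm[OF Q(1) P(1)])
  interpret N: lr_module \<kappa> L "mod_tensor L Q P" by (rule fgm_lr_module[OF fg])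
  show "cprod L P f (p \<oplus>\<^bsub>P\<^esub> p') Q g q = cprod L P f p Q g q \<oplus>\<^bsub>U\<^esub> cprod L P f p' Q g q" if "p' \<in> carrier P"
    unfolding cprod_def using that P Q
    by (simp add: C.pure_add cc_add_right[OF fg C.linear_form_star])
  show "cprod L P (\<lambda>x. f x + f' x) p Q g q = cprod L P f p Q g q \<oplus>\<^bsub>U\<^esub> cprod L P f' p Q g q"
    if f': "linear_form L P f'"
  proof -
    note sf = C.linear_form_star[OF Q(2) P(2)] C.linear_form_star[OF Q(2) f']
      C.linear_form_star[OF Q(2) linear_form_plus[OF P(2) f']]
    have "star g (\<lambda>x. f x + f' x) Z = star g f Z + star g f' Z" if "Z \<in> carrier (mod_tensor L Q P)" for Z
      by (rule C.linear_form_ext[OF sf(3) linear_form_plus[OF sf(1,2)]])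
        (use that P Q f' in \<open>simp_all add: C.star_tn linear_form_plus distrib_left C.mod_tensor_simps flip: pure_def\<close>)
    then have "cprod L P (\<lambda>x. f x + f' x) p Q g q =
        cc L (mod_tensor L Q P) (\<lambda>Z. star g f Z + star g f' Z) (pure L Q P q p)"
      unfolding cprod_def by (intro cc_cong fg)
    then show ?thesis
      using P Q by (simp add: cprod_def cc_add_left[OF fg sf(1,2)])
  qed
qed

lemma rmod_hom_id: "(\<lambda>x. x) \<in> rmod_hom (VA L) M M"
  by (simp add: rmod_hom_def)

lemma cprod_cong:
  assumes P: "fgm L P" "linear_form L P f" "p \<in> carrier P" and Q: "fgm L Q" "linear_form L Q g" "q \<in> carrier Q"
    and f: "\<And>x. x \<in> carrier P \<Longrightarrow> f x = f' x"
  shows "cprod L P f p Q g q = cprod L P f' p Q g q"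
proof -
  interpret C: lr_module_pair \<kappa> L Q P by (rule fgm_pair[OF Q(1) P(1)])
  have f': "linear_form L P f'" using P(2) linear_form_cong[OF fgm_module[OF P(1)] f] by simp
  have "star g f Z = star g f' Z" if "Z \<in> carrier (mod_tensor L Q P)" for Z
    by (rule C.linear_form_ext[OF C.linear_form_star[OF Q(2) P(2)] C.linear_form_star[OF Q(2) f']])
      (use that P Q f' f in \<open>simp_all add: C.star_tn C.mod_tensor_simps flip: pure_def\<close>)
  then show ?thesis unfolding cprod_def by (intro cc_cong C.mod_tensor_fgm P Q)
qed

lemma cprod_natural:
  assumes Q: "fgm L Q" "linear_form L Q g" "q \<in> carrier Q"
  shows "natural_coeff U (\<lambda>P f p. cprod L P f p Q g q)"
  unfolding natural_coeff_def
proof (intro conjI allI impI)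
  fix P P' :: "('a, 'l) rmod" and h f p
  assume "fgm L P" "fgm L P'" "h \<in> rmod_hom (VA L) P P'" "linear_form L P' f" "p \<in> carrier P"
  then show "cprod L P' f (h p) Q g q = cprod L P (\<lambda>m. f (h m)) p Q g q"
    using cprod_hom[OF _ _ _ _ _ Q(1,1,2) rmod_hom_id Q(3), of P P' f h p] by simp
next
  fix P :: "('a, 'l) rmod" and f f' :: "'a list \<Rightarrow> 'a" and p
  assume "fgm L P" "linear_form L P f" "p \<in> carrier P" "\<forall>m\<in>carrier P. f m = f' m"
  then show "cprod L P f p Q g q = cprod L P f' p Q g q" using cprod_cong[of P f p Q g q f'] Q by simp
qed (use Q in \<open>auto simp: cprod_closed cprod_add U.is_abelian_group\<close>)

text \<open>Inherited from the first argument through commutativity, except for morphisms, where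
  \<open>cprod_hom\<close> applies directly.\<close>

lemma cprod_natural': 
  assumes P: "fgm L P" "linear_form L P f" "p \<in> carrier P"
  shows "natural_coeff U (\<lambda>Q g q. cprod L P f p Q g q)"
proof -
  note N = cprod_natural[OF P]
  note D = natural_coeffD[OF N]
  note c = cprod_commute[OF P]
  show ?thesis
    unfolding natural_coeff_def
  proof (intro conjI allI impI U.is_abelian_group)
    fix Q :: "('a, 'l) rmod" and g q assume Q: "fgm L Q" "linear_form L Q g" "q \<in> carrier Q"
    interpret Q: lr_module \<kappa> L Q by (rule fgm_lr_module[OF Q(1)])
    show "cprod L P f p Q g q \<in> carrier U" using D(1)[OF Q] c[OF Q] by simp
    show "cprod L P f p Q g (q \<oplus>\<^bsub>Q\<^esub> q') = cprod L P f p Q g q \<oplus>\<^bsub>U\<^esub> cprod L P f p Q g q'"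
      if q': "q' \<in> carrier Q" for q'
      using D(3)[OF Q q'] c[OF Q] c[OF Q(1,2) q'] c[OF Q(1,2), of "q \<oplus>\<^bsub>Q\<^esub> q'"] Q q' by simp
    show "cprod L P f p Q g q = cprod L P f p Q g' q" if g': "\<forall>m\<in>carrier Q. g m = g' m" for g'
    proof -
      have "linear_form L Q g'" using Q(2) g' linear_form_cong[OF fgm_module[OF Q(1)], of g g'] by blast
      then show ?thesis using D(5)[OF Q, of g'] g' c[OF Q] c[OF Q(1) _ Q(3), of g'] by simp
    qed
  next
    fix Q :: "('a, 'l) rmod" and g g' q
    assume Q: "fgm L Q" "linear_form L Q g" "linear_form L Q g'" "q \<in> carrier Q"
    then show "cprod L P f p Q (\<lambda>m. g m + g' m) q = cprod L P f p Q g q \<oplus>\<^bsub>U\<^esub> cprod L P f p Q g' q"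
      using D(2)[OF Q(1,2,4,3)] by (simp add: c linear_form_plus)
  next
    fix Q Q' :: "('a, 'l) rmod" and h g q
    assume Q: "fgm L Q" "fgm L Q'" "h \<in> rmod_hom (VA L) Q Q'" "linear_form L Q' g" "q \<in> carrier Q"
    show "cprod L P f p Q' g (h q) = cprod L P f p Q (\<lambda>m. g (h m)) q"
      using cprod_hom[OF P(1,1,2) rmod_hom_id P(3) Q(1,2,4,3,5)] .
  qed
qed

lemma coeff_mult_cprod:
  assumes "(P, f, p) \<in> coeffs L" "(Q, g, q) \<in> coeffs L"
  shows "coeff_mult L (P, f, p) (Q, g, q) \<in> coeffs L"
    and "ccls L [coeff_mult L (P, f, p) (Q, g, q)] = cprod L P f p Q g q"
proof -
  have P: "fgm L P" "linear_form L P f" "p \<in> carrier P" and Q: "fgm L Q" "linear_form L Q g" "q \<in> carrier Q"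
    using assms by (auto simp: coeffs_iff mdual_iff)
  interpret C: lr_module_pair \<kappa> L Q P by (rule fgm_pair[OF Q(1) P(1)])
  have "coeff_mult L (P, f, p) (Q, g, q) = transport L (mod_tensor L Q P) (star g f) (pure L Q P q p)"
    by (simp add: coeff_mult_def star_def tlift_def[abs_def] pure_def tn_def)
  then show "coeff_mult L (P, f, p) (Q, g, q) \<in> coeffs L"
    "ccls L [coeff_mult L (P, f, p) (Q, g, q)] = cprod L P f p Q g q"
    using transport_coeffs[OF C.mod_tensor_fgm[OF Q(1) P(1)] C.linear_form_star[OF Q(2) P(2)] C.pure_closed[OF Q(3) P(3)]]
    by (simp_all add: cprod_def cc_def)
qed

text \<open>The product is lifted in two stages: over the second factor for a fixed coefficient,
  then over the first. This is the compatibility that the second stage requires.\<close>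

lemma fdlift_cprod_natural:
  assumes Y: "Y \<in> carrier U"
  shows "natural_coeff U (\<lambda>P f p. fdlift U (\<lambda>Q g q. cprod L P f p Q g q) Y)"
proof -
  note ag = U.is_abelian_group
  note ext = fdual_ext[OF _ _ ag Y]
  have ad: "additive U U (fdlift U (\<lambda>Q g q. cprod L P f p Q g q))"
    if "fgm L P" "linear_form L P f" "p \<in> carrier P" for P :: "('a, 'l) rmod" and f p
    using that by (intro fdlift_additive cprod_natural')
  note fd = fdlift_cc[OF cprod_natural']
  show ?thesis
    unfolding natural_coeff_def
  proof (intro conjI allI impI ag)
    fix P :: "('a, 'l) rmod" and f p assume P: "fgm L P" "linear_form L P f" "p \<in> carrier P"
    interpret P: lr_module \<kappa> L P by (rule fgm_lr_module[OF P(1)])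
    show "fdlift U (\<lambda>Q g q. cprod L P f p Q g q) Y \<in> carrier U" by (rule additive_closed[OF ad[OF P] Y])
    show "fdlift U (\<lambda>Q g q. cprod L P f (p \<oplus>\<^bsub>P\<^esub> q') Q g q) Y =
        fdlift U (\<lambda>Q g q. cprod L P f p Q g q) Y \<oplus>\<^bsub>U\<^esub> fdlift U (\<lambda>Q g q. cprod L P f q' Q g q) Y"
      if q': "q' \<in> carrier P" for q'
      by (rule ext[OF ad[OF P(1,2)] additive_add_fun[OF ag ag ad[OF P] ad[OF P(1,2) q']]])
        (use P q' in \<open>simp_all add: fd cprod_add\<close>)
    show "fdlift U (\<lambda>Q g q. cprod L P f p Q g q) Y = fdlift U (\<lambda>Q g q. cprod L P f' p Q g q) Y"
      if f': "\<forall>m\<in>carrier P. f m = f' m" for f'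
    proof -
      have "linear_form L P f'" using P(2) f' linear_form_cong[OF fgm_module[OF P(1)], of f f'] by blast
      then show ?thesis
        by (intro ext[OF ad[OF P] ad[OF P(1) _ P(3)]]) (use P f' in \<open>simp_all add: fd cprod_cong[of P f p _ _ _ f']\<close>)
    qed
  next
    fix P :: "('a, 'l) rmod" and f f' p
    assume P: "fgm L P" "linear_form L P f" "linear_form L P f'" "p \<in> carrier P"
    show "fdlift U (\<lambda>Q g q. cprod L P (\<lambda>m. f m + f' m) p Q g q) Y =
        fdlift U (\<lambda>Q g q. cprod L P f p Q g q) Y \<oplus>\<^bsub>U\<^esub> fdlift U (\<lambda>Q g q. cprod L P f' p Q g q) Y"
      by (rule ext[OF ad[OF P(1) linear_form_plus[OF P(2,3)] P(4)]
            additive_add_fun[OF ag ag ad[OF P(1,2,4)] ad[OF P(1,3,4)]]])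
        (use P in \<open>simp_all add: fd cprod_add linear_form_plus\<close>)
  next
    fix P P' :: "('a, 'l) rmod" and h f p
    assume *: "fgm L P" "fgm L P'" "h \<in> rmod_hom (VA L) P P'" "linear_form L P' f" "p \<in> carrier P"
    have **: "linear_form L P (\<lambda>m. f (h m))" "h p \<in> carrier P'"
      using linear_form_hom[OF *(3,4)] rmod_hom_closed[OF *(3,5)] .
    show "fdlift U (\<lambda>Q g q. cprod L P' f (h p) Q g q) Y = fdlift U (\<lambda>Q g q. cprod L P (\<lambda>m. f (h m)) p Q g q) Y"
    proof (rule ext[OF ad[OF *(2,4) **(2)] ad[OF *(1) **(1) *(5)]])
      fix Q :: "('a, 'l) rmod" and g q assume Q: "fgm L Q" "linear_form L Q g" "q \<in> carrier Q"
      show "fdlift U (\<lambda>Q g q. cprod L P' f (h p) Q g q) (cc L Q g q) =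
          fdlift U (\<lambda>Q g q. cprod L P (\<lambda>m. f (h m)) p Q g q) (cc L Q g q)"
        using cprod_hom[OF *(1,2,4,3,5) Q(1,1,2) rmod_hom_id Q(3)] * ** Q by (simp add: fd)
    qed
  qed
qed

lemma mult_fdlift:
  assumes "X \<in> carrier U" "Y \<in> carrier U"
  shows "X \<otimes>\<^bsub>U\<^esub> Y = fdlift U (\<lambda>P f p. fdlift U (\<lambda>Q g q. cprod L P f p Q g q) Y) X"
proof -
  have *: "ccls L [coeff_mult L g h. g \<leftarrow> x, h \<leftarrow> y] = lsum U [fdlift U (\<lambda>Q g q. cprod L P f p Q g q) Y. (P, f, p) \<leftarrow> x]"
    if x: "x \<in> X" and y: "y \<in> Y" for x y
  proof -
    have xs: "set x \<subseteq> coeffs L" and ys: "set y \<subseteq> coeffs L"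
      using U.carrier_memD(1)[OF assms(1) x] U.carrier_memD(1)[OF assms(2) y] .
    have cm: "coeff_mult L g h \<in> coeffs L" if "g \<in> set x" "h \<in> set y" for g h
    proof -
      have "g \<in> coeffs L" "h \<in> coeffs L" using that xs ys by auto
      then show ?thesis using coeff_mult_cprod(1) by (cases g, cases h) simp
    qed
    then have cl: "set [coeff_mult L g h. g \<leftarrow> x, h \<leftarrow> y] \<subseteq> coeffs L"
      by (simp add: UN_subset_iff image_subset_iff)
    have "ccls L [coeff_mult L g h. g \<leftarrow> x, h \<leftarrow> y] =
        lsum U (concat [[ccls L [coeff_mult L g h]. h \<leftarrow> y]. g \<leftarrow> x])"
      unfolding ccls_pcls U.pcls_lsum[OF cl] by (simp add: map_concat o_def)
    also have "\<dots> = lsum U [lsum U [ccls L [coeff_mult L g h]. h \<leftarrow> y]. g \<leftarrow> x]"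
      by (rule U.lsum_concat) (use cm in \<open>simp add: image_subset_iff ccls_pcls U.pcls_closed\<close>)
    also have "\<dots> = lsum U [fdlift U (\<lambda>Q g q. cprod L P f p Q g q) Y. (P, f, p) \<leftarrow> x]"
    proof (intro lsum_cong, clarify)
      fix P f p assume "(P, f, p) \<in> set x"
      then have Pc: "(P, f, p) \<in> coeffs L" using xs by auto
      then have P: "fgm L P" "linear_form L P f" "p \<in> carrier P" by (auto simp: coeffs_iff mdual_iff)
      have "lsum U [ccls L [coeff_mult L (P, f, p) h]. h \<leftarrow> y] = lsum U (map (\<lambda>(Q, g, q). cprod L P f p Q g q) y)"
        using ys Pc by (intro lsum_cong) (auto simp: coeff_mult_cprod(2))
      then show "lsum U [ccls L [coeff_mult L (P, f, p) h]. h \<leftarrow> y] = fdlift U (\<lambda>Q g q. cprod L P f p Q g q) Y"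
        unfolding fdlift_def using U.plift_mem[OF natural_compat[OF cprod_natural'[OF P]] assms(2) y] by simp
    qed
    finally show ?thesis .
  qed
  have **: "(\<Union>y\<in>Y. ccls L [coeff_mult L g h. g \<leftarrow> x, h \<leftarrow> y]) =
      lsum U [fdlift U (\<lambda>Q g q. cprod L P f p Q g q) Y. (P, f, p) \<leftarrow> x]" if "x \<in> X" for x
    using U.rep_mem[OF assms(2)] *[OF that] by blast
  have "X \<otimes>\<^bsub>U\<^esub> Y = (\<Union>x\<in>X. lsum U [fdlift U (\<lambda>Q g q. cprod L P f p Q g q) Y. (P, f, p) \<leftarrow> x])"
    using ** by (simp add: finite_dual_simps)
  also have "\<dots> = fdlift U (\<lambda>P f p. fdlift U (\<lambda>Q g q. cprod L P f p Q g q) Y) X"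
    unfolding fdlift_def[of U "\<lambda>P f p. fdlift U (\<lambda>Q g q. cprod L P f p Q g q) Y"]
    by (rule U.UN_plift[OF natural_compat[OF fdlift_cprod_natural[OF assms(2)]] assms(1)])
  finally show ?thesis .
qed

text \<open>With a representative of \<open>X\<close> fixed, the product is a finite sum of lifted
  maps in \<open>Y\<close>.\<close>

lemma mult_additive_right: 
  assumes "X \<in> carrier U"
  shows "additive U U (\<lambda>Y. X \<otimes>\<^bsub>U\<^esub> Y)"
proof -
  note X = U.rep_mem[OF assms]
  have A: "additive U U (\<lambda>Y. lsum U [fdlift U (\<lambda>Q g q. cprod L P f p Q g q) Y. (P, f, p) \<leftarrow> rep X])"
    unfolding case_prod_unfold
  proof (intro additive_lsum_fun U.is_abelian_group fdlift_additive cprod_natural')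
    fix g assume "g \<in> set (rep X)"
    then have "g \<in> coeffs L" using U.carrier_memD(1)[OF assms X] by blast
    then obtain P f p where "g = (P, f, p)" "(P, f, p) \<in> coeffs L" by (cases g) auto
    then show "fgm L (fst g)" "linear_form L (fst g) (fst (snd g))" "snd (snd g) \<in> carrier (fst g)"
      by (auto simp: coeffs_iff mdual_iff)
  qed
  have E: "X \<otimes>\<^bsub>U\<^esub> Y = lsum U [fdlift U (\<lambda>Q g q. cprod L P f p Q g q) Y. (P, f, p) \<leftarrow> rep X]"
    if "Y \<in> carrier U" for Y
    unfolding mult_fdlift[OF assms that] fdlift_def[of U "\<lambda>P f p. fdlift U (\<lambda>Q g q. cprod L P f p Q g q) Y"]
      plift_def ..
  show ?thesis by (rule iffD2[OF additive_cong[OF U.is_abelian_group E] A])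
qed

lemma mult_additive_left: 
  assumes "Y \<in> carrier U"
  shows "additive U U (\<lambda>X. X \<otimes>\<^bsub>U\<^esub> Y)"
proof -
  show ?thesis
    by (rule iffD2[OF additive_cong[OF U.is_abelian_group] fdlift_additive[OF fdlift_cprod_natural[OF assms]]])
      (rule mult_fdlift[OF _ assms])
qed

lemma mult_cc_object:
  fixes P Q :: "('a, 'l) rmod"
  assumes P: "fgm L P" "linear_form L P f" "p \<in> carrier P" and Q: "fgm L Q" "linear_form L Q g" "q \<in> carrier Q"
  shows "cc L P f p \<otimes>\<^bsub>U\<^esub> cc L Q g q = cprod L P f p Q g q"
proof -
  have Y: "cc L Q g q \<in> carrier U" using Q by (rule cc_closed)
  have X: "cc L P f p \<in> carrier U" using P by (rule cc_closed)
  show ?thesis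
    using P Q by (simp add: mult_fdlift[OF X Y] fdlift_cc[OF fdlift_cprod_natural[OF Y]] fdlift_cc[OF cprod_natural'])
qed

lemma mult_cc:
  assumes P: "fgm L P" "linear_form L P f" "p \<in> carrier P" and Q: "fgm L Q" "linear_form L Q g" "q \<in> carrier Q"
  shows "cc L P f p \<otimes>\<^bsub>U\<^esub> cc L Q g q = cprod L P f p Q g q"
proof -
  obtain R :: "('a, 'l) rmod" and h where R: "fgm L R" "h \<in> rmod_hom (VA L) P R"
    "inv_into (carrier P) h \<in> rmod_hom (VA L) R P"
    "\<And>x. x \<in> carrier P \<Longrightarrow> inv_into (carrier P) h (h x) = x"
    "linear_form L R (\<lambda>r. f (inv_into (carrier P) h r))"
    "\<And>f m. linear_form L P f \<Longrightarrow> m \<in> carrier P \<Longrightarrow> cc L P f m = cc L R (\<lambda>r. f (inv_into (carrier P) h r)) (h m)"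
    using cc_realize[OF P] by metis
  obtain S :: "('a, 'l) rmod" and k where S: "fgm L S" "k \<in> rmod_hom (VA L) Q S"
    "inv_into (carrier Q) k \<in> rmod_hom (VA L) S Q"
    "\<And>x. x \<in> carrier Q \<Longrightarrow> inv_into (carrier Q) k (k x) = x"
    "linear_form L S (\<lambda>r. g (inv_into (carrier Q) k r))"
    "\<And>f m. linear_form L Q f \<Longrightarrow> m \<in> carrier Q \<Longrightarrow> cc L Q f m = cc L S (\<lambda>r. f (inv_into (carrier Q) k r)) (k m)"
    using cc_realize[OF Q] by metis
  note cl = rmod_hom_closed[OF R(2) P(3)] rmod_hom_closed[OF S(2) Q(3)]
  have "cc L P f p \<otimes>\<^bsub>U\<^esub> cc L Q g q =
      cprod L R (\<lambda>r. f (inv_into (carrier P) h r)) (h p) S (\<lambda>r. g (inv_into (carrier Q) k r)) (k q)"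
    using P Q R(6) S(6) by (simp add: mult_cc_object[OF R(1,5) cl(1) S(1,5) cl(2)])
  also have "\<dots> = cprod L P f (inv_into (carrier P) h (h p)) Q g (inv_into (carrier Q) k (k q))"
    by (rule cprod_hom[OF R(1) P(1,2) R(3) cl(1) S(1) Q(1,2) S(3) cl(2), symmetric])
  finally show ?thesis using R(4)[OF P(3)] S(4)[OF Q(3)] by simp
qed

lemma fdual_mult_closed: "X \<in> carrier U \<Longrightarrow> Y \<in> carrier U \<Longrightarrow> X \<otimes>\<^bsub>U\<^esub> Y \<in> carrier U"
  using additive_closed[OF mult_additive_left] .

lemma fdual_mult_comm:
  assumes "X \<in> carrier U" "Y \<in> carrier U"
  shows "X \<otimes>\<^bsub>U\<^esub> Y = Y \<otimes>\<^bsub>U\<^esub> X"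
proof -
  note ag = U.is_abelian_group
  have 1: "X \<otimes>\<^bsub>U\<^esub> cc L Q g q = cc L Q g q \<otimes>\<^bsub>U\<^esub> X"
    if Q: "fgm L Q" "linear_form L Q g" "q \<in> carrier Q" for Q :: "('a, 'l) rmod" and g q
  proof (rule fdual_ext[OF mult_additive_left[OF cc_closed[OF Q]] mult_additive_right[OF cc_closed[OF Q]] ag assms(1)])
    fix P :: "('a, 'l) rmod" and f p assume P: "fgm L P" "linear_form L P f" "p \<in> carrier P"
    show "cc L P f p \<otimes>\<^bsub>U\<^esub> cc L Q g q = cc L Q g q \<otimes>\<^bsub>U\<^esub> cc L P f p"
      by (simp only: mult_cc[OF P Q] mult_cc[OF Q P] cprod_commute[OF P Q])
  qed
  show ?thesis
    by (rule fdual_ext[OF mult_additive_right[OF assms(1)] mult_additive_left[OF assms(1)] ag assms(2)])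
      (simp add: 1)
qed

text \<open>The reassociation \<open>(r \<otimes> q) \<otimes> p \<mapsto> r \<otimes> (q \<otimes>
  p)\<close> is lifted in its first variable with \<open>p\<close> fixed. The result
  \<open>G\<close> is a balanced Leibniz map, so \<open>cc_balanced\<close> compares the two
  products.\<close>

lemma cprod_assoc:
  assumes P: "fgm L P" "linear_form L P f" "p \<in> carrier P" and Q: "fgm L Q" "linear_form L Q g" "q \<in> carrier Q"
    and R: "fgm L R" "linear_form L R h" "r \<in> carrier R"
  shows "(cc L P f p \<otimes>\<^bsub>U\<^esub> cc L Q g q) \<otimes>\<^bsub>U\<^esub> cc L R h r = cc L P f p \<otimes>\<^bsub>U\<^esub> (cc L Q g q \<otimes>\<^bsub>U\<^esub> cc L R h r)"
proof -
  interpret QP: lr_module_pair \<kappa> L Q P by (rule fgm_pair[OF Q(1) P(1)])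
  interpret RQ: lr_module_pair \<kappa> L R Q by (rule fgm_pair[OF R(1) Q(1)])
  let ?QP = "mod_tensor L Q P" and ?RQ = "mod_tensor L R Q"
  have fQP: "fgm L ?QP" "fgm L ?RQ" using P Q R by (simp_all add: QP.mod_tensor_fgm RQ.mod_tensor_fgm)
  interpret A: lr_module_pair \<kappa> L R ?QP by (rule fgm_pair[OF R(1) fQP(1)])
  interpret B: lr_module_pair \<kappa> L ?RQ P by (rule fgm_pair[OF fQP(2) P(1)])
  let ?N = "mod_tensor L R ?QP"
  have fN: "fgm L ?N" by (rule A.mod_tensor_fgm[OF R(1) fQP(1)])
  interpret N: lr_module \<kappa> L ?N by (rule fgm_lr_module[OF fN])
  note [simp del] = QP.mod_tensor_simps RQ.mod_tensor_simps A.mod_tensor_simps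
  note ag = N.M.abelian_group_axioms
  note [simp] = QP.P.M.act_closed QP.Q.M.act_closed RQ.Q.M.act_closed
  let ?b = "\<lambda>p r q. pure L R ?QP r (pure L Q P q p)"
  have bal: "balanced (amod L R) (amod L Q) ?N (?b p)" if "p \<in> carrier P" for p
    by (rule RQ.balancedI[OF ag])
      (use that in \<open>simp_all add: A.pure_add QP.pure_add A.pure_act(2) QP.pure_act\<close>)
  define G where "G = (\<lambda>T p. tlift ?N (?b p) T)"
  have G: "G (pure L R Q r q) p = pure L R ?QP r (pure L Q P q p)"
    if "r \<in> carrier R" "q \<in> carrier Q" "p \<in> carrier P" for r q p
    unfolding G_def by (rule RQ.tlift_pure[OF bal]) (use that in auto)
  have T_eq: "carrier ?RQ = carrier (tensor (amod L R) (amod L Q))" "add ?RQ = add (tensor (amod L R) (amod L Q))"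
    by (simp_all add: RQ.mod_tensor_simps)
  have Gad: "additive ?RQ ?N (\<lambda>T. G T p)" if "p \<in> carrier P" for p
    using RQ.TT.tlift_additive[OF bal[OF that]] by (simp add: G_def additive_def T_eq)
  have ext: "h T = k T" if "additive ?RQ ?N h" "additive ?RQ ?N k" "T \<in> carrier ?RQ"
    "\<And>r q. r \<in> carrier R \<Longrightarrow> q \<in> carrier Q \<Longrightarrow> h (pure L R Q r q) = k (pure L R Q r q)" for h k T
    by (rule RQ.TT.tensor_ext[of ?N h k]) (use that ag in \<open>auto simp: additive_def T_eq pure_def\<close>)
  have act: "additive ?RQ ?RQ (smult ?RQ u)" "additive ?N ?N (smult ?N u)" if "u \<in> carrier (VA L)" for u
    using B.Q.act_additive[OF that] N.act_additive[OF that] .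
  have Gadd: "G T (p \<oplus>\<^bsub>P\<^esub> p') = G T p \<oplus>\<^bsub>?N\<^esub> G T p'" if "p \<in> carrier P" "p' \<in> carrier P" "T \<in> carrier ?RQ" for T p p'
    by (rule ext[OF Gad additive_add_fun[OF B.Q.M.abelian_group_axioms ag Gad Gad]])
      (use that in \<open>simp_all add: G QP.pure_add A.pure_add\<close>)
  have GA: "G (iotaA L a \<odot>\<^bsub>?RQ\<^esub> T) p = iotaA L a \<odot>\<^bsub>?N\<^esub> G T p" if "p \<in> carrier P" "T \<in> carrier ?RQ" for T p a
    by (rule ext[OF additive_comp[OF act(1) Gad] additive_comp[OF Gad act(2)]])
      (use that in \<open>simp_all add: G RQ.pure_act(1) A.pure_act(1)\<close>)
  have GA': "G (iotaA L a \<odot>\<^bsub>?RQ\<^esub> T) p = G T (iotaA L a \<odot>\<^bsub>P\<^esub> p)" if "p \<in> carrier P" "T \<in> carrier ?RQ" for T p a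
    by (rule ext[OF additive_comp[OF act(1) Gad] Gad])
      (use that in \<open>simp_all add: G RQ.pure_act(1) A.pure_act(2) QP.pure_act\<close>)
  \<comment> \<open>Both sides are the sum of the three terms in which \<open>X\<close> acts on
    \<open>r\<close>, on \<open>q\<close> or on \<open>p\<close>.\<close>
  have GL: "G (iotaL L X \<odot>\<^bsub>?RQ\<^esub> T) p \<oplus>\<^bsub>?N\<^esub> G T (iotaL L X \<odot>\<^bsub>P\<^esub> p) = iotaL L X \<odot>\<^bsub>?N\<^esub> G T p"
    if "p \<in> carrier P" "T \<in> carrier ?RQ" "X \<in> carrier L" for T p X
    by (rule ext[OF additive_add_fun[OF B.Q.M.abelian_group_axioms ag additive_comp[OF act(1) Gad] Gad]
          additive_comp[OF Gad act(2)]])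
      (use that in \<open>simp_all add: G RQ.pure_act(3) A.pure_act(3) QP.pure_act(3) A.pure_add N.M.a_assoc
        additive_add[OF Gad]\<close>)
  note sg = QP.linear_form_star[OF Q(2) P(2)] and sh = RQ.linear_form_star[OF R(2) Q(2)]
  note sN = A.linear_form_star[OF R(2) sg]
  have bG: "balanced (amod L ?RQ) (amod L P) ?N G"
    by (rule B.balancedI[OF ag]) (simp_all add: additive_closed[OF Gad] additive_add[OF Gad] Gadd GA')
  have F: "star h (star g f) (G T p) = star h g T * f p" if "T \<in> carrier ?RQ" "p \<in> carrier P" for T p
  proof -
    have "additive ?N regular_bimod (star h (star g f))" using sN by (simp add: linear_form_def additive_def)
    from additive_comp[OF Gad[OF that(2)] this]
    have 1: "additive (tensor (amod L R) (amod L Q)) regular_bimod (\<lambda>T. star h (star g f) (G T p))"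
      by (simp add: additive_def T_eq)
    have 2: "additive (tensor (amod L R) (amod L Q)) regular_bimod (\<lambda>T. star h g T * f p)"
      using sh by (simp add: linear_form_def additive_def T_eq distrib_right)
    show ?thesis
      by (rule RQ.TT.tensor_ext[OF 1 2 regular_abelian_group])
        (use that G P Q R sg in \<open>simp_all add: T_eq A.star_tn QP.star_tn RQ.star_tn mult.assoc flip: pure_def\<close>)
  qed
  have "(cc L P f p \<otimes>\<^bsub>U\<^esub> cc L Q g q) \<otimes>\<^bsub>U\<^esub> cc L R h r = cc L ?N (star h (star g f)) (pure L R ?QP r (pure L Q P q p))"
    using P Q R by (simp add: mult_cc[OF P Q] mult_cc[OF fQP(1) sg _ R] cprod_def)
  also have "\<dots> = cc L ?N (star h (star g f)) (G (pure L R Q r q) p)" using P Q R by (simp add: G)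
  also have "\<dots> = cprod L P f p ?RQ (star h g) (pure L R Q r q)"
    by (rule cc_balanced[OF P(1,2) fQP(2) sh fN sN bG]) (use GA GL F P Q R in simp_all)
  also have "\<dots> = cc L P f p \<otimes>\<^bsub>U\<^esub> (cc L Q g q \<otimes>\<^bsub>U\<^esub> cc L R h r)"
    using P Q R by (simp add: mult_cc[OF P fQP(2) sh] mult_cc[OF Q R] cprod_def[of L Q])
  finally show ?thesis .
qed

section \<open>The unit, and the two actions as multiplications\<close>

lemma unit_mod_basis: "dual_basis L (unit_mod L) [(1, \<lambda>x. x)]"
  by (auto simp: dual_basis_def mdual_iff linear_form_def mult.commute extensional_def)

lemma unit_mod_fgm: "fgm L (unit_mod L)"
  by (rule fgmI[OF unit_mod_module unit_mod_basis])

lemma unit_form: "linear_form L (unit_mod L) (\<lambda>x. a * x)"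
  by (simp add: linear_form_def algebra_simps)

lemma fdual_unit_cc: "fdual_unit L a b = cc L (unit_mod L) (\<lambda>x. a * x) b"
  by (simp add: fdual_unit_def cc_def)

lemma fdual_unit_closed: "fdual_unit L a b \<in> carrier U"
  unfolding fdual_unit_cc by (intro cc_closed unit_mod_fgm unit_form) simp

text \<open>The comparison of \<open>A \<otimes> P\<close> with \<open>P\<close> is the map
  \<open>b \<otimes> p \<mapsto> p b\<close>, which obeys the Leibniz rule because \<open>X\<close>
  acts on the unit object by \<open>- X(b)\<close>. The formula contains the unit law and describes
  both actions as multiplication by source and target.\<close>

lemma fdual_unit_mult:
  assumes "fgm L P" "linear_form L P f" "p \<in> carrier P"
  shows "cc L P f p \<otimes>\<^bsub>U\<^esub> fdual_unit L a b = cc L P (\<lambda>x. a * f x) (iotaA L b \<odot>\<^bsub>P\<^esub> p)"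
proof -
  interpret P: lr_module \<kappa> L P by (rule fgm_lr_module[OF assms(1)])
  interpret C: lr_module_pair \<kappa> L "unit_mod L" P by (rule fgm_pair[OF unit_mod_fgm assms(1)])
  \<comment> \<open>The term with \<open>- X(q)\<close> cancels the one that arises when
    \<open>q\<close> is moved past \<open>X\<close>.\<close>
  have Lb: "iotaA L (- anchor L X q) \<odot>\<^bsub>P\<^esub> p \<oplus>\<^bsub>P\<^esub> iotaA L q \<odot>\<^bsub>P\<^esub> (iotaL L X \<odot>\<^bsub>P\<^esub> p) =
      iotaL L X \<odot>\<^bsub>P\<^esub> (iotaA L q \<odot>\<^bsub>P\<^esub> p)" if "p \<in> carrier P" "X \<in> carrier L" for X q p
  proof -
    have "iotaA L (- anchor L X q) \<odot>\<^bsub>P\<^esub> p \<oplus>\<^bsub>P\<^esub> iotaA L (anchor L X q) \<odot>\<^bsub>P\<^esub> p = \<zero>\<^bsub>P\<^esub>"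
      using that P.amod.zero_lact[of p] P.M.act_add_left[of "iotaA L (- anchor L X q)" "iotaA L (anchor L X q)" p]
      by (simp flip: iotaA_add)
    moreover have "iotaA L q \<odot>\<^bsub>P\<^esub> (iotaL L X \<odot>\<^bsub>P\<^esub> p) = iotaA L (anchor L X q) \<odot>\<^bsub>P\<^esub> p \<oplus>\<^bsub>P\<^esub> iotaL L X \<odot>\<^bsub>P\<^esub> (iotaA L q \<odot>\<^bsub>P\<^esub> p)"
      using that by (simp add: P.act_anchor P.M.a_comm P.M.act_closed)
    ultimately show ?thesis
      using that by (simp add: P.M.act_closed flip: P.M.a_assoc)
  qed
  have "cc L P (\<lambda>x. a * f x) (iotaA L b \<odot>\<^bsub>P\<^esub> p) = cprod L P f p (unit_mod L) (\<lambda>x. a * x) b"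
  proof (rule cc_balanced[OF assms(1,2) unit_mod_fgm unit_form assms(1) linear_form_scale[OF assms(2)]])
    show "balanced (amod L (unit_mod L)) (amod L P) P (\<lambda>b p. iotaA L b \<odot>\<^bsub>P\<^esub> p)"
      by (rule C.balancedI[OF P.M.abelian_group_axioms])
        (auto simp: iotaA_add P.M.act_add_left P.M.act_add_right P.M.act_closed P.act_A, metis P.act_A_commute)
  qed (use assms in \<open>auto simp: P.act_A linear_form_smult mult.assoc Lb\<close>)
  then show ?thesis
    using mult_cc[OF assms unit_mod_fgm unit_form, of b] by (simp add: fdual_unit_cc)
qed

lemma fdual_unit_mult': 
  assumes X: "X \<in> carrier U"
  shows "X \<otimes>\<^bsub>U\<^esub> fdual_unit L a b = ract U (lact U a X) b"
  using mult_additive_left[OF fdual_unit_closed[of a b]] additive_comp[OF lact_additive[of a] ract_additive[of b]]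
    U.is_abelian_group X
  by (rule fdual_ext) (simp add: fdual_unit_mult lact_cc ract_cc linear_form_scale)

theorem finite_dual_cring: "cring U"
proof -
  note ag = U.is_abelian_group
  interpret bimodule \<kappa> U by (rule finite_dual_bimodule)
  have one: "\<one>\<^bsub>U\<^esub> = fdual_unit L 1 1" "\<one>\<^bsub>U\<^esub> \<in> carrier U" by (simp_all add: finite_dual_simps(5) fdual_unit_closed)
  have r_one: "X \<otimes>\<^bsub>U\<^esub> \<one>\<^bsub>U\<^esub> = X" if "X \<in> carrier U" for X
    using that by (simp add: one fdual_unit_mult' one_lact one_ract)
  have assoc: "(X \<otimes>\<^bsub>U\<^esub> Y) \<otimes>\<^bsub>U\<^esub> Z = X \<otimes>\<^bsub>U\<^esub> (Y \<otimes>\<^bsub>U\<^esub> Z)" if X: "X \<in> carrier U" and Y: "Y \<in> carrier U" and Z: "Z \<in> carrier U" for X Y Z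
  proof (rule fdual_ext[OF _ _ ag X])
    show "additive U U (\<lambda>X. (X \<otimes>\<^bsub>U\<^esub> Y) \<otimes>\<^bsub>U\<^esub> Z)" "additive U U (\<lambda>X. X \<otimes>\<^bsub>U\<^esub> (Y \<otimes>\<^bsub>U\<^esub> Z))"
      using additive_comp[OF mult_additive_left[OF Y] mult_additive_left[OF Z]]
        mult_additive_left[OF fdual_mult_closed[OF Y Z]] .
    fix P :: "('a, 'l) rmod" and f p assume P: "fgm L P" "linear_form L P f" "p \<in> carrier P"
    let ?p = "cc L P f p"
    have p: "?p \<in> carrier U" using P by (rule cc_closed)
    show "(?p \<otimes>\<^bsub>U\<^esub> Y) \<otimes>\<^bsub>U\<^esub> Z = ?p \<otimes>\<^bsub>U\<^esub> (Y \<otimes>\<^bsub>U\<^esub> Z)"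
    proof (rule fdual_ext[OF _ _ ag Y])
      show "additive U U (\<lambda>Y. (?p \<otimes>\<^bsub>U\<^esub> Y) \<otimes>\<^bsub>U\<^esub> Z)" "additive U U (\<lambda>Y. ?p \<otimes>\<^bsub>U\<^esub> (Y \<otimes>\<^bsub>U\<^esub> Z))"
        using additive_comp[OF mult_additive_right[OF p] mult_additive_left[OF Z]]
          additive_comp[OF mult_additive_left[OF Z] mult_additive_right[OF p]] .
      fix Q :: "('a, 'l) rmod" and g q assume Q: "fgm L Q" "linear_form L Q g" "q \<in> carrier Q"
      let ?q = "cc L Q g q"
      have q: "?q \<in> carrier U" using Q by (rule cc_closed)
      show "(?p \<otimes>\<^bsub>U\<^esub> ?q) \<otimes>\<^bsub>U\<^esub> Z = ?p \<otimes>\<^bsub>U\<^esub> (?q \<otimes>\<^bsub>U\<^esub> Z)"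
        by (rule fdual_ext[OF mult_additive_right[OF fdual_mult_closed[OF p q]]
              additive_comp[OF mult_additive_right[OF q] mult_additive_right[OF p]] ag Z])
          (rule cprod_assoc[OF P Q])
    qed
  qed
  show ?thesis
  proof (rule cringI[OF ag])
    show "comm_monoid U"
    proof (rule comm_monoidI)
      show "X \<otimes>\<^bsub>U\<^esub> Y = Y \<otimes>\<^bsub>U\<^esub> X" if "X \<in> carrier U" "Y \<in> carrier U" for X Y
        using that by (rule fdual_mult_comm)
    qed (simp_all add: fdual_mult_closed one(2) assoc fdual_mult_comm[of "\<one>\<^bsub>U\<^esub>"] r_one)
  qed (rule additive_add[OF mult_additive_left])
qed

text \<open>The factors change places on the right because the product of coefficients is formed on
  \<open>Q \<otimes> P\<close>, where the first leg of the coproduct acts on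
  \<open>Q\<close>.\<close>

lemma zeta_mult_cc:
  assumes P: "fgm L P" "linear_form L P f" "p \<in> carrier P" and Q: "fgm L Q" "linear_form L Q g" "q \<in> carrier Q"
    and u: "u \<in> carrier (VA L)" and us: "us \<in> ucomult L u"
  shows "zeta L (cc L P f p \<otimes>\<^bsub>U\<^esub> cc L Q g q) u = (\<Sum>(x, y) \<leftarrow> us. zeta L (cc L Q g q) x * zeta L (cc L P f p) y)"
proof -
  interpret C: lr_module_pair \<kappa> L Q P by (rule fgm_pair[OF Q(1) P(1)])
  let ?N = "mod_tensor L Q P" and ?T = "tensor (amod L Q) (amod L P)"
  obtain t where t: "t \<in> uterms L" "u = ucls L t" using u by (rule VA_cases)
  note cl = ucomult_closed[OF t(1) us[unfolded t(2)]]
  have "zeta L (cc L P f p \<otimes>\<^bsub>U\<^esub> cc L Q g q) u = star g f (u \<odot>\<^bsub>?N\<^esub> pure L Q P q p)"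
    using zeta_cc[OF C.mod_tensor_fgm[OF Q(1) P(1)] C.linear_form_star[OF Q(2) P(2)] C.pure_closed[OF Q(3) P(3)] u]
    by (simp add: mult_cc[OF P Q] cprod_def)
  also have "u \<odot>\<^bsub>?N\<^esub> pure L Q P q p = lsum ?T [pure L Q P (x \<odot>\<^bsub>Q\<^esub> q) (y \<odot>\<^bsub>P\<^esub> p). (x, y) \<leftarrow> us]"
    using C.ucomult_sum[OF t(1) us[unfolded t(2)] Q(3) P(3)] C.mod_tensor_smult[OF t(1)] Q(3) P(3)
    by (simp add: pure_def t(2))
  also have "star g f \<dots> = (\<Sum>(x, y) \<leftarrow> us. star g f (pure L Q P (x \<odot>\<^bsub>Q\<^esub> q) (y \<odot>\<^bsub>P\<^esub> p)))"
    using cl P(3) Q(3)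
    by (subst additive_lsum_map[OF C.TT.T.is_abelian_group regular_abelian_group C.star_additive[OF Q(2) P(2)]])
      (auto simp: case_prod_unfold pure_def C.Q.M.act_closed C.P.M.act_closed subset_iff)
  also have "\<dots> = (\<Sum>(x, y) \<leftarrow> us. zeta L (cc L Q g q) x * zeta L (cc L P f p) y)"
    using cl P Q by (intro arg_cong[of _ _ sum_list] map_cong refl)
      (auto simp: zeta_cc C.star_tn C.Q.M.act_closed C.P.M.act_closed)
  finally show ?thesis .
qed

lemma zeta_additive: "u \<in> carrier (VA L) \<Longrightarrow> additive U regular_bimod (\<lambda>X. zeta L X u)"
  by (simp add: zeta_fdlift fdlift_additive zeta_natural)

lemma zeta_mult:
  assumes X: "X \<in> carrier U" and Y: "Y \<in> carrier U" and u: "u \<in> carrier (VA L)" and us: "us \<in> ucomult L u"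
  shows "zeta L (X \<otimes>\<^bsub>U\<^esub> Y) u = (\<Sum>(x, y) \<leftarrow> us. zeta L Y x * zeta L X y)"
proof -
  obtain t where t: "t \<in> uterms L" "u = ucls L t" using u by (rule VA_cases)
  note cl = ucomult_closed[OF t(1) us[unfolded t(2)]]
  note rg = regular_abelian_group
  have ad: "additive U regular_bimod (\<lambda>X. zeta L Y' (fst x) * zeta L X (snd x))"
    "additive U regular_bimod (\<lambda>X. zeta L X (fst x) * zeta L Y' (snd x))" if "x \<in> set us" for x Y'
    using that cl zeta_additive[of "fst x"] zeta_additive[of "snd x"]
    by (auto simp: additive_def distrib_left distrib_right)
  have ads: "additive U regular_bimod (\<lambda>X. \<Sum>(x, y) \<leftarrow> us. zeta L Y' x * zeta L X y)"
    "additive U regular_bimod (\<lambda>X. \<Sum>(x, y) \<leftarrow> us. zeta L X x * zeta L Y' y)" for Y'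
    using additive_lsum_fun[OF U.is_abelian_group rg, of us "\<lambda>x X. zeta L Y' (fst x) * zeta L X (snd x)"]
      additive_lsum_fun[OF U.is_abelian_group rg, of us "\<lambda>x X. zeta L X (fst x) * zeta L Y' (snd x)"] ad
    by (simp_all add: case_prod_unfold)
  show ?thesis
  proof (rule fdual_ext[OF additive_comp[OF mult_additive_left[OF Y] zeta_additive[OF u]] ads(1) rg X])
    fix P :: "('a, 'l) rmod" and f p assume P: "fgm L P" "linear_form L P f" "p \<in> carrier P"
    have p: "cc L P f p \<in> carrier U" using P by (rule cc_closed)
    show "zeta L (cc L P f p \<otimes>\<^bsub>U\<^esub> Y) u = (\<Sum>(x, y) \<leftarrow> us. zeta L Y x * zeta L (cc L P f p) y)"
      by (rule fdual_ext[OF additive_comp[OF mult_additive_right[OF p] zeta_additive[OF u]] ads(2) rg Y])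
        (rule zeta_mult_cc[OF P _ _ _ u us])
  qed
qed

end

section \<open>Corings, coassociativity as an equation of maps\<close>

text \<open>A coring without coassociativity and the counit axioms. It allows these to be stated as
  equations between additive maps, which can be verified on generators.\<close>

locale precoring = bimodule \<kappa> C
  for \<kappa> :: "'k::field_char_0 \<Rightarrow> 'a::{comm_ring,comm_monoid_mult}"
    and C :: "('a, 'c, 'x) coring_scheme" (structure) +
  assumes comult_hom: "comult C \<in> bimod_hom C (tensor C C)"
    and counit_hom: "counit C \<in> bimod_hom C regular_bimod"
begin

sublocale CC: bimodule_pair \<kappa> C C
  by (intro bimodule_pairI bimodule_axioms)

sublocale CT: bimodule_pair \<kappa> C "tensor C C"
  by (intro bimodule_pairI bimodule_axioms CC.tensor_bimodule)

lemma comult_closed: "z \<in> carrier C \<Longrightarrow> comult C z \<in> carrier (tensor C C)"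
  and comult_additive: "additive C (tensor C C) (comult C)"
  and comult_lact: "z \<in> carrier C \<Longrightarrow> comult C (lact C a z) = lact (tensor C C) a (comult C z)"
  and comult_ract: "z \<in> carrier C \<Longrightarrow> comult C (ract C z a) = ract (tensor C C) (comult C z) a"
  and counit_additive: "additive C regular_bimod (counit C)"
  and counit_lact: "z \<in> carrier C \<Longrightarrow> counit C (lact C a z) = a * counit C z"
  and counit_ract: "z \<in> carrier C \<Longrightarrow> counit C (ract C z a) = counit C z * a"
  using comult_hom counit_hom by (auto simp: bimod_hom_def additive_def)

abbreviation "C2 \<equiv> tensor C C"
abbreviation "C3 \<equiv> tensor C (tensor C C)"

text \<open>Reassociation with its last entry held fixed; in this form it has a single tensor
  variable to lift.\<close>

definition assoc_with :: "'c \<Rightarrow> ('c \<times> 'c) list set \<Rightarrow> ('c \<times> ('c \<times> 'c) list set) list set" where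
  "assoc_with y = tlift C3 (\<lambda>a b. tn C C2 a (tn C C b y))"

definition co_right :: "'c \<Rightarrow> ('c \<times> ('c \<times> 'c) list set) list set" where
  "co_right z = tlift C3 (\<lambda>x y. tn C C2 x (comult C y)) (comult C z)"

text \<open>This is \<open>(\<Delta> \<otimes> 1) \<Delta>\<close> followed by reassociation; its
  partner \<open>co_right\<close> is \<open>(1 \<otimes> \<Delta>) \<Delta>\<close>.\<close>

definition co_left :: "'c \<Rightarrow> ('c \<times> ('c \<times> 'c) list set) list set" where
  "co_left z = tlift C3 (\<lambda>x y. assoc_with y (comult C x)) (comult C z)"

lemma balanced_assoc_with: "y \<in> carrier C \<Longrightarrow> balanced C C C3 (\<lambda>a b. tn C C2 a (tn C C b y))"
  unfolding balanced_def using CT.T.is_abelian_group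
  by (auto simp: CC.tn_add_left CT.tn_add_left CT.tn_add_right CT.tn_balanced CC.lact_tn intro!: additiveI)

lemma assoc_with_additive: "y \<in> carrier C \<Longrightarrow> additive C2 C3 (assoc_with y)"
  unfolding assoc_with_def by (rule CC.tlift_additive[OF balanced_assoc_with])

lemma assoc_with_tn: "\<lbrakk>y \<in> carrier C; a \<in> carrier C; b \<in> carrier C\<rbrakk> \<Longrightarrow>
    assoc_with y (tn C C a b) = tn C C2 a (tn C C b y)"
  unfolding assoc_with_def by (rule CC.tlift_tn[OF balanced_assoc_with])

lemma balanced_co_right: "balanced C C C3 (\<lambda>x y. tn C C2 x (comult C y))"
  unfolding balanced_def using CT.T.is_abelian_group
  by (auto simp: CT.tn_add_left CT.tn_add_right CT.tn_balanced comult_lact comult_closed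
      additive_add[OF comult_additive] intro!: additiveI)

lemma balanced_co_left: "balanced C C C3 (\<lambda>x y. assoc_with y (comult C x))"
  unfolding balanced_def
proof (intro conjI ballI allI)
  note ag = CT.T.is_abelian_group
  show "abelian_group C3" by (rule ag)
  fix y assume y: "y \<in> carrier C"
  show "additive C C3 (\<lambda>x. assoc_with y (comult C x))"
    by (rule additive_comp[OF comult_additive assoc_with_additive[OF y]])
  fix x a assume x: "x \<in> carrier C"
  \<comment> \<open>The scalar sits on the second leg of \<open>\<Delta>(x)\<close>, hence next to
    the tensor sign before \<open>y\<close>, which it crosses.\<close>
  have "assoc_with y (comult C (ract C x a)) = tlift C3 (\<lambda>b c. tn C C2 b (tn C C (ract C c a) y)) (comult C x)"
    unfolding assoc_with_def comult_ract[OF x]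
    by (rule CC.tlift_ract[OF balanced_assoc_with[OF y] comult_closed[OF x]])
  also have "\<dots> = assoc_with (lact C a y) (comult C x)"
    unfolding assoc_with_def tlift_def
    using y CC.tensor_mem(1)[OF comult_closed[OF x] CC.T.rep_mem[OF comult_closed[OF x]]]
    by (intro lsum_cong) (auto simp: CC.tn_balanced)
  finally show "assoc_with y (comult C (ract C x a)) = assoc_with (lact C a y) (comult C x)" .
next
  fix x assume x: "x \<in> carrier C"
  note ag = CT.T.is_abelian_group
  show "additive C C3 (\<lambda>y. assoc_with y (comult C x))"
  proof (rule additiveI)
    fix y y' assume y: "y \<in> carrier C" "y' \<in> carrier C"
    show "assoc_with y (comult C x) \<in> carrier C3"
      by (rule additive_closed[OF assoc_with_additive[OF y(1)] comult_closed[OF x]])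
    show "assoc_with (y \<oplus> y') (comult C x) = assoc_with y (comult C x) \<oplus>\<^bsub>C3\<^esub> assoc_with y' (comult C x)"
      by (rule CC.tensor_ext[OF assoc_with_additive additive_add_fun[OF CC.T.is_abelian_group ag
            assoc_with_additive assoc_with_additive] ag comult_closed[OF x]])
        (use y in \<open>auto simp: assoc_with_tn CC.tn_add_right CT.tn_add_right\<close>)
  qed
qed

lemma co_right_additive: "additive C C3 co_right"
  unfolding co_right_def by (rule additive_comp[OF comult_additive CC.tlift_additive[OF balanced_co_right]])

lemma co_left_additive: "additive C C3 co_left"
  unfolding co_left_def by (rule additive_comp[OF comult_additive CC.tlift_additive[OF balanced_co_left]])

lemma comult_sub: "z \<in> carrier C \<Longrightarrow> zs \<in> comult C z \<Longrightarrow> (x, y) \<in> set zs \<Longrightarrow> x \<in> carrier C \<and> y \<in> carrier C"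
  using CC.tensor_mem(1)[OF comult_closed] by fastforce

lemma rep_comult: "z \<in> carrier C \<Longrightarrow> rep (comult C z) \<in> comult C z"
  by (rule CC.T.rep_mem) (rule comult_closed)

lemma co_right_list:
  "z \<in> carrier C \<Longrightarrow> zs \<in> comult C z \<Longrightarrow> lsum C3 [tn C C2 x (comult C y). (x, y) \<leftarrow> zs] = co_right z"
  unfolding co_right_def by (rule CC.tlift_mem[OF balanced_co_right comult_closed])

lemma co_left_list:
  assumes "z \<in> carrier C" "zs \<in> comult C z"
  shows "lsum C3 [lsum C3 [tn C C2 a (tn C C b y). (a, b) \<leftarrow> rep (comult C x)]. (x, y) \<leftarrow> zs] = co_left z"
  using CC.tlift_mem[OF balanced_co_left comult_closed[OF assms(1)] assms(2)]
  by (simp add: co_left_def assoc_with_def tlift_def)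

text \<open>The two formal sums represent \<open>co_right z\<close> and \<open>co_left z\<close> in
  \<open>C \<otimes> (C \<otimes> C)\<close>, and \<open>teq\<close> is equality of classes.\<close>

lemma coassoc_iff:
  assumes z: "z \<in> carrier C" and zs: "zs \<in> comult C z"
  shows "teq C (tensor C C) [(x, comult C y). (x, y) \<leftarrow> zs]
      [(a, tcls C C [(b, y)]). (x, y) \<leftarrow> zs, (a, b) \<leftarrow> rep (comult C x)] \<longleftrightarrow> co_right z = co_left z"
    (is "teq _ _ ?l ?r \<longleftrightarrow> _")
proof -
  note el = comult_sub[OF z zs]
  have el2: "a \<in> carrier C \<and> b \<in> carrier C \<and> y \<in> carrier C"
    if "(x, y) \<in> set zs" "(a, b) \<in> set (rep (comult C x))" for x y a b
    using el[OF that(1)] comult_sub[OF _ rep_comult, of x a b] that(2) by auto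
  have l: "set ?l \<subseteq> carrier C \<times> carrier C2" using el by (auto simp: comult_closed)
  have r: "set ?r \<subseteq> carrier C \<times> carrier C2"
    using el2 CC.tn_closed by (fastforce simp: tn_def)
  have "lsum C3 (map (\<lambda>(m, n). tn C C2 m n) ?r) =
      lsum C3 (concat [[tn C C2 a (tn C C b y). (a, b) \<leftarrow> rep (comult C x)]. (x, y) \<leftarrow> zs])"
    by (simp add: map_concat o_def case_prod_unfold tn_def[of C C])
  also have "\<dots> = lsum C3 [lsum C3 [tn C C2 a (tn C C b y). (a, b) \<leftarrow> rep (comult C x)]. (x, y) \<leftarrow> zs]"
    using el2 by (subst CT.T.lsum_concat) (auto simp: case_prod_unfold)
  also have "\<dots> = co_left z" by (rule co_left_list[OF z zs])
  finally have r': "tcls C C2 ?r = co_left z" using CT.tcls_lsum[OF r] by simp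
  have l': "tcls C C2 ?l = co_right z"
    using CT.tcls_lsum[OF l] co_right_list[OF z zs] by (simp add: o_def case_prod_unfold)
  show ?thesis
    unfolding l'[symmetric] r'[symmetric] tcls_pcls teq_peq CT.T.pcls_eq_iff[OF l] ..
qed

lemma balanced_counit_left: "balanced C C C (\<lambda>x y. lact C (counit C x) y)"
  unfolding balanced_def using abelian_group_axioms
  by (auto simp: additive_add[OF counit_additive] add_lact lact_closed lact_add counit_ract mult_lact
      intro!: additiveI)

lemma balanced_counit_right: "balanced C C C (\<lambda>x y. ract C x (counit C y))"
  unfolding balanced_def using abelian_group_axioms
  by (auto simp: additive_add[OF counit_additive] add_ract ract_closed ract_add counit_lact mult_ract
      intro!: additiveI)

lemma coringI:
  assumes "\<And>z. z \<in> carrier C \<Longrightarrow> co_right z = co_left z"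
    and "\<And>z. z \<in> carrier C \<Longrightarrow> tlift C (\<lambda>x y. lact C (counit C x) y) (comult C z) = z"
    and "\<And>z. z \<in> carrier C \<Longrightarrow> tlift C (\<lambda>x y. ract C x (counit C y)) (comult C z) = z"
  shows "coring \<kappa> C"
proof (unfold_locales, rule comult_hom, rule counit_hom)
  fix z zs assume z: "z \<in> carrier C" "zs \<in> comult C z"
  show "teq C (tensor C C) [(x, comult C y). (x, y) \<leftarrow> zs]
      [(a, tcls C C [(b, y)]). (x, y) \<leftarrow> zs, (a, b) \<leftarrow> rep (comult C x)]"
    using coassoc_iff[OF z] assms(1)[OF z(1)] by simp
  show "lsum C [lact C (counit C x) y. (x, y) \<leftarrow> zs] = z"
    using CC.tlift_mem[OF balanced_counit_left comult_closed[OF z(1)] z(2)] assms(2)[OF z(1)] by simp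
  show "lsum C [ract C x (counit C y). (x, y) \<leftarrow> zs] = z"
    using CC.tlift_mem[OF balanced_counit_right comult_closed[OF z(1)] z(2)] assms(3)[OF z(1)] by simp
qed

lemma counit_left_additive: "additive C C (\<lambda>z. tlift C (\<lambda>x y. lact C (counit C x) y) (comult C z))"
  by (rule additive_comp[OF comult_additive CC.tlift_additive[OF balanced_counit_left]])

lemma counit_right_additive: "additive C C (\<lambda>z. tlift C (\<lambda>x y. ract C x (counit C y)) (comult C z))"
  by (rule additive_comp[OF comult_additive CC.tlift_additive[OF balanced_counit_right]])

end

section \<open>The coring structure of the finite dual\<close>

context lr_alg
begin

sublocale UU: bimodule_pair \<kappa> "finite_dual L" "finite_dual L"
  by (intro bimodule_pairI finite_dual_bimodule)

abbreviation (input) "U2 \<equiv> tensor U U"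

text \<open>In its definition the comultiplication takes values in the tensor square of the bare
  bimodule, for the full record is not yet available there; \<open>teq\<close> depends on fields
  that both records share.\<close>

lemma comult_finite_dual:
  "comult U X = (\<Union>x\<in>X. tcls U U [(ccls L [(P, f, e)], ccls L [(P, e', p)]).
     (P, f, p) \<leftarrow> x, (e, e') \<leftarrow> (SOME es. dual_basis L P es)])"
proof -
  define C :: "('a, ('a, 'l) fdual) bimod" where
    "C = \<lparr>carrier = ccls L ` {zs. set zs \<subseteq> coeffs L}, mult = undefined, one = undefined, zero = ccls L [],
      add = (\<lambda>X Y. \<Union>x\<in>X. \<Union>y\<in>Y. ccls L (x @ y)),
      lact = (\<lambda>a X. \<Union>x\<in>X. ccls L [(P, \<lambda>m\<in>carrier P. a * f m, p). (P, f, p) \<leftarrow> x]),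
      ract = (\<lambda>X a. \<Union>x\<in>X. ccls L [(P, f, iotaA L a \<odot>\<^bsub>P\<^esub> p). (P, f, p) \<leftarrow> x])\<rparr>"
  have "comult U X = (\<Union>x\<in>X. tcls C C [(ccls L [(P, f, e)], ccls L [(P, e', p)]).
     (P, f, p) \<leftarrow> x, (e, e') \<leftarrow> (SOME es. dual_basis L P es)])"
    unfolding C_def finite_dual_def Let_def by simp
  moreover have "teq C C = teq U U"
    by (rule teq_cong) (simp_all add: finite_dual_simps C_def)
  ultimately show ?thesis by (simp only: tcls_def)
qed

text \<open>The value of the comultiplication with the dual basis as a parameter;
  \<open>copr_hom\<close> shows that its choice does not matter.\<close>

definition copr :: "(('a, 'l) env, 'm) module \<Rightarrow> ('m \<Rightarrow> 'a) \<Rightarrow> 'm \<Rightarrow> ('m \<times> ('m \<Rightarrow> 'a)) list \<Rightarrow>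
    (('a, 'l) fdual \<times> ('a, 'l) fdual) list set" where
  "copr M f m es = lsum U2 [tn U U (cc L M f e) (cc L M e' m). (e, e') \<leftarrow> es]"

lemma cc_zero_left:
  assumes "fgm L M" "m \<in> carrier M"
  shows "cc L M (\<lambda>x. 0) m = \<zero>\<^bsub>U\<^esub>"
proof -
  have c: "cc L M (\<lambda>x. 0) m \<in> carrier U" by (rule cc_closed[OF assms(1) linear_form_zero assms(2)])
  have "cc L M (\<lambda>x. 0) m \<oplus>\<^bsub>U\<^esub> cc L M (\<lambda>x. 0) m = cc L M (\<lambda>x. 0) m"
    using cc_add_left[OF assms(1) linear_form_zero linear_form_zero assms(2)] by simp
  then show ?thesis using c U.add.l_cancel_one' by force
qed

lemma linear_form_sum:
  "(\<And>i. i \<in> set is \<Longrightarrow> linear_form L M (f i)) \<Longrightarrow> linear_form L M (\<lambda>x. \<Sum>i\<leftarrow>is. f i x)"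
  by (induction "is") (simp_all add: linear_form_zero linear_form_plus)

lemma cc_sum_left:
  assumes "fgm L M" "\<And>i. i \<in> set is \<Longrightarrow> linear_form L M (f i)" "m \<in> carrier M"
  shows "cc L M (\<lambda>x. \<Sum>i\<leftarrow>is. f i x) m = lsum U [cc L M (f i) m. i \<leftarrow> is]"
  using assms(2)
  by (induction "is") (simp_all add: cc_zero_left cc_add_left linear_form_sum assms(1,3))

lemma linear_form_lsum:
  assumes "fgm L M" "linear_form L M f" "\<And>i. i \<in> set is \<Longrightarrow> e i \<in> carrier M"
  shows "f (lsum M [iotaA L (a i) \<odot>\<^bsub>M\<^esub> e i. i \<leftarrow> is]) = (\<Sum>i\<leftarrow>is. a i * f (e i))"
proof -
  interpret M: lr_module \<kappa> L M by (rule fgm_lr_module[OF assms(1)])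
  have "f (lsum M [iotaA L (a i) \<odot>\<^bsub>M\<^esub> e i. i \<leftarrow> is]) = lsum regular_bimod [f (iotaA L (a i) \<odot>\<^bsub>M\<^esub> e i). i \<leftarrow> is]"
    by (rule additive_lsum_map[OF M.M.abelian_group_axioms regular_abelian_group linear_form_additive[OF assms(2)]])
      (simp add: assms(3) M.M.act_closed)
  also have "\<dots> = (\<Sum>i\<leftarrow>is. a i * f (e i))"
    unfolding lsum_regular using assms(3)
    by (intro arg_cong[of _ _ sum_list] map_cong refl) (simp add: linear_form_smult[OF assms(2)])
  finally show ?thesis .
qed

lemma dual_basis_form:
  assumes "fgm L M" "dual_basis L M es" "linear_form L M f" "x \<in> carrier M"
  shows "(\<Sum>(e, e') \<leftarrow> es. f e * e' x) = f x"
proof -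
  have "f x = f (lsum M [iotaA L (snd i x) \<odot>\<^bsub>M\<^esub> fst i. i \<leftarrow> es])"
    using dual_basisD(4)[OF assms(2,4)] by (simp add: case_prod_unfold)
  also have "\<dots> = (\<Sum>i\<leftarrow>es. snd i x * f (fst i))"
    using dual_basisD(1)[OF assms(2)] by (intro linear_form_lsum assms(1,3)) auto
  finally show ?thesis by (simp add: case_prod_unfold mult.commute)
qed

text \<open>Here the vector is expanded; \<open>cc_dual_basis_left\<close> expands the form. These
  are the two counit axioms, and together they also give independence of the dual basis.\<close>

lemma cc_dual_basis_right:
  assumes "fgm L M" "dual_basis L M es" "linear_form L M f" "x \<in> carrier M"
  shows "lsum U [ract U (cc L M f e) (e' x). (e, e') \<leftarrow> es] = cc L M f x"
proof -
  interpret M: lr_module \<kappa> L M by (rule fgm_lr_module[OF assms(1)])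
  note eD = dual_basisD[OF assms(2)]
  have "cc L M f x = cc L M f (lsum M [iotaA L (e' x) \<odot>\<^bsub>M\<^esub> e. (e, e') \<leftarrow> es])" using eD(4)[OF assms(4)] by simp
  also have "\<dots> = lsum U [cc L M f (iotaA L (e' x) \<odot>\<^bsub>M\<^esub> e). (e, e') \<leftarrow> es]"
    using eD(1)
    by (subst additive_lsum_map[OF M.M.abelian_group_axioms U.is_abelian_group cc_additive_right[OF assms(1,3)]])
      (auto simp: case_prod_unfold M.M.act_closed)
  also have "\<dots> = lsum U [ract U (cc L M f e) (e' x). (e, e') \<leftarrow> es]"
    using eD(1) by (intro lsum_cong) (auto simp: ract_cc assms)
  finally show ?thesis ..
qed

lemma cc_dual_basis_left:
  assumes "fgm L M" "dual_basis L M es" "linear_form L M f" "x \<in> carrier M"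
  shows "lsum U [lact U (f e) (cc L M e' x). (e, e') \<leftarrow> es] = cc L M f x"
proof -
  note eD = dual_basisD[OF assms(2)]
  have "lsum U [lact U (f e) (cc L M e' x). (e, e') \<leftarrow> es] = lsum U [cc L M (\<lambda>y. f (fst i) * snd i y) x. i \<leftarrow> es]"
    using eD(2) by (intro lsum_cong) (auto simp: lact_cc assms)
  also have "\<dots> = cc L M (\<lambda>y. \<Sum>i\<leftarrow>es. f (fst i) * snd i y) x"
    using eD(2) by (intro cc_sum_left[symmetric] assms) (auto intro: linear_form_scale)
  also have "\<dots> = cc L M f x"
    using dual_basis_form[OF assms(1,2,3)] by (intro cc_cong assms) (simp add: case_prod_unfold)
  finally show ?thesis .
qed

text \<open>Expand \<open>h(d)\<close> in the basis of \<open>N\<close>, move the coefficients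
  \<open>e'(h(d))\<close> across the tensor sign, exchange the sums and contract over the basis of
  \<open>M\<close>. With an isomorphism for \<open>h\<close> this gives independence of the basis
  and of the realization.\<close>

lemma copr_hom:
  assumes M: "fgm L M" and N: "fgm L N" and h: "h \<in> rmod_hom (VA L) M N"
    and f: "linear_form L N f" and m: "m \<in> carrier M"
    and ds: "dual_basis L M ds" and es: "dual_basis L N es"
  shows "copr N f (h m) es = copr M (\<lambda>x. f (h x)) m ds"
proof -
  note dD = dual_basisD[OF ds] and eD = dual_basisD[OF es]
  note hc = rmod_hom_closed[OF h]
  note ag = UU.T.is_abelian_group
  have c1: "cc L N f e \<in> carrier U" "cc L N e' (h m) \<in> carrier U" if "(e, e') \<in> set es" for e e'
    using eD(1,2)[OF that] by (auto intro!: cc_closed N f hc m)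
  have c2: "cc L M d' m \<in> carrier U" "cc L N f (h d) \<in> carrier U" if "(d, d') \<in> set ds" for d d'
    using dD(1,2)[OF that] by (auto intro!: cc_closed M N f hc m)
  have "copr M (\<lambda>x. f (h x)) m ds = lsum U2 [lsum U2 [tn U U (cc L N f e) (lact U (e' (h d)) (cc L M d' m)).
      (e, e') \<leftarrow> es]. (d, d') \<leftarrow> ds]"
    unfolding copr_def
  proof (intro lsum_cong, clarify)
    fix d d' assume *: "(d, d') \<in> set ds"
    have add: "additive U U2 (\<lambda>x. tn U U x (cc L M d' m))"
      using c2[OF *] by (intro additiveI) (simp_all add: UU.tn_add_left)
    have "tn U U (cc L M (\<lambda>x. f (h x)) d) (cc L M d' m) = tn U U (cc L N f (h d)) (cc L M d' m)"
      using dD(1)[OF *] by (simp add: cc_hom[OF M N h f])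
    also have "cc L N f (h d) = lsum U [ract U (cc L N f e) (e' (h d)). (e, e') \<leftarrow> es]"
      using cc_dual_basis_right[OF N es f hc[OF dD(1)[OF *]]] by simp
    also have "tn U U \<dots> (cc L M d' m) = lsum U2 [tn U U (ract U (cc L N f e) (e' (h d))) (cc L M d' m). (e, e') \<leftarrow> es]"
      using c1 by (subst additive_lsum_map[OF U.is_abelian_group ag add])
        (auto simp: case_prod_unfold UU.M.ract_closed)
    also have "\<dots> = lsum U2 [tn U U (cc L N f e) (lact U (e' (h d)) (cc L M d' m)). (e, e') \<leftarrow> es]"
      using c1 c2[OF *] by (intro lsum_cong) (auto simp: UU.tn_balanced)
    finally show "tn U U (cc L M (\<lambda>x. f (h x)) d) (cc L M d' m) =
      lsum U2 [tn U U (cc L N f e) (lact U (e' (h d)) (cc L M d' m)). (e, e') \<leftarrow> es]" .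
  qed
  also have "\<dots> = lsum U2 [lsum U2 [tn U U (cc L N f e) (lact U (e' (h d)) (cc L M d' m)).
      (d, d') \<leftarrow> ds]. (e, e') \<leftarrow> es]"
    using UU.T.lsum_swap[of ds es "\<lambda>(d, d') (e, e'). tn U U (cc L N f e) (lact U (e' (h d)) (cc L M d' m))"] c1 c2
    by (auto simp: case_prod_unfold UU.M.lact_closed)
  also have "\<dots> = copr N f (h m) es"
    unfolding copr_def
  proof (intro lsum_cong, clarify)
    fix e e' assume *: "(e, e') \<in> set es"
    have add: "additive U U2 (\<lambda>y. tn U U (cc L N f e) y)"
      using c1[OF *] by (intro additiveI) (simp_all add: UU.tn_add_right)
    have "lsum U2 [tn U U (cc L N f e) (lact U (e' (h d)) (cc L M d' m)). (d, d') \<leftarrow> ds] =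
        tn U U (cc L N f e) (lsum U [lact U (e' (h d)) (cc L M d' m). (d, d') \<leftarrow> ds])"
      using c2 by (subst additive_lsum_map[OF U.is_abelian_group ag add])
        (auto simp: case_prod_unfold UU.M.lact_closed)
    also have "lsum U [lact U (e' (h d)) (cc L M d' m). (d, d') \<leftarrow> ds] = cc L M (\<lambda>x. e' (h x)) m"
      by (rule cc_dual_basis_left[OF M ds linear_form_hom[OF h eD(2)[OF *]] m])
    also have "\<dots> = cc L N e' (h m)" by (rule cc_hom[OF M N h eD(2)[OF *] m, symmetric])
    finally show "lsum U2 [tn U U (cc L N f e) (lact U (e' (h d)) (cc L M d' m)). (d, d') \<leftarrow> ds] =
      tn U U (cc L N f e) (cc L N e' (h m))" .
  qed
  finally show ?thesis ..
qed

lemma copr_elem_closed: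
  assumes "fgm L M" "dual_basis L M es" "linear_form L M f" "m \<in> carrier M" "(e, e') \<in> set es"
  shows "cc L M f e \<in> carrier U" "cc L M e' m \<in> carrier U" "tn U U (cc L M f e) (cc L M e' m) \<in> carrier U2"
proof -
  show "cc L M f e \<in> carrier U" "cc L M e' m \<in> carrier U"
    using dual_basisD(1,2)[OF assms(2,5)] by (auto intro!: cc_closed assms)
  then show "tn U U (cc L M f e) (cc L M e' m) \<in> carrier U2" by (rule UU.tn_closed)
qed

lemma copr_natural: "natural_coeff U2 (\<lambda>P f p. copr P f p (SOME es. dual_basis L P es))"
proof -
  note sb = some_dual_basis
  show ?thesis
    unfolding natural_coeff_def
  proof (intro conjI allI impI)
    show "abelian_group U2" by (rule UU.T.is_abelian_group)
    fix P :: "('a, 'l) rmod" and f p assume P: "fgm L P" "linear_form L P f" "p \<in> carrier P"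
    let ?es = "SOME es. dual_basis L P es"
    note el = copr_elem_closed[OF P(1) sb[OF P(1)]] and eD = dual_basisD[OF sb[OF P(1)]]
    interpret P: lr_module \<kappa> L P by (rule fgm_lr_module[OF P(1)])
    show "copr P f p ?es \<in> carrier U2" unfolding copr_def using el(3)[OF P(2,3)] by auto
    show "copr P f (p \<oplus>\<^bsub>P\<^esub> q) ?es = copr P f p ?es \<oplus>\<^bsub>U2\<^esub> copr P f q ?es" if q: "q \<in> carrier P" for q
    proof -
      have "copr P f (p \<oplus>\<^bsub>P\<^esub> q) ?es =
          lsum U2 (map (\<lambda>i. tn U U (cc L P f (fst i)) (cc L P (snd i) p) \<oplus>\<^bsub>U2\<^esub> tn U U (cc L P f (fst i)) (cc L P (snd i) q)) ?es)"
        unfolding copr_def using el(1,2)[OF P(2,3)] el(2)[OF P(2) q] eD(2) P(3) q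
        by (intro lsum_cong) (auto simp: cc_add_right[OF P(1)] UU.tn_add_right)
      also have "\<dots> = copr P f p ?es \<oplus>\<^bsub>U2\<^esub> copr P f q ?es"
        unfolding copr_def case_prod_unfold using el(3)[OF P(2,3)] el(3)[OF P(2) q]
        by (intro UU.T.lsum_map_add) auto
      finally show ?thesis .
    qed
    show "copr P f p ?es = copr P g p ?es" if "\<forall>m\<in>carrier P. f m = g m" for g
      unfolding copr_def using that cc_cong[OF P(1), of f g] by simp
  next
    fix P :: "('a, 'l) rmod" and f g p assume P: "fgm L P" "linear_form L P f" "linear_form L P g" "p \<in> carrier P"
    let ?es = "SOME es. dual_basis L P es"
    note el = copr_elem_closed[OF P(1) sb[OF P(1)]] and eD = dual_basisD[OF sb[OF P(1)]]
    have "copr P (\<lambda>m. f m + g m) p ?es =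
        lsum U2 (map (\<lambda>i. tn U U (cc L P f (fst i)) (cc L P (snd i) p) \<oplus>\<^bsub>U2\<^esub> tn U U (cc L P g (fst i)) (cc L P (snd i) p)) ?es)"
      unfolding copr_def using el(1,2)[OF P(2,4)] el(1)[OF P(3,4)] eD(1) P
      by (intro lsum_cong) (auto simp: cc_add_left[OF P(1)] UU.tn_add_left)
    also have "\<dots> = copr P f p ?es \<oplus>\<^bsub>U2\<^esub> copr P g p ?es"
      unfolding copr_def case_prod_unfold using el(3)[OF P(2,4)] el(3)[OF P(3,4)]
      by (intro UU.T.lsum_map_add) auto
    finally show "copr P (\<lambda>m. f m + g m) p ?es = copr P f p ?es \<oplus>\<^bsub>U2\<^esub> copr P g p ?es" .
  next
    fix P Q :: "('a, 'l) rmod" and h f p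
    assume *: "fgm L P" "fgm L Q" "h \<in> rmod_hom (VA L) P Q" "linear_form L Q f" "p \<in> carrier P"
    show "copr Q f (h p) (SOME es. dual_basis L Q es) = copr P (\<lambda>m. f (h m)) p (SOME es. dual_basis L P es)"
      by (rule copr_hom[OF * sb[OF *(1)] sb[OF *(2)]])
  qed
qed

lemma comult_fdlift:
  assumes X: "X \<in> carrier U"
  shows "comult U X = fdlift U2 (\<lambda>P f p. copr P f p (SOME es. dual_basis L P es)) X"
proof -
  let ?b = "\<lambda>P. SOME es. dual_basis L P es"
  have "tcls U U [(ccls L [(P, f, e)], ccls L [(P, e', p)]). (P, f, p) \<leftarrow> x, (e, e') \<leftarrow> ?b P] =
      lsum U2 (map (\<lambda>(P, f, p). copr P f p (?b P)) x)" if "x \<in> X" for x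
  proof -
    have x: "set x \<subseteq> coeffs L" by (rule U.carrier_memD[OF X that])
    have el: "ccls L [(P, f, e)] = cc L P f e \<and> ccls L [(P, e', p)] = cc L P e' p \<and>
        cc L P f e \<in> carrier U \<and> cc L P e' p \<in> carrier U"
      if "(P, f, p) \<in> set x" "(e, e') \<in> set (?b P)" for P f p e e'
    proof -
      have Pc: "fgm L P" "f \<in> mdual L P" "linear_form L P f" "p \<in> carrier P"
        using x that(1) by (auto simp: coeffs_iff mdual_iff)
      note eD = dual_basisD(1-3)[OF some_dual_basis[OF Pc(1)] that(2)]
      show ?thesis
        using Pc eD by (auto intro!: cc_closed cc_object[symmetric] simp: coeffs_iff)
    qed
    have "tcls U U [(ccls L [(P, f, e)], ccls L [(P, e', p)]). (P, f, p) \<leftarrow> x, (e, e') \<leftarrow> ?b P] =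
        lsum U2 (concat [[tn U U (ccls L [(P, f, e)]) (ccls L [(P, e', p)]). (e, e') \<leftarrow> ?b P]. (P, f, p) \<leftarrow> x])"
      using el by (subst UU.tcls_lsum) (auto simp: map_concat o_def case_prod_unfold)
    also have "\<dots> = lsum U2 [lsum U2 [tn U U (ccls L [(P, f, e)]) (ccls L [(P, e', p)]). (e, e') \<leftarrow> ?b P]. (P, f, p) \<leftarrow> x]"
      using el by (subst UU.T.lsum_concat) (auto simp: case_prod_unfold)
    also have "\<dots> = lsum U2 (map (\<lambda>(P, f, p). copr P f p (?b P)) x)"
      unfolding copr_def using el by (intro lsum_cong) (auto intro!: lsum_cong)
    finally show ?thesis .
  qed
  then have "comult U X = (\<Union>x\<in>X. lsum U2 (map (\<lambda>(P, f, p). copr P f p (?b P)) x))"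
    by (simp add: comult_finite_dual)
  also have "\<dots> = fdlift U2 (\<lambda>P f p. copr P f p (?b P)) X"
    unfolding fdlift_def by (rule U.UN_plift[OF natural_compat[OF copr_natural] X])
  finally show ?thesis .
qed

lemma comult_fd_additive: "additive U U2 (comult U)"
  by (rule iffD2[OF additive_cong[OF U.is_abelian_group comult_fdlift] fdlift_additive[OF copr_natural]])

lemma comult_cc:
  assumes M: "fgm L M" "linear_form L M f" "m \<in> carrier M" and es: "dual_basis L M es"
  shows "comult U (cc L M f m) = copr M f m es"
proof -
  obtain R :: "('a, 'l) rmod" and h where R: "fgm L R" "h \<in> rmod_hom (VA L) M R"
    "inv_into (carrier M) h \<in> rmod_hom (VA L) R M"
    "\<And>x. x \<in> carrier M \<Longrightarrow> inv_into (carrier M) h (h x) = x"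
    "linear_form L R (\<lambda>r. f (inv_into (carrier M) h r))"
    "\<And>f m. linear_form L M f \<Longrightarrow> m \<in> carrier M \<Longrightarrow> cc L M f m = cc L R (\<lambda>r. f (inv_into (carrier M) h r)) (h m)"
    using cc_realize[OF M] by metis
  have hm: "h m \<in> carrier R" by (rule rmod_hom_closed[OF R(2) M(3)])
  have "comult U (cc L M f m) = copr R (\<lambda>r. f (inv_into (carrier M) h r)) (h m) (SOME es. dual_basis L R es)"
    unfolding R(6)[OF M(2,3)] comult_fdlift[OF cc_closed[OF R(1,5) hm]]
    by (rule fdlift_cc[OF copr_natural R(1,5) hm])
  also have "\<dots> = copr M f (inv_into (carrier M) h (h m)) es"
    by (rule copr_hom[OF R(1) M(1) R(3) M(2) hm some_dual_basis[OF R(1)] es, symmetric])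
  finally show ?thesis using R(4)[OF M(3)] by simp
qed

lemma comult_cc_mem:
  assumes M: "fgm L M" "linear_form L M f" "m \<in> carrier M" and es: "dual_basis L M es"
  shows "[(cc L M f e, cc L M e' m). (e, e') \<leftarrow> es] \<in> comult U (cc L M f m)"
proof (rule UU.tcls_memI)
  show "set [(cc L M f e, cc L M e' m). (e, e') \<leftarrow> es] \<subseteq> carrier U \<times> carrier U"
    using copr_elem_closed[OF M(1) es M(2,3)] by auto
  show "comult U (cc L M f m) = lsum U2 (map (\<lambda>(m, n). tn U U m n) [(cc L M f e, cc L M e' m). (e, e') \<leftarrow> es])"
    by (simp add: comult_cc[OF M es] copr_def o_def case_prod_unfold)
qed (rule additive_closed[OF comult_fd_additive cc_closed[OF M]])

lemma finite_dual_precoring: "precoring \<kappa> U"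
proof (intro precoring.intro finite_dual_bimodule precoring_axioms.intro)
  note ag = U.is_abelian_group and ag2 = UU.T.is_abelian_group
  have cl: "comult U X \<in> carrier U2" if "X \<in> carrier U" for X
    using that by (rule additive_closed[OF comult_fd_additive])
  have 1: "comult U (lact U a X) = lact U2 a (comult U X)" if X: "X \<in> carrier U" for X a
  proof (rule fdual_ext[OF additive_comp[OF lact_additive comult_fd_additive]
        additive_comp[OF comult_fd_additive UU.additive_lact_T] ag2 X])
    fix P :: "('a, 'l) rmod" and f p assume P: "fgm L P" "linear_form L P f" "p \<in> carrier P"
    obtain es where es: "dual_basis L P es" using fgm_basis[OF P(1)] .
    note el = copr_elem_closed[OF P(1) es P(2,3)] and eD = dual_basisD[OF es]
    have "lact U2 a (copr P f p es) = lsum U2 [lact U2 a (tn U U (cc L P f e) (cc L P e' p)). (e, e') \<leftarrow> es]"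
      unfolding copr_def using el
      by (subst additive_lsum_map[OF ag2 ag2 UU.additive_lact_T]) (auto simp: case_prod_unfold)
    also have "\<dots> = copr P (\<lambda>m. a * f m) p es"
      unfolding copr_def using el eD(1) by (intro lsum_cong) (auto simp: UU.lact_tn lact_cc P)
    finally show "comult U (lact U a (cc L P f p)) = lact U2 a (comult U (cc L P f p))"
      using P by (simp add: lact_cc comult_cc[OF _ _ _ es] linear_form_scale)
  qed
  have 2: "comult U (ract U X a) = ract U2 (comult U X) a" if X: "X \<in> carrier U" for X a
  proof (rule fdual_ext[OF additive_comp[OF ract_additive comult_fd_additive]
        additive_comp[OF comult_fd_additive UU.additive_ract_T] ag2 X])
    fix P :: "('a, 'l) rmod" and f p assume P: "fgm L P" "linear_form L P f" "p \<in> carrier P"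
    interpret P: lr_module \<kappa> L P by (rule fgm_lr_module[OF P(1)])
    obtain es where es: "dual_basis L P es" using fgm_basis[OF P(1)] .
    note el = copr_elem_closed[OF P(1) es P(2,3)] and eD = dual_basisD[OF es]
    have "ract U2 (copr P f p es) a = lsum U2 [ract U2 (tn U U (cc L P f e) (cc L P e' p)) a. (e, e') \<leftarrow> es]"
      unfolding copr_def using el
      by (subst additive_lsum_map[OF ag2 ag2 UU.additive_ract_T]) (auto simp: case_prod_unfold)
    also have "\<dots> = copr P f (iotaA L a \<odot>\<^bsub>P\<^esub> p) es"
      unfolding copr_def using el eD(2) by (intro lsum_cong) (auto simp: UU.ract_tn ract_cc P)
    finally show "comult U (ract U (cc L P f p) a) = ract U2 (comult U (cc L P f p)) a"
      using P by (simp add: ract_cc comult_cc[OF _ _ _ es] P.M.act_closed)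
  qed
  show "comult U \<in> bimod_hom U U2"
    using cl 1 2 additive_add[OF comult_fd_additive] by (auto simp: bimod_hom_def)
  note rg = regular_abelian_group
  have ca: "additive U regular_bimod (counit U)"
    unfolding counit_fdlift by (rule fdlift_additive[OF counit_natural])
  have 3: "counit U (lact U a X) = a * counit U X" if X: "X \<in> carrier U" for X a
  proof (rule fdual_ext[OF additive_comp[OF lact_additive ca] _ rg X])
    show "additive U regular_bimod (\<lambda>X. a * counit U X)"
      using ca by (simp add: additive_def distrib_left)
  qed (simp add: lact_cc counit_cc linear_form_scale)
  have 4: "counit U (ract U X a) = counit U X * a" if X: "X \<in> carrier U" for X a
  proof (rule fdual_ext[OF additive_comp[OF ract_additive ca] _ rg X])
    show "additive U regular_bimod (\<lambda>X. counit U X * a)"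
      using ca by (simp add: additive_def distrib_right)
    fix P :: "('a, 'l) rmod" and f p assume P: "fgm L P" "linear_form L P f" "p \<in> carrier P"
    interpret P: lr_module \<kappa> L P by (rule fgm_lr_module[OF P(1)])
    show "counit U (ract U (cc L P f p) a) = counit U (cc L P f p) * a"
      using P by (simp add: ract_cc counit_cc P.M.act_closed linear_form_smult mult.commute)
  qed
  show "counit U \<in> bimod_hom U regular_bimod"
    using 3 4 additive_add[OF ca] by (auto simp: bimod_hom_def)
qed

sublocale UC: precoring \<kappa> "finite_dual L"
  by (rule finite_dual_precoring)

theorem finite_dual_coring: "coring \<kappa> U"
proof (rule UC.coringI)
  note ag = U.is_abelian_group and ag3 = UC.CT.T.is_abelian_group
  have id: "additive U U (\<lambda>X. X)" by (simp add: additive_def)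
  fix X assume X: "X \<in> carrier U"
  show "UC.co_right X = UC.co_left X"
  proof (rule fdual_ext[OF UC.co_right_additive UC.co_left_additive ag3 X])
    fix P :: "('a, 'l) rmod" and f p assume P: "fgm L P" "linear_form L P f" "p \<in> carrier P"
    obtain es where es: "dual_basis L P es" using fgm_basis[OF P(1)] .
    note el = copr_elem_closed[OF P(1) es] and eD = dual_basisD[OF es]
    have c: "cc L P f e \<in> carrier U" "cc L P e' d \<in> carrier U" "cc L P d' p \<in> carrier U"
      if "(e, e') \<in> set es" "(d, d') \<in> set es" for e e' d d'
      using eD(1,2)[OF that(1)] eD(1,2)[OF that(2)] P by (auto intro!: cc_closed)
    let ?t = "\<lambda>x y z. tn U U2 x (tn U U y z)"
    \<comment> \<open>Both sides become the double sum of \<open>(f \<otimes> e) \<otimes> (e'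
      \<otimes> d) \<otimes> (d' \<otimes> p)\<close> over two copies of the dual basis, with the
      order of summation exchanged.\<close>
    have "UC.co_right (cc L P f p) = lsum (UC.C3) [tn U U2 x (comult U y). (x, y) \<leftarrow> [(cc L P f e, cc L P e' p). (e, e') \<leftarrow> es]]"
      by (rule UC.co_right_list[OF cc_closed[OF P] comult_cc_mem[OF P es], symmetric])
    also have "\<dots> = lsum (UC.C3) [lsum (UC.C3) [?t (cc L P f e) (cc L P e' d) (cc L P d' p). (d, d') \<leftarrow> es]. (e, e') \<leftarrow> es]"
      unfolding map_map o_def case_prod_unfold fst_conv snd_conv
    proof (intro lsum_cong)
      fix i assume i: "i \<in> set es"
      then have ie: "(fst i, snd i) \<in> set es" by simp
      have add: "additive U2 (UC.C3) (tn U U2 (cc L P f (fst i)))"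
        using c[OF ie ie] by (intro additiveI) (simp_all add: UC.CT.tn_add_right)
      have "tn U U2 (cc L P f (fst i)) (comult U (cc L P (snd i) p)) =
          tn U U2 (cc L P f (fst i)) (copr P (snd i) p es)"
        using comult_cc[OF P(1) eD(2)[OF ie] P(3) es] by simp
      also have "\<dots> = lsum (UC.C3) [?t (cc L P f (fst i)) (cc L P (snd i) (fst j)) (cc L P (snd j) p). j \<leftarrow> es]"
        unfolding copr_def case_prod_unfold using c[OF ie]
        by (intro additive_lsum_map[OF UU.T.is_abelian_group ag3 add]) auto
      finally show "tn U U2 (cc L P f (fst i)) (comult U (cc L P (snd i) p)) =
          lsum (UC.C3) [?t (cc L P f (fst i)) (cc L P (snd i) (fst j)) (cc L P (snd j) p). j \<leftarrow> es]" .
    qed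
    also have "\<dots> = lsum (UC.C3) [lsum (UC.C3) [?t (cc L P f e) (cc L P e' d) (cc L P d' p). (e, e') \<leftarrow> es]. (d, d') \<leftarrow> es]"
      using UC.CT.T.lsum_swap[of es es "\<lambda>(e, e') (d, d'). ?t (cc L P f e) (cc L P e' d) (cc L P d' p)"] c
      by (auto simp: case_prod_unfold)
    also have "\<dots> = lsum (UC.C3) [UC.assoc_with y (comult U x). (x, y) \<leftarrow> [(cc L P f e, cc L P e' p). (e, e') \<leftarrow> es]]"
      unfolding map_map o_def case_prod_unfold fst_conv snd_conv
    proof (intro lsum_cong)
      fix i assume i: "i \<in> set es"
      then have ie: "(fst i, snd i) \<in> set es" by simp
      have y: "cc L P (snd i) p \<in> carrier U" by (rule c(3)[OF ie ie])
      have "UC.assoc_with (cc L P (snd i) p) (comult U (cc L P f (fst i))) =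
          UC.assoc_with (cc L P (snd i) p) (copr P f (fst i) es)"
        using comult_cc[OF P(1,2) eD(1)[OF ie] es] by simp
      also have "\<dots> = lsum (UC.C3) [UC.assoc_with (cc L P (snd i) p) (tn U U (cc L P f (fst j)) (cc L P (snd j) (fst i))). j \<leftarrow> es]"
        unfolding copr_def case_prod_unfold using c[OF _ ie]
        by (intro additive_lsum_map[OF UU.T.is_abelian_group ag3 UC.assoc_with_additive[OF y]]) auto
      also have "\<dots> = lsum (UC.C3) [?t (cc L P f (fst j)) (cc L P (snd j) (fst i)) (cc L P (snd i) p). j \<leftarrow> es]"
        using c[OF _ ie] y by (intro lsum_cong UC.assoc_with_tn) auto
      finally show "lsum (UC.C3) [?t (cc L P f (fst j)) (cc L P (snd j) (fst i)) (cc L P (snd i) p). j \<leftarrow> es] =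
        UC.assoc_with (cc L P (snd i) p) (comult U (cc L P f (fst i)))" ..
    qed
    also have "\<dots> = UC.co_left (cc L P f p)"
      unfolding UC.co_left_def
      by (rule UU.tlift_mem[OF UC.balanced_co_left UC.comult_closed[OF cc_closed[OF P]] comult_cc_mem[OF P es]])
    finally show "UC.co_right (cc L P f p) = UC.co_left (cc L P f p)" .
  qed
  show "tlift U (\<lambda>x y. lact U (counit U x) y) (comult U X) = X"
  proof (rule fdual_ext[OF UC.counit_left_additive id ag X])
    fix P :: "('a, 'l) rmod" and f p assume P: "fgm L P" "linear_form L P f" "p \<in> carrier P"
    obtain es where es: "dual_basis L P es" using fgm_basis[OF P(1)] .
    have "tlift U (\<lambda>x y. lact U (counit U x) y) (comult U (cc L P f p)) =
        lsum U [lact U (counit U x) y. (x, y) \<leftarrow> [(cc L P f e, cc L P e' p). (e, e') \<leftarrow> es]]"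
      by (rule UU.tlift_mem[OF UC.balanced_counit_left UC.comult_closed[OF cc_closed[OF P]] comult_cc_mem[OF P es], symmetric])
    also have "\<dots> = lsum U [lact U (f e) (cc L P e' p). (e, e') \<leftarrow> es]"
      unfolding map_map o_def case_prod_unfold fst_conv snd_conv
    proof (intro lsum_cong)
      fix i assume "i \<in> set es"
      then have "fst i \<in> carrier P" using dual_basisD(1)[OF es, of "fst i" "snd i"] by simp
      then show "lact U (counit U (cc L P f (fst i))) (cc L P (snd i) p) = lact U (f (fst i)) (cc L P (snd i) p)"
        by (simp add: counit_cc[OF P(1,2)])
    qed
    also have "\<dots> = cc L P f p" by (rule cc_dual_basis_left[OF P(1) es P(2,3)])
    finally show "tlift U (\<lambda>x y. lact U (counit U x) y) (comult U (cc L P f p)) = cc L P f p" .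
  qed
  show "tlift U (\<lambda>x y. ract U x (counit U y)) (comult U X) = X"
  proof (rule fdual_ext[OF UC.counit_right_additive id ag X])
    fix P :: "('a, 'l) rmod" and f p assume P: "fgm L P" "linear_form L P f" "p \<in> carrier P"
    obtain es where es: "dual_basis L P es" using fgm_basis[OF P(1)] .
    have "tlift U (\<lambda>x y. ract U x (counit U y)) (comult U (cc L P f p)) =
        lsum U [ract U x (counit U y). (x, y) \<leftarrow> [(cc L P f e, cc L P e' p). (e, e') \<leftarrow> es]]"
      by (rule UU.tlift_mem[OF UC.balanced_counit_right UC.comult_closed[OF cc_closed[OF P]] comult_cc_mem[OF P es], symmetric])
    also have "\<dots> = lsum U [ract U (cc L P f e) (e' p). (e, e') \<leftarrow> es]"
      unfolding map_map o_def case_prod_unfold fst_conv snd_conv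
    proof (intro lsum_cong)
      fix i assume "i \<in> set es"
      then have "linear_form L P (snd i)" using dual_basisD(2)[OF es, of "fst i" "snd i"] by simp
      then show "ract U (cc L P f (fst i)) (counit U (cc L P (snd i) p)) = ract U (cc L P f (fst i)) (snd i p)"
        using P(3) by (simp add: counit_cc[OF P(1)])
    qed
    also have "\<dots> = cc L P f p" by (rule cc_dual_basis_right[OF P(1) es P(2,3)])
    finally show "tlift U (\<lambda>x y. ract U x (counit U y)) (comult U (cc L P f p)) = cc L P f p" .
  qed
qed

sublocale UR: cring "finite_dual L"
  by (rule finite_dual_cring)

section \<open>Multiplicativity of the comultiplication and of the counit\<close>

lemma fdual_unit_lact: "lact U c (fdual_unit L a b) = fdual_unit L (c * a) b"
  and fdual_unit_ract: "ract U (fdual_unit L a b) c = fdual_unit L a (b * c)"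
proof -
  have "(\<lambda>x. c * (a * x)) = (\<lambda>x. c * a * x)" by (simp add: fun_eq_iff mult.assoc)
  then show "lact U c (fdual_unit L a b) = fdual_unit L (c * a) b"
    "ract U (fdual_unit L a b) c = fdual_unit L a (b * c)"
    by (simp_all add: fdual_unit_cc lact_cc ract_cc unit_mod_fgm unit_form)
qed

lemma fdual_unit_add: "fdual_unit L (a + a') b = fdual_unit L a b \<oplus>\<^bsub>U\<^esub> fdual_unit L a' b"
  "fdual_unit L a (b + b') = fdual_unit L a b \<oplus>\<^bsub>U\<^esub> fdual_unit L a b'"
  using cc_add_left[OF unit_mod_fgm unit_form unit_form, of b a a']
    cc_add_right[OF unit_mod_fgm unit_form, of b b' a]
  by (simp_all add: fdual_unit_cc distrib_right)

lemma fdual_unit_units: "fdual_unit L a b \<otimes>\<^bsub>U\<^esub> fdual_unit L c d = fdual_unit L (a * c) (b * d)"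
  by (simp add: fdual_unit_mult' fdual_unit_closed fdual_unit_lact fdual_unit_ract mult.commute)

text \<open>Both actions are multiplication by elements \<open>fdual_unit L 1 a\<close> and
  \<open>fdual_unit L a 1\<close>, so this is associativity.\<close>

lemma mult_ract_right: "X \<in> carrier U \<Longrightarrow> Y \<in> carrier U \<Longrightarrow> X \<otimes>\<^bsub>U\<^esub> ract U Y a = ract U (X \<otimes>\<^bsub>U\<^esub> Y) a"
  and mult_lact_right: "X \<in> carrier U \<Longrightarrow> Y \<in> carrier U \<Longrightarrow> X \<otimes>\<^bsub>U\<^esub> lact U a Y = lact U a (X \<otimes>\<^bsub>U\<^esub> Y)"
proof -
  have r: "ract U Z a = Z \<otimes>\<^bsub>U\<^esub> fdual_unit L 1 a" and l: "lact U a Z = Z \<otimes>\<^bsub>U\<^esub> fdual_unit L a 1" if "Z \<in> carrier U" for Z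
    using that by (simp_all add: fdual_unit_mult' UU.M.one_lact UU.M.one_ract UU.M.lact_closed)
  assume "X \<in> carrier U" "Y \<in> carrier U"
  then show "X \<otimes>\<^bsub>U\<^esub> ract U Y a = ract U (X \<otimes>\<^bsub>U\<^esub> Y) a" "X \<otimes>\<^bsub>U\<^esub> lact U a Y = lact U a (X \<otimes>\<^bsub>U\<^esub> Y)"
    by (simp_all add: r l UR.m_assoc fdual_unit_closed)
qed

text \<open>The product of \<open>x \<otimes> y\<close> with an element of the tensor square.
  Componentwise products are balanced in each argument because both actions on the finite dual are
  multiplications in a commutative ring.\<close>

definition tmul1 :: "('a, 'l) fdual \<Rightarrow> ('a, 'l) fdual \<Rightarrow> (('a, 'l) fdual \<times> ('a, 'l) fdual) list set \<Rightarrow>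
    (('a, 'l) fdual \<times> ('a, 'l) fdual) list set" where
  "tmul1 x y = tlift U2 (\<lambda>x' y'. tn U U (x \<otimes>\<^bsub>U\<^esub> x') (y \<otimes>\<^bsub>U\<^esub> y'))"

definition tmul :: "(('a, 'l) fdual \<times> ('a, 'l) fdual) list set \<Rightarrow> (('a, 'l) fdual \<times> ('a, 'l) fdual) list set \<Rightarrow>
    (('a, 'l) fdual \<times> ('a, 'l) fdual) list set" where
  "tmul Z W = tlift U2 (\<lambda>x y. tmul1 x y W) Z"

lemma balanced_tmul1:
  assumes "x \<in> carrier U" "y \<in> carrier U"
  shows "balanced U U U2 (\<lambda>x' y'. tn U U (x \<otimes>\<^bsub>U\<^esub> x') (y \<otimes>\<^bsub>U\<^esub> y'))"
  unfolding balanced_def using assms UU.T.is_abelian_group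
  by (auto simp: UR.r_distr UU.tn_add_left UU.tn_add_right mult_ract_right mult_lact_right UU.tn_balanced
      intro!: additiveI)

lemma tmul1_additive: "x \<in> carrier U \<Longrightarrow> y \<in> carrier U \<Longrightarrow> additive U2 U2 (tmul1 x y)"
  unfolding tmul1_def by (rule UU.tlift_additive[OF balanced_tmul1])

lemma tmul1_tn: "\<lbrakk>x \<in> carrier U; y \<in> carrier U; x' \<in> carrier U; y' \<in> carrier U\<rbrakk> \<Longrightarrow>
    tmul1 x y (tn U U x' y') = tn U U (x \<otimes>\<^bsub>U\<^esub> x') (y \<otimes>\<^bsub>U\<^esub> y')"
  unfolding tmul1_def by (rule UU.tlift_tn[OF balanced_tmul1])

lemma balanced_tmul:
  assumes W: "W \<in> carrier U2"
  shows "balanced U U U2 (\<lambda>x y. tmul1 x y W)"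
proof -
  note ag = UU.T.is_abelian_group
  note ext = UU.tensor_ext[OF _ _ ag W] and ad = tmul1_additive
  note [simp] = tmul1_tn UR.l_distr UU.tn_add_left UU.tn_add_right
  have "tmul1 (x \<oplus>\<^bsub>U\<^esub> x') y W = tmul1 x y W \<oplus>\<^bsub>U2\<^esub> tmul1 x' y W"
    if "x \<in> carrier U" "x' \<in> carrier U" "y \<in> carrier U" for x x' y
    by (rule ext[OF ad additive_add_fun[OF ag ag ad ad]]) (use that in simp_all)
  moreover have "tmul1 x (y \<oplus>\<^bsub>U\<^esub> y') W = tmul1 x y W \<oplus>\<^bsub>U2\<^esub> tmul1 x y' W"
    if "x \<in> carrier U" "y \<in> carrier U" "y' \<in> carrier U" for x y y'
    by (rule ext[OF ad additive_add_fun[OF ag ag ad ad]]) (use that in simp_all)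
  moreover have "tmul1 (ract U x a) y W = tmul1 x (lact U a y) W" if "x \<in> carrier U" "y \<in> carrier U" for x y a
  proof (rule ext[OF ad ad])
    fix x' y' assume c: "x' \<in> carrier U" "y' \<in> carrier U"
    have "ract U x a \<otimes>\<^bsub>U\<^esub> x' = ract U (x \<otimes>\<^bsub>U\<^esub> x') a" "lact U a y \<otimes>\<^bsub>U\<^esub> y' = lact U a (y \<otimes>\<^bsub>U\<^esub> y')"
      using that c mult_ract_right[of x' x a] mult_lact_right[of y' y a]
      by (simp_all add: UR.m_comm UU.M.ract_closed UU.M.lact_closed)
    then show "tmul1 (ract U x a) y (tn U U x' y') = tmul1 x (lact U a y) (tn U U x' y')"
      using that c by (simp add: UU.M.ract_closed UU.M.lact_closed UU.tn_balanced)
  qed (use that in \<open>simp_all add: UU.M.ract_closed UU.M.lact_closed\<close>)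
  ultimately show ?thesis
    unfolding balanced_def using ag additive_closed[OF ad W] by (auto intro!: additiveI)
qed

text \<open>Connects the lifted product with the list comprehension in which the bialgebroid axiom
  states multiplicativity.\<close>

lemma tmul_list:
  assumes "Z \<in> carrier U2" "W \<in> carrier U2" "zs \<in> Z" "ws \<in> W"
  shows "[(x \<otimes>\<^bsub>U\<^esub> x', y \<otimes>\<^bsub>U\<^esub> y'). (x, y) \<leftarrow> zs, (x', y') \<leftarrow> ws] \<in> tmul Z W"
proof -
  note z = UU.tensor_mem(1)[OF assms(1,3)] and w = UU.tensor_mem(1)[OF assms(2,4)]
  let ?l = "[(x \<otimes>\<^bsub>U\<^esub> x', y \<otimes>\<^bsub>U\<^esub> y'). (x, y) \<leftarrow> zs, (x', y') \<leftarrow> ws]"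
  have l: "set ?l \<subseteq> carrier U \<times> carrier U" using z w by auto
  have "tmul Z W = lsum U2 [tmul1 x y W. (x, y) \<leftarrow> zs]"
    unfolding tmul_def by (rule UU.tlift_mem[OF balanced_tmul[OF assms(2)] assms(1,3), symmetric])
  also have "\<dots> = lsum U2 [lsum U2 [tn U U (x \<otimes>\<^bsub>U\<^esub> x') (y \<otimes>\<^bsub>U\<^esub> y'). (x', y') \<leftarrow> ws]. (x, y) \<leftarrow> zs]"
    unfolding tmul1_def using z UU.tlift_mem[OF balanced_tmul1 assms(2,4)] by (intro lsum_cong) auto
  also have "\<dots> = lsum U2 (concat [[tn U U (x \<otimes>\<^bsub>U\<^esub> x') (y \<otimes>\<^bsub>U\<^esub> y'). (x', y') \<leftarrow> ws]. (x, y) \<leftarrow> zs])"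
    using z w by (subst UU.T.lsum_concat) (auto simp: case_prod_unfold subset_iff)
  also have "\<dots> = tcls U U ?l"
    using UU.tcls_lsum[OF l] by (simp add: map_concat o_def case_prod_unfold)
  finally show ?thesis using UU.tcls_self[OF l] by simp
qed

text \<open>In the product basis of \<open>Q \<otimes> P\<close> each term of the coproduct is the
  product of a term for \<open>P\<close> with a term for \<open>Q\<close>; what differs is the order
  of the two sums.\<close>

lemma comult_mult_cc:
  assumes P: "fgm L P" "linear_form L P f" "p \<in> carrier P" and Q: "fgm L Q" "linear_form L Q g" "q \<in> carrier Q"
  shows "comult U (cc L P f p \<otimes>\<^bsub>U\<^esub> cc L Q g q) = tmul (comult U (cc L P f p)) (comult U (cc L Q g q))"
proof -
  interpret A: lr_module_pair \<kappa> L Q P by (rule fgm_pair[OF Q(1) P(1)])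
  let ?N = "mod_tensor L Q P"
  have fN: "fgm L ?N" by (rule A.mod_tensor_fgm[OF Q(1) P(1)])
  obtain ds where ds: "dual_basis L P ds" using fgm_basis[OF P(1)] .
  obtain es where es: "dual_basis L Q es" using fgm_basis[OF Q(1)] .
  note dD = dual_basisD[OF ds] and eD = dual_basisD[OF es]
  note B = A.mod_tensor_dual_basis[OF es ds]
  have pq: "pure L Q P q p \<in> carrier ?N" using P Q by simp
  note sf = A.linear_form_star[OF Q(2) P(2)]
  have el: "cc L P f d \<otimes>\<^bsub>U\<^esub> cc L Q g e = cc L ?N (star g f) (pure L Q P e d)"
    "cc L P d' p \<otimes>\<^bsub>U\<^esub> cc L Q e' q = cc L ?N (restrict (star e' d') (carrier ?N)) (pure L Q P q p)"
    "cc L P f d \<in> carrier U" "cc L Q g e \<in> carrier U" "cc L P d' p \<in> carrier U" "cc L Q e' q \<in> carrier U"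
    if "(e, e') \<in> set es" "(d, d') \<in> set ds" for e e' d d'
    using dD(1,2)[OF that(2)] eD(1,2)[OF that(1)] P Q fN
    by (auto simp: mult_cc cprod_def cc_restrict intro!: cc_closed)
  let ?l = "[(cc L P f d \<otimes>\<^bsub>U\<^esub> cc L Q g e, cc L P d' p \<otimes>\<^bsub>U\<^esub> cc L Q e' q). (d, d') \<leftarrow> ds, (e, e') \<leftarrow> es]"
  have X: "comult U (cc L P f p) \<in> carrier U2" "comult U (cc L Q g q) \<in> carrier U2"
    using cc_closed[OF P] cc_closed[OF Q] by (auto intro: UC.comult_closed)
  have m: "?l \<in> tmul (comult U (cc L P f p)) (comult U (cc L Q g q))"
    using tmul_list[OF X comult_cc_mem[OF P ds] comult_cc_mem[OF Q es]]
    by (simp add: o_def case_prod_unfold)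
  have T: "tmul (comult U (cc L P f p)) (comult U (cc L Q g q)) \<in> carrier U2"
    unfolding tmul_def by (rule UU.tlift_closed[OF balanced_tmul[OF X(2)] X(1)])
  have "comult U (cc L P f p \<otimes>\<^bsub>U\<^esub> cc L Q g q) = copr ?N (star g f) (pure L Q P q p)
      [(pure L Q P e d, restrict (star e' d') (carrier ?N)). (e, e') \<leftarrow> es, (d, d') \<leftarrow> ds]"
    unfolding mult_cc[OF P Q] cprod_def by (rule comult_cc[OF fN sf pq B])
  also have "\<dots> = lsum U2 (concat [[tn U U (cc L ?N (star g f) (pure L Q P e d))
      (cc L ?N (restrict (star e' d') (carrier ?N)) (pure L Q P q p)). (d, d') \<leftarrow> ds]. (e, e') \<leftarrow> es])"
    unfolding copr_def by (simp add: map_concat o_def case_prod_unfold)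
  also have "\<dots> = lsum U2 [lsum U2 [tn U U (cc L ?N (star g f) (pure L Q P e d))
      (cc L ?N (restrict (star e' d') (carrier ?N)) (pure L Q P q p)). (d, d') \<leftarrow> ds]. (e, e') \<leftarrow> es]"
  proof -
    have "tn U U (cc L ?N (star g f) (pure L Q P e d))
      (cc L ?N (restrict (star e' d') (carrier ?N)) (pure L Q P q p)) \<in> carrier U2"
      if "(e, e') \<in> set es" "(d, d') \<in> set ds" for e e' d d'
      unfolding el(1,2)[OF that, symmetric] using el(3-)[OF that] by simp
    then show ?thesis by (subst UU.T.lsum_concat) (auto simp: case_prod_unfold)
  qed
  also have "\<dots> = lsum U2 [lsum U2 [tn U U (cc L P f d \<otimes>\<^bsub>U\<^esub> cc L Q g e) (cc L P d' p \<otimes>\<^bsub>U\<^esub> cc L Q e' q).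
      (d, d') \<leftarrow> ds]. (e, e') \<leftarrow> es]"
    using el(1,2) by (intro lsum_cong) (auto intro!: lsum_cong)
  also have "\<dots> = lsum U2 [lsum U2 [tn U U (cc L P f d \<otimes>\<^bsub>U\<^esub> cc L Q g e) (cc L P d' p \<otimes>\<^bsub>U\<^esub> cc L Q e' q).
      (e, e') \<leftarrow> es]. (d, d') \<leftarrow> ds]"
    using UU.T.lsum_swap[of es ds "\<lambda>(e, e') (d, d'). tn U U (cc L P f d \<otimes>\<^bsub>U\<^esub> cc L Q g e) (cc L P d' p \<otimes>\<^bsub>U\<^esub> cc L Q e' q)"] el(3-)
    by (auto simp: case_prod_unfold)
  also have "\<dots> = lsum U2 (concat [[tn U U (cc L P f d \<otimes>\<^bsub>U\<^esub> cc L Q g e) (cc L P d' p \<otimes>\<^bsub>U\<^esub> cc L Q e' q).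
      (e, e') \<leftarrow> es]. (d, d') \<leftarrow> ds])"
    using el(3-) by (subst UU.T.lsum_concat) (auto simp: case_prod_unfold)
  also have "\<dots> = lsum U2 (map (\<lambda>(x, y). tn U U x y) ?l)"
    by (simp add: map_concat o_def case_prod_unfold)
  also have "\<dots> = tmul (comult U (cc L P f p)) (comult U (cc L Q g q))"
    using UU.tensor_mem(3)[OF T m] by simp
  finally show ?thesis .
qed

lemma tmul_additive: "W \<in> carrier U2 \<Longrightarrow> additive U2 U2 (\<lambda>Z. tmul Z W)"
  unfolding tmul_def by (rule UU.tlift_additive[OF balanced_tmul])

lemma tmul_additive_right:
  assumes Z: "Z \<in> carrier U2"
  shows "additive U2 U2 (\<lambda>W. tmul Z W)"
proof -
  note z = UU.tensor_mem(1)[OF Z UU.T.rep_mem[OF Z]]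
  show ?thesis
    unfolding tmul_def tlift_def case_prod_unfold using z
    by (intro additive_lsum_fun UU.T.is_abelian_group tmul1_additive) auto
qed

lemma comult_fd_mult:
  assumes X: "X \<in> carrier U" and Y: "Y \<in> carrier U"
  shows "comult U (X \<otimes>\<^bsub>U\<^esub> Y) = tmul (comult U X) (comult U Y)"
proof -
  note ag = UU.T.is_abelian_group
  show ?thesis
  proof (rule fdual_ext[OF additive_comp[OF mult_additive_left[OF Y] comult_fd_additive]
        additive_comp[OF comult_fd_additive tmul_additive[OF UC.comult_closed[OF Y]]] ag X])
    fix P :: "('a, 'l) rmod" and f p assume P: "fgm L P" "linear_form L P f" "p \<in> carrier P"
    have p: "cc L P f p \<in> carrier U" by (rule cc_closed[OF P])
    show "comult U (cc L P f p \<otimes>\<^bsub>U\<^esub> Y) = tmul (comult U (cc L P f p)) (comult U Y)"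
      by (rule fdual_ext[OF additive_comp[OF mult_additive_right[OF p] comult_fd_additive]
            additive_comp[OF comult_fd_additive tmul_additive_right[OF UC.comult_closed[OF p]]] ag Y])
        (rule comult_mult_cc[OF P])
  qed
qed

lemma counit_fd_mult:
  assumes X: "X \<in> carrier U" and Y: "Y \<in> carrier U"
  shows "counit U (X \<otimes>\<^bsub>U\<^esub> Y) = counit U X * counit U Y"
proof -
  note rg = regular_abelian_group
  have a: "additive U regular_bimod (\<lambda>X. counit U X * c)" "additive U regular_bimod (\<lambda>X. c * counit U X)" for c
    using UC.counit_additive by (simp_all add: additive_def distrib_left distrib_right)
  show ?thesis
  proof (rule fdual_ext[OF additive_comp[OF mult_additive_left[OF Y] UC.counit_additive] a(1) rg X])
    fix P :: "('a, 'l) rmod" and f p assume P: "fgm L P" "linear_form L P f" "p \<in> carrier P"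
    have p: "cc L P f p \<in> carrier U" by (rule cc_closed[OF P])
    show "counit U (cc L P f p \<otimes>\<^bsub>U\<^esub> Y) = counit U (cc L P f p) * counit U Y"
    proof (rule fdual_ext[OF additive_comp[OF mult_additive_right[OF p] UC.counit_additive] a(2) rg Y])
      fix Q :: "('a, 'l) rmod" and g q assume Q: "fgm L Q" "linear_form L Q g" "q \<in> carrier Q"
      interpret A: lr_module_pair \<kappa> L Q P by (rule fgm_pair[OF Q(1) P(1)])
      show "counit U (cc L P f p \<otimes>\<^bsub>U\<^esub> cc L Q g q) = counit U (cc L P f p) * counit U (cc L Q g q)"
        using P Q by (simp add: mult_cc cprod_def counit_cc A.mod_tensor_fgm A.linear_form_star A.star_tn mult.commute)
    qed
  qed
qed

lemma fd_src_tgt: "src U a = fdual_unit L a 1" "tgt U a = fdual_unit L 1 a" "\<one>\<^bsub>U\<^esub> = fdual_unit L 1 1"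
  by (simp_all add: finite_dual_simps)

lemma counit_fdual_unit: "counit U (fdual_unit L a b) = a * b"
  unfolding fdual_unit_cc by (subst counit_cc[OF unit_mod_fgm unit_form]) simp_all

text \<open>Centrality of the field, read at the unit element.\<close>

lemma src_field: "fdual_unit L (\<kappa> c) 1 = fdual_unit L 1 (\<kappa> c)"
  using UU.M.central[OF fdual_unit_closed[of 1 1], of c] by (simp add: fdual_unit_lact fdual_unit_ract)

theorem finite_dual_bialgebroid: "comm_bialgebroid \<kappa> U"
proof (intro comm_bialgebroid.intro finite_dual_coring finite_dual_cring comm_bialgebroid_axioms.intro)
  have u: "cc L (unit_mod L) (\<lambda>x. x) 1 = fdual_unit L 1 1"
    unfolding fdual_unit_cc by (rule cc_cong[OF unit_mod_fgm]) simp
  show "[(\<one>\<^bsub>U\<^esub>, \<one>\<^bsub>U\<^esub>)] \<in> comult U \<one>\<^bsub>U\<^esub>"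
    using comult_cc_mem[OF unit_mod_fgm unit_form, of 1 "[(1, \<lambda>x. x)]" 1] unit_mod_basis
    by (simp add: u flip: fdual_unit_cc) (simp add: finite_dual_simps)
  fix X assume X: "X \<in> carrier U"
  show "lact U a X = src U a \<otimes>\<^bsub>U\<^esub> X" "ract U X a = X \<otimes>\<^bsub>U\<^esub> tgt U a" for a
    using X by (simp_all add: fd_src_tgt UR.m_comm[of _ X] fdual_unit_closed fdual_unit_mult'
        UU.M.one_lact UU.M.one_ract UU.M.lact_closed)
  fix Y zs ws assume Y: "Y \<in> carrier U" "zs \<in> comult U X" "ws \<in> comult U Y"
  show "[(x \<otimes>\<^bsub>U\<^esub> x', y \<otimes>\<^bsub>U\<^esub> y'). (x, y) \<leftarrow> zs, (x', y') \<leftarrow> ws] \<in> comult U (X \<otimes>\<^bsub>U\<^esub> Y)"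
    unfolding comult_fd_mult[OF X Y(1)]
    by (rule tmul_list[OF UC.comult_closed[OF X] UC.comult_closed[OF Y(1)] Y(2,3)])
qed (auto simp: ring_hom_def fd_src_tgt fdual_unit_closed fdual_unit_units fdual_unit_add counit_fd_mult
    counit_fdual_unit src_field additive_add[OF UC.counit_additive])

section \<open>The pairing \<zeta> and the morphism \<Theta>\<close>

lemma zeta_udual: 
  assumes X: "X \<in> carrier U" shows "zeta L X \<in> udual L"
proof -
  note rg = regular_abelian_group
  have "zeta L X (u \<oplus>\<^bsub>VA L\<^esub> v) = zeta L X u + zeta L X v"
    if u: "u \<in> carrier (VA L)" and v: "v \<in> carrier (VA L)" for u v
  proof (rule fdual_ext[OF zeta_additive additive_add_fun[OF U.is_abelian_group rg zeta_additive[OF u] zeta_additive[OF v], simplified] rg X])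
    fix P :: "('a, 'l) rmod" and f p assume P: "fgm L P" "linear_form L P f" "p \<in> carrier P"
    interpret P: lr_module \<kappa> L P by (rule fgm_lr_module[OF P(1)])
    show "zeta L (cc L P f p) (u \<oplus>\<^bsub>VA L\<^esub> v) = zeta L (cc L P f p) u + zeta L (cc L P f p) v"
      using P u v by (simp add: zeta_cc P.M.act_add_left P.M.act_closed linear_form_add)
  qed (use u v in simp)
  moreover have "zeta L X (u \<otimes>\<^bsub>VA L\<^esub> iotaA L a) = zeta L X u * a" if u: "u \<in> carrier (VA L)" for u a
  proof (rule fdual_ext[OF zeta_additive _ rg X])
    show "additive U regular_bimod (\<lambda>X. zeta L X u * a)"
      using zeta_additive[OF u] by (simp add: additive_def distrib_right)
    fix P :: "('a, 'l) rmod" and f p assume P: "fgm L P" "linear_form L P f" "p \<in> carrier P"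
    interpret P: lr_module \<kappa> L P by (rule fgm_lr_module[OF P(1)])
    show "zeta L (cc L P f p) (u \<otimes>\<^bsub>VA L\<^esub> iotaA L a) = zeta L (cc L P f p) u * a"
      using P u by (simp add: zeta_cc P.M.act_mult P.M.act_closed linear_form_smult mult.commute)
  qed (use u in simp)
  ultimately show ?thesis by (simp add: udual_def) (simp add: zeta_def)
qed

lemma zeta_bimodule:
  assumes X: "X \<in> carrier U" and u: "u \<in> carrier (VA L)"
  shows "zeta L (ract U (lact U a X) b) u = a * zeta L X (iotaA L b \<otimes>\<^bsub>VA L\<^esub> u)"
proof -
  have c: "iotaA L b \<otimes>\<^bsub>VA L\<^esub> u \<in> carrier (VA L)" using u by simp
  show ?thesis
  proof (rule fdual_ext[OF additive_comp[OF additive_comp[OF lact_additive ract_additive] zeta_additive[OF u]]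
        _ regular_abelian_group X])
    show "additive U regular_bimod (\<lambda>X. a * zeta L X (iotaA L b \<otimes>\<^bsub>VA L\<^esub> u))"
      using zeta_additive[OF c] by (simp add: additive_def distrib_left)
    fix P :: "('a, 'l) rmod" and f p assume P: "fgm L P" "linear_form L P f" "p \<in> carrier P"
    interpret P: lr_module \<kappa> L P by (rule fgm_lr_module[OF P(1)])
    show "zeta L (ract U (lact U a (cc L P f p)) b) u = a * zeta L (cc L P f p) (iotaA L b \<otimes>\<^bsub>VA L\<^esub> u)"
      using P u by (simp add: lact_cc ract_cc linear_form_scale zeta_cc P.M.act_closed P.M.act_mult)
  qed
qed

theorem zeta_pairing: "pairing L U (zeta L)"
  unfolding pairing_def
proof (intro conjI ballI allI)
  note rg = regular_abelian_group
  show "zeta L \<in> carrier U \<rightarrow> udual L" using zeta_udual by blast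
  fix X assume X: "X \<in> carrier U"
  show "zeta L (X \<oplus>\<^bsub>U\<^esub> Y) u = zeta L X u + zeta L Y u" if "Y \<in> carrier U" "u \<in> carrier (VA L)" for Y u
    using additive_add[OF zeta_additive[OF that(2)] X that(1)] by simp
  show "zeta L (ract U (lact U a X) b) u = a * zeta L X (iotaA L b \<otimes>\<^bsub>VA L\<^esub> u)"
    if "u \<in> carrier (VA L)" for a b u using X that by (rule zeta_bimodule)
  show "zeta L X \<one>\<^bsub>VA L\<^esub> = counit U X"
  proof (rule fdual_ext[OF zeta_additive UC.counit_additive rg X])
    fix P :: "('a, 'l) rmod" and f p assume P: "fgm L P" "linear_form L P f" "p \<in> carrier P"
    interpret P: lr_module \<kappa> L P by (rule fgm_lr_module[OF P(1)])
    show "zeta L (cc L P f p) \<one>\<^bsub>VA L\<^esub> = counit U (cc L P f p)"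
      using P by (simp add: zeta_cc counit_cc P.M.act_one)
  qed simp
  fix zs u v assume zs: "zs \<in> comult U X" and u: "u \<in> carrier (VA L)" and v: "v \<in> carrier (VA L)"
  let ?\<beta> = "\<lambda>x y. zeta L x (iotaA L (zeta L y u) \<otimes>\<^bsub>VA L\<^esub> v)"
  have z: "zeta L x (w \<oplus>\<^bsub>VA L\<^esub> w') = zeta L x w + zeta L x w'"
    if "x \<in> carrier U" "w \<in> carrier (VA L)" "w' \<in> carrier (VA L)" for x w w'
    using zeta_udual[OF that(1)] that by (simp add: udual_def)
  have bz: "zeta L (ract U x a) w = zeta L x (iotaA L a \<otimes>\<^bsub>VA L\<^esub> w)" "zeta L (lact U a x) w = a * zeta L x w"
    if "x \<in> carrier U" "w \<in> carrier (VA L)" for x a w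
    using zeta_bimodule[OF that, of 1 a] zeta_bimodule[OF that, of a 1] that
    by (simp_all add: UU.M.one_lact UU.M.one_ract UU.M.lact_closed flip: VA_one)
  \<comment> \<open>Balancedness makes the sum independent of the representative \<open>zs\<close>,
    so that the one from a dual basis can be used.\<close>
  have "balanced U U regular_bimod ?\<beta>"
    unfolding balanced_def
  proof (intro conjI ballI allI rg)
    fix y assume y: "y \<in> carrier U"
    show "additive U regular_bimod (\<lambda>x. ?\<beta> x y)" using v by (intro zeta_additive) simp
    show "additive U regular_bimod (?\<beta> y)"
      using u v y by (intro additiveI)
        (simp_all add: additive_add[OF zeta_additive[OF u]] iotaA_add V.l_distr z)
    show "?\<beta> (ract U x a) y = ?\<beta> x (lact U a y)" if "x \<in> carrier U" for x a
      using that u v y by (simp add: bz iotaA_mult V.m_assoc)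
  qed
  note bal = this
  have "zeta L X (u \<otimes>\<^bsub>VA L\<^esub> v) = tlift regular_bimod ?\<beta> (comult U X)"
  proof (rule fdual_ext[OF zeta_additive additive_comp[OF comult_fd_additive UU.tlift_additive[OF bal]] rg X])
    fix P :: "('a, 'l) rmod" and f p assume P: "fgm L P" "linear_form L P f" "p \<in> carrier P"
    interpret P: lr_module \<kappa> L P by (rule fgm_lr_module[OF P(1)])
    obtain es where es: "dual_basis L P es" using fgm_basis[OF P(1)] .
    note eD = dual_basisD[OF es]
    have up: "u \<odot>\<^bsub>P\<^esub> p \<in> carrier P" using u P by (simp add: P.M.act_closed)
    have "tlift regular_bimod ?\<beta> (comult U (cc L P f p)) =
        lsum regular_bimod [?\<beta> x y. (x, y) \<leftarrow> [(cc L P f e, cc L P e' p). (e, e') \<leftarrow> es]]"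
      by (rule UU.tlift_mem[OF bal UC.comult_closed[OF cc_closed[OF P]] comult_cc_mem[OF P es], symmetric])
    also have "\<dots> = (\<Sum>i\<leftarrow>es. f (v \<odot>\<^bsub>P\<^esub> (iotaA L (snd i (u \<odot>\<^bsub>P\<^esub> p)) \<odot>\<^bsub>P\<^esub> fst i)))"
      unfolding lsum_regular map_map o_def case_prod_unfold fst_conv snd_conv
      using eD(1,2) u v by (intro arg_cong[of _ _ sum_list] map_cong refl) (auto simp: zeta_cc P P.M.act_mult)
    \<comment> \<open>The scalars act on the basis elements before \<open>v\<close> does, so the
      inner sum is the dual basis expansion of \<open>p u\<close>.\<close>
    also have "\<dots> = f (v \<odot>\<^bsub>P\<^esub> lsum P [iotaA L (snd i (u \<odot>\<^bsub>P\<^esub> p)) \<odot>\<^bsub>P\<^esub> fst i. i \<leftarrow> es])"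
      using additive_lsum_map[OF P.M.abelian_group_axioms rg additive_comp[OF P.act_additive[OF v] linear_form_additive[OF P(2)]],
          of es "\<lambda>i. iotaA L (snd i (u \<odot>\<^bsub>P\<^esub> p)) \<odot>\<^bsub>P\<^esub> fst i"] eD(1)
      by (auto simp: P.M.act_closed)
    also have "\<dots> = f (v \<odot>\<^bsub>P\<^esub> (u \<odot>\<^bsub>P\<^esub> p))" using eD(4)[OF up] by (simp add: case_prod_unfold)
    finally show "zeta L (cc L P f p) (u \<otimes>\<^bsub>VA L\<^esub> v) = tlift regular_bimod ?\<beta> (comult U (cc L P f p))"
      using P u v by (simp add: zeta_cc P.M.act_mult)
  qed (use u v in simp)
  also have "\<dots> = (\<Sum>(x, y) \<leftarrow> zs. ?\<beta> x y)"
    using UU.tlift_mem[OF bal UC.comult_closed[OF X] zs] by simp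
  finally show "zeta L X (u \<otimes>\<^bsub>VA L\<^esub> v) = (\<Sum>(x, y) \<leftarrow> zs. ?\<beta> x y)" .
qed

text \<open>Primitivity of \<open>X\<close> turns the multiplicativity of \<zeta> into the product
  rule at \<open>X\<close>.\<close>

theorem Theta_lr_morphism: "lr_morphism \<kappa> L (der_lr \<kappa> U) (Theta L)"
proof -
  have "Theta L = Theta' L U (zeta L)" by (simp add: fun_eq_iff Theta_def Theta'_def)
  moreover have "lr_morphism \<kappa> L (der_lr \<kappa> U) (Theta' L U (zeta L))"
  proof (rule Theta'_lr_morphism[OF finite_dual_bialgebroid zeta_pairing])
    fix x y X assume *: "x \<in> carrier U" "y \<in> carrier U" "X \<in> carrier L"
    have one: "zeta L z \<one>\<^bsub>VA L\<^esub> = counit U z" if "z \<in> carrier U" for z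
      using zeta_pairing that by (simp add: pairing_def)
    show "zeta L (x \<otimes>\<^bsub>U\<^esub> y) (iotaL L X) = counit U x * zeta L y (iotaL L X) + zeta L x (iotaL L X) * counit U y"
      using zeta_mult[OF *(1,2) iotaL_closed[OF *(3)] ucomult_iotaL[OF *(3)]] *
      by (simp add: one mult.commute)
  qed
  ultimately show ?thesis by simp
qed

end

section \<open>The tensor product of a coring with itself over \<open>A \<otimes> A\<close>\<close>

text \<open>For a commutative bialgebroid the product \<open>x \<otimes> y \<mapsto> x y\<close> is a morphism of corings from
  this tensor product.  That makes the universal property of corings applicable to products.\<close>

definition tlift2 :: "('z, 'v) ring_scheme \<Rightarrow> ('m \<Rightarrow> 'n \<Rightarrow> 'm' \<Rightarrow> 'n' \<Rightarrow> 'z) \<Rightarrow> ('m \<times> 'n) list set \<Rightarrow>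
    ('m' \<times> 'n') list set \<Rightarrow> 'z" where
  "tlift2 Y \<beta> X X' = tlift Y (\<lambda>m n. tlift Y (\<beta> m n) X') X"

locale bimodule_quad = P: bimodule_pair \<kappa> M N + Q: bimodule_pair \<kappa> M' N'
  for \<kappa> :: "'k::field_char_0 \<Rightarrow> 'a::{comm_ring,comm_monoid_mult}"
    and M :: "('a, 'm, 'x) bimod_scheme" and N :: "('a, 'n, 'y) bimod_scheme"
    and M' :: "('a, 'm', 'x2) bimod_scheme" and N' :: "('a, 'n', 'y2) bimod_scheme" +
  fixes Y :: "('z, 'v) ring_scheme" and \<beta> :: "'m \<Rightarrow> 'n \<Rightarrow> 'm' \<Rightarrow> 'n' \<Rightarrow> 'z"
  assumes bal1: "\<lbrakk>m \<in> carrier M; n \<in> carrier N\<rbrakk> \<Longrightarrow> balanced M' N' Y (\<beta> m n)"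
    and bal2: "\<lbrakk>m' \<in> carrier M'; n' \<in> carrier N'\<rbrakk> \<Longrightarrow> balanced M N Y (\<lambda>m n. \<beta> m n m' n')"
    and ag: "abelian_group Y"
begin

abbreviation "T \<equiv> tensor M N"
abbreviation "T' \<equiv> tensor M' N'"

text \<open>After lifting in the second pair of variables, balancedness in the first pair is checked
  on pure tensors of the second.\<close>

lemma bal_outer:
  assumes X': "X' \<in> carrier T'"
  shows "balanced M N Y (\<lambda>m n. tlift Y (\<beta> m n) X')"
proof -
  note ad = Q.tlift_additive[OF bal1] and tl = Q.tlift_tn[OF bal1]
  note ext = Q.tensor_ext[OF _ _ ag X']
  note D = bal2[unfolded balanced_def]
  have "tlift Y (\<beta> (m \<oplus>\<^bsub>M\<^esub> m2) n) X' = tlift Y (\<beta> m n) X' \<oplus>\<^bsub>Y\<^esub> tlift Y (\<beta> m2 n) X'"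
    if "m \<in> carrier M" "m2 \<in> carrier M" "n \<in> carrier N" for m m2 n
    by (rule ext[OF ad additive_add_fun[OF Q.T.is_abelian_group ag ad ad]])
      (use that D in \<open>simp_all add: tl additive_def\<close>)
  moreover have "tlift Y (\<beta> m (n \<oplus>\<^bsub>N\<^esub> n2)) X' = tlift Y (\<beta> m n) X' \<oplus>\<^bsub>Y\<^esub> tlift Y (\<beta> m n2) X'"
    if "m \<in> carrier M" "n \<in> carrier N" "n2 \<in> carrier N" for m n n2
    by (rule ext[OF ad additive_add_fun[OF Q.T.is_abelian_group ag ad ad]])
      (use that D in \<open>simp_all add: tl additive_def\<close>)
  moreover have "tlift Y (\<beta> (ract M m a) n) X' = tlift Y (\<beta> m (lact N a n)) X'"
    if "m \<in> carrier M" "n \<in> carrier N" for m n a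
    by (rule ext[OF ad ad]) (use that D in \<open>simp_all add: tl P.M.ract_closed P.N.lact_closed\<close>)
  ultimately show ?thesis
    unfolding balanced_def using ag additive_closed[OF ad X'] by (auto intro!: additiveI)
qed

lemma tlift2_tn: "\<lbrakk>m \<in> carrier M; n \<in> carrier N; m' \<in> carrier M'; n' \<in> carrier N'\<rbrakk> \<Longrightarrow>
    tlift2 Y \<beta> (tn M N m n) (tn M' N' m' n') = \<beta> m n m' n'"
  unfolding tlift2_def by (simp add: P.tlift_tn[OF bal_outer] Q.tlift_tn[OF bal1])

lemma tlift2_additive_left: "X' \<in> carrier T' \<Longrightarrow> additive T Y (\<lambda>X. tlift2 Y \<beta> X X')"
  unfolding tlift2_def by (rule P.tlift_additive[OF bal_outer])

lemma tlift2_additive_right: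
  assumes X: "X \<in> carrier T"
  shows "additive T' Y (tlift2 Y \<beta> X)"
proof -
  note z = P.tensor_mem(1)[OF X P.T.rep_mem[OF X]]
  have "additive T' Y (\<lambda>X'. lsum Y (map (\<lambda>i. tlift Y (\<beta> (fst i) (snd i)) X') (rep X)))"
    using z by (intro additive_lsum_fun Q.T.is_abelian_group ag Q.tlift_additive bal1) auto
  then show ?thesis by (simp add: tlift2_def[abs_def] tlift_def[of Y "\<lambda>m n. tlift Y (\<beta> m n) _"] case_prod_unfold)
qed

lemma tlift2_closed: "X \<in> carrier T \<Longrightarrow> X' \<in> carrier T' \<Longrightarrow> tlift2 Y \<beta> X X' \<in> carrier Y"
  by (rule additive_closed[OF tlift2_additive_left])

lemma biadditive_ext:
  assumes "abelian_group Z" "X \<in> carrier T" "X' \<in> carrier T'"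
    and "\<And>X'. X' \<in> carrier T' \<Longrightarrow> additive T Z (\<lambda>X. h X X')" "\<And>X'. X' \<in> carrier T' \<Longrightarrow> additive T Z (\<lambda>X. k X X')"
    and "\<And>X. X \<in> carrier T \<Longrightarrow> additive T' Z (h X)" "\<And>X. X \<in> carrier T \<Longrightarrow> additive T' Z (k X)"
    and "\<And>m n m' n'. \<lbrakk>m \<in> carrier M; n \<in> carrier N; m' \<in> carrier M'; n' \<in> carrier N'\<rbrakk> \<Longrightarrow>
      h (tn M N m n) (tn M' N' m' n') = k (tn M N m n) (tn M' N' m' n')"
  shows "h X X' = k X X'"
proof (rule P.tensor_ext[OF assms(4)[OF assms(3)] assms(5)[OF assms(3)] assms(1,2)])
  fix m n assume mn: "m \<in> carrier M" "n \<in> carrier N"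
  then have t: "tn M N m n \<in> carrier T" by simp
  show "h (tn M N m n) X' = k (tn M N m n) X'"
    by (rule Q.tensor_ext[OF assms(6)[OF t] assms(7)[OF t] assms(1,3)]) (use mn assms(8) in auto)
qed

end

text \<open>The relations of \<open>C \<otimes> C\<close> over \<open>A \<otimes> A\<close>: left
  scalars move between left actions and right scalars between right actions, whereas over
  \<open>A\<close> a right scalar moves to a left action.\<close>

inductive dbase :: "('a, 'c, 'x) bimod_scheme \<Rightarrow> ('c \<times> 'c) list \<Rightarrow> ('c \<times> 'c) list \<Rightarrow> bool"
  for C :: "('a, 'c, 'x) bimod_scheme" where
  "x \<in> carrier C \<Longrightarrow> x' \<in> carrier C \<Longrightarrow> y \<in> carrier C \<Longrightarrow> dbase C [(x \<oplus>\<^bsub>C\<^esub> x', y)] [(x, y), (x', y)]"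
| "x \<in> carrier C \<Longrightarrow> y \<in> carrier C \<Longrightarrow> y' \<in> carrier C \<Longrightarrow> dbase C [(x, y \<oplus>\<^bsub>C\<^esub> y')] [(x, y), (x, y')]"
| "y \<in> carrier C \<Longrightarrow> dbase C [(\<zero>\<^bsub>C\<^esub>, y)] []"
| "x \<in> carrier C \<Longrightarrow> y \<in> carrier C \<Longrightarrow> dbase C [(lact C a x, y)] [(x, lact C a y)]"
| "x \<in> carrier C \<Longrightarrow> y \<in> carrier C \<Longrightarrow> dbase C [(ract C x a, y)] [(x, ract C y a)]"

definition dcls :: "('a, 'c, 'x) bimod_scheme \<Rightarrow> ('c \<times> 'c) list \<Rightarrow> ('c \<times> 'c) list set" where
  "dcls C = pcls (carrier C \<times> carrier C) (dbase C)"

definition dn :: "('a, 'c, 'x) bimod_scheme \<Rightarrow> 'c \<Rightarrow> 'c \<Rightarrow> ('c \<times> 'c) list set" where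
  "dn C x y = dcls C [(x, y)]"

definition dbalanced :: "('a, 'c, 'x) bimod_scheme \<Rightarrow> ('z, 'v) ring_scheme \<Rightarrow> ('c \<Rightarrow> 'c \<Rightarrow> 'z) \<Rightarrow> bool" where
  "dbalanced C Y \<beta> \<longleftrightarrow> abelian_group Y \<and> (\<forall>y\<in>carrier C. additive C Y (\<lambda>x. \<beta> x y)) \<and>
     (\<forall>x\<in>carrier C. additive C Y (\<beta> x)) \<and>
     (\<forall>x\<in>carrier C. \<forall>y\<in>carrier C. \<forall>a. \<beta> (lact C a x) y = \<beta> x (lact C a y) \<and> \<beta> (ract C x a) y = \<beta> x (ract C y a))"

definition dlift :: "('z, 'v) ring_scheme \<Rightarrow> ('c \<Rightarrow> 'c \<Rightarrow> 'z) \<Rightarrow> ('c \<times> 'c) list set \<Rightarrow> 'z" where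
  "dlift Y \<beta> X = lsum Y (map (\<lambda>(x, y). \<beta> x y) (rep X))"

definition square_bimod :: "('a, 'c, 'x) bimod_scheme \<Rightarrow> ('a, ('c \<times> 'c) list set) bimod" where
  "square_bimod C = \<lparr>carrier = dcls C ` {zs. set zs \<subseteq> carrier C \<times> carrier C}, mult = undefined, one = undefined,
     zero = dcls C [], add = (\<lambda>X Y. \<Union>x\<in>X. \<Union>y\<in>Y. dcls C (x @ y)),
     lact = (\<lambda>a X. \<Union>z\<in>X. dcls C [(lact C a x, y). (x, y) \<leftarrow> z]),
     ract = (\<lambda>X a. \<Union>z\<in>X. dcls C [(ract C x a, y). (x, y) \<leftarrow> z])\<rparr>"

text \<open>The interchange \<open>(x\<^sub>1 \<otimes> x\<^sub>2, y\<^sub>1 \<otimes> y\<^sub>2)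
  \<mapsto> (x\<^sub>1 y\<^sub>1) \<otimes> (x\<^sub>2 y\<^sub>2)\<close>, in which the inner pairs
  are generators of the square.\<close>

definition shuffle :: "('a, 'c, 'x) bimod_scheme \<Rightarrow> ('a, ('c \<times> 'c) list set, 'y) bimod_scheme \<Rightarrow>
    ('c \<times> 'c) list set \<Rightarrow> ('c \<times> 'c) list set \<Rightarrow> (('c \<times> 'c) list set \<times> ('c \<times> 'c) list set) list set" where
  "shuffle C B = tlift2 (tensor B B) (\<lambda>x1 x2 y1 y2. tn B B (dn C x1 y1) (dn C x2 y2))"

text \<open>The record is assembled in two stages because the comultiplication takes values in the
  tensor square of the bimodule that is being extended.\<close>

definition square_coring :: "('a::{comm_ring,comm_monoid_mult}, 'c, 'x) coring_scheme \<Rightarrow>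
    ('a, ('c \<times> 'c) list set) coring" where
  "square_coring C = bimod.extend (square_bimod C) (coring.fields
     (dlift (tensor (square_bimod C) (square_bimod C))
       (\<lambda>x y. shuffle C (square_bimod C) (comult C x) (comult C y)))
     (dlift regular_bimod (\<lambda>x y. counit C x * counit C y)))"

lemma tensor_cong:
  assumes "carrier M = carrier M'" "carrier N = carrier N'" "\<zero>\<^bsub>M\<^esub> = \<zero>\<^bsub>M'\<^esub>" "\<zero>\<^bsub>N\<^esub> = \<zero>\<^bsub>N'\<^esub>"
    "add M = add M'" "add N = add N'" "lact M = lact M'" "ract M = ract M'" "lact N = lact N'" "ract N = ract N'"
  shows "tensor M N = tensor M' N'" "tn M N = tn M' N'" "tcls M N = tcls M' N'" "teq M N = teq M' N'"
proof -
  show t: "teq M N = teq M' N'" by (rule teq_cong) (simp_all add: assms)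
  show c: "tcls M N = tcls M' N'" by (simp add: tcls_def t fun_eq_iff)
  show "tensor M N = tensor M' N'" by (simp add: tensor_def c assms)
  show "tn M N = tn M' N'" by (simp add: tn_def c fun_eq_iff)
qed

lemma square_coring_simps:
  "carrier (square_coring C) = dcls C ` {zs. set zs \<subseteq> carrier C \<times> carrier C}"
  "\<zero>\<^bsub>square_coring C\<^esub> = dcls C []"
  "add (square_coring C) X Y = (\<Union>x\<in>X. \<Union>y\<in>Y. dcls C (x @ y))"
  "lact (square_coring C) a X = (\<Union>z\<in>X. dcls C [(lact C a x, y). (x, y) \<leftarrow> z])"
  "ract (square_coring C) X a = (\<Union>z\<in>X. dcls C [(ract C x a, y). (x, y) \<leftarrow> z])"
  "counit (square_coring C) = dlift regular_bimod (\<lambda>x y. counit C x * counit C y)"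
  by (simp_all add: square_coring_def square_bimod_def bimod.defs coring.defs)

lemma square_coring_comult:
  "comult (square_coring C) = dlift (tensor (square_coring C) (square_coring C))
     (\<lambda>x y. shuffle C (square_coring C) (comult C x) (comult C y))"
proof -
  let ?B = "square_bimod C" and ?D = "square_coring C"
  have *: "tensor ?B ?B = tensor ?D ?D" "tn ?B ?B = tn ?D ?D"
    by (rule tensor_cong; simp add: square_coring_def bimod.defs coring.defs)+
  have "comult ?D = dlift (tensor ?B ?B) (\<lambda>x y. shuffle C ?B (comult C x) (comult C y))"
    by (simp add: square_coring_def bimod.defs coring.defs)
  then show ?thesis by (simp add: shuffle_def *)
qed

section \<open>Presentation and bimodule structure of the square\<close>

context precoring
begin

abbreviation "D \<equiv> square_coring C"
abbreviation "D2 \<equiv> tensor D D"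
abbreviation "D3 \<equiv> tensor D (tensor D D)"

lemma square_presented: "presented_group (carrier C \<times> carrier C) (dbase C) D"
proof
  fix l r :: "('c \<times> 'c) list" assume "dbase C l r"
  then show "set l \<subseteq> carrier C \<times> carrier C \<and> set r \<subseteq> carrier C \<times> carrier C"
    by cases (auto simp: lact_closed ract_closed)
next
  fix g assume "g \<in> carrier C \<times> carrier C"
  then obtain m n where g: "g = (m, n)" "m \<in> carrier C" "n \<in> carrier C" by auto
  have "peq (carrier C \<times> carrier C) (dbase C) [(m \<oplus> \<ominus> m, n)] [(m, n), (\<ominus> m, n)]"
    using g by (intro peq_base dbase.intros) auto
  moreover have "peq (carrier C \<times> carrier C) (dbase C) [(m \<oplus> \<ominus> m, n)] []"
    using g by (auto simp: r_neg intro: peq_base dbase.intros)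
  ultimately show "\<exists>h\<in>carrier C \<times> carrier C. peq (carrier C \<times> carrier C) (dbase C) [g, h] []"
    using g by (intro bexI[of _ "(\<ominus> m, n)"]) (auto intro: peq_trans peq_sym)
qed (simp_all add: square_coring_simps dcls_def)

sublocale G: presented_group "carrier C \<times> carrier C" "dbase C" "square_coring C"
  by (rule square_presented)

lemma dn_closed [simp]: "x \<in> carrier C \<Longrightarrow> y \<in> carrier C \<Longrightarrow> dn C x y \<in> carrier D"
  unfolding dn_def dcls_def by (rule G.pcls_closed) simp

lemma dn_add_left: "\<lbrakk>x \<in> carrier C; x' \<in> carrier C; y \<in> carrier C\<rbrakk> \<Longrightarrow> dn C (x \<oplus> x') y = dn C x y \<oplus>\<^bsub>D\<^esub> dn C x' y"
  and dn_add_right: "\<lbrakk>x \<in> carrier C; y \<in> carrier C; y' \<in> carrier C\<rbrakk> \<Longrightarrow> dn C x (y \<oplus> y') = dn C x y \<oplus>\<^bsub>D\<^esub> dn C x y'"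
  and dn_lact: "\<lbrakk>x \<in> carrier C; y \<in> carrier C\<rbrakk> \<Longrightarrow> dn C (lact C a x) y = dn C x (lact C a y)"
  and dn_ract: "\<lbrakk>x \<in> carrier C; y \<in> carrier C\<rbrakk> \<Longrightarrow> dn C (ract C x a) y = dn C x (ract C y a)"
  unfolding dn_def dcls_def
  by (simp_all add: G.pcls_append, auto intro!: G.pcls_eqI peq_base dbase.intros)

lemma dbalanced_compat:
  assumes "dbalanced C Y \<beta>"
  shows "compat (carrier C \<times> carrier C) (dbase C) Y (\<lambda>(x, y). \<beta> x y)"
proof -
  interpret Y: abelian_group Y using assms by (simp add: dbalanced_def)
  have cl: "\<beta> x y \<in> carrier Y" if "x \<in> carrier C" "y \<in> carrier C" for x y
    using assms that by (auto simp: dbalanced_def additive_def)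
  have z: "\<beta> \<zero> y = \<zero>\<^bsub>Y\<^esub>" if "y \<in> carrier C" for y
    using assms that additive_zero[OF abelian_group_axioms Y.abelian_group_axioms, of "\<lambda>m. \<beta> m y"]
    by (simp add: dbalanced_def)
  have "lsum Y (map (\<lambda>(x, y). \<beta> x y) l) = lsum Y (map (\<lambda>(x, y). \<beta> x y) r)" if "dbase C l r" for l r
    using that
  proof cases
    case 1
    then show ?thesis using assms cl by (auto simp: dbalanced_def additive_def)
  next
    case 2
    then show ?thesis using assms cl by (auto simp: dbalanced_def additive_def)
  next
    case (4 x y a)
    moreover have "\<beta> (lact C a x) y = \<beta> x (lact C a y)" using assms 4 by (simp add: dbalanced_def)
    ultimately show ?thesis by simp
  next
    case (5 x y a)
    moreover have "\<beta> (ract C x a) y = \<beta> x (ract C y a)" using assms 5 by (simp add: dbalanced_def)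
    ultimately show ?thesis by simp
  qed (auto simp: z)
  then show ?thesis using cl Y.abelian_group_axioms by (auto simp: compat_def)
qed

lemma dlift_plift: "dlift Y \<beta> = plift Y (\<lambda>(x, y). \<beta> x y)"
  by (rule ext) (simp add: dlift_def plift_def)

lemma dlift_dn: "dbalanced C Y \<beta> \<Longrightarrow> x \<in> carrier C \<Longrightarrow> y \<in> carrier C \<Longrightarrow> dlift Y \<beta> (dn C x y) = \<beta> x y"
  using G.plift_gen[OF dbalanced_compat, of Y \<beta> "(x, y)"] by (simp add: dlift_plift dn_def dcls_def)

lemma dlift_additive: "dbalanced C Y \<beta> \<Longrightarrow> additive D Y (dlift Y \<beta>)"
  by (simp add: dlift_plift G.plift_additive dbalanced_compat)

lemma square_ext:
  assumes "additive D Y h" "additive D Y k" "abelian_group Y" "X \<in> carrier D"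
    and "\<And>x y. x \<in> carrier C \<Longrightarrow> y \<in> carrier C \<Longrightarrow> h (dn C x y) = k (dn C x y)"
  shows "h X = k X"
proof (rule G.additive_ext[OF assms(1-4)])
  fix g assume "g \<in> carrier C \<times> carrier C"
  then obtain x y where "g = (x, y)" "x \<in> carrier C" "y \<in> carrier C" by blast
  then show "h (pcls (carrier C \<times> carrier C) (dbase C) [g]) = k (pcls (carrier C \<times> carrier C) (dbase C) [g])"
    using assms(5)[of x y] by (simp only: dn_def dcls_def)
qed

text \<open>Both actions of the square are taken on the first entry. Their compatibility with the
  relations that move scalars comes from the commutativity of the base algebra.\<close>

lemma dbalanced_lact: "dbalanced C D (\<lambda>x y. dn C (lact C a x) y)"
proof -
  have "lact C a (lact C b x) = lact C b (lact C a x)" if "x \<in> carrier C" for b x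
    using mult_lact[OF that, of a b] mult_lact[OF that, of b a] by (simp add: mult.commute)
  then show ?thesis
    unfolding dbalanced_def using G.is_abelian_group
    by (auto simp: lact_closed lact_add dn_add_left dn_add_right dn_lact dn_ract lact_ract ract_closed intro!: additiveI)
qed

lemma dbalanced_ract: "dbalanced C D (\<lambda>x y. dn C (ract C x a) y)"
proof -
  have "ract C (ract C x b) a = ract C (ract C x a) b" if "x \<in> carrier C" for b x
    using mult_ract[OF that, of a b] mult_ract[OF that, of b a] by (simp add: mult.commute)
  then show ?thesis
    unfolding dbalanced_def using G.is_abelian_group
    by (auto simp: ract_closed ract_add dn_add_left dn_add_right dn_lact dn_ract lact_ract lact_closed intro!: additiveI)
qed

lemma square_UN:
  assumes bal: "dbalanced C D (\<lambda>x y. dn C (h x) y)" and h: "\<And>x. x \<in> carrier C \<Longrightarrow> h x \<in> carrier C"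
    and X: "X \<in> carrier D"
  shows "(\<Union>z\<in>X. dcls C [(h x, y). (x, y) \<leftarrow> z]) = dlift D (\<lambda>x y. dn C (h x) y) X"
proof -
  have "dcls C [(h x, y). (x, y) \<leftarrow> z] = lsum D (map (\<lambda>(x, y). dn C (h x) y) z)" if "z \<in> X" for z
  proof -
    have "set z \<subseteq> carrier C \<times> carrier C" by (rule G.carrier_memD(1)[OF X that])
    then have "set [(h x, y). (x, y) \<leftarrow> z] \<subseteq> carrier C \<times> carrier C" using h by auto
    from G.pcls_lsum[OF this] show ?thesis by (simp add: dcls_def dn_def case_prod_unfold o_def)
  qed
  then have "(\<Union>z\<in>X. dcls C [(h x, y). (x, y) \<leftarrow> z]) = (\<Union>z\<in>X. lsum D (map (\<lambda>(x, y). dn C (h x) y) z))"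
    by simp
  then show ?thesis unfolding dlift_plift by (simp only: G.UN_plift[OF dbalanced_compat[OF bal] X])
qed

lemma square_lact: "X \<in> carrier D \<Longrightarrow> lact D a X = dlift D (\<lambda>x y. dn C (lact C a x) y) X"
  unfolding square_coring_simps(4) by (rule square_UN[OF dbalanced_lact lact_closed])

lemma square_ract: "X \<in> carrier D \<Longrightarrow> ract D X a = dlift D (\<lambda>x y. dn C (ract C x a) y) X"
  unfolding square_coring_simps(5) by (rule square_UN[OF dbalanced_ract ract_closed])

lemma square_lact_additive: "additive D D (lact D a)"
  by (rule iffD2[OF additive_cong[OF G.is_abelian_group] dlift_additive[OF dbalanced_lact]]) (rule square_lact)

lemma square_ract_additive: "additive D D (\<lambda>X. ract D X a)"
  by (rule iffD2[OF additive_cong[OF G.is_abelian_group] dlift_additive[OF dbalanced_ract]]) (rule square_ract)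

lemma lact_dn: "\<lbrakk>x \<in> carrier C; y \<in> carrier C\<rbrakk> \<Longrightarrow> lact D a (dn C x y) = dn C (lact C a x) y"
  by (simp add: square_lact dlift_dn[OF dbalanced_lact])

lemma ract_dn: "\<lbrakk>x \<in> carrier C; y \<in> carrier C\<rbrakk> \<Longrightarrow> ract D (dn C x y) a = dn C (ract C x a) y"
  by (simp add: square_ract dlift_dn[OF dbalanced_ract])

lemma square_bimodule: "bimodule \<kappa> D"
proof -
  note ag = G.is_abelian_group
  note la = square_lact_additive and ra = square_ract_additive
  have id: "additive D D (\<lambda>X. X)" by (simp add: additive_def)
  note ext = square_ext[OF _ _ ag]
  note [simp] = lact_dn ract_dn lact_closed ract_closed
  show ?thesis
  proof (rule bimodule.intro[OF ag], unfold_locales)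
    fix X a b assume X: "X \<in> carrier D"
    show "lact D (a + b) X = lact D a X \<oplus>\<^bsub>D\<^esub> lact D b X"
      by (rule ext[OF la additive_add_fun[OF ag ag la la] X]) (simp add: add_lact dn_add_left)
    show "ract D X (a + b) = ract D X a \<oplus>\<^bsub>D\<^esub> ract D X b"
      by (rule ext[OF ra additive_add_fun[OF ag ag ra ra] X]) (simp add: add_ract dn_add_left)
    show "lact D (a * b) X = lact D a (lact D b X)"
      by (rule ext[OF la additive_comp[OF la la] X]) (simp add: mult_lact)
    show "ract D X (a * b) = ract D (ract D X a) b"
      by (rule ext[OF ra additive_comp[OF ra ra] X]) (simp add: mult_ract)
    show "lact D 1 X = X" by (rule ext[OF la id X]) (simp add: one_lact)
    show "ract D X 1 = X" by (rule ext[OF ra id X]) (simp add: one_ract)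
    show "ract D (lact D a X) b = lact D a (ract D X b)"
      by (rule ext[OF additive_comp[OF la ra] additive_comp[OF ra la] X]) (simp add: lact_ract)
    fix c show "lact D (\<kappa> c) X = ract D X (\<kappa> c)"
      by (rule ext[OF la ra X]) (simp add: central)
  qed (auto simp: additive_closed[OF la] additive_closed[OF ra] additive_add[OF la] additive_add[OF ra])
qed

section \<open>The interchange map and the comultiplication of the square\<close>

sublocale DD: bimodule_pair \<kappa> "square_coring C" "square_coring C"
  by (intro bimodule_pairI square_bimodule)

sublocale DT: bimodule_pair \<kappa> "square_coring C" "tensor (square_coring C) (square_coring C)"
  by (intro bimodule_pairI square_bimodule DD.tensor_bimodule)

abbreviation "W \<equiv> shuffle C D"

text \<open>A scalar between \<open>x1\<close> and \<open>x2\<close> lies, after the interchange,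
  between two elements of the square, where it can cross the tensor sign; likewise for
  \<open>y1\<close> and \<open>y2\<close>.\<close>

lemma shuffle_quad:
  "bimodule_quad \<kappa> C C C C D2 (\<lambda>x1 x2 y1 y2. tn D D (dn C x1 y1) (dn C x2 y2))"
proof (intro bimodule_quad.intro bimodule_pairI bimodule_axioms bimodule_quad_axioms.intro DD.T.is_abelian_group)
  have r: "dn C x (ract C y a) = ract D (dn C x y) a" "dn C x (lact C a y) = lact D a (dn C x y)"
    if "x \<in> carrier C" "y \<in> carrier C" for x y a using that by (simp_all add: ract_dn dn_ract lact_dn dn_lact)
  show "balanced C C D2 (\<lambda>y1 y2. tn D D (dn C x1 y1) (dn C x2 y2))" if "x1 \<in> carrier C" "x2 \<in> carrier C" for x1 x2
    unfolding balanced_def using that DD.T.is_abelian_group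
    by (auto simp: dn_add_right DD.tn_add_left DD.tn_add_right r DD.tn_balanced intro!: additiveI)
  show "balanced C C D2 (\<lambda>x1 x2. tn D D (dn C x1 y1) (dn C x2 y2))" if "y1 \<in> carrier C" "y2 \<in> carrier C" for y1 y2
    unfolding balanced_def using that DD.T.is_abelian_group
    by (auto simp: dn_add_left DD.tn_add_left DD.tn_add_right DD.tn_balanced simp flip: ract_dn lact_dn intro!: additiveI)
qed

sublocale W: bimodule_quad \<kappa> C C C C "tensor (square_coring C) (square_coring C)"
    "\<lambda>x1 x2 y1 y2. tn (square_coring C) (square_coring C) (dn C x1 y1) (dn C x2 y2)"
  by (rule shuffle_quad)

lemma W_tn: "\<lbrakk>x1 \<in> carrier C; x2 \<in> carrier C; y1 \<in> carrier C; y2 \<in> carrier C\<rbrakk> \<Longrightarrow>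
    W (tn C C x1 x2) (tn C C y1 y2) = tn D D (dn C x1 y1) (dn C x2 y2)"
  unfolding shuffle_def by (rule W.tlift2_tn)

lemma W_additive: "Y \<in> carrier C2 \<Longrightarrow> additive C2 D2 (\<lambda>X. W X Y)" "X \<in> carrier C2 \<Longrightarrow> additive C2 D2 (W X)"
  unfolding shuffle_def by (rule W.tlift2_additive_left, assumption) (rule W.tlift2_additive_right)

lemma W_closed: "X \<in> carrier C2 \<Longrightarrow> Y \<in> carrier C2 \<Longrightarrow> W X Y \<in> carrier D2"
  unfolding shuffle_def by (rule W.tlift2_closed)

text \<open>A left scalar on either argument reaches the first leg, where the relations of the
  square identify the two positions.\<close>

lemma W_lact:
  assumes "X \<in> carrier C2" "Y \<in> carrier C2"
  shows "W (lact C2 a X) Y = lact D2 a (W X Y)" "W X (lact C2 a Y) = lact D2 a (W X Y)"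
proof -
  note ag = DD.T.is_abelian_group
  note cl = additive_closed[OF CC.additive_lact_T]
  show "W (lact C2 a X) Y = lact D2 a (W X Y)"
    by (rule W.biadditive_ext[OF ag assms, of "\<lambda>X Y. W (lact C2 a X) Y" "\<lambda>X Y. lact D2 a (W X Y)"])
      (auto simp: CC.lact_tn W_tn DD.lact_tn lact_dn lact_closed cl intro!: additive_comp[OF CC.additive_lact_T W_additive(1)]
        W_additive additive_comp[OF _ DD.additive_lact_T])
  show "W X (lact C2 a Y) = lact D2 a (W X Y)"
    by (rule W.biadditive_ext[OF ag assms, of "\<lambda>X Y. W X (lact C2 a Y)" "\<lambda>X Y. lact D2 a (W X Y)"])
      (auto simp: CC.lact_tn W_tn DD.lact_tn lact_dn dn_lact lact_closed cl intro!: additive_comp[OF CC.additive_lact_T W_additive(2)]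
        W_additive additive_comp[OF _ DD.additive_lact_T])
qed

lemma W_ract:
  assumes "X \<in> carrier C2" "Y \<in> carrier C2"
  shows "W (ract C2 X a) Y = ract D2 (W X Y) a" "W X (ract C2 Y a) = ract D2 (W X Y) a"
proof -
  note ag = DD.T.is_abelian_group
  note cl = additive_closed[OF CC.additive_ract_T]
  show "W (ract C2 X a) Y = ract D2 (W X Y) a"
    by (rule W.biadditive_ext[OF ag assms, of "\<lambda>X Y. W (ract C2 X a) Y" "\<lambda>X Y. ract D2 (W X Y) a"])
      (auto simp: CC.ract_tn W_tn DD.ract_tn ract_dn ract_closed cl intro!: additive_comp[OF CC.additive_ract_T W_additive(1)]
        W_additive additive_comp[OF _ DD.additive_ract_T])
  show "W X (ract C2 Y a) = ract D2 (W X Y) a"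
    by (rule W.biadditive_ext[OF ag assms, of "\<lambda>X Y. W X (ract C2 Y a)" "\<lambda>X Y. ract D2 (W X Y) a"])
      (auto simp: CC.ract_tn W_tn DD.ract_tn ract_dn dn_ract ract_closed cl intro!: additive_comp[OF CC.additive_ract_T W_additive(2)]
        W_additive additive_comp[OF _ DD.additive_ract_T])
qed

lemma dbalanced_comult: "dbalanced C D2 (\<lambda>x y. W (comult C x) (comult C y))"
  unfolding dbalanced_def
proof (intro conjI ballI allI DD.T.is_abelian_group)
  fix y assume y: "y \<in> carrier C"
  show "additive C D2 (\<lambda>x. W (comult C x) (comult C y))"
    by (rule additive_comp[OF comult_additive W_additive(1)[OF comult_closed[OF y]]])
  show "additive C D2 (\<lambda>x. W (comult C y) (comult C x))"
    by (rule additive_comp[OF comult_additive W_additive(2)[OF comult_closed[OF y]]])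
  fix x a assume x: "x \<in> carrier C"
  show "W (comult C (lact C a x)) (comult C y) = W (comult C x) (comult C (lact C a y))"
    "W (comult C (ract C x a)) (comult C y) = W (comult C x) (comult C (ract C y a))"
    using x y by (simp_all add: comult_lact comult_ract W_lact W_ract comult_closed)
qed

lemma dbalanced_counit: "dbalanced C regular_bimod (\<lambda>x y. counit C x * counit C y)"
  unfolding dbalanced_def using regular_abelian_group
  by (auto simp: additive_add[OF counit_additive] counit_lact counit_ract algebra_simps intro!: additiveI)

lemma comult_dn: "\<lbrakk>x \<in> carrier C; y \<in> carrier C\<rbrakk> \<Longrightarrow> comult D (dn C x y) = W (comult C x) (comult C y)"
  unfolding square_coring_comult by (rule dlift_dn[OF dbalanced_comult])

lemma counit_dn: "\<lbrakk>x \<in> carrier C; y \<in> carrier C\<rbrakk> \<Longrightarrow> counit D (dn C x y) = counit C x * counit C y"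
  unfolding square_coring_simps by (rule dlift_dn[OF dbalanced_counit])

lemma square_comult_additive: "additive D D2 (comult D)"
  unfolding square_coring_comult by (rule dlift_additive[OF dbalanced_comult])

lemma square_counit_additive: "additive D regular_bimod (counit D)"
  unfolding square_coring_simps by (rule dlift_additive[OF dbalanced_counit])

lemma square_precoring: "precoring \<kappa> D"
proof (intro precoring.intro square_bimodule precoring_axioms.intro)
  note ag2 = DD.T.is_abelian_group and rg = regular_abelian_group
  note cm = square_comult_additive and cu = square_counit_additive
  have "comult D (lact D a X) = lact D2 a (comult D X)" if X: "X \<in> carrier D" for X a
    by (rule square_ext[OF additive_comp[OF square_lact_additive cm] additive_comp[OF cm DD.additive_lact_T] ag2 X])
      (simp add: lact_dn comult_dn lact_closed comult_lact W_lact comult_closed)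
  moreover have "comult D (ract D X a) = ract D2 (comult D X) a" if X: "X \<in> carrier D" for X a
    by (rule square_ext[OF additive_comp[OF square_ract_additive cm] additive_comp[OF cm DD.additive_ract_T] ag2 X])
      (simp add: ract_dn comult_dn ract_closed comult_ract W_ract comult_closed)
  ultimately show "comult D \<in> bimod_hom D D2"
    using additive_closed[OF cm] additive_add[OF cm] by (auto simp: bimod_hom_def)
  have a: "additive D regular_bimod (\<lambda>X. a * counit D X)" "additive D regular_bimod (\<lambda>X. counit D X * a)" for a
    using cu by (simp_all add: additive_def distrib_left distrib_right)
  have "counit D (lact D a X) = a * counit D X" if X: "X \<in> carrier D" for X a
    by (rule square_ext[OF additive_comp[OF square_lact_additive cu] a(1) rg X])
      (simp add: lact_dn counit_dn lact_closed counit_lact mult.assoc)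
  moreover have "counit D (ract D X a) = counit D X * a" if X: "X \<in> carrier D" for X a
    by (rule square_ext[OF additive_comp[OF square_ract_additive cu] a(2) rg X])
      (simp add: ract_dn counit_dn ract_closed counit_ract algebra_simps)
  ultimately show "counit D \<in> bimod_hom D regular_bimod"
    using additive_add[OF cu] by (auto simp: bimod_hom_def)
qed

text \<open>The interchange one level higher, from two copies of
  \<open>C \<otimes> (C \<otimes> C)\<close> to the triple tensor product of the square.\<close>

lemma W3_quad:
  "bimodule_quad \<kappa> C C2 C C2 D3 (\<lambda>x X y Y. tn D D2 (dn C x y) (W X Y))"
proof (intro bimodule_quad.intro bimodule_pairI bimodule_axioms CC.tensor_bimodule bimodule_quad_axioms.intro DT.T.is_abelian_group)
  have r: "dn C x (ract C y a) = ract D (dn C x y) a" "dn C (ract C x a) y = ract D (dn C x y) a"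
    if "x \<in> carrier C" "y \<in> carrier C" for x y a using that by (simp_all add: ract_dn dn_ract)
  note wa = additive_add[OF W_additive(1)] additive_add[OF W_additive(2)]
  show "balanced C C2 D3 (\<lambda>y Y. tn D D2 (dn C x y) (W X Y))" if "x \<in> carrier C" "X \<in> carrier C2" for x X
    unfolding balanced_def using that DT.T.is_abelian_group
    by (auto simp: dn_add_right DT.tn_add_left DT.tn_add_right r DT.tn_balanced W_closed wa W_lact intro!: additiveI)
  show "balanced C C2 D3 (\<lambda>x X. tn D D2 (dn C x y) (W X Y))" if "y \<in> carrier C" "Y \<in> carrier C2" for y Y
    unfolding balanced_def using that DT.T.is_abelian_group
    by (auto simp: dn_add_left DT.tn_add_left DT.tn_add_right r DT.tn_balanced W_closed wa W_lact intro!: additiveI)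
qed

text \<open>The interchange maps intertwine the structures: to apply the coproduct of the square to
  a leg of \<open>W X Y\<close> is to apply that of \<open>C\<close> to the same leg of
  \<open>X\<close> and of \<open>Y\<close> and then to interchange. So each axiom for the square
  follows from the same axiom for both factors.\<close>

theorem square_coring:
  assumes C: "coring \<kappa> C"
  shows "coring \<kappa> D"
proof -
  interpret E: precoring \<kappa> D by (rule square_precoring)
  interpret C: coring \<kappa> C by fact
  note ag3 = DT.T.is_abelian_group and agD = G.is_abelian_group
  define \<beta>3 where "\<beta>3 = (\<lambda>x X y Y. tn D D2 (dn C x y) (W X Y))"
  interpret W3: bimodule_quad \<kappa> C C2 C C2 D3 \<beta>3 unfolding \<beta>3_def by (rule W3_quad)
  let ?W3 = "tlift2 D3 \<beta>3"
  have W3: "?W3 (tn C C2 x X) (tn C C2 y Y) = tn D D2 (dn C x y) (W X Y)"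
    if "x \<in> carrier C" "X \<in> carrier C2" "y \<in> carrier C" "Y \<in> carrier C2" for x X y Y
    using W3.tlift2_tn[OF that] by (simp add: \<beta>3_def)
  \<comment> \<open>The maps \<open>1 \<otimes> \<Delta>\<close> and
    \<open>\<Delta> \<otimes> 1\<close> on the tensor squares of \<open>C\<close> and of
    \<open>D\<close>. Separated from the first coproduct they are maps of a tensor variable, to
    which \<open>biadditive_ext\<close> applies.\<close>
  define r where "r = tlift C3 (\<lambda>x y. tn C C2 x (comult C y))"
  define l where "l = tlift C3 (\<lambda>x y. assoc_with y (comult C x))"
  define R where "R = tlift D3 (\<lambda>x y. tn D D2 x (comult D y))"
  define F where "F = tlift D3 (\<lambda>x y. E.assoc_with y (comult D x))"
  have ad: "additive C2 C3 r" "additive C2 C3 l" "additive D2 D3 R" "additive D2 D3 F"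
    unfolding r_def l_def R_def F_def
    by (intro CC.tlift_additive balanced_co_right balanced_co_left DD.tlift_additive E.balanced_co_right E.balanced_co_left)+
  have tn: "r (tn C C x y) = tn C C2 x (comult C y)" "l (tn C C x y) = assoc_with y (comult C x)"
    if "x \<in> carrier C" "y \<in> carrier C" for x y
    unfolding r_def l_def using that by (simp_all add: CC.tlift_tn balanced_co_right balanced_co_left)
  have tn': "R (tn D D x y) = tn D D2 x (comult D y)" "F (tn D D x y) = E.assoc_with y (comult D x)"
    if "x \<in> carrier D" "y \<in> carrier D" for x y
    unfolding R_def F_def using that by (simp_all add: DD.tlift_tn E.balanced_co_right E.balanced_co_left)
  note cl = additive_closed[OF ad(1)] additive_closed[OF ad(2)]
  have RW: "R (W X Y) = ?W3 (r X) (r Y)" if "X \<in> carrier C2" "Y \<in> carrier C2" for X Y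
  proof (rule W.biadditive_ext[OF ag3 that, of "\<lambda>X Y. R (W X Y)" "\<lambda>X Y. ?W3 (r X) (r Y)"])
    fix x1 x2 y1 y2 assume "x1 \<in> carrier C" "x2 \<in> carrier C" "y1 \<in> carrier C" "y2 \<in> carrier C"
    then show "R (W (tn C C x1 x2) (tn C C y1 y2)) = ?W3 (r (tn C C x1 x2)) (r (tn C C y1 y2))"
      by (simp add: W_tn tn tn' W3 comult_dn comult_closed)
  qed (auto intro!: additive_comp[OF W_additive(1) ad(3)] additive_comp[OF W_additive(2) ad(3)]
      additive_comp[OF ad(1) W3.tlift2_additive_left] additive_comp[OF ad(1) W3.tlift2_additive_right] cl)
  \<comment> \<open>The interchange also commutes with reassociation, for a fixed last entry in each
    factor.\<close>
  have AW: "E.assoc_with (dn C x y) (W X Y) = ?W3 (assoc_with x X) (assoc_with y Y)"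
    if xy: "x \<in> carrier C" "y \<in> carrier C" and XY: "X \<in> carrier C2" "Y \<in> carrier C2" for x y X Y
  proof -
    have c: "assoc_with x X \<in> carrier C3" "assoc_with y X \<in> carrier C3" if "X \<in> carrier C2" for X
      using xy that additive_closed[OF assoc_with_additive] by auto
    show ?thesis
    proof (rule W.biadditive_ext[OF ag3 XY, of "\<lambda>X Y. E.assoc_with (dn C x y) (W X Y)"
          "\<lambda>X Y. ?W3 (assoc_with x X) (assoc_with y Y)"])
      fix x1 x2 y1 y2 assume *: "x1 \<in> carrier C" "x2 \<in> carrier C" "y1 \<in> carrier C" "y2 \<in> carrier C"
      show "E.assoc_with (dn C x y) (W (tn C C x1 x2) (tn C C y1 y2)) =
          ?W3 (assoc_with x (tn C C x1 x2)) (assoc_with y (tn C C y1 y2))"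
        using * xy by (simp add: W_tn assoc_with_tn E.assoc_with_tn W3)
    qed (use xy c in \<open>auto intro!: additive_comp[OF W_additive(1) E.assoc_with_additive]
        additive_comp[OF W_additive(2) E.assoc_with_additive]
        additive_comp[OF assoc_with_additive W3.tlift2_additive_left]
        additive_comp[OF assoc_with_additive W3.tlift2_additive_right]\<close>)
  qed
  have FW: "F (W X Y) = ?W3 (l X) (l Y)" if "X \<in> carrier C2" "Y \<in> carrier C2" for X Y
  proof (rule W.biadditive_ext[OF ag3 that, of "\<lambda>X Y. F (W X Y)" "\<lambda>X Y. ?W3 (l X) (l Y)"])
    fix x1 x2 y1 y2 assume "x1 \<in> carrier C" "x2 \<in> carrier C" "y1 \<in> carrier C" "y2 \<in> carrier C"
    then show "F (W (tn C C x1 x2) (tn C C y1 y2)) = ?W3 (l (tn C C x1 x2)) (l (tn C C y1 y2))"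
      by (simp add: W_tn tn tn' AW comult_dn comult_closed)
  qed (auto intro!: additive_comp[OF W_additive(1) ad(4)] additive_comp[OF W_additive(2) ad(4)]
      additive_comp[OF ad(2) W3.tlift2_additive_left] additive_comp[OF ad(2) W3.tlift2_additive_right] cl)
  have id: "additive D D (\<lambda>X. X)" by (simp add: additive_def)
  have co: "co_right x = co_left x" if "x \<in> carrier C" for x
    using coassoc_iff[OF that rep_comult[OF that]] C.coassoc[OF that rep_comult[OF that]] by simp
  show ?thesis
  proof (rule E.coringI)
    fix X assume X: "X \<in> carrier D"
    show "E.co_right X = E.co_left X"
    proof (rule square_ext[OF E.co_right_additive E.co_left_additive ag3 X])
      fix x y assume xy: "x \<in> carrier C" "y \<in> carrier C"
      have "E.co_right (dn C x y) = ?W3 (co_right x) (co_right y)"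
        using RW[OF comult_closed comult_closed, OF xy] xy
        by (simp add: E.co_right_def co_right_def comult_dn R_def r_def)
      also have "\<dots> = E.co_left (dn C x y)"
        using FW[OF comult_closed comult_closed, OF xy] xy
        by (simp add: E.co_left_def co co_left_def comult_dn F_def l_def)
      finally show "E.co_right (dn C x y) = E.co_left (dn C x y)" .
    qed
    show "tlift D (\<lambda>x y. lact D (counit D x) y) (comult D X) = X"
    proof (rule square_ext[OF E.counit_left_additive id agD X])
      fix x y assume xy: "x \<in> carrier C" "y \<in> carrier C"
      define c where "c = tlift C (\<lambda>x y. lact C (counit C x) y)"
      define d where "d = tlift D (\<lambda>x y. lact D (counit D x) y)"
      have ca: "additive C2 C c" unfolding c_def by (rule CC.tlift_additive[OF balanced_counit_left])
      have da: "additive D2 D d" unfolding d_def by (rule DD.tlift_additive[OF E.balanced_counit_left])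
      have cx: "c (comult C x) = x" if "x \<in> carrier C" for x
        unfolding c_def using CC.tlift_mem[OF balanced_counit_left comult_closed[OF that] rep_comult[OF that]]
          C.counit_left[OF that rep_comult[OF that]] by simp
      \<comment> \<open>The counit of a pair is the product of the counits, and each of them can be
        given back to its own entry, since left scalars move freely between the two.\<close>
      have "d (W X Y) = dn C (c X) (c Y)" if "X \<in> carrier C2" "Y \<in> carrier C2" for X Y
      proof (rule W.biadditive_ext[OF agD that, of "\<lambda>X Y. d (W X Y)" "\<lambda>X Y. dn C (c X) (c Y)"])
        fix x1 x2 y1 y2 assume *: "x1 \<in> carrier C" "x2 \<in> carrier C" "y1 \<in> carrier C" "y2 \<in> carrier C"
        then show "d (W (tn C C x1 x2) (tn C C y1 y2)) = dn C (c (tn C C x1 x2)) (c (tn C C y1 y2))"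
          using mult_lact[of x2 "counit C y1" "counit C x1"]
          by (simp add: W_tn c_def d_def CC.tlift_tn balanced_counit_left DD.tlift_tn E.balanced_counit_left
              counit_dn lact_dn lact_closed mult.commute flip: dn_lact)
      qed (auto intro!: additive_comp[OF W_additive(1) da] additive_comp[OF W_additive(2) da] additiveI
          simp: additive_closed[OF ca] additive_add[OF ca] dn_add_left dn_add_right)
      then show "tlift D (\<lambda>x y. lact D (counit D x) y) (comult D (dn C x y)) = dn C x y"
        using xy by (simp add: comult_dn comult_closed cx flip: d_def)
    qed
    show "tlift D (\<lambda>x y. ract D x (counit D y)) (comult D X) = X"
    proof (rule square_ext[OF E.counit_right_additive id agD X])
      fix x y assume xy: "x \<in> carrier C" "y \<in> carrier C"
      define c where "c = tlift C (\<lambda>x y. ract C x (counit C y))"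
      define d where "d = tlift D (\<lambda>x y. ract D x (counit D y))"
      have ca: "additive C2 C c" unfolding c_def by (rule CC.tlift_additive[OF balanced_counit_right])
      have da: "additive D2 D d" unfolding d_def by (rule DD.tlift_additive[OF E.balanced_counit_right])
      have cx: "c (comult C x) = x" if "x \<in> carrier C" for x
        unfolding c_def using CC.tlift_mem[OF balanced_counit_right comult_closed[OF that] rep_comult[OF that]]
          C.counit_right[OF that rep_comult[OF that]] by simp
      have "d (W X Y) = dn C (c X) (c Y)" if "X \<in> carrier C2" "Y \<in> carrier C2" for X Y
      proof (rule W.biadditive_ext[OF agD that, of "\<lambda>X Y. d (W X Y)" "\<lambda>X Y. dn C (c X) (c Y)"])
        fix x1 x2 y1 y2 assume *: "x1 \<in> carrier C" "x2 \<in> carrier C" "y1 \<in> carrier C" "y2 \<in> carrier C"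
        then show "d (W (tn C C x1 x2) (tn C C y1 y2)) = dn C (c (tn C C x1 x2)) (c (tn C C y1 y2))"
          by (simp add: W_tn c_def d_def CC.tlift_tn balanced_counit_right DD.tlift_tn E.balanced_counit_right
              counit_dn ract_dn ract_closed mult_ract flip: dn_ract)
      qed (auto intro!: additive_comp[OF W_additive(1) da] additive_comp[OF W_additive(2) da] additiveI
          simp: additive_closed[OF ca] additive_add[OF ca] dn_add_left dn_add_right)
      then show "tlift D (\<lambda>x y. ract D x (counit D y)) (comult D (dn C x y)) = dn C x y"
        using xy by (simp add: comult_dn comult_closed cx flip: d_def)
    qed
  qed
qed

text \<open>The product \<open>f(x) g(y)\<close> respects coproducts because the coproduct of a
  bialgebroid is multiplicative. Two identities yield the multiplication of the finite dual, two
  copies of \<open>zeta_hat\<close> the product of images in \<open>H\<close>.\<close>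

lemma product_coring_hom:
  fixes H :: "('a, 'h) hopf_algebroid"
  assumes H: "comm_bialgebroid \<kappa> H" and f: "f \<in> coring_hom C H" and g: "g \<in> coring_hom C H"
  defines "m \<equiv> dlift H (\<lambda>x y. f x \<otimes>\<^bsub>H\<^esub> g y)"
  shows "m \<in> coring_hom D H" "\<And>x y. \<lbrakk>x \<in> carrier C; y \<in> carrier C\<rbrakk> \<Longrightarrow> m (dn C x y) = f x \<otimes>\<^bsub>H\<^esub> g y"
proof -
  interpret H: comm_bialgebroid \<kappa> H by fact
  interpret E: precoring \<kappa> D by (rule square_precoring)
  let ?H2 = "tensor H H"
  have hom: "k x \<in> carrier H" "k (lact C a x) = lact H a (k x)" "k (ract C x a) = ract H (k x) a"
    "counit H (k x) = counit C x" "zs \<in> comult C x \<Longrightarrow> [(k x, k y). (x, y) \<leftarrow> zs] \<in> comult H (k x)"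
    if "k \<in> coring_hom C H" "x \<in> carrier C" for k x a zs
    using that by (auto simp: coring_hom_def bimod_hom_def)
  have add: "k (x \<oplus> y) = k x \<oplus>\<^bsub>H\<^esub> k y" if "k \<in> coring_hom C H" "x \<in> carrier C" "y \<in> carrier C" for k x y
    using that by (auto simp: coring_hom_def bimod_hom_def)
  have bal: "dbalanced C H (\<lambda>x y. f x \<otimes>\<^bsub>H\<^esub> g y)"
    unfolding dbalanced_def using H.abelian_group_axioms
    by (auto simp: hom[OF f] hom[OF g] add[OF f] add[OF g] H.l_distr H.r_distr H.lact_src H.ract_tgt H.m_ac intro!: additiveI)
  have ma: "additive D H m" unfolding m_def by (rule dlift_additive[OF bal])
  show md: "m (dn C x y) = f x \<otimes>\<^bsub>H\<^esub> g y" if "x \<in> carrier C" "y \<in> carrier C" for x y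
    unfolding m_def using that by (rule dlift_dn[OF bal])
  have ml: "m (lact D a X) = lact H a (m X)" if X: "X \<in> carrier D" for a X
    by (rule square_ext[OF additive_comp[OF square_lact_additive ma] additive_comp[OF ma H.additive_lact] H.abelian_group_axioms X])
      (simp add: lact_dn md lact_closed hom[OF f] hom[OF g] H.lact_src H.m_assoc)
  have mr: "m (ract D X a) = ract H (m X) a" if X: "X \<in> carrier D" for a X
    by (rule square_ext[OF additive_comp[OF square_ract_additive ma] additive_comp[OF ma H.additive_ract] H.abelian_group_axioms X])
      (simp add: ract_dn md ract_closed hom[OF f] hom[OF g] H.ract_tgt H.m_ac)
  have me: "counit H (m X) = counit D X" if X: "X \<in> carrier D" for X
  proof (rule square_ext[OF additive_comp[OF ma] square_counit_additive regular_abelian_group X])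
    show "additive H regular_bimod (counit H)" by (rule H.left_linear_additive[OF H.left_linear_counit])
  qed (simp add: md counit_dn H.counit_mult hom[OF f] hom[OF g])
  have mc: "m X \<in> carrier H" if "X \<in> carrier D" for X using that by (rule additive_closed[OF ma])
  have bm: "balanced D D ?H2 (\<lambda>u v. tn H H (m u) (m v))"
    unfolding balanced_def using H.CC.T.is_abelian_group
    by (auto simp: mc additive_add[OF ma] H.CC.tn_add_left H.CC.tn_add_right ml mr H.CC.tn_balanced intro!: additiveI)
  let ?mm = "tlift ?H2 (\<lambda>u v. tn H H (m u) (m v))"
  have mma: "additive D2 ?H2 ?mm" by (rule DD.tlift_additive[OF bm])
  \<comment> \<open>On a generator the coproducts of both entries are expanded; the interchange
    followed by \<open>m\<close> on both legs produces the double sum that multiplicativity of the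
    coproduct of \<open>H\<close> prescribes.\<close>
  have mm: "?mm (comult D X) = comult H (m X)" if X: "X \<in> carrier D" for X
  proof (rule square_ext[OF additive_comp[OF square_comult_additive mma] additive_comp[OF ma H.comult_additive]
        H.CC.T.is_abelian_group X])
    fix x y assume x: "x \<in> carrier C" and y: "y \<in> carrier C"
    let ?zs = "rep (comult C x)" and ?ws = "rep (comult C y)"
    note zs = rep_comult[OF x] and ws = rep_comult[OF y]
    note ez = comult_sub[OF x zs] and ew = comult_sub[OF y ws]
    have sz: "set ?zs \<subseteq> carrier C \<times> carrier C" "set ?ws \<subseteq> carrier C \<times> carrier C" using ez ew by auto
    let ?l = "[(a \<otimes>\<^bsub>H\<^esub> a', b \<otimes>\<^bsub>H\<^esub> b'). (a, b) \<leftarrow> [(f a, f b). (a, b) \<leftarrow> ?zs], (a', b') \<leftarrow> [(g a, g b). (a, b) \<leftarrow> ?ws]]"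
    have l: "?l \<in> comult H (f x \<otimes>\<^bsub>H\<^esub> g y)"
      using x y by (intro H.comult_mult hom[OF f] hom[OF g] zs ws)
    note WX = additive_lsum_map[OF CC.T.is_abelian_group DD.T.is_abelian_group]
    have "W (comult C x) (comult C y) = W (lsum C2 [tn C C (fst i) (snd i). i \<leftarrow> ?zs]) (comult C y)"
      using CC.tensor_mem(3)[OF comult_closed[OF x] zs] by (simp add: case_prod_unfold)
    also have "\<dots> = lsum D2 [W (tn C C (fst i) (snd i)) (comult C y). i \<leftarrow> ?zs]"
      using sz by (intro WX W_additive comult_closed y) auto
    also have "\<dots> = lsum D2 [lsum D2 [tn D D (dn C (fst i) (fst j)) (dn C (snd i) (snd j)). j \<leftarrow> ?ws]. i \<leftarrow> ?zs]"
    proof (intro lsum_cong)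
      fix i assume i: "i \<in> set ?zs"
      then have ic: "fst i \<in> carrier C" "snd i \<in> carrier C" using sz by auto
      have "W (tn C C (fst i) (snd i)) (comult C y) = W (tn C C (fst i) (snd i)) (lsum C2 [tn C C (fst j) (snd j). j \<leftarrow> ?ws])"
        using CC.tensor_mem(3)[OF comult_closed[OF y] ws] by (simp add: case_prod_unfold)
      also have "\<dots> = lsum D2 [W (tn C C (fst i) (snd i)) (tn C C (fst j) (snd j)). j \<leftarrow> ?ws]"
        using sz ic by (intro WX W_additive) auto
      also have "\<dots> = lsum D2 [tn D D (dn C (fst i) (fst j)) (dn C (snd i) (snd j)). j \<leftarrow> ?ws]"
        using sz ic by (intro lsum_cong W_tn) auto
      finally show "W (tn C C (fst i) (snd i)) (comult C y) =
          lsum D2 [tn D D (dn C (fst i) (fst j)) (dn C (snd i) (snd j)). j \<leftarrow> ?ws]" .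
    qed
    finally have W: "W (comult C x) (comult C y) =
        lsum D2 [lsum D2 [tn D D (dn C (fst i) (fst j)) (dn C (snd i) (snd j)). j \<leftarrow> ?ws]. i \<leftarrow> ?zs]" .
    have tc: "tn D D (dn C (fst i) (fst j)) (dn C (snd i) (snd j)) \<in> carrier D2" if "i \<in> set ?zs" "j \<in> set ?ws" for i j
      using that sz by (intro DD.tn_closed dn_closed) auto
    note MX = additive_lsum_map[OF DD.T.is_abelian_group H.CC.T.is_abelian_group mma]
    have "?mm (comult D (dn C x y)) = lsum ?H2 [?mm (lsum D2 [tn D D (dn C (fst i) (fst j)) (dn C (snd i) (snd j)). j \<leftarrow> ?ws]). i \<leftarrow> ?zs]"
      unfolding comult_dn[OF x y] W using tc by (intro MX) auto
    also have "\<dots> = lsum ?H2 [lsum ?H2 [tn H H (f (fst i) \<otimes>\<^bsub>H\<^esub> g (fst j)) (f (snd i) \<otimes>\<^bsub>H\<^esub> g (snd j)). j \<leftarrow> ?ws]. i \<leftarrow> ?zs]"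
    proof (intro lsum_cong)
      fix i assume i: "i \<in> set ?zs"
      have "?mm (lsum D2 [tn D D (dn C (fst i) (fst j)) (dn C (snd i) (snd j)). j \<leftarrow> ?ws]) =
          lsum ?H2 [?mm (tn D D (dn C (fst i) (fst j)) (dn C (snd i) (snd j))). j \<leftarrow> ?ws]"
        using tc[OF i] by (intro MX)
      also have "\<dots> = lsum ?H2 [tn H H (f (fst i) \<otimes>\<^bsub>H\<^esub> g (fst j)) (f (snd i) \<otimes>\<^bsub>H\<^esub> g (snd j)). j \<leftarrow> ?ws]"
      proof (intro lsum_cong)
        fix j assume j: "j \<in> set ?ws"
        then have c: "fst i \<in> carrier C" "snd i \<in> carrier C" "fst j \<in> carrier C" "snd j \<in> carrier C" using i sz by auto
        then show "?mm (tn D D (dn C (fst i) (fst j)) (dn C (snd i) (snd j))) =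
            tn H H (f (fst i) \<otimes>\<^bsub>H\<^esub> g (fst j)) (f (snd i) \<otimes>\<^bsub>H\<^esub> g (snd j))"
          by (subst DD.tlift_tn[OF bm]) (simp_all add: md)
      qed
      finally show "?mm (lsum D2 [tn D D (dn C (fst i) (fst j)) (dn C (snd i) (snd j)). j \<leftarrow> ?ws]) =
          lsum ?H2 [tn H H (f (fst i) \<otimes>\<^bsub>H\<^esub> g (fst j)) (f (snd i) \<otimes>\<^bsub>H\<^esub> g (snd j)). j \<leftarrow> ?ws]" .
    qed
    also have "\<dots> = lsum ?H2 (concat [[tn H H (f (fst i) \<otimes>\<^bsub>H\<^esub> g (fst j)) (f (snd i) \<otimes>\<^bsub>H\<^esub> g (snd j)). j \<leftarrow> ?ws]. i \<leftarrow> ?zs])"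
    proof (rule H.CC.T.lsum_concat[symmetric])
      fix i assume i: "i \<in> set ?zs"
      show "set [tn H H (f (fst i) \<otimes>\<^bsub>H\<^esub> g (fst j)) (f (snd i) \<otimes>\<^bsub>H\<^esub> g (snd j)). j \<leftarrow> ?ws] \<subseteq> carrier ?H2"
        using i sz by (auto intro!: H.CC.tn_closed H.m_closed hom[OF f] hom[OF g])
    qed
    also have "\<dots> = lsum ?H2 (map (\<lambda>(a, b). tn H H a b) ?l)"
      by (simp add: map_concat o_def case_prod_unfold)
    also have "\<dots> = comult H (f x \<otimes>\<^bsub>H\<^esub> g y)"
      using x y by (intro H.CC.tensor_mem(3)[OF _ l, symmetric] H.comult_closed H.m_closed hom[OF f] hom[OF g])
    finally show "?mm (comult D (dn C x y)) = comult H (m (dn C x y))" using x y by (simp add: md)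
  qed
  have "[(m u, m v). (u, v) \<leftarrow> zs] \<in> comult H (m X)" if X: "X \<in> carrier D" and zs: "zs \<in> comult D X" for X zs
  proof (rule H.CC.tcls_memI[OF H.comult_closed[OF mc[OF X]]])
    note el = E.comult_sub[OF X zs]
    show "set [(m u, m v). (u, v) \<leftarrow> zs] \<subseteq> carrier H \<times> carrier H" using el mc by auto
    show "comult H (m X) = lsum ?H2 (map (\<lambda>(a, b). tn H H a b) [(m u, m v). (u, v) \<leftarrow> zs])"
      using DD.tlift_mem[OF bm E.comult_closed[OF X] zs] mm[OF X] by (simp add: o_def case_prod_unfold)
  qed
  then show "m \<in> coring_hom D H"
    unfolding coring_hom_def bimod_hom_def
    using mc ml mr me additive_add[OF ma] by auto
qed

end

section \<open>The morphism from the finite dual to the universal coring\<close>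

text \<open>The universal property speaks of plain \<open>coring\<close> records. The finite dual is
  a larger record and has to be truncated, which keeps all fields of a coring.\<close>

lemma truncate_simps [simp]:
  "carrier (coring.truncate C) = carrier C" "zero (coring.truncate C) = zero C" "add (coring.truncate C) = add C"
  "lact (coring.truncate C) = lact C" "ract (coring.truncate C) = ract C"
  "comult (coring.truncate C) = comult C" "counit (coring.truncate C) = counit C"
  by (simp_all add: coring.defs)

lemma lsum_truncate: "lsum (coring.truncate C) xs = lsum C xs"
  by (simp add: lsum_def)

lemma tensor_truncate:
  "tensor (coring.truncate C) (coring.truncate C) = tensor C C"
  "tcls (coring.truncate C) (coring.truncate C) = tcls C C"
  "teq (coring.truncate C) N = teq C N"
  by (rule tensor_cong; simp)+

lemma coring_truncate:
  assumes "coring \<kappa> C" shows "coring \<kappa> (coring.truncate C)"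
proof -
  interpret coring \<kappa> C by fact
  have ag: "abelian_group (coring.truncate C)"
    by (rule abelian_groupI) (auto simp: a_ac intro: add.l_inv_ex)
  have "bimodule \<kappa> (coring.truncate C)"
    using bimodule_axioms ag by (simp add: bimodule_def bimodule_axioms_def)
  then show ?thesis
    using assms by (simp add: coring_def coring_axioms_def tensor_truncate lsum_truncate bimod_hom_def)
qed

text \<open>Supplies the pairing on the square, pulled back along the multiplication, to which the
  universal property is applied.\<close>

lemma pairing_comp:
  assumes C: "precoring \<kappa> C" and f: "f \<in> coring_hom C C'" and \<xi>: "pairing L C' \<xi>"
  shows "pairing L C (\<lambda>z. \<xi> (f z))"
proof -
  interpret precoring \<kappa> C by fact
  have prod: "\<xi> z (u \<otimes>\<^bsub>VA L\<^esub> v) = (\<Sum>(x, y) \<leftarrow> zs. \<xi> x (iotaA L (\<xi> y u) \<otimes>\<^bsub>VA L\<^esub> v))"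
    if "z \<in> carrier C'" "zs \<in> comult C' z" "u \<in> carrier (VA L)" "v \<in> carrier (VA L)" for z zs u v
    using \<xi> that by (simp add: pairing_def)
  have h: "f z \<in> carrier C'" "f (lact C a z) = lact C' a (f z)" "f (ract C z a) = ract C' (f z) a"
    "counit C' (f z) = counit C z" "zs \<in> comult C z \<Longrightarrow> [(f x, f y). (x, y) \<leftarrow> zs] \<in> comult C' (f z)"
    "w \<in> carrier C \<Longrightarrow> f (z \<oplus>\<^bsub>C\<^esub> w) = f z \<oplus>\<^bsub>C'\<^esub> f w" if "z \<in> carrier C" for z w a zs
    using f that by (auto simp: coring_hom_def bimod_hom_def)
  show ?thesis
    unfolding pairing_def
  proof (intro conjI ballI allI)
    show "(\<lambda>z. \<xi> (f z)) \<in> carrier C \<rightarrow> udual L" using \<xi> h(1) by (auto simp: pairing_def)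
    fix z assume z: "z \<in> carrier C"
    show "\<xi> (f (z \<oplus>\<^bsub>C\<^esub> w)) u = \<xi> (f z) u + \<xi> (f w) u" if "w \<in> carrier C" "u \<in> carrier (VA L)" for w u
      using \<xi> z that h by (simp add: pairing_def)
    show "\<xi> (f (ract C (lact C a z) b)) u = a * \<xi> (f z) (iotaA L b \<otimes>\<^bsub>VA L\<^esub> u)" if "u \<in> carrier (VA L)" for a b u
      using \<xi> z that h by (simp add: pairing_def lact_closed)
    show "\<xi> (f z) \<one>\<^bsub>VA L\<^esub> = counit C z" using \<xi> z h by (simp add: pairing_def)
    fix zs u v assume zs: "zs \<in> comult C z" and uv: "u \<in> carrier (VA L)" "v \<in> carrier (VA L)"
    have "\<xi> (f z) (u \<otimes>\<^bsub>VA L\<^esub> v) = (\<Sum>(x, y) \<leftarrow> [(f x, f y). (x, y) \<leftarrow> zs]. \<xi> x (iotaA L (\<xi> y u) \<otimes>\<^bsub>VA L\<^esub> v))"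
      by (rule prod[OF h(1)[OF z] h(5)[OF z zs] uv])
    then show "\<xi> (f z) (u \<otimes>\<^bsub>VA L\<^esub> v) = (\<Sum>(x, y) \<leftarrow> zs. \<xi> (f x) (iotaA L (\<xi> (f y) u) \<otimes>\<^bsub>VA L\<^esub> v))"
      by (simp add: o_def case_prod_unfold)
  qed
qed

lemma coring_hom_comp:
  assumes f: "f \<in> coring_hom C C'" and g: "g \<in> coring_hom C' C''"
  shows "(\<lambda>z. g (f z)) \<in> coring_hom C C''"
proof -
  have g': "[(g x, g y). (x, y) \<leftarrow> zs] \<in> comult C'' (g z)" if "z \<in> carrier C'" "zs \<in> comult C' z" for z zs
    using g that by (auto simp: coring_hom_def)
  have "[(g (f x), g (f y)). (x, y) \<leftarrow> zs] \<in> comult C'' (g (f z))" if "z \<in> carrier C" "zs \<in> comult C z" for z zs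
  proof -
    have "[(f x, f y). (x, y) \<leftarrow> zs] \<in> comult C' (f z)" "f z \<in> carrier C'"
      using f that by (auto simp: coring_hom_def bimod_hom_def)
    then have "[(g x, g y). (x, y) \<leftarrow> [(f x, f y). (x, y) \<leftarrow> zs]] \<in> comult C'' (g (f z))"
      by (intro g')
    then show ?thesis by (simp add: o_def case_prod_unfold)
  qed
  then show ?thesis using f g by (auto simp: coring_hom_def bimod_hom_def Pi_def)
qed

text \<open>Uniqueness in the universal property holds among extensional functions, so candidates
  are restricted to the carrier before they are compared.\<close>

lemma coring_hom_restrict:
  assumes C: "precoring \<kappa> C" and f: "f \<in> coring_hom C C'"
  shows "restrict f (carrier C) \<in> coring_hom C C'"
proof -
  interpret precoring \<kappa> C by fact
  have r: "restrict f (carrier C) z = f z" if "z \<in> carrier C" for z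
    using that by simp
  have eq: "[(restrict f (carrier C) x, restrict f (carrier C) y). (x, y) \<leftarrow> zs] = [(f x, f y). (x, y) \<leftarrow> zs]"
    if "z \<in> carrier C" "zs \<in> comult C z" for z zs
    using comult_sub[OF that] by auto
  have "[(restrict f (carrier C) x, restrict f (carrier C) y). (x, y) \<leftarrow> zs] \<in> comult C' (restrict f (carrier C) z)"
    if z: "z \<in> carrier C" "zs \<in> comult C z" for z zs
    unfolding eq[OF z] r[OF z(1)] using f z by (auto simp: coring_hom_def)
  moreover have "restrict f (carrier C) \<in> bimod_hom C C'"
    using f by (auto simp: coring_hom_def bimod_hom_def lact_closed ract_closed)
  moreover have "counit C' (restrict f (carrier C) z) = counit C z" if "z \<in> carrier C" for z
    using f that by (simp add: coring_hom_def)
  ultimately show ?thesis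
    unfolding coring_hom_def by blast
qed

lemma coring_hom_id: "(\<lambda>z. z) \<in> coring_hom C C"
  by (simp add: coring_hom_def bimod_hom_def)

section \<open>The comparison map under the universal property\<close>

context lr_alg
begin

context
  fixes H :: "('a, 'h) hopf_algebroid" and \<xi>
  assumes univ: "universal_hopf \<kappa> L H \<xi>"
begin

lemma H_hopf: "comm_hopf_algebroid \<kappa> H" and H_pairing: "pairing L H \<xi>"
  using univ by (simp_all add: universal_hopf_def)

lemma H_bialgebroid: "comm_bialgebroid \<kappa> H"
  by (rule comm_hopf_algebroid_imp_bialgebroid[OF H_hopf])

lemma xi_mult: "\<lbrakk>x \<in> carrier H; y \<in> carrier H; u \<in> carrier (VA L); us \<in> ucomult L u\<rbrakk> \<Longrightarrow>
    \<xi> (x \<otimes>\<^bsub>H\<^esub> y) u = (\<Sum>(u', u'') \<leftarrow> us. \<xi> x u' * \<xi> y u'')"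
  using univ by (simp add: universal_hopf_def)

text \<open>The universal property for the carrier type of the finite dual makes the definite
  description meaningful.\<close>

lemma zeta_hat:
  shows "zeta_hat L H \<xi> \<in> extensional (carrier U)" "zeta_hat L H \<xi> \<in> coring_hom U H"
    "X \<in> carrier U \<Longrightarrow> \<xi> (zeta_hat L H \<xi> X) = zeta L X"
proof -
  let ?tr = "coring.truncate U"
  have p: "pairing L ?tr (zeta L)" using zeta_pairing by (simp add: pairing_def)
  have "universal_pairing TYPE(('a, 'l) fdual) \<kappa> L H \<xi>" using univ by (simp add: universal_hopf_def)
  then have "\<exists>!g. g \<in> extensional (carrier ?tr) \<and> g \<in> coring_hom ?tr H \<and> (\<forall>z\<in>carrier ?tr. \<xi> (g z) = zeta L z)"
    unfolding universal_pairing_def using coring_truncate[OF finite_dual_coring] p by blast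
  then have "\<exists>!g. g \<in> extensional (carrier U) \<and> g \<in> coring_hom U H \<and> (\<forall>z\<in>carrier U. \<xi> (g z) = zeta L z)"
    by (simp add: coring_hom_def bimod_hom_def)
  from theI'[OF this]
  show "zeta_hat L H \<xi> \<in> extensional (carrier U)" "zeta_hat L H \<xi> \<in> coring_hom U H"
    "X \<in> carrier U \<Longrightarrow> \<xi> (zeta_hat L H \<xi> X) = zeta L X"
    by (simp_all add: zeta_hat_def)
qed

lemma zeta_hat_mult:
  assumes X: "X \<in> carrier U" and Y: "Y \<in> carrier U"
  shows "zeta_hat L H \<xi> (X \<otimes>\<^bsub>U\<^esub> Y) = zeta_hat L H \<xi> X \<otimes>\<^bsub>H\<^esub> zeta_hat L H \<xi> Y"
proof -
  interpret H: comm_bialgebroid \<kappa> H by (rule H_bialgebroid)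
  let ?D = "square_coring U" and ?h = "zeta_hat L H \<xi>"
  interpret E: precoring \<kappa> ?D by (rule UC.square_precoring)
  note h = zeta_hat(2,3)
  have hc: "?h z \<in> carrier H" if "z \<in> carrier U" for z using h(1) that by (auto simp: coring_hom_def bimod_hom_def)
  define \<mu> where "\<mu> = dlift U (\<lambda>x y. x \<otimes>\<^bsub>U\<^esub> y)"
  define \<nu> where "\<nu> = dlift H (\<lambda>x y. ?h x \<otimes>\<^bsub>H\<^esub> ?h y)"
  note \<mu> = UC.product_coring_hom[OF finite_dual_bialgebroid coring_hom_id coring_hom_id, folded \<mu>_def]
  note \<nu> = UC.product_coring_hom[OF H_bialgebroid h(1) h(1), folded \<nu>_def]
  have Dc: "coring \<kappa> ?D" by (rule UC.square_coring[OF finite_dual_coring])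
  have pD: "pairing L ?D (\<lambda>z. zeta L (\<mu> z))"
    by (rule pairing_comp[OF UC.square_precoring \<mu>(1) zeta_pairing])
  have "universal_pairing TYPE((('a, 'l) fdual \<times> ('a, 'l) fdual) list set) \<kappa> L H \<xi>"
    using univ by (simp add: universal_hopf_def)
  then have ex1: "\<exists>!g. g \<in> extensional (carrier ?D) \<and> g \<in> coring_hom ?D H \<and> (\<forall>z\<in>carrier ?D. \<xi> (g z) = zeta L (\<mu> z))"
    unfolding universal_pairing_def using Dc pD by blast
  \<comment> \<open>Two coring morphisms from the square to \<open>H\<close> whose composites with
    \<xi> are \<open>z \<mapsto> \<zeta>(\<mu>(z))\<close>. Uniqueness identifies them, and their
    values at the generator for \<open>X\<close> and \<open>Y\<close> are the two sides of the
    claim.\<close>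
  let ?g1 = "restrict (\<lambda>z. ?h (\<mu> z)) (carrier ?D)" and ?g2 = "restrict \<nu> (carrier ?D)"
  have \<mu>c: "\<mu> z \<in> carrier U" and \<nu>c: "\<nu> z \<in> carrier H" if "z \<in> carrier ?D" for z
    using \<mu>(1) \<nu>(1) that by (auto simp: coring_hom_def bimod_hom_def)
  have g1: "?g1 \<in> coring_hom ?D H" "\<forall>z\<in>carrier ?D. \<xi> (?g1 z) = zeta L (\<mu> z)"
    using coring_hom_restrict[OF UC.square_precoring coring_hom_comp[OF \<mu>(1) h(1)]] h(2)[OF \<mu>c] by simp_all
  have g2: "?g2 \<in> coring_hom ?D H" by (rule coring_hom_restrict[OF UC.square_precoring \<nu>(1)])
  have ud: "\<xi> z \<in> extensional (carrier (VA L))" if "z \<in> carrier H" for z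
    using H_pairing that by (auto simp: pairing_def udual_def Pi_def)
  have zd: "zeta L z \<in> extensional (carrier (VA L))" for z by (simp add: zeta_def)
  have xa: "additive H regular_bimod (\<lambda>z. \<xi> z u)" if "u \<in> carrier (VA L)" for u
    using H_pairing that by (simp add: pairing_def additive_def)
  have "\<xi> (\<nu> z) u = zeta L (\<mu> z) u" if z: "z \<in> carrier ?D" and u: "u \<in> carrier (VA L)" for z u
  proof (rule UC.square_ext[OF additive_comp[OF _ xa[OF u]] additive_comp[OF _ zeta_additive[OF u]] regular_abelian_group z])
    show "additive ?D H \<nu>" "additive ?D U \<mu>"
      using \<mu>(1) \<nu>(1) by (auto simp: coring_hom_def bimod_hom_def additive_def)
    fix x y assume x: "x \<in> carrier U" and y: "y \<in> carrier U"
    obtain t where t: "t \<in> uterms L" "u = ucls L t" using u by (rule VA_cases)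
    note us = ucop_mem_ucomult[OF t(1), folded t(2)]
    have "\<xi> (\<nu> (dn U x y)) u = (\<Sum>(u', u'') \<leftarrow> ucop L t. zeta L x u' * zeta L y u'')"
      using xi_mult[OF hc[OF x] hc[OF y] u us] x y by (simp add: \<nu>(2) h(2))
    \<comment> \<open>\<open>zeta_mult\<close> reverses the factors while the product rule of \<xi>
      keeps them; commutativity of the finite dual settles the difference.\<close>
    also have "\<dots> = zeta L (y \<otimes>\<^bsub>U\<^esub> x) u" by (rule zeta_mult[OF y x u us, symmetric])
    finally show "\<xi> (\<nu> (dn U x y)) u = zeta L (\<mu> (dn U x y)) u" using x y by (simp add: \<mu>(2) UR.m_comm)
  qed
  then have "\<forall>z\<in>carrier ?D. \<xi> (?g2 z) = zeta L (\<mu> z)"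
    using ud[OF \<nu>c] zd by (auto intro!: extensionalityI)
  with ex1 g1 g2 have "?g1 = ?g2" by (metis (no_types, lifting) restrict_extensional)
  then have "?g1 (dn U X Y) = ?g2 (dn U X Y)" by simp
  then show ?thesis using X Y by (simp add: \<mu>(2) \<nu>(2))
qed

text \<open>The image of the unit is grouplike and idempotent; the antipode inverts grouplike elements,
  so the image is the unit.\<close>

lemma zeta_hat_one: "zeta_hat L H \<xi> \<one>\<^bsub>U\<^esub> = \<one>\<^bsub>H\<^esub>"
proof -
  interpret H: comm_hopf_algebroid \<kappa> H by (rule H_hopf)
  interpret UB: comm_bialgebroid \<kappa> U by (rule finite_dual_bialgebroid)
  let ?e = "zeta_hat L H \<xi> \<one>\<^bsub>U\<^esub>"
  have e: "?e \<in> carrier H" "[(?e, ?e)] \<in> comult H ?e" "counit H ?e = 1"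
    using zeta_hat(2) UB.comult_one UB.counit_one by (force simp: coring_hom_def bimod_hom_def)+
  have idem: "?e \<otimes>\<^bsub>H\<^esub> ?e = ?e" using zeta_hat_mult[of "\<one>\<^bsub>U\<^esub>" "\<one>\<^bsub>U\<^esub>"] by simp
  have S: "antipode H ?e \<in> carrier H" using ring_hom_closed[OF H.antipode_hom e(1)] .
  have "antipode H ?e \<otimes>\<^bsub>H\<^esub> ?e = tgt H 1" using H.antipode_left[OF e(1,2)] e(1,3) S by simp
  also have "tgt H 1 = \<one>\<^bsub>H\<^esub>" using ring_hom_one[OF H.tgt_hom] by simp
  finally have inv: "antipode H ?e \<otimes>\<^bsub>H\<^esub> ?e = \<one>\<^bsub>H\<^esub>" .
  have "\<one>\<^bsub>H\<^esub> \<otimes>\<^bsub>H\<^esub> ?e = antipode H ?e \<otimes>\<^bsub>H\<^esub> (?e \<otimes>\<^bsub>H\<^esub> ?e)" using e S by (simp flip: inv H.m_assoc)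
  then show ?thesis using e inv idem by simp
qed

theorem zeta_hat_bialgebroid_hom: "zeta_hat L H \<xi> \<in> bialgebroid_hom U H"
  using zeta_hat(2) zeta_hat_mult zeta_hat_one by (simp add: bialgebroid_hom_def)

theorem Theta'_universal: "lr_morphism \<kappa> L (der_lr \<kappa> H) (Theta' L H \<xi>)"
proof (rule Theta'_lr_morphism[OF H_bialgebroid H_pairing])
  fix x y X assume *: "x \<in> carrier H" "y \<in> carrier H" "X \<in> carrier L"
  have one: "\<xi> z \<one>\<^bsub>VA L\<^esub> = counit H z" if "z \<in> carrier H" for z
    using H_pairing that by (simp add: pairing_def)
  show "\<xi> (x \<otimes>\<^bsub>H\<^esub> y) (iotaL L X) = counit H x * \<xi> y (iotaL L X) + \<xi> x (iotaL L X) * counit H y"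
    using xi_mult[OF *(1,2) iotaL_closed[OF *(3)] ucomult_iotaL[OF *(3)]] *
    by (simp add: one add.commute)
qed

lemma Theta_factor: "Theta L X = der_map U (zeta_hat L H \<xi>) (Theta' L H \<xi> X)"
proof -
  have "zeta_hat L H \<xi> z \<in> carrier H" if "z \<in> carrier U" for z
    using zeta_hat(2) that by (auto simp: coring_hom_def bimod_hom_def)
  then show ?thesis by (auto simp: Theta_def der_map_def Theta'_def zeta_hat(3) fun_eq_iff)
qed

end

end

section \<open>Restriction of scalars\<close>

text \<open>Restriction of scalars for a carrier of any type: it has to be applied to tensor
  products and to the unit object as well as to \<open>objects\<close>.\<close>

definition restrict_module :: "('a::{comm_ring,comm_monoid_mult}, 'm) lr_algebra \<Rightarrow>
    ('l \<Rightarrow> 'm) \<Rightarrow> (('a, 'm) env, 'p) module \<Rightarrow> (('a, 'l) env, 'p) module" where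
  "restrict_module M \<phi> P =
    \<lparr>carrier = carrier P, mult = undefined, one = undefined, zero = \<zero>\<^bsub>P\<^esub>, add = add P,
     smult = (\<lambda>u p. VA_map M \<phi> u \<odot>\<^bsub>P\<^esub> p)\<rparr>"

lemma restrict_module_simps [simp]:
  "carrier (restrict_module M \<phi> P) = carrier P" "zero (restrict_module M \<phi> P) = zero P"
  "add (restrict_module M \<phi> P) = add P" "u \<odot>\<^bsub>restrict_module M \<phi> P\<^esub> p = VA_map M \<phi> u \<odot>\<^bsub>P\<^esub> p"
  by (simp_all add: restrict_module_def)

lemma restrict_scalars_eq: "restrict_scalars M \<phi> P = restrict_module M \<phi> P"
  by (simp add: restrict_scalars_def restrict_module_def)

locale lr_hom = L: lr_alg \<kappa> L + M: lr_alg \<kappa> M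
  for \<kappa> :: "'k::field_char_0 \<Rightarrow> 'a::{comm_ring,comm_monoid_mult}"
    and L :: "('a, 'l) lr_algebra" and M :: "('a, 'm) lr_algebra" +
  fixes \<phi> :: "'l \<Rightarrow> 'm"
  assumes hom: "lr_morphism \<kappa> L M \<phi>"
begin

lemma \<phi>_closed [simp]: "X \<in> carrier L \<Longrightarrow> \<phi> X \<in> carrier M"
  and \<phi>_add: "X \<in> carrier L \<Longrightarrow> Y \<in> carrier L \<Longrightarrow> \<phi> (X \<oplus>\<^bsub>L\<^esub> Y) = \<phi> X \<oplus>\<^bsub>M\<^esub> \<phi> Y"
  and \<phi>_smult: "X \<in> carrier L \<Longrightarrow> \<phi> (a \<odot>\<^bsub>L\<^esub> X) = a \<odot>\<^bsub>M\<^esub> \<phi> X"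
  and \<phi>_bracket: "X \<in> carrier L \<Longrightarrow> Y \<in> carrier L \<Longrightarrow> \<phi> (bracket L X Y) = bracket M (\<phi> X) (\<phi> Y)"
  and \<phi>_anchor: "X \<in> carrier L \<Longrightarrow> anchor M (\<phi> X) = anchor L X"
  using hom by (auto simp: lr_morphism_def)

abbreviation "mt \<equiv> map_uterm id \<phi>"
abbreviation "res \<equiv> restrict_module M \<phi>"
abbreviation "UL \<equiv> finite_dual L"
abbreviation "UM \<equiv> finite_dual M"

lemma mt_uterms: "t \<in> uterms L \<Longrightarrow> mt t \<in> uterms M"
  by (induction t) simp_all

lemma mt_cong: "ucong L t t' \<Longrightarrow> ucong M (mt t) (mt t')"
proof (induction rule: ucong.induct)
  case (ucong_sym t t')
  then show ?case by (blast intro: ucong.ucong_sym)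
next
  case (ucong_trans t t' t'')
  then show ?case by (blast intro: ucong.ucong_trans)
qed (simp_all add: mt_uterms[unfolded id_def] \<phi>_add \<phi>_smult \<phi>_bracket ucong.intros(1,4-20) flip: \<phi>_anchor)

lemma VA_map_ucls:
  assumes "t \<in> uterms L"
  shows "VA_map M \<phi> (ucls L t) = ucls M (mt t)"
proof -
  have "ucls M (mt t') = ucls M (mt t)" if "t' \<in> ucls L t" for t'
    using that mt_cong[of t t'] ucls_eq_iff[OF mt_uterms[OF assms], of "mt t'"] by (simp add: ucls_def)
  then show ?thesis unfolding VA_map_def using ucls_self[OF assms] by blast
qed

lemma VA_map_iota [simp]: "VA_map M \<phi> (iotaA L a) = iotaA M a"
  "X \<in> carrier L \<Longrightarrow> VA_map M \<phi> (iotaL L X) = iotaL M (\<phi> X)"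
  by (simp_all add: iotaA_def iotaL_def VA_map_ucls)

lemma VA_map_ops:
  assumes "u \<in> carrier (VA L)" "v \<in> carrier (VA L)"
  shows "VA_map M \<phi> u \<in> carrier (VA M)"
    "VA_map M \<phi> (u \<oplus>\<^bsub>VA L\<^esub> v) = VA_map M \<phi> u \<oplus>\<^bsub>VA M\<^esub> VA_map M \<phi> v"
    "VA_map M \<phi> (u \<otimes>\<^bsub>VA L\<^esub> v) = VA_map M \<phi> u \<otimes>\<^bsub>VA M\<^esub> VA_map M \<phi> v"
proof -
  obtain t r where "t \<in> uterms L" "u = ucls L t" "r \<in> uterms L" "v = ucls L r"
    using assms by (auto elim!: L.VA_cases)
  then show "VA_map M \<phi> u \<in> carrier (VA M)"
    "VA_map M \<phi> (u \<oplus>\<^bsub>VA L\<^esub> v) = VA_map M \<phi> u \<oplus>\<^bsub>VA M\<^esub> VA_map M \<phi> v"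
    "VA_map M \<phi> (u \<otimes>\<^bsub>VA L\<^esub> v) = VA_map M \<phi> u \<otimes>\<^bsub>VA M\<^esub> VA_map M \<phi> v"
    by (simp_all add: VA_map_ucls VA_op mt_uterms)
qed

lemma res_module:
  assumes "right_module (VA M) P"
  shows "right_module (VA L) (res P)"
proof -
  interpret P: right_module "VA M" P by fact
  have ag: "abelian_group (res P)" by (rule abelian_groupI) (auto simp: P.a_ac intro: P.add.l_inv_ex)
  show ?thesis
    by (intro right_module.intro L.V.ring_axioms ag right_module_axioms.intro)
      (simp_all add: VA_map_ops P.act_closed P.act_add_left P.act_add_right P.act_mult L.VA_one
        P.act_one flip: M.VA_one)
qed

text \<open>The action of the base is unchanged because \<open>VA_map\<close> sends
  \<open>iotaA L a\<close> to \<open>iotaA M a\<close>; projectivity, forms and dual bases of the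
  restricted module are therefore those of the original.\<close>

lemma amod_res: "amod L (res P) = amod M P"
  by (simp add: amod_def)

lemma res_fgm: "fgm M P \<Longrightarrow> fgm L (res P)"
  by (simp add: fgm_def res_module amod_res)

lemma res_form: "linear_form L (res P) f \<longleftrightarrow> linear_form M P f"
  by (simp add: linear_form_def)

lemma res_mdual: "mdual L (res P) = mdual M P"
  by (simp add: mdual_def amod_res)

lemma res_lsum: "lsum (res P) xs = lsum P xs"
  by (simp add: lsum_def)

lemma res_dual_basis: "dual_basis L (res P) es \<longleftrightarrow> dual_basis M P es"
  by (simp add: dual_basis_def res_mdual res_lsum)

lemma res_hom: "h \<in> rmod_hom (VA M) P Q \<Longrightarrow> h \<in> rmod_hom (VA L) (res P) (res Q)"
  by (auto simp: rmod_hom_def VA_map_ops)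

abbreviation "F \<equiv> finite_dual_map L M \<phi>"

lemma F_natural: "M.natural_coeff UL (\<lambda>P f p. cc L (res P) f p)"
  unfolding M.natural_coeff_def
proof (intro conjI allI impI L.U.is_abelian_group)
  fix P Q :: "('a, 'm) rmod" and h f p
  assume "fgm M P" "fgm M Q" "h \<in> rmod_hom (VA M) P Q" "linear_form M Q f" "p \<in> carrier P"
  then show "cc L (res Q) f (h p) = cc L (res P) (\<lambda>m. f (h m)) p"
    using L.cc_hom[of "res P" "res Q" h f p] by (simp add: res_fgm res_hom res_form)
next
  fix P :: "('a, 'm) rmod" and f p q assume "fgm M P" "linear_form M P f" "p \<in> carrier P" "q \<in> carrier P"
  then show "cc L (res P) f (p \<oplus>\<^bsub>P\<^esub> q) = cc L (res P) f p \<oplus>\<^bsub>UL\<^esub> cc L (res P) f q"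
    using L.cc_add_right[of "res P" f p q] by (simp add: res_fgm res_form)
next
  fix P :: "('a, 'm) rmod" and f g :: "'a list \<Rightarrow> 'a" and p assume "fgm M P" "\<forall>m\<in>carrier P. f m = g m"
  then show "cc L (res P) f p = cc L (res P) g p" by (intro L.cc_cong) (simp_all add: res_fgm)
qed (simp_all add: L.cc_closed L.cc_add_left res_fgm res_form)

lemma F_fdlift:
  assumes X: "X \<in> carrier UM"
  shows "F X = M.fdlift UL (\<lambda>P f p. cc L (res P) f p) X"
proof -
  have "ccls L [(restrict_scalars M \<phi> P, f, p). (P, f, p) \<leftarrow> x] = lsum UL (map (\<lambda>(P, f, p). cc L (res P) f p) x)"
    if "x \<in> X" for x
  proof -
    have x: "set x \<subseteq> coeffs M" by (rule M.U.carrier_memD[OF X that])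
    have el: "(restrict_scalars M \<phi> P, f, p) \<in> coeffs L \<and> ccls L [(restrict_scalars M \<phi> P, f, p)] = cc L (res P) f p"
      if "(P, f, p) \<in> set x" for P f p
    proof -
      have "(P, f, p) \<in> coeffs M" using that x by auto
      then have "(restrict_scalars M \<phi> P, f, p) \<in> coeffs L"
        by (simp add: M.coeffs_iff L.coeffs_iff restrict_scalars_eq res_fgm res_mdual)
      then show ?thesis using L.cc_object by (simp add: restrict_scalars_eq)
    qed
    then have "set [(restrict_scalars M \<phi> P, f, p). (P, f, p) \<leftarrow> x] \<subseteq> coeffs L" by auto
    then have "ccls L [(restrict_scalars M \<phi> P, f, p). (P, f, p) \<leftarrow> x] =
        lsum UL [ccls L [(restrict_scalars M \<phi> P, f, p)]. (P, f, p) \<leftarrow> x]"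
      unfolding ccls_pcls by (subst L.U.pcls_lsum) (simp_all add: o_def case_prod_unfold)
    also have "\<dots> = lsum UL (map (\<lambda>(P, f, p). cc L (res P) f p) x)"
      using el by (intro lsum_cong) auto
    finally show ?thesis .
  qed
  then have "F X = (\<Union>x\<in>X. lsum UL (map (\<lambda>(P, f, p). cc L (res P) f p) x))"
    by (simp add: finite_dual_map_def)
  then show ?thesis
    unfolding M.fdlift_def by (simp only: M.U.UN_plift[OF M.natural_compat[OF F_natural] X])
qed

lemma F_additive: "additive UM UL F"
  by (rule iffD2[OF additive_cong[OF M.U.is_abelian_group F_fdlift] M.fdlift_additive[OF F_natural]])

lemma F_closed: "X \<in> carrier UM \<Longrightarrow> F X \<in> carrier UL"
  by (rule additive_closed[OF F_additive])

lemma F_cc: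
  assumes N: "fgm M N" "linear_form M N f" "n \<in> carrier N"
  shows "F (cc M N f n) = cc L (res N) f n"
proof -
  obtain R :: "('a, 'm) rmod" and h where R: "fgm M R" "h \<in> rmod_hom (VA M) N R"
    "inv_into (carrier N) h \<in> rmod_hom (VA M) R N"
    "\<And>x. x \<in> carrier N \<Longrightarrow> inv_into (carrier N) h (h x) = x"
    "linear_form M R (\<lambda>r. f (inv_into (carrier N) h r))"
    "\<And>f m. linear_form M N f \<Longrightarrow> m \<in> carrier N \<Longrightarrow> cc M N f m = cc M R (\<lambda>r. f (inv_into (carrier N) h r)) (h m)"
    using M.cc_realize[OF N] by metis
  have hn: "h n \<in> carrier R" by (rule M.rmod_hom_closed[OF R(2) N(3)])
  have "F (cc M N f n) = cc L (res R) (\<lambda>r. f (inv_into (carrier N) h r)) (h n)"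
    unfolding R(6)[OF N(2,3)] F_fdlift[OF M.cc_closed[OF R(1,5) hn]]
    by (rule M.fdlift_cc[OF F_natural R(1,5) hn])
  also have "\<dots> = cc L (res N) (\<lambda>x. f (inv_into (carrier N) h (h x))) n"
    by (rule L.cc_hom) (use N R in \<open>simp_all add: res_fgm res_hom res_form\<close>)
  also have "\<dots> = cc L (res N) f n"
    by (rule L.cc_cong) (use N R in \<open>simp_all add: res_fgm\<close>)
  finally show ?thesis .
qed

text \<open>Restriction is compatible with tensor products: pure tensors of the original modules
  form a balanced Leibniz map for the restricted ones, and \<open>cc_balanced\<close> turns this
  into the product formula.\<close>

lemma F_mult:
  assumes X: "X \<in> carrier UM" and Y: "Y \<in> carrier UM"
  shows "F (X \<otimes>\<^bsub>UM\<^esub> Y) = F X \<otimes>\<^bsub>UL\<^esub> F Y"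
proof -
  note ag = L.U.is_abelian_group
  show ?thesis
  proof (rule M.fdual_ext[OF additive_comp[OF M.mult_additive_left[OF Y] F_additive]
        additive_comp[OF F_additive L.mult_additive_left[OF F_closed[OF Y]]] ag X])
    fix P :: "('a, 'm) rmod" and f p assume P: "fgm M P" "linear_form M P f" "p \<in> carrier P"
    have p: "cc M P f p \<in> carrier UM" by (rule M.cc_closed[OF P])
    show "F (cc M P f p \<otimes>\<^bsub>UM\<^esub> Y) = F (cc M P f p) \<otimes>\<^bsub>UL\<^esub> F Y"
    proof (rule M.fdual_ext[OF additive_comp[OF M.mult_additive_right[OF p] F_additive]
          additive_comp[OF F_additive L.mult_additive_right[OF F_closed[OF p]]] ag Y])
      fix Q :: "('a, 'm) rmod" and g q assume Q: "fgm M Q" "linear_form M Q g" "q \<in> carrier Q"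
      interpret A: lr_module_pair \<kappa> M Q P by (rule M.fgm_pair[OF Q(1) P(1)])
      interpret B: lr_module_pair \<kappa> L "res Q" "res P" by (rule L.fgm_pair[OF res_fgm[OF Q(1)] res_fgm[OF P(1)]])
      let ?N = "mod_tensor M Q P"
      have fN: "fgm M ?N" by (rule A.mod_tensor_fgm[OF Q(1) P(1)])
      interpret N: lr_module \<kappa> M ?N by (rule M.fgm_lr_module[OF fN])
      note sf = A.linear_form_star[OF Q(2) P(2)]
      interpret RN: lr_module \<kappa> L "res ?N" by (rule L.fgm_lr_module[OF res_fgm[OF fN]])
      have "F (cc M P f p \<otimes>\<^bsub>UM\<^esub> cc M Q g q) = cc L (res ?N) (star g f) (pure M Q P q p)"
        unfolding M.mult_cc[OF P Q] cprod_def by (rule F_cc[OF fN sf A.pure_closed[OF Q(3) P(3)]])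
      also have "\<dots> = cprod L (res P) f p (res Q) g q"
      proof (rule L.cc_balanced)
        show "balanced (amod L (res Q)) (amod L (res P)) (res ?N) (pure M Q P)"
          by (rule B.balancedI[OF RN.M.abelian_group_axioms]) (simp_all add: A.pure_add A.pure_act(2))
      qed (use P Q fN sf in \<open>simp_all add: res_fgm res_form A.pure_act A.star_tn\<close>)
      also have "\<dots> = cc L (res P) f p \<otimes>\<^bsub>UL\<^esub> cc L (res Q) g q"
        by (rule L.mult_cc[symmetric]) (use P Q in \<open>simp_all add: res_fgm res_form\<close>)
      finally show "F (cc M P f p \<otimes>\<^bsub>UM\<^esub> cc M Q g q) = F (cc M P f p) \<otimes>\<^bsub>UL\<^esub> F (cc M Q g q)"
        by (simp add: F_cc P Q)
    qed
  qed
qed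

text \<open>The identity of \<open>A\<close> is a module morphism from the unit object of
  \<open>L\<close> to the restricted one of \<open>M\<close>, because \<phi> preserves
  anchors.\<close>

lemma F_one: "F \<one>\<^bsub>UM\<^esub> = \<one>\<^bsub>UL\<^esub>"
proof -
  have "F \<one>\<^bsub>UM\<^esub> = cc L (res (unit_mod M)) (\<lambda>x. 1 * x) 1"
    unfolding M.fd_src_tgt M.fdual_unit_cc by (rule F_cc) (simp_all add: M.unit_mod_fgm M.unit_form)
  also have "\<dots> = cc L (unit_mod L) (\<lambda>x. 1 * x) 1"
  proof (rule L.cc_hom[OF L.unit_mod_fgm res_fgm[OF M.unit_mod_fgm], of "\<lambda>x. x"])
    show "(\<lambda>x. x) \<in> rmod_hom (VA L) (unit_mod L) (res (unit_mod M))"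
      by (rule L.rmod_homI[OF L.unit_mod_module res_module[OF M.unit_mod_module]])
        (simp_all add: additive_def \<phi>_anchor)
  qed (use M.unit_form[of 1] in \<open>simp_all add: res_form\<close>)
  finally show ?thesis by (simp add: L.fd_src_tgt L.fdual_unit_cc)
qed

text \<open>A dual basis of a module is also one of its restriction, so both coproducts are given by
  the same sum.\<close>

theorem F_bialgebroid_hom: "F \<in> bialgebroid_hom UM UL"
proof -
  note ag = L.U.is_abelian_group and ag2 = L.UU.T.is_abelian_group
  note Fa = F_additive
  have Fl: "F (lact UM a X) = lact UL a (F X)" if X: "X \<in> carrier UM" for a X
    by (rule M.fdual_ext[OF additive_comp[OF M.lact_additive Fa] additive_comp[OF Fa L.lact_additive] ag X])
      (simp add: M.lact_cc F_cc M.linear_form_scale L.lact_cc res_fgm res_form)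
  have Fr: "F (ract UM X a) = ract UL (F X) a" if X: "X \<in> carrier UM" for a X
  proof (rule M.fdual_ext[OF additive_comp[OF M.ract_additive Fa] additive_comp[OF Fa L.ract_additive] ag X])
    fix P :: "('a, 'm) rmod" and f p assume P: "fgm M P" "linear_form M P f" "p \<in> carrier P"
    interpret P: lr_module \<kappa> M P by (rule M.fgm_lr_module[OF P(1)])
    show "F (ract UM (cc M P f p) a) = ract UL (F (cc M P f p)) a"
      using P by (simp add: M.ract_cc F_cc L.ract_cc res_fgm res_form P.M.act_closed)
  qed
  have Fe: "counit UL (F X) = counit UM X" if X: "X \<in> carrier UM" for X
    by (rule M.fdual_ext[OF additive_comp[OF Fa L.UC.counit_additive] M.UC.counit_additive regular_abelian_group X])
      (simp add: F_cc M.counit_cc L.counit_cc res_fgm res_form)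
  let ?L2 = "tensor UL UL" and ?M2 = "tensor UM UM"
  have bm: "balanced UM UM ?L2 (\<lambda>u v. tn UL UL (F u) (F v))"
    unfolding balanced_def using ag2
    by (auto simp: F_closed additive_add[OF Fa] L.UU.tn_add_left L.UU.tn_add_right Fl Fr L.UU.tn_balanced intro!: additiveI)
  let ?FF = "tlift ?L2 (\<lambda>u v. tn UL UL (F u) (F v))"
  have FFa: "additive ?M2 ?L2 ?FF" by (rule M.UU.tlift_additive[OF bm])
  have FF: "?FF (comult UM X) = comult UL (F X)" if X: "X \<in> carrier UM" for X
  proof (rule M.fdual_ext[OF additive_comp[OF M.comult_fd_additive FFa] additive_comp[OF Fa L.comult_fd_additive] ag2 X])
    fix P :: "('a, 'm) rmod" and f p assume P: "fgm M P" "linear_form M P f" "p \<in> carrier P"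
    obtain es where es: "dual_basis M P es" using M.fgm_basis[OF P(1)] .
    note eD = M.dual_basisD(1,2)[OF es]
    have "?FF (comult UM (cc M P f p)) = lsum ?L2 [tn UL UL (F x) (F y). (x, y) \<leftarrow> [(cc M P f e, cc M P e' p). (e, e') \<leftarrow> es]]"
      by (rule M.UU.tlift_mem[OF bm M.UC.comult_closed[OF M.cc_closed[OF P]] M.comult_cc_mem[OF P es], symmetric])
    also have "\<dots> = L.copr (res P) f p es"
      unfolding L.copr_def map_map o_def using eD P by (intro lsum_cong) (auto simp: F_cc)
    also have "\<dots> = comult UL (cc L (res P) f p)"
      by (rule L.comult_cc[symmetric]) (use P es in \<open>simp_all add: res_fgm res_form res_dual_basis\<close>)
    finally show "?FF (comult UM (cc M P f p)) = comult UL (F (cc M P f p))" using P by (simp add: F_cc)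
  qed
  have "[(F u, F v). (u, v) \<leftarrow> zs] \<in> comult UL (F X)" if X: "X \<in> carrier UM" and zs: "zs \<in> comult UM X" for X zs
  proof (rule L.UU.tcls_memI[OF L.UC.comult_closed[OF F_closed[OF X]]])
    note el = M.UC.comult_sub[OF X zs]
    show "set [(F u, F v). (u, v) \<leftarrow> zs] \<subseteq> carrier UL \<times> carrier UL" using el F_closed by auto
    show "comult UL (F X) = lsum ?L2 (map (\<lambda>(a, b). tn UL UL a b) [(F u, F v). (u, v) \<leftarrow> zs])"
      using M.UU.tlift_mem[OF bm M.UC.comult_closed[OF X] zs] FF[OF X] by (simp add: o_def case_prod_unfold)
  qed
  then show ?thesis
    unfolding bialgebroid_hom_def coring_hom_def bimod_hom_def
    using F_closed Fl Fr Fe additive_add[OF Fa] F_mult F_one by auto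
qed

lemma zeta_F:
  assumes X: "X \<in> carrier UM" and u: "u \<in> carrier (VA L)"
  shows "zeta L (F X) u = zeta M X (VA_map M \<phi> u)"
  by (rule M.fdual_ext[OF additive_comp[OF F_additive L.zeta_additive[OF u]]
        M.zeta_additive[OF VA_map_ops(1)[OF u u]] regular_abelian_group X])
    (simp add: F_cc L.zeta_cc M.zeta_cc res_fgm res_form u VA_map_ops(1)[OF u u])

text \<open>On a restricted module \<open>X\<close> acts as \<open>\<phi>(X)\<close> does on the
  original.\<close>

lemma Theta_natural: "X \<in> carrier L \<Longrightarrow> Theta M (\<phi> X) = der_map UM F (Theta L X)"
  by (auto simp: Theta_def der_map_def F_closed zeta_F fun_eq_iff)

end

theorem propositionA7:
  fixes \<kappa> :: "'k::field_char_0 \<Rightarrow> 'a::{comm_ring,comm_monoid_mult}"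
    and L :: "('a, 'l) lr_algebra"
  assumes "\<kappa> \<in> ring_hom base_ring base_ring"
    and "lie_rinehart \<kappa> L"
  shows "lr_morphism \<kappa> L (der_lr \<kappa> (finite_dual L)) (Theta L) \<and>
    (\<forall>(M :: ('a, 'm) lr_algebra) \<phi>. lr_morphism \<kappa> L M \<phi> \<longrightarrow>
      lr_morphism \<kappa> (der_lr \<kappa> (finite_dual L)) (der_lr \<kappa> (finite_dual M))
        (der_map (finite_dual M) (finite_dual_map L M \<phi>)) \<and>
      (\<forall>X\<in>carrier L.
        Theta M (\<phi> X) = der_map (finite_dual M) (finite_dual_map L M \<phi>) (Theta L X))) \<and>
    (\<forall>(H :: ('a, 'h) hopf_algebroid) \<xi>. universal_hopf \<kappa> L H \<xi> \<longrightarrow>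
      lr_morphism \<kappa> L (der_lr \<kappa> H) (Theta' L H \<xi>) \<and>
      lr_morphism \<kappa> (der_lr \<kappa> H) (der_lr \<kappa> (finite_dual L))
        (der_map (finite_dual L) (zeta_hat L H \<xi>)) \<and>
      (\<forall>X\<in>carrier L.
        Theta L X = der_map (finite_dual L) (zeta_hat L H \<xi>) (Theta' L H \<xi> X)))"
proof -
  interpret lr_alg \<kappa> L using assms(2) by (rule lr_algI)
  show ?thesis
  proof (intro conjI allI impI ballI)
    show "lr_morphism \<kappa> L (der_lr \<kappa> (finite_dual L)) (Theta L)" by (rule Theta_lr_morphism)
  next
    fix M :: "('a, 'm) lr_algebra" and \<phi> assume \<phi>: "lr_morphism \<kappa> L M \<phi>"
    then have "lr_alg \<kappa> M" by (simp add: lr_morphism_def lr_algI)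
    then interpret F: lr_hom \<kappa> L M \<phi>
      using \<phi> lr_alg_axioms by (simp add: lr_hom_def lr_hom_axioms_def)
    show "lr_morphism \<kappa> (der_lr \<kappa> (finite_dual L)) (der_lr \<kappa> (finite_dual M))
        (der_map (finite_dual M) (finite_dual_map L M \<phi>))"
      by (rule der_map_lr_morphism[OF F.M.finite_dual_bialgebroid finite_dual_bialgebroid F.F_bialgebroid_hom])
    show "Theta M (\<phi> X) = der_map (finite_dual M) (finite_dual_map L M \<phi>) (Theta L X)" if "X \<in> carrier L" for X
      using that by (rule F.Theta_natural)
  next
    fix H :: "('a, 'h) hopf_algebroid" and \<xi> assume u: "universal_hopf \<kappa> L H \<xi>"
    show "lr_morphism \<kappa> L (der_lr \<kappa> H) (Theta' L H \<xi>)" by (rule Theta'_universal[OF u])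
    show "lr_morphism \<kappa> (der_lr \<kappa> H) (der_lr \<kappa> (finite_dual L)) (der_map (finite_dual L) (zeta_hat L H \<xi>))"
      by (rule der_map_lr_morphism[OF finite_dual_bialgebroid H_bialgebroid[OF u] zeta_hat_bialgebroid_hom[OF u]])
    show "Theta L X = der_map (finite_dual L) (zeta_hat L H \<xi>) (Theta' L H \<xi> X)" for X
      by (rule Theta_factor[OF u])
  qed
qed

end
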